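(* Let $C/\mathbb{Q}$ be a superelliptic curve with affine model $y^n = f(x)$, where $f(x) \in \mathbb{Z}[x]$ is squarefree and weakly intersective. For an $n$th power free integer $d$ let $C_d$ be the twist with affine model $dy^n = f(x)$, and let $\mathcal{D}_C(X)$ be the number of $n$th power free integers $d \in [-X,X]$ such that $C_d$ has points everywhere locally. Then $\mathcal{D}_C(X) \gg_C X$.
   Context: Let $n \ge 2$. A superelliptic curve $C/\mathbb{Q}$ is a nice (smooth, projective, geometrically integral) curve admitting an affine model $y^n = f(x)$ with $f(x) \in \mathbb{Q}[x]$ factoring over $\overline{\mathbb{Q}}$ as $f(x) = A\prod_{j=1}^r (x-\alpha_j)^{n_j}$, where $A \in \overline{\mathbb{Q}}^*$, the $\alpha_j$ are distinct, $1 \le n_j < n$, and $\gcd(n,n_1,\ldots,n_r)=1$. A polynomial $f \in \mathbb{Z}[x]$ is weakly intersective if the set of primes $\ell$ such that $f$ has a root modulo $\ell$ has density $1$ in the set of all primes. A curve over $\mathbb{Q}$ has points everywhere locally if it has a $\mathbb{Q}_v$-point for every place $v$ of $\mathbb{Q}$, including $\mathbb{R}$. *)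

theory Defs
  imports
    "HOL-Library.Landau_Symbols"
    "HOL-Algebra.Algebraic_Closure_Type"
    "HOL-Algebra.QuotRing"
    "HOL-Number_Theory.Cong"
begin

(* f = A * prod (x - alpha)^(e alpha) over the algebraic closure of the rationals, where S is the
   set of distinct roots alpha and e alpha their multiplicities. A constant f (S empty) is excluded
   for n >= 2 by the gcd condition. *)
definition superelliptic_model :: "nat \<Rightarrow> rat poly \<Rightarrow> bool" where
  "superelliptic_model n f \<longleftrightarrow>
     (\<exists>(A :: rat alg_closure) S e.
        A \<noteq> 0 \<and> finite S \<and>
        map_poly to_ac f = Polynomial.smult A (\<Prod>\<alpha>\<in>S. [:-\<alpha>, 1:] ^ e \<alpha>) \<and>
        (\<forall>\<alpha>\<in>S. 1 \<le> e \<alpha> \<and> e \<alpha> < n) \<and>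
        Gcd (insert n (e ` S)) = 1)"

definition has_prime_density :: "nat set \<Rightarrow> real \<Rightarrow> bool" where
  "has_prime_density P \<delta> \<longleftrightarrow>
     (\<lambda>N. real (card {p \<in> P. Factorial_Ring.prime p \<and> p \<le> N}) /
          real (card {p :: nat. Factorial_Ring.prime p \<and> p \<le> N}))
       \<longlonglongrightarrow> \<delta>"

definition weakly_intersective :: "int poly \<Rightarrow> bool" where
  "weakly_intersective f \<longleftrightarrow>
     has_prime_density {p. Factorial_Ring.prime p \<and> (\<exists>a. [poly f a = 0] (mod int p))} 1"

definition nth_power_free :: "nat \<Rightarrow> int \<Rightarrow> bool" where
  "nth_power_free n d \<longleftrightarrow> (\<forall>k. k ^ n dvd d \<longrightarrow> is_unit k)"


(* The p-adic numbers as the completion of the rationals: Cauchy sequences modulo null sequences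
   for the p-adic absolute value. *)

definition padic_abs :: "nat \<Rightarrow> rat \<Rightarrow> real" where
  "padic_abs p q =
     (if q = 0 then 0
      else real p powi (int (multiplicity (int p) (snd (quotient_of q))) -
                        int (multiplicity (int p) (fst (quotient_of q)))))"

definition padic_cauchy_ring :: "nat \<Rightarrow> (nat \<Rightarrow> rat) ring" where
  "padic_cauchy_ring p =
     \<lparr>carrier = {s. \<forall>\<epsilon>>0. \<exists>N. \<forall>i\<ge>N. \<forall>j\<ge>N. padic_abs p (s i - s j) < \<epsilon>},
      monoid.mult = (\<lambda>s t i. s i * t i), monoid.one = (\<lambda>_. 1),
      ring.zero = (\<lambda>_. 0), add = (\<lambda>s t i. s i + t i)\<rparr>"

definition padic_null_ideal :: "nat \<Rightarrow> (nat \<Rightarrow> rat) set" where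
  "padic_null_ideal p = {s. (\<lambda>i. padic_abs p (s i)) \<longlonglongrightarrow> 0}"

definition padic_field :: "nat \<Rightarrow> (nat \<Rightarrow> rat) set ring" where
  "padic_field p = padic_cauchy_ring p Quot padic_null_ideal p"


definition eval_int_poly :: "('a, 'b) ring_scheme \<Rightarrow> int poly \<Rightarrow> 'a \<Rightarrow> 'a" where
  "eval_int_poly K f x =
     (\<Oplus>\<^bsub>K\<^esub>i\<in>{..Polynomial.degree f}. [Polynomial.coeff f i] \<cdot>\<^bsub>K\<^esub> (x [^]\<^bsub>K\<^esub> i))"

(* For d nonzero, f nonconstant and squarefree over the rationals, the smooth projective curve with
   affine model d y^n = f(x) is the union of two smooth affine charts, over a field K of
   characteristic 0. The first is the affine model itself, which is finite over the x-line.

   For the second let m = degree f, g = gcd m n, m = g m', n = g n', b n' + c m' = 1 with c >= 0,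
   and substitute
       x = s^(-n') t^(-c),  y = s^(-m') t^b,   inversely   s = x^(-b) y^(-c),  t = x^(-m') y^n'.
   This identifies the part x y nonzero of d y^n = f(x) = x^m f*(1/x), with f* the reversed
   polynomial of f, with the part s nonzero of
       d t^g = f*(s^n' t^c),   t nonzero.
   That chart is smooth at s = 0, since the t-derivative there is g d t^(g-1). Over an algebraic
   closure it has g points with s = 0, namely d t^g = lead_coeff f; at each of them 1/x = s^n' t^c
   vanishes to order n'. As g n' = n is the degree of x, these are all the points above
   x = infinity. *)

definition affine_chart_points :: "('a, 'b) ring_scheme \<Rightarrow> nat \<Rightarrow> int \<Rightarrow> int poly \<Rightarrow> ('a \<times> 'a) set" where
  "affine_chart_points K n d f =
     {(x, y). x \<in> carrier K \<and> y \<in> carrier K \<and>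
        [d] \<cdot>\<^bsub>K\<^esub> (y [^]\<^bsub>K\<^esub> n) = eval_int_poly K f x}"

definition infinity_chart_points :: "('a, 'b) ring_scheme \<Rightarrow> nat \<Rightarrow> int \<Rightarrow> int poly \<Rightarrow> ('a \<times> 'a) set" where
  "infinity_chart_points K n d f =
     (let m = Polynomial.degree f; g = gcd m n; m' = m div g; n' = n div g;
          c = (LEAST c. [c * m' = 1] (mod n'))
      in {(s, t). s \<in> carrier K \<and> t \<in> carrier K - {\<zero>\<^bsub>K\<^esub>} \<and>
            [d] \<cdot>\<^bsub>K\<^esub> (t [^]\<^bsub>K\<^esub> g) =
              eval_int_poly K (reflect_poly f) (s [^]\<^bsub>K\<^esub> n' \<otimes>\<^bsub>K\<^esub> t [^]\<^bsub>K\<^esub> c)})"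

definition twist_has_point :: "('a, 'b) ring_scheme \<Rightarrow> nat \<Rightarrow> int \<Rightarrow> int poly \<Rightarrow> bool" where
  "twist_has_point K n d f \<longleftrightarrow>
     affine_chart_points K n d f \<noteq> {} \<or> infinity_chart_points K n d f \<noteq> {}"

definition twist_locally_soluble :: "nat \<Rightarrow> int \<Rightarrow> int poly \<Rightarrow> bool" where
  "twist_locally_soluble n d f \<longleftrightarrow>
     twist_has_point (ring_of_type_algebra :: real ring) n d f \<and>
     (\<forall>p. Factorial_Ring.prime p \<longrightarrow> twist_has_point (padic_field p) n d f)"

definition locally_soluble_twist_count :: "nat \<Rightarrow> int poly \<Rightarrow> real \<Rightarrow> nat" where
  "locally_soluble_twist_count n f B =
     card {d :: int. \<bar>real_of_int d\<bar> \<le> B \<and> nth_power_free n d \<and> twist_locally_soluble n d f}"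

end

theory Submission
  imports Defs "Jordan_Normal_Form.Char_Poly" "HOL-Computational_Algebra.Computational_Algebra"
    "HOL-Number_Theory.Number_Theory"
begin

text \<open>
  If \<open>f\<close> has a simple root modulo \<open>p\<close>, Hensel's lemma gives a point \<open>(x, 0)\<close> over the \<open>p\<close>-adic numbers on
  every twist. The key fact is that \<open>f\<close> has a root modulo all but finitely many primes. Let \<open>G\<close> be the
  Galois group of the splitting field and \<open>W\<close> a finite \<open>G\<close>-stable set of algebraic integers. The number of
  fixed points of the Frobenius element at \<open>p\<close> on \<open>W\<close>, averaged with the weights \<open>ln p / p\<close>, tends to the
  average number of fixed points of the elements of \<open>G\<close>. For an orbit \<open>W\<close> of size \<open>n\<close> this is proved by
  counting lattice points, without zeta functions: the sum of \<open>ln \<bar>N(a)\<bar>\<close> over the integer vectors \<open>a\<close> in a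
  box of side \<open>B\<close>, where \<open>N(a)\<close> is the norm of \<open>\<Sum>j. a\<^sub>j x\<^sup>j\<close>, is asymptotic to \<open>n B\<^sup>n ln B\<close>; factoring the
  norms, a prime \<open>p\<close> contributes about \<open>B\<^sup>n ln p / p\<close> for each root modulo \<open>p\<close> of the polynomial with root set
  \<open>W\<close>, and these roots correspond to the fixed points of Frobenius. Applied to powers of \<open>W\<close> this gives all
  moments of the number of fixed points, hence the frequency of the value \<open>0\<close>, which is the proportion of
  elements of \<open>G\<close> without a fixed point. For the set of roots of a weakly intersective polynomial that
  frequency is \<open>0\<close>, so every element of \<open>G\<close> has a fixed point.

  For the remaining finitely many primes write \<open>f(a) = d k\<^sup>n\<close> with \<open>d\<close> free of \<open>n\<close>th powers, and twist by
  \<open>d u\<close> with \<open>u = 1 + n\<^sup>2 c > 0\<close> squarefree, where all these primes and \<open>d\<close> divide \<open>c\<close>. Then \<open>u\<close> is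
  an \<open>n\<close>th power in the real numbers and in the \<open>p\<close>-adic numbers for these \<open>p\<close>, which gives a point with
  first coordinate \<open>a\<close>. Squarefree numbers have positive density in the progression of the \<open>u\<close>.
\<close>

hide_const (open) Divisibility.prime Divisibility.irreducible Polynomials.degree UnivPoly.coeff UnivPoly.monom Coset.order

section \<open>Algebraic integers and primes above a rational prime\<close>

text \<open>The count succeeds because a norm form of degree n in n variables is balanced. Its
  values on a box of side B have size B^n, and the vectors satisfying a root condition modulo p form
  a lattice of covering radius O(p^(1/n)), so they are equidistributed in the box as long as p is at
  most a small multiple of B^n. Primes between that bound and the largest norm contribute O(B^n) by
  Chebyshev's upper bound, negligible against B^n ln B. Norms divisible by p^2 with p > p1 occur for
  about 1/p1 of the vectors, so p1 is chosen large.

  One prime ideal of the ring of all algebraic integers serves for each p, so congruences between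
  conjugates in any number field make sense at once, and factorization of ideals is replaced by
  norms and interpolation.

  Density one becomes "all but finitely many" through finiteness of G: the exceptional frequency is
  a multiple of 1/card G, so if it is 0 there is no element without fixed points that a Frobenius
  element could be.\<close>

lemma algebraic_int_of_eigenvalue:
  fixes e :: "nat \<Rightarrow> complex" and M :: "nat \<Rightarrow> nat \<Rightarrow> int"
  assumes ex: "\<exists>i<k. e i \<noteq> 0"
    and eq: "\<And>i. i < k \<Longrightarrow> x * e i = (\<Sum>j<k. of_int (M i j) * e j)"
  shows "algebraic_int x"
proof -
  define A where "A = mat k k (\<lambda>(i, j). M i j)"
  define B where "B = map_mat (of_int :: int \<Rightarrow> complex) A"
  have A: "A \<in> carrier_mat k k" and B: "B \<in> carrier_mat k k" by (auto simp: A_def B_def)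
  define v where "v = vec k e"
  have v: "v \<in> carrier_vec k" by (simp add: v_def)
  obtain i where i: "i < k" "e i \<noteq> 0" using ex by blast
  have "v \<noteq> 0\<^sub>v k"
  proof
    assume "v = 0\<^sub>v k"
    hence "v $ i = 0\<^sub>v k $ i" by simp
    thus False using i by (simp add: v_def)
  qed
  moreover have "B *\<^sub>v v = x \<cdot>\<^sub>v v"
    by (rule eq_vecI) (auto simp: B_def A_def v_def scalar_prod_def eq lessThan_atLeast0)
  ultimately have "eigenvector B v x" using B v by (auto simp: eigenvector_def)
  hence "eigenvalue B x" by (auto simp: eigenvalue_def)
  hence "poly (char_poly B) x = 0" using eigenvalue_root_char_poly[OF B] by simp
  moreover have "char_poly B = map_poly of_int (char_poly A)"
    unfolding B_def by (rule of_int_hom.char_poly_hom[OF A])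
  moreover have "lead_coeff (char_poly A) = 1" using degree_monic_char_poly[OF A] by auto
  ultimately show ?thesis unfolding algebraic_int_altdef_ipoly by metis
qed

definition int_span :: "complex set \<Rightarrow> complex set" where
  "int_span E = {x. \<exists>c :: complex \<Rightarrow> int. x = (\<Sum>e\<in>E. of_int (c e) * e)}"

lemma int_span_base: "finite E \<Longrightarrow> e \<in> E \<Longrightarrow> e \<in> int_span E"
proof -
  assume "finite E" "e \<in> E"
  hence "e = (\<Sum>e'\<in>E. of_int (if e' = e then 1 else 0) * e')"
    by (simp add: if_distrib[of "\<lambda>x. x * _"] if_distrib[of of_int] sum.delta cong: if_cong)
  thus ?thesis unfolding int_span_def by (intro CollectI exI)
qed

lemma int_span_add: "x \<in> int_span E \<Longrightarrow> y \<in> int_span E \<Longrightarrow> x + y \<in> int_span E"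
proof -
  assume "x \<in> int_span E" "y \<in> int_span E"
  then obtain c d where "x = (\<Sum>e\<in>E. of_int (c e) * e)" "y = (\<Sum>e\<in>E. of_int (d e) * e)"
    unfolding int_span_def by blast
  hence "x + y = (\<Sum>e\<in>E. of_int (c e + d e) * e)" by (simp add: algebra_simps sum.distrib)
  thus ?thesis unfolding int_span_def by (intro CollectI exI)
qed

lemma int_span_smult: "x \<in> int_span E \<Longrightarrow> of_int m * x \<in> int_span E"
proof -
  assume "x \<in> int_span E"
  then obtain c where "x = (\<Sum>e\<in>E. of_int (c e) * e)" unfolding int_span_def by blast
  hence "of_int m * x = (\<Sum>e\<in>E. of_int (m * c e) * e)" by (simp add: sum_distrib_left mult.assoc)
  thus ?thesis unfolding int_span_def by (intro CollectI exI)
qed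

lemma int_span_0: "0 \<in> int_span E"
  unfolding int_span_def by (intro CollectI exI[of _ "\<lambda>_. 0"]) simp

lemma int_span_sum: "(\<And>i. i \<in> I \<Longrightarrow> f i \<in> int_span E) \<Longrightarrow> (\<Sum>i\<in>I. f i) \<in> int_span E"
  by (induction I rule: infinite_finite_induct) (auto intro: int_span_0 int_span_add)

lemma int_span_stable:
  assumes "\<And>e. e \<in> E \<Longrightarrow> x * e \<in> int_span E" "y \<in> int_span E"
  shows "x * y \<in> int_span E"
proof -
  obtain c where "y = (\<Sum>e\<in>E. of_int (c e) * e)" using assms(2) unfolding int_span_def by blast
  hence "x * y = (\<Sum>e\<in>E. of_int (c e) * (x * e))" by (simp add: sum_distrib_left mult_ac)
  also have "\<dots> \<in> int_span E" by (intro int_span_sum int_span_smult assms(1))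
  finally show ?thesis .
qed

text \<open>The determinant trick: a nonzero finitely generated group of complex numbers that is
  stable under \<open>x\<close> makes \<open>x\<close> an eigenvalue of an integer matrix, hence a
  root of its monic characteristic polynomial.\<close>

lemma algebraic_int_of_int_span:
  assumes fin: "finite E" and e0: "e0 \<in> E" "e0 \<noteq> 0"
    and st: "\<And>e. e \<in> E \<Longrightarrow> x * e \<in> int_span E"
  shows "algebraic_int x"
proof -
  obtain g where g: "bij_betw g {0..<card E} E" using ex_bij_betw_nat_finite[OF fin] by blast
  have "\<exists>c :: complex \<Rightarrow> int. x * g i = (\<Sum>e\<in>E. of_int (c e) * e)" if "i < card E" for i
    using st[of "g i"] bij_betwE[OF g] that unfolding int_span_def by auto
  then obtain C where C: "\<And>i. i < card E \<Longrightarrow> x * g i = (\<Sum>e\<in>E. of_int (C i e) * e)" by metis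
  show ?thesis
  proof (rule algebraic_int_of_eigenvalue)
    show "\<exists>i<card E. g i \<noteq> 0" using e0 g unfolding bij_betw_def by (metis atLeastLessThan_iff imageE)
    fix i assume "i < card E"
    hence "x * g i = (\<Sum>e\<in>E. of_int (C i e) * e)" by (rule C)
    also have "\<dots> = (\<Sum>j<card E. of_int (C i (g j)) * g j)"
      using sum.reindex_bij_betw[OF g, of "\<lambda>e. of_int (C i e) * e"] by (simp add: lessThan_atLeast0)
    finally show "x * g i = (\<Sum>j<card E. of_int (C i (g j)) * g j)" .
  qed
qed

lemma algebraic_int_power_reduce:
  assumes "algebraic_int (x :: complex)"
  obtains m :: nat and c :: "nat \<Rightarrow> int" where "m > 0" "x ^ m = (\<Sum>i<m. of_int (c i) * x ^ i)"
proof -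
  obtain q where q: "poly (map_poly of_int q) x = 0" "lead_coeff q = 1"
    using assms unfolding algebraic_int_altdef_ipoly by blast
  have d: "degree q > 0"
  proof (rule ccontr)
    assume "\<not> degree q > 0"
    then obtain a where "q = [:a:]" by (auto elim: degree_eq_zeroE)
    thus False using q by auto
  qed
  have "0 = (\<Sum>i\<le>degree q. of_int (coeff q i) * x ^ i)"
    using q by (simp add: poly_altdef coeff_map_poly degree_map_poly)
  also have "{..degree q} = insert (degree q) {..<degree q}" by auto
  also have "(\<Sum>i\<in>\<dots>. of_int (coeff q i) * x ^ i) = x ^ degree q + (\<Sum>i<degree q. of_int (coeff q i) * x ^ i)"
    using q by simp
  finally have "x ^ degree q = - (\<Sum>i<degree q. of_int (coeff q i) * x ^ i)" by (simp add: eq_neg_iff_add_eq_0)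
  also have "\<dots> = (\<Sum>i<degree q. of_int (- coeff q i) * x ^ i)" by (simp add: sum_negf)
  finally show ?thesis using that[of "degree q" "\<lambda>i. - coeff q i"] d by blast
qed

text \<open>The products \<open>x ^ i * y ^ j\<close> with exponents below the degrees of monic
  equations for \<open>x\<close> and \<open>y\<close> span a group stable under both numbers, hence
  under their sum and product.\<close>

lemma algebraic_int_closure:
  assumes x: "algebraic_int (x :: complex)" and y: "algebraic_int y"
  shows "algebraic_int (x + y)" "algebraic_int (x * y)"
proof -
  obtain m c where m: "m > 0" "x ^ m = (\<Sum>i<m. of_int (c i) * x ^ i)"
    using algebraic_int_power_reduce[OF x] by blast
  obtain n d where n: "n > 0" "y ^ n = (\<Sum>i<n. of_int (d i) * y ^ i)"
    using algebraic_int_power_reduce[OF y] by blast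
  define E where "E = (\<lambda>(i, j). x ^ i * y ^ j) ` ({..<m} \<times> {..<n})"
  have fin: "finite E" by (simp add: E_def)
  have mem: "x ^ i * y ^ j \<in> int_span E" if "i < m" "j < n" for i j
    using that by (intro int_span_base fin) (auto simp: E_def)
  have one: "1 \<in> E" using m n unfolding E_def by (intro image_eqI[of _ _ "(0, 0)"]) auto
  have xs: "x * e \<in> int_span E" if "e \<in> E" for e
  proof -
    obtain i j where ij: "i < m" "j < n" "e = x ^ i * y ^ j" using \<open>e \<in> E\<close> by (auto simp: E_def)
    show ?thesis
    proof (cases "Suc i < m")
      case True
      thus ?thesis using mem[of "Suc i" j] ij by (simp add: mult.assoc)
    next
      case False
      hence "x * e = x ^ m * y ^ j" using ij by (metis Suc_lessI mult.assoc power_Suc)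
      also have "\<dots> = (\<Sum>i<m. of_int (c i) * (x ^ i * y ^ j))" by (simp add: m(2) sum_distrib_right mult.assoc)
      also have "\<dots> \<in> int_span E" using ij by (intro int_span_sum int_span_smult mem) auto
      finally show ?thesis .
    qed
  qed
  have ys: "y * e \<in> int_span E" if "e \<in> E" for e
  proof -
    obtain i j where ij: "i < m" "j < n" "e = x ^ i * y ^ j" using \<open>e \<in> E\<close> by (auto simp: E_def)
    show ?thesis
    proof (cases "Suc j < n")
      case True
      thus ?thesis using mem[of i "Suc j"] ij by (simp add: mult_ac)
    next
      case False
      hence "y * e = x ^ i * y ^ n" using ij by (metis Suc_lessI mult.left_commute power_Suc)
      also have "\<dots> = (\<Sum>j<n. of_int (d j) * (x ^ i * y ^ j))" by (simp add: n(2) sum_distrib_left mult_ac)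
      also have "\<dots> \<in> int_span E" using ij by (intro int_span_sum int_span_smult mem) auto
      finally show ?thesis .
    qed
  qed
  show "algebraic_int (x + y)"
    by (rule algebraic_int_of_int_span[OF fin one]) (auto simp: distrib_right intro: int_span_add xs ys)
  show "algebraic_int (x * y)"
    by (rule algebraic_int_of_int_span[OF fin one])
       (auto simp: mult.assoc intro: int_span_stable[of E x] xs ys)
qed

section \<open>The ring of algebraic integers\<close>

definition alg_ints :: "complex set" where "alg_ints = {x. algebraic_int x}"

lemma alg_ints_of_int [simp, intro]: "of_int k \<in> alg_ints"
  by (auto simp: alg_ints_def intro: int_imp_algebraic_int)

lemma alg_ints_of_nat [simp, intro]: "of_nat k \<in> alg_ints"
  using alg_ints_of_int[of "int k"] by simp

lemma alg_ints_0 [simp, intro]: "0 \<in> alg_ints" using alg_ints_of_int[of 0] by simp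
lemma alg_ints_1 [simp, intro]: "1 \<in> alg_ints" using alg_ints_of_int[of 1] by simp

lemma alg_ints_add [intro]: "x \<in> alg_ints \<Longrightarrow> y \<in> alg_ints \<Longrightarrow> x + y \<in> alg_ints"
  and alg_ints_mult [intro]: "x \<in> alg_ints \<Longrightarrow> y \<in> alg_ints \<Longrightarrow> x * y \<in> alg_ints"
  using algebraic_int_closure by (auto simp: alg_ints_def)

lemma alg_ints_minus [intro]: "x \<in> alg_ints \<Longrightarrow> - x \<in> alg_ints"
  by (auto simp: alg_ints_def)

lemma alg_ints_diff [intro]: "x \<in> alg_ints \<Longrightarrow> y \<in> alg_ints \<Longrightarrow> x - y \<in> alg_ints"
  using alg_ints_add[of x "- y"] by auto

lemma alg_ints_power [intro]: "x \<in> alg_ints \<Longrightarrow> x ^ k \<in> alg_ints"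
  by (induction k) auto

lemma alg_ints_sum [intro]: "(\<And>i. i \<in> I \<Longrightarrow> f i \<in> alg_ints) \<Longrightarrow> (\<Sum>i\<in>I. f i) \<in> alg_ints"
  by (induction I rule: infinite_finite_induct) auto

lemma alg_ints_prod [intro]: "(\<And>i. i \<in> I \<Longrightarrow> f i \<in> alg_ints) \<Longrightarrow> (\<Prod>i\<in>I. f i) \<in> alg_ints"
  by (induction I rule: infinite_finite_induct) auto

lemma alg_ints_rational: "x \<in> alg_ints \<Longrightarrow> x \<in> \<rat> \<Longrightarrow> x \<in> \<int>"
  by (auto simp: alg_ints_def intro: rational_algebraic_int_is_int)


section \<open>Prime ideals of the ring of algebraic integers and residues modulo p\<close>

definition ai_ideal :: "complex set \<Rightarrow> bool" where
  "ai_ideal I \<longleftrightarrow> I \<subseteq> alg_ints \<and> 0 \<in> I \<and> (\<forall>x\<in>I. \<forall>y\<in>I. x + y \<in> I) \<and> (\<forall>r\<in>alg_ints. \<forall>x\<in>I. r * x \<in> I)"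

definition ai_prime :: "complex set \<Rightarrow> bool" where
  "ai_prime I \<longleftrightarrow> ai_ideal I \<and> 1 \<notin> I \<and> (\<forall>x\<in>alg_ints. \<forall>y\<in>alg_ints. x * y \<in> I \<longrightarrow> x \<in> I \<or> y \<in> I)"

text \<open>An ideal maximal among those containing \<open>p\<close> but not \<open>1\<close> is
  prime. Zorn's lemma needs one such ideal, and the multiples of \<open>p\<close> will do:
  \<open>1 / p\<close> is rational but not an integer, hence not an algebraic integer.\<close>

lemma exists_ai_prime:
  assumes "prime (p :: nat)"
  shows "\<exists>I. ai_prime I \<and> of_nat p \<in> I"
proof -
  define A where "A = {I. ai_ideal I \<and> 1 \<notin> I \<and> of_nat p \<in> I}"
  have "{of_nat p * x |x. x \<in> alg_ints} \<in> A"
  proof -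
    have "1 \<noteq> of_nat p * x" if "x \<in> alg_ints" for x :: complex
    proof
      assume eq: "1 = of_nat p * x"
      have p: "p > 1" using assms prime_gt_1_nat by blast
      hence "x = 1 / of_nat p" using eq by (auto simp: field_simps)
      hence "x \<in> \<rat>" by auto
      hence "x \<in> \<int>" using alg_ints_rational that by blast
      then obtain k where "x = of_int k" by (auto elim: Ints_cases)
      hence "(of_int 1 :: complex) = of_int (int p * k)" using eq by simp
      hence "1 = int p * k" by (simp only: of_int_eq_iff)
      thus False using p by (metis dvd_triv_left int_one_le_iff_zero_less of_nat_1 of_nat_dvd_iff nat_dvd_1_iff_1 less_irrefl)
    qed
    thus ?thesis
      unfolding A_def ai_ideal_def
      by (auto simp: distrib_left[symmetric] mult.left_commute intro: exI[of _ 0] exI[of _ 1])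
  qed
  hence ne: "A \<noteq> {}" by blast
  have "\<exists>U\<in>A. \<forall>V\<in>C. V \<subseteq> U" if C: "subset.chain A C" for C
  proof (cases "C = {}")
    case True thus ?thesis using ne by blast
  next
    case False
    have CA: "C \<subseteq> A" and tot: "\<And>V Y. V \<in> C \<Longrightarrow> Y \<in> C \<Longrightarrow> V \<subseteq> Y \<or> Y \<subseteq> V"
      using C by (auto simp: subset_chain_def)
    have "\<Union>C \<in> A"
      unfolding A_def ai_ideal_def
    proof (intro CollectI conjI ballI)
      fix x y assume "x \<in> \<Union>C" "y \<in> \<Union>C"
      then obtain V Y where XY: "V \<in> C" "Y \<in> C" "x \<in> V" "y \<in> Y" by blast
      then obtain Z where "Z \<in> C" "x \<in> Z" "y \<in> Z" using tot[of V Y] by blast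
      moreover from this have "x + y \<in> Z" using CA by (auto simp: A_def ai_ideal_def)
      ultimately show "x + y \<in> \<Union>C" by blast
    next
      fix r x assume r: "r \<in> alg_ints" and "x \<in> \<Union>C"
      then obtain Z where Z: "Z \<in> C" "x \<in> Z" by blast
      hence "r * x \<in> Z" using CA r by (auto simp: A_def ai_ideal_def)
      thus "r * x \<in> \<Union>C" using Z by blast
    qed (use CA False in \<open>auto simp: A_def ai_ideal_def\<close>)
    thus ?thesis by blast
  qed
  then obtain I where I: "I \<in> A" and max: "\<And>V. V \<in> A \<Longrightarrow> I \<subseteq> V \<Longrightarrow> V = I"
    using subset_Zorn'[of A] ne subset_Zorn[of A] by metis
  have Ii: "ai_ideal I" "1 \<notin> I" "of_nat p \<in> I" using I by (auto simp: A_def)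
  \<comment> \<open>Maximality: adjoining to \<open>I\<close> an element outside it produces the
    unit ideal.\<close>
  have gen: "\<exists>i\<in>I. \<exists>r\<in>alg_ints. 1 = i + r * x" if x: "x \<in> alg_ints" "x \<notin> I" for x
  proof (rule ccontr)
    assume neg: "\<not> ?thesis"
    define J where "J = {i + r * x |i r. i \<in> I \<and> r \<in> alg_ints}"
    have "ai_ideal J"
      unfolding ai_ideal_def
    proof (intro conjI ballI)
      show "J \<subseteq> alg_ints" using Ii x by (auto simp: J_def ai_ideal_def)
      show "0 \<in> J" using Ii by (auto simp: J_def ai_ideal_def intro!: exI[of _ 0])
      fix u v assume "u \<in> J" "v \<in> J"
      then obtain i r j s where "u = i + r * x" "v = j + s * x" "i \<in> I" "j \<in> I" "r \<in> alg_ints" "s \<in> alg_ints"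
        by (auto simp: J_def)
      moreover from this have "u + v = (i + j) + (r + s) * x" by (simp add: algebra_simps)
      ultimately show "u + v \<in> J" using Ii unfolding J_def ai_ideal_def by blast
    next
      fix t u assume "t \<in> alg_ints" "u \<in> J"
      then obtain i r where "u = i + r * x" "i \<in> I" "r \<in> alg_ints" by (auto simp: J_def)
      moreover from this have "t * u = t * i + (t * r) * x" by (simp add: algebra_simps)
      ultimately show "t * u \<in> J" using Ii \<open>t \<in> alg_ints\<close> unfolding J_def ai_ideal_def by blast
    qed
    moreover have IJ: "I \<subseteq> J"
    proof
      fix i assume "i \<in> I"
      thus "i \<in> J" unfolding J_def by (intro CollectI exI[of _ i] exI[of _ 0]) auto
    qed
    moreover have "1 \<notin> J" using neg by (auto simp: J_def)
    ultimately have "J = I" using Ii by (intro max) (auto simp: A_def)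
    moreover have "x \<in> J" using Ii unfolding J_def ai_ideal_def
      by (intro CollectI exI[of _ 0] exI[of _ 1]) auto
    ultimately show False using x by simp
  qed
  have "ai_prime I"
    unfolding ai_prime_def
  proof (intro conjI ballI impI)
    fix x y assume xy: "x \<in> alg_ints" "y \<in> alg_ints" "x * y \<in> I"
    show "x \<in> I \<or> y \<in> I"
    proof (rule ccontr)
      assume neg: "\<not> ?thesis"
      obtain i r where 1: "i \<in> I" "r \<in> alg_ints" "1 = i + r * x" using gen[of x] xy neg by blast
      have "y = y * i + r * (x * y)" using 1(3) by (metis distrib_right mult.assoc mult.commute mult_1)
      also have "\<dots> \<in> I" using Ii 1 xy unfolding ai_ideal_def by blast
      finally show False using neg by blast
    qed
  qed (use Ii in auto)
  thus ?thesis using Ii by blast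
qed

text \<open>Induction on the number of points: synthetic division at \<open>r\<close> leaves a
  quotient vanishing modulo \<open>p\<close> at the other points, since \<open>s - r\<close> is
  prime to \<open>p\<close>. This is Lagrange's bound for the number of roots over the field with
  \<open>p\<close> elements, read off the coefficients.\<close>

lemma int_poly_vanishing_mod:
  fixes q :: "int poly"
  assumes p: "prime (p :: int)" and "finite S" "\<And>r. r \<in> S \<Longrightarrow> p dvd poly q r"
    and "\<And>r s. r \<in> S \<Longrightarrow> s \<in> S \<Longrightarrow> r \<noteq> s \<Longrightarrow> \<not> p dvd r - s"
    and "q = 0 \<or> degree q < card S"
  shows "p dvd coeff q i"
  using assms(2-)
proof (induction "card S" arbitrary: S q i)
  case (Suc k)
  then obtain r where r: "r \<in> S" by fastforce
  define Q where "Q = synthetic_div q r"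
  have q: "q = pCons (poly q r) 0 + [:- r, 1:] * Q"
    using synthetic_div_correct'[of r q] by (simp add: Q_def add.commute)
  have "p dvd coeff Q j" for j
  proof (rule Suc.hyps(1))
    show "k = card (S - {r})" "finite (S - {r})" using Suc r by auto
    show "Q = 0 \<or> degree Q < card (S - {r})"
      using Suc.prems(4) Suc.hyps(2) r Suc.prems(1)
      by (auto simp: Q_def degree_synthetic_div synthetic_div_eq_0_iff)
    fix s assume s: "s \<in> S - {r}"
    have "poly q s = poly q r + (s - r) * poly Q s" by (subst q) (simp add: algebra_simps)
    hence "p dvd (s - r) * poly Q s" using Suc.prems(2)[of s] Suc.prems(2)[of r] s r by (metis DiffD1 dvd_add_right_iff)
    thus "p dvd poly Q s" using Suc.prems(3)[of s r] s r p by (auto simp: prime_dvd_mult_iff)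
  qed (use Suc.prems(3) in auto)
  moreover have "coeff q i = (if i = 0 then poly q r else coeff Q (i - 1)) - r * coeff Q i"
    by (subst q) (auto simp: coeff_pCons split: nat.split)
  ultimately show ?case using Suc.prems(2)[OF r] by auto
qed auto

lemma fermat_int: "prime p \<Longrightarrow> int p dvd k ^ p - k"
proof -
  assume p: "prime p"
  have "[k ^ p = k] (mod int p)"
  proof (cases "int p dvd k")
    case True
    hence "int p dvd k ^ p" using prime_gt_0_nat[OF p] by (metis dvd_power dvd_trans)
    thus ?thesis using True by (simp add: Cong.cong_def dvd_eq_mod_eq_0)
  next
    case False
    have "[nat (k mod int p) ^ (p - 1) = 1] (mod p)"
    proof (rule fermat_theorem[OF p])
      have "k mod int p \<noteq> 0" "k mod int p < int p" "k mod int p \<ge> 0"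
        using False p prime_gt_0_nat[OF p] by (auto simp: dvd_eq_mod_eq_0)
      thus "\<not> p dvd nat (k mod int p)" using nat_dvd_not_less[of "nat (k mod int p)" p] by linarith
    qed
    hence "[int (nat (k mod int p)) ^ (p - 1) = 1] (mod int p)" by (metis cong_int_iff of_nat_1 of_nat_power)
    moreover have "int (nat (k mod int p)) = k mod int p" using prime_gt_0_nat[OF p] by simp
    ultimately have "[(k mod int p) ^ (p - 1) = 1] (mod int p)" by simp
    hence "[k ^ (p - 1) = 1] (mod int p)" by (simp add: Cong.cong_def power_mod)
    hence "[k * k ^ (p - 1) = k * 1] (mod int p)" by (rule cong_scalar_left)
    thus ?thesis using prime_gt_0_nat[OF p] by (cases p) auto
  qed
  thus ?thesis by (simp add: cong_iff_dvd_diff)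
qed

text \<open>The leading terms cancel, so the difference has degree below \<open>p\<close>, and by
  Fermat it vanishes modulo \<open>p\<close> at all \<open>p\<close> residues. It expresses the
  splitting of \<open>X ^ p - X\<close> over the field with \<open>p\<close> elements.\<close>

lemma frobenius_poly_split:
  assumes p: "prime p"
  shows "int p dvd coeff (monom 1 p - [:0, 1:] - (\<Prod>r\<in>{0..<int p}. [:- r, 1:])) i"
proof (rule int_poly_vanishing_mod[of _ "{0..<int p}"])
  define R :: "int poly" where "R = (\<Prod>r\<in>{0..<int p}. [:- r, 1:])"
  have R: "degree R = p" "lead_coeff R = 1"
    unfolding R_def using degree_prod_eq_sum_degree[of "{0..<int p}" "\<lambda>r. [:- r, 1:]"]
    using lead_coeff_prod[of "\<lambda>r. [:- r, 1:]" "{0..<int p}"] by auto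
  have p1: "p > 1" using p prime_gt_1_nat by blast
  have "degree (monom 1 p - [:0, 1:] - R) < p"
  proof (rule degree_lessI)
    show "\<forall>k\<ge>p. coeff (monom 1 p - [:0, 1:] - R) k = 0"
      using R p1 by (auto simp: coeff_pCons coeff_eq_0 split: nat.split dest!: le_neq_implies_less)
  qed (use p1 in auto)
  thus "monom 1 p - [:0, 1:] - R = 0 \<or> degree (monom 1 p - [:0, 1:] - R) < card {0..<int p}" by simp
  fix r s assume "r \<in> {0..<int p}" "s \<in> {0..<int p}" "r \<noteq> s"
  thus "\<not> int p dvd r - s" using dvd_imp_le_int[of "r - s" "int p"] by auto
next
  fix r assume r: "r \<in> {0..<int p}"
  hence "poly (\<Prod>r\<in>{0..<int p}. [:- r, 1:]) r = 0" by (auto simp: poly_prod)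
  thus "int p dvd poly (monom 1 p - [:0, 1:] - (\<Prod>r\<in>{0..<int p}. [:- r, 1:])) r"
    using fermat_int[OF p, of r] by (simp add: poly_monom)
qed (use p in auto)

text \<open>One choice of a prime ideal above \<open>p\<close>, fixed once and for all; every
  congruence below and the elements \<open>frob p\<close> refer to it.\<close>

definition prime_over :: "nat \<Rightarrow> complex set" where
  "prime_over p = (SOME I. ai_prime I \<and> of_nat p \<in> I)"

context
  fixes p :: nat and P :: "complex set"
  assumes p: "prime p" and P_def: "P = prime_over p"
begin

lemma prime_over_props: "ai_prime P" "of_nat p \<in> P"
  using someI_ex[OF exists_ai_prime[OF p]] by (auto simp: P_def prime_over_def)

lemma po_0: "0 \<in> P"
  and po_add: "x \<in> P \<Longrightarrow> y \<in> P \<Longrightarrow> x + y \<in> P"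
  and po_mult: "r \<in> alg_ints \<Longrightarrow> x \<in> P \<Longrightarrow> r * x \<in> P"
  and po_1: "1 \<notin> P"
  and po_prime: "x \<in> alg_ints \<Longrightarrow> y \<in> alg_ints \<Longrightarrow> x * y \<in> P \<Longrightarrow> x \<in> P \<or> y \<in> P"
  using prime_over_props(1) unfolding ai_prime_def ai_ideal_def by blast+

lemma po_mult2: "r \<in> alg_ints \<Longrightarrow> x \<in> P \<Longrightarrow> x * r \<in> P"
  using po_mult[of r x] by (simp add: mult.commute)

lemma po_minus: "x \<in> P \<Longrightarrow> - x \<in> P"
  using po_mult[of "-1" x] alg_ints_minus[of 1] by simp

lemma po_diff: "x \<in> P \<Longrightarrow> y \<in> P \<Longrightarrow> x - y \<in> P"
  using po_add[of x "- y"] po_minus[of y] by simp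

lemma po_sum: "(\<And>i. i \<in> I \<Longrightarrow> f i \<in> P) \<Longrightarrow> (\<Sum>i\<in>I. f i) \<in> P"
  by (induction I rule: infinite_finite_induct) (auto intro: po_0 po_add)

lemma po_prod:
  "finite I \<Longrightarrow> (\<And>i. i \<in> I \<Longrightarrow> f i \<in> alg_ints) \<Longrightarrow> (\<Prod>i\<in>I. f i) \<in> P \<longleftrightarrow> (\<exists>i\<in>I. f i \<in> P)"
proof (induction I rule: finite_induct)
  case (insert i I)
  have a: "f i \<in> alg_ints" "prod f I \<in> alg_ints" using insert by auto
  show ?case using po_prime[OF a] insert po_mult[OF a(1), of "prod f I"] po_mult2[OF a(2), of "f i"] a by auto
qed (use po_1 in auto)

text \<open>An integer prime to \<open>p\<close> combines with \<open>p\<close> to \<open>1\<close>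
  by Bezout. This is the way back from congruences between algebraic integers to divisibility of
  rational integers.\<close>

lemma po_of_int: "of_int k \<in> P \<longleftrightarrow> int p dvd k"
proof
  assume "int p dvd k"
  then obtain m where "k = int p * m" by blast
  thus "of_int k \<in> P" using po_mult2[OF alg_ints_of_int[of m] prime_over_props(2)] by simp
next
  assume k: "of_int k \<in> P"
  show "int p dvd k"
  proof (rule ccontr)
    assume "\<not> int p dvd k"
    hence "coprime (int p) k" using p by (simp add: prime_imp_coprime)
    then obtain u v where "u * int p + v * k = 1" by (metis bezout_int coprime_iff_gcd_eq_1)
    hence "(of_int (u * int p + v * k) :: complex) = 1" by simp
    hence "of_int u * of_nat p + of_int v * of_int k = (1 :: complex)" by simp
    moreover have "of_int u * of_nat p + of_int v * of_int k \<in> P"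
      using k prime_over_props(2) by (intro po_add po_mult) auto
    ultimately show False using po_1 by simp
  qed
qed

lemma po_cong_power: "x \<in> alg_ints \<Longrightarrow> y \<in> alg_ints \<Longrightarrow> x - y \<in> P \<Longrightarrow> x ^ k - y ^ k \<in> P"
proof (induction k)
  case (Suc k)
  have "x ^ Suc k - y ^ Suc k = x * (x ^ k - y ^ k) + (x - y) * y ^ k" by (simp add: algebra_simps)
  moreover have "x * (x ^ k - y ^ k) + (x - y) * y ^ k \<in> P"
    using Suc by (intro po_add po_mult po_mult2) auto
  ultimately show ?case by simp
qed (simp add: po_0)

lemma po_frobenius_add:
  assumes "x \<in> alg_ints" "y \<in> alg_ints"
  shows "(x + y) ^ p - (x ^ p + y ^ p) \<in> P"
proof -
  have p0: "p > 0" using p prime_gt_0_nat by blast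
  have "(x + y) ^ p = (\<Sum>k\<le>p. of_nat (p choose k) * x ^ k * y ^ (p - k))" by (rule binomial_ring)
  also have "{..p} = insert 0 (insert p {1..<p})" using p0 by auto
  also have "(\<Sum>k\<in>\<dots>. of_nat (p choose k) * x ^ k * y ^ (p - k)) =
      y ^ p + x ^ p + (\<Sum>k\<in>{1..<p}. of_nat (p choose k) * x ^ k * y ^ (p - k))"
    using p0 by (subst sum.insert; auto)+
  finally have "(x + y) ^ p - (x ^ p + y ^ p) = (\<Sum>k\<in>{1..<p}. of_nat (p choose k) * x ^ k * y ^ (p - k))" by simp
  also have "\<dots> \<in> P"
  proof (rule po_sum)
    fix k assume "k \<in> {1..<p}"
    hence "p dvd (p choose k)" using p by (intro dvd_choose_prime) auto
    then obtain m where "p choose k = p * m" by blast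
    hence "of_nat (p choose k) * x ^ k * y ^ (p - k) = of_nat p * (of_nat m * x ^ k * y ^ (p - k))"
      by simp
    also have "\<dots> \<in> P" using assms prime_over_props(2) by (intro po_mult2) auto
    finally show "of_nat (p choose k) * x ^ k * y ^ (p - k) \<in> P" .
  qed
  finally show ?thesis .
qed

lemma po_fermat: "of_int k ^ p - of_int k \<in> P"
  using fermat_int[OF p, of k] po_of_int[of "k ^ p - k"] by simp

lemma po_frobenius_sum:
  assumes "finite I" "\<And>i. i \<in> I \<Longrightarrow> f i \<in> alg_ints"
  shows "(\<Sum>i\<in>I. f i) ^ p - (\<Sum>i\<in>I. f i ^ p) \<in> P"
  using assms
proof (induction I rule: finite_induct)
  case empty
  thus ?case using prime_gt_0_nat[OF p] po_0 by (simp add: zero_power)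
next
  case (insert i I)
  have "(\<Sum>i\<in>insert i I. f i) ^ p - (\<Sum>i\<in>insert i I. f i ^ p) =
    ((f i + sum f I) ^ p - (f i ^ p + sum f I ^ p)) + (sum f I ^ p - (\<Sum>i\<in>I. f i ^ p))"
    using insert by simp
  also have "\<dots> \<in> P" using insert by (intro po_add po_frobenius_add) auto
  finally show ?case .
qed

lemma po_frobenius_poly:
  assumes "x \<in> alg_ints"
  shows "(\<Sum>i<n. of_int (c i) * x ^ i) ^ p - (\<Sum>i<n. of_int (c i) * (x ^ p) ^ i) \<in> P"
proof -
  have "(\<Sum>i<n. of_int (c i) * x ^ i) ^ p - (\<Sum>i<n. (of_int (c i) * x ^ i) ^ p) \<in> P"
    using assms by (intro po_frobenius_sum) auto
  moreover have "(\<Sum>i<n. (of_int (c i) * x ^ i) ^ p) - (\<Sum>i<n. of_int (c i) * (x ^ p) ^ i) \<in> P"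
  proof -
    have "(\<Sum>i<n. (of_int (c i) * x ^ i) ^ p) - (\<Sum>i<n. of_int (c i) * (x ^ p) ^ i)
      = (\<Sum>i<n. (of_int (c i) ^ p - of_int (c i)) * (x ^ p) ^ i)"
      by (simp add: sum_subtractf[symmetric] power_mult_distrib left_diff_distrib power_mult[symmetric] mult.commute[of p])
    also have "\<dots> \<in> P" using assms by (intro po_sum po_mult2 po_fermat) auto
    finally show ?thesis .
  qed
  ultimately show ?thesis using po_add by fastforce
qed

text \<open>Modulo the prime, \<open>x ^ p - x\<close> is the product of the differences of
  \<open>x\<close> with the \<open>p\<close> residues, so one of these factors lies in the
  prime.\<close>

lemma po_fixed_imp_int:
  assumes x: "x \<in> alg_ints" and fx: "x ^ p - x \<in> P"
  shows "\<exists>r\<in>{0..<int p}. x - of_int r \<in> P"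
proof -
  define R :: "int poly" where "R = (\<Prod>r\<in>{0..<int p}. [:- r, 1:])"
  define D where "D = monom 1 p - [:0, 1:] - R"
  have "poly (map_poly of_int D) x = (\<Sum>i\<le>degree D. of_int (coeff D i) * x ^ i)"
    by (simp add: poly_altdef degree_map_poly coeff_map_poly)
  also have "\<dots> \<in> P"
    using x by (intro po_sum po_mult2 iffD2[OF po_of_int] frobenius_poly_split[OF p, folded R_def D_def]) auto
  finally have "poly (map_poly of_int D) x \<in> P" .
  moreover have e1: "map_poly of_int D = monom 1 p - [:0, 1:] - map_poly of_int R"
    by (rule poly_eqI) (simp add: D_def coeff_map_poly coeff_pCons split: nat.split)
  have e2: "map_poly of_int R = (\<Prod>r\<in>{0..<int p}. [:- of_int r, 1 :: complex:])"
    by (simp add: R_def of_int_poly_hom.hom_prod)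
  have "poly (map_poly of_int D) x = x ^ p - x - (\<Prod>r\<in>{0..<int p}. x - of_int r)"
    unfolding e1 e2 by (simp add: poly_monom poly_prod)
  ultimately have "x ^ p - x - (\<Prod>r\<in>{0..<int p}. x - of_int r) \<in> P" by simp
  hence "(x ^ p - x) - (x ^ p - x - (\<Prod>r\<in>{0..<int p}. x - of_int r)) \<in> P"
    by (rule po_diff[OF fx])
  hence "(\<Prod>r\<in>{0..<int p}. x - of_int r) \<in> P" by simp
  thus ?thesis using x by (subst (asm) po_prod) auto
qed

end

section \<open>Integer points of boxes in residue classes\<close>

text \<open>Members are \<open>undefined\<close> outside \<open>{..<n}\<close>, which makes the box
  a finite set with \<open>T ^ n\<close> elements and lets equality be tested on
  coordinates.\<close>

definition box :: "nat \<Rightarrow> nat \<Rightarrow> (nat \<Rightarrow> int) set" where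
  "box n T = PiE {..<n} (\<lambda>_. {0..<int T})"

lemma card_box: "card (box n T) = T ^ n"
  by (simp add: box_def card_PiE)

lemma finite_box [simp, intro]: "finite (box n T)"
  unfolding box_def by (rule finite_PiE) auto

lemma box_ext: "b \<in> box n T \<Longrightarrow> c \<in> box n S \<Longrightarrow> (\<And>j. j < n \<Longrightarrow> b j = c j) \<Longrightarrow> b = c"
  unfolding box_def PiE_def by (rule extensionalityI[of b "{..<n}"]) simp_all

lemma box_restrict: "(\<And>j. j < n \<Longrightarrow> 0 \<le> b j \<and> b j < int T) \<Longrightarrow> restrict b {..<n} \<in> box n T"
  by (auto simp: box_def)

lemma box_bounds: "b \<in> box n T \<Longrightarrow> j < n \<Longrightarrow> 0 \<le> b j \<and> b j < int T"
  using PiE_mem[of b "{..<n}" "\<lambda>_. {0..<int T}" j] by (simp add: box_def)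

text \<open>Applied with \<open>v j = r ^ j\<close>, it is the value at \<open>r\<close> of the
  polynomial with coefficient vector \<open>b\<close>.\<close>

definition vdot :: "nat \<Rightarrow> (nat \<Rightarrow> int) \<Rightarrow> (nat \<Rightarrow> int) \<Rightarrow> int" where
  "vdot n v b = (\<Sum>j<n. b j * v j)"

lemma vdot_add: "vdot n v (\<lambda>j. b j + c j) = vdot n v b + vdot n v c"
  by (simp add: vdot_def algebra_simps sum.distrib)

lemma vdot_diff: "vdot n v (\<lambda>j. b j - c j) = vdot n v b - vdot n v c"
  by (simp add: vdot_def algebra_simps sum_subtractf)

lemma vdot_restrict [simp]: "vdot n v (restrict b {..<n}) = vdot n v b"
  by (simp add: vdot_def)

text \<open>The classes at word distance \<open>0, 2, 4, \<dots>\<close> from \<open>0\<close>, for the generating set given by the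
  image of the cube \<open>[-T, T]^n\<close>, have disjoint translates of the image of \<open>box n T\<close>.\<close>

lemma residues_covered_by_box:
  fixes p :: nat and v :: "nat \<Rightarrow> int"
  assumes n: "n > 0" and v0: "v 0 = 1" and T: "T > 0"
    and inj: "\<And>b c. b \<in> box n T \<Longrightarrow> c \<in> box n T \<Longrightarrow> [vdot n v b = vdot n v c] (mod int p) \<Longrightarrow> b = c"
    and m: "p < (m div 2 + 1) * T ^ n" and p: "p > 0"
  shows "\<exists>b \<in> box n (2 * m * T + 1). [vdot n v b = t] (mod int p)"
proof -
  define I where "I k = {t. \<exists>b. (\<forall>j<n. \<bar>b j\<bar> \<le> int (k * T)) \<and> [vdot n v b = t] (mod int p)}" for k
  have reach: "t \<in> I (nat \<bar>t\<bar>)" for t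
  proof -
    have "vdot n v (\<lambda>j. if j = 0 then t else 0) = t"
      using n v0 by (simp add: vdot_def if_distrib[of "\<lambda>x. x * _"] sum.delta cong: if_cong)
    moreover have "\<bar>t\<bar> * 1 \<le> \<bar>t\<bar> * int T" using T by (intro mult_left_mono) auto
    ultimately show ?thesis unfolding I_def by (intro CollectI exI[of _ "\<lambda>j. if j = 0 then t else 0"]) auto
  qed
  have add: "s + t \<in> I (k + l)" if "s \<in> I k" "t \<in> I l" for s t k l
  proof -
    obtain b c where "\<forall>j<n. \<bar>b j\<bar> \<le> int (k * T)" "[vdot n v b = s] (mod int p)"
      "\<forall>j<n. \<bar>c j\<bar> \<le> int (l * T)" "[vdot n v c = t] (mod int p)" using \<open>s \<in> I k\<close> \<open>t \<in> I l\<close> unfolding I_def by blast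
    moreover have "\<bar>b j + c j\<bar> \<le> int ((k + l) * T)" if "\<bar>b j\<bar> \<le> int (k * T)" "\<bar>c j\<bar> \<le> int (l * T)" for j
    proof -
      have "\<bar>b j + c j\<bar> \<le> int (k * T) + int (l * T)" using that by linarith
      thus ?thesis by (simp add: distrib_right)
    qed
    ultimately show ?thesis unfolding I_def
      by (intro CollectI exI[of _ "\<lambda>j. b j + c j"]) (auto simp: vdot_add intro: cong_add)
  qed
  have split: "\<exists>y\<in>I k. t - y \<in> I 1" if tk: "t \<in> I (Suc k)" for t k
  proof -
    obtain b where b: "\<forall>j<n. \<bar>b j\<bar> \<le> int (Suc k * T)" "[vdot n v b = t] (mod int p)"
      using tk unfolding I_def by blast
    define c where "c j = max (- int (k * T)) (min (int (k * T)) (b j))" for j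
    have "\<bar>c j\<bar> \<le> int (k * T)" for j unfolding c_def by linarith
    hence "vdot n v c \<in> I k" unfolding I_def by (intro CollectI exI[of _ c]) auto
    moreover have "t - vdot n v c \<in> I 1"
      unfolding I_def
    proof (intro CollectI exI[of _ "\<lambda>j. b j - c j"] conjI allI impI)
      fix j assume "j < n"
      hence "\<bar>b j\<bar> \<le> int (k * T) + int T" using b(1) by auto
      thus "\<bar>b j - c j\<bar> \<le> int (1 * T)" unfolding c_def by auto
    next
      show "[vdot n v (\<lambda>j. b j - c j) = t - vdot n v c] (mod int p)"
        unfolding vdot_diff using b(2) by (intro cong_diff) auto
    qed
    ultimately show ?thesis by blast
  qed
  have all: "t \<in> I m" for t
  proof (rule ccontr)
    assume nt: "t \<notin> I m"
    have mono: "t \<in> I l" if tk: "t \<in> I k" and kl: "k \<le> l" for k l t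
    proof -
      obtain b where b: "\<forall>j<n. \<bar>b j\<bar> \<le> int (k * T)" "[vdot n v b = t] (mod int p)"
        using tk unfolding I_def by blast
      have "int (k * T) \<le> int (l * T)" using kl by (intro of_nat_mono mult_le_mono1)
      thus ?thesis unfolding I_def using b by (intro CollectI exI[of _ b]) force
    qed
    define d where "d = (LEAST k. t \<in> I k)"
    have td: "t \<in> I d" "\<And>k. k < d \<Longrightarrow> t \<notin> I k"
      unfolding d_def using reach[of t] by (auto intro: LeastI dest: not_less_Least)
    have dm: "m < d" using nt mono[OF td(1)] by (meson not_le)
    \<comment> \<open>Walking back from \<open>t\<close> along a shortest path meets a class at
      every exact distance up to \<open>d\<close>.\<close>
    have "\<exists>x. x \<in> I (d - i) \<and> (\<forall>k < d - i. x \<notin> I k)" if "i \<le> d" for i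
      using that
    proof (induction i)
      case 0 thus ?case using td by auto
    next
      case (Suc i)
      then obtain x where x: "x \<in> I (d - i)" "\<forall>k < d - i. x \<notin> I k" by auto
      have e: "d - i = Suc (d - Suc i)" using Suc by simp
      obtain y where y: "y \<in> I (d - Suc i)" "x - y \<in> I 1" using split[of x "d - Suc i"] x e by auto
      have "y \<notin> I k" if "k < d - Suc i" for k
      proof
        assume "y \<in> I k"
        hence "x \<in> I (k + 1)" using add[of y k "x - y" 1] y by simp
        thus False using x(2) that e by auto
      qed
      thus ?case using y by blast
    qed
    hence "\<exists>x. x \<in> I k \<and> (\<forall>i < k. x \<notin> I i)" if "k \<le> d" for k
      using that by (metis diff_diff_cancel diff_le_self)
    then obtain x where x: "\<And>k. k \<le> d \<Longrightarrow> x k \<in> I k" "\<And>k i. k \<le> d \<Longrightarrow> i < k \<Longrightarrow> x k \<notin> I i" by metis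
    define \<phi> where "\<phi> = (\<lambda>(k :: nat, b). (x (2 * k) + vdot n v b) mod int p)"
    \<comment> \<open>Differences of points of \<open>box n T\<close> lie in the cube, so
      overlapping translates would bring the class at distance \<open>2 * l\<close> within
      \<open>2 * k + 1 < 2 * l\<close> steps of \<open>0\<close>. Using only even distances makes
      room for this extra step.\<close>
    have sep: False if kl: "k < l" "l \<le> m div 2" and b: "b \<in> box n T" "c \<in> box n T"
      and eq: "[x (2 * k) + vdot n v b = x (2 * l) + vdot n v c] (mod int p)" for k l b c
    proof -
      have "[vdot n v (\<lambda>j. b j - c j) = x (2 * l) - x (2 * k)] (mod int p)"
        unfolding vdot_diff using eq by (simp add: cong_iff_dvd_diff algebra_simps)
      moreover have "\<bar>b j - c j\<bar> \<le> int (1 * T)" if "j < n" for j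
        using box_bounds[OF b(1) that] box_bounds[OF b(2) that] by auto
      ultimately have "x (2 * l) - x (2 * k) \<in> I 1" unfolding I_def by (intro CollectI exI[of _ "\<lambda>j. b j - c j"]) auto
      have "2 * l \<le> m" using kl(2) by linarith
      hence "2 * l \<le> d" using dm by simp
      hence "x (2 * k) \<in> I (2 * k)" "x (2 * l) \<notin> I (2 * k + 1)" using kl x by auto
      thus False using add[of "x (2 * k)" "2 * k" "x (2 * l) - x (2 * k)" 1] \<open>x (2 * l) - x (2 * k) \<in> I 1\<close> by simp
    qed
    have "inj_on \<phi> ({..m div 2} \<times> box n T)"
    proof (rule inj_onI)
      fix y z assume "y \<in> {..m div 2} \<times> box n T" "z \<in> {..m div 2} \<times> box n T" and yz: "\<phi> y = \<phi> z"
      then obtain k b l c where ykb: "y = (k, b)" "z = (l, c)" and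
        a: "k \<in> {..m div 2}" "l \<in> {..m div 2}" "b \<in> box n T" "c \<in> box n T" and "\<phi> (k, b) = \<phi> (l, c)"
        by (metis SigmaE)
      hence eq: "[x (2 * k) + vdot n v b = x (2 * l) + vdot n v c] (mod int p)" by (simp add: \<phi>_def Cong.cong_def)
      have kl: "k = l"
      proof (rule ccontr)
        assume "k \<noteq> l"
        then consider "k < l" | "l < k" by linarith
        thus False
        proof cases
          case 1 show False by (rule sep[OF 1 _ _ _ eq]) (use a in auto)
        next
          case 2 show False by (rule sep[OF 2 _ _ _ cong_sym[OF eq]]) (use a in auto)
        qed
      qed
      moreover have "b = c" using eq a unfolding kl by (intro inj) (auto simp: cong_add_lcancel)
      ultimately show "y = z" using ykb by simp
    qed
    moreover have "\<phi> ` ({..m div 2} \<times> box n T) \<subseteq> {0..<int p}" using p by (auto simp: \<phi>_def)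
    ultimately have "card ({..m div 2} \<times> box n T) \<le> card {0..<int p}" by (intro card_inj_on_le) auto
    thus False using m by (simp add: card_box card_cartesian_product)
  qed
  \<comment> \<open>Adding \<open>m * T\<close> to every coordinate moves the cube of half side
    \<open>m * T\<close> around \<open>0\<close> to the box of side \<open>2 * m * T + 1\<close>;
    the target class is shifted accordingly.\<close>
  obtain b where b: "\<forall>j<n. \<bar>b j\<bar> \<le> int (m * T)" "[vdot n v b = t - vdot n v (\<lambda>_. int (m * T))] (mod int p)"
    using all[of "t - vdot n v (\<lambda>_. int (m * T))"] unfolding I_def by blast
  have "restrict (\<lambda>j. b j + int (m * T)) {..<n} \<in> box n (2 * m * T + 1)"
  proof (rule box_restrict)
    fix j assume "j < n"
    hence "\<bar>b j\<bar> \<le> int (m * T)" using b by auto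
    moreover have "int (2 * m * T + 1) = int (m * T) + int (m * T) + 1" by simp
    ultimately show "0 \<le> b j + int (m * T) \<and> b j + int (m * T) < int (2 * m * T + 1)" by linarith
  qed
  moreover have "[vdot n v b + vdot n v (\<lambda>_. int (m * T)) = t - vdot n v (\<lambda>_. int (m * T)) + vdot n v (\<lambda>_. int (m * T))] (mod int p)"
    by (intro cong_add b(2)) auto
  ultimately show ?thesis by (intro bexI[of _ "restrict (\<lambda>j. b j + int (m * T)) {..<n}"]) (auto simp: vdot_add)
qed

text \<open>Any residue can be corrected by a vector of the small box. Adding such vectors for all
  \<open>p\<close> residues maps pairs of a solution and a residue injectively into the box of side
  \<open>B + R\<close>; subtracting them maps a shrunken box injectively into those pairs. So each
  residue class has its expected share \<open>B ^ n / p\<close>, up to boundary effects of width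
  \<open>R\<close>.\<close>

lemma box_residue_count:
  fixes p B :: nat and v :: "nat \<Rightarrow> int" and t :: int
  assumes p: "p > 0" and cov: "\<And>t. \<exists>b \<in> box n R. [vdot n v b = t] (mod int p)"
  defines "N \<equiv> {b \<in> box n B. [vdot n v b = t] (mod int p)}"
  shows "p * card N \<le> (B + R) ^ n" and "R \<le> B \<Longrightarrow> (B - R) ^ n \<le> p * card N"
proof -
  obtain F where F: "\<And>t. F t \<in> box n R" "\<And>t. [vdot n v (F t) = t] (mod int p)" using cov by metis
  have finN: "finite N" by (auto simp: N_def)
  have cp: "card (N \<times> {0..<int p}) = p * card N" by (simp add: card_cartesian_product)
  define \<phi> where "\<phi> = (\<lambda>(b, s). restrict (\<lambda>j. b j + F s j) {..<n})"
  have "inj_on \<phi> (N \<times> {0..<int p})"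
  proof (rule inj_onI)
    fix y z assume "y \<in> N \<times> {0..<int p}" "z \<in> N \<times> {0..<int p}" and yz: "\<phi> y = \<phi> z"
    then obtain b s c r where yb: "y = (b, s)" "z = (c, r)" and
      a: "b \<in> N" "c \<in> N" "s \<in> {0..<int p}" "r \<in> {0..<int p}" and eq: "\<phi> (b, s) = \<phi> (c, r)"
      by (metis SigmaE)
    have "[vdot n v (\<phi> (b, s)) = t + s] (mod int p)"
      using a F(2)[of s] unfolding \<phi>_def N_def by (auto simp: vdot_add intro!: cong_add)
    moreover have "[vdot n v (\<phi> (c, r)) = t + r] (mod int p)"
      using a F(2)[of r] unfolding \<phi>_def N_def by (auto simp: vdot_add intro!: cong_add)
    ultimately have "[t + s = t + r] (mod int p)" using eq cong_sym cong_trans by metis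
    hence "[s = r] (mod int p)" by (simp only: cong_add_lcancel)
    hence sr: "s = r" using a by (simp add: Cong.cong_def)
    have "b j = c j" if "j < n" for j using fun_cong[OF eq, of j] that by (simp add: \<phi>_def sr)
    hence "b = c" using a by (intro box_ext[of b n B c B]) (auto simp: N_def)
    thus "y = z" using sr yb by simp
  qed
  moreover have "\<phi> ` (N \<times> {0..<int p}) \<subseteq> box n (B + R)"
  proof clarify
    fix b s assume "b \<in> N"
    hence "0 \<le> b j + F s j \<and> b j + F s j < int (B + R)" if "j < n" for j
      using box_bounds[of b n B, OF _ that] box_bounds[OF F(1)[of s] that] by (auto simp: N_def)
    thus "\<phi> (b, s) \<in> box n (B + R)" unfolding \<phi>_def by (auto intro: box_restrict)
  qed
  ultimately have "card (N \<times> {0..<int p}) \<le> card (box n (B + R))" by (intro card_inj_on_le) auto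
  thus "p * card N \<le> (B + R) ^ n" by (simp add: cp card_box)

  assume RB: "R \<le> B"
  \<comment> \<open>The shift by \<open>R\<close> keeps the coordinates nonnegative after
    \<open>F (s c)\<close>, whose entries are below \<open>R\<close>, has been subtracted.\<close>
  define s where "s c = (vdot n v (\<lambda>j. c j + int R) - t) mod int p" for c
  define \<psi> where "\<psi> c = (restrict (\<lambda>j. c j + int R - F (s c) j) {..<n}, s c)" for c
  have "inj_on \<psi> (box n (B - R))"
  proof (rule inj_onI)
    fix b c assume a: "b \<in> box n (B - R)" "c \<in> box n (B - R)" and eq: "\<psi> b = \<psi> c"
    have "s b = s c" using eq by (simp add: \<psi>_def)
    moreover have "fst (\<psi> b) j = fst (\<psi> c) j" for j using eq by simp
    ultimately have "b j = c j" if "j < n" for j using that by (simp add: \<psi>_def) (metis add_right_cancel diff_add_cancel)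
    thus "b = c" using a by (intro box_ext) auto
  qed
  moreover have "\<psi> ` box n (B - R) \<subseteq> N \<times> {0..<int p}"
  proof (rule image_subsetI)
    fix c assume c: "c \<in> box n (B - R)"
    have "0 \<le> c j + int R - F (s c) j \<and> c j + int R - F (s c) j < int B" if "j < n" for j
      using box_bounds[OF c that] box_bounds[OF F(1)[of "s c"] that] RB by auto
    hence 1: "restrict (\<lambda>j. c j + int R - F (s c) j) {..<n} \<in> box n B" by (rule box_restrict)
    have "[vdot n v (F (s c)) = vdot n v (\<lambda>j. c j + int R) - t] (mod int p)"
      using F(2)[of "s c"] by (auto simp: s_def Cong.cong_def)
    hence "[vdot n v (\<lambda>j. c j + int R) - vdot n v (F (s c)) = vdot n v (\<lambda>j. c j + int R) - (vdot n v (\<lambda>j. c j + int R) - t)] (mod int p)"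
      by (intro cong_diff) auto
    hence "[vdot n v (\<lambda>j. c j + int R - F (s c) j) = t] (mod int p)"
      by (simp only: vdot_diff diff_diff_eq2 add_diff_cancel_left' diff_add_cancel)
    thus "\<psi> c \<in> N \<times> {0..<int p}" using 1 p by (auto simp: \<psi>_def N_def s_def)
  qed
  ultimately have "card (box n (B - R)) \<le> card (N \<times> {0..<int p})" using finN by (intro card_inj_on_le) auto
  thus "(B - R) ^ n \<le> p * card N" by (simp add: cp card_box)
qed

text \<open>Two points in the same cell of a grid of mesh \<open>l\<close> have all coordinates
  closer than \<open>l\<close>, so a separated set meets each cell at most once.\<close>

lemma box_packing:
  assumes S: "S \<subseteq> box n B" and l: "l > 0"
    and sep: "\<And>b c. b \<in> S \<Longrightarrow> c \<in> S \<Longrightarrow> b \<noteq> c \<Longrightarrow> \<exists>j<n. int l \<le> \<bar>b j - c j\<bar>"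
  shows "card S \<le> (B div l + 1) ^ n"
proof -
  define \<phi> where "\<phi> b = restrict (\<lambda>j. b j div int l) {..<n}" for b
  have "inj_on \<phi> S"
  proof (rule inj_onI, rule ccontr)
    fix b c assume a: "b \<in> S" "c \<in> S" "\<phi> b = \<phi> c" "b \<noteq> c"
    obtain j where j: "j < n" "int l \<le> \<bar>b j - c j\<bar>" using sep a by blast
    have "b j div int l = c j div int l" using fun_cong[OF a(3), of j] j by (simp add: \<phi>_def)
    moreover have "b j = int l * (b j div int l) + b j mod int l" "c j = int l * (c j div int l) + c j mod int l" by simp_all
    ultimately have "b j - c j = b j mod int l - c j mod int l" by (metis add_diff_cancel_left)
    moreover have "0 \<le> b j mod int l" "b j mod int l < int l" "0 \<le> c j mod int l" "c j mod int l < int l" using l by auto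
    ultimately show False using j by linarith
  qed
  moreover have "\<phi> ` S \<subseteq> box n (B div l + 1)"
  proof clarify
    fix b assume "b \<in> S"
    hence "0 \<le> b j div int l \<and> b j div int l < int (B div l + 1)" if "j < n" for j
      using box_bounds[of b n B j] that S l zdiv_mono1[of "b j" "int B" "int l"]
      by (auto simp: pos_imp_zdiv_nonneg_iff zdiv_int)
    thus "\<phi> b \<in> box n (B div l + 1)" unfolding \<phi>_def by (rule box_restrict)
  qed
  ultimately have "card S \<le> card (box n (B div l + 1))" by (intro card_inj_on_le) auto
  thus ?thesis by (simp add: card_box)
qed

section \<open>Elementary bounds for sums over primes\<close>

lemma prod_primes_dvd:
  assumes "finite F" "\<And>p. p \<in> F \<Longrightarrow> prime p \<and> p dvd (N :: nat)"
  shows "\<Prod>F dvd N"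
  using assms
proof (induction F rule: finite_induct)
  case (insert p F)
  have "coprime p (\<Prod>F)"
  proof (rule prod_coprime_right)
    fix q assume "q \<in> F"
    hence "p \<noteq> q" "prime p" "prime q" using insert by auto
    thus "coprime p q" by (simp add: primes_coprime)
  qed
  thus ?case using insert by (simp add: divides_mult)
qed auto

lemma sum_ln_primes_le:
  assumes "finite F" "\<And>p. p \<in> F \<Longrightarrow> prime p \<and> p dvd (N :: nat)" "N > 0"
  shows "(\<Sum>p\<in>F. ln (real p)) \<le> ln (real N)"
proof -
  have pos: "\<Prod>F > 0" using assms prime_gt_0_nat by (intro prod_pos) auto
  have "(\<Sum>p\<in>F. ln (real p)) = ln (\<Prod>p\<in>F. real p)"
    using assms prime_gt_0_nat by (intro ln_prod[symmetric]) auto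
  also have "\<dots> = ln (real (\<Prod>F))" by simp
  also have "\<dots> \<le> ln (real N)"
  proof -
    have "real (\<Prod>F) \<le> real N" using dvd_imp_le[OF prod_primes_dvd[OF assms(1,2)] assms(3)] by linarith
    moreover have "real (\<Prod>F) > 0" using pos by linarith
    ultimately show ?thesis using assms(3) by simp
  qed
  finally show ?thesis .
qed

lemma central_binomial_le: "(2 * k + 1) choose k \<le> 4 ^ k"
proof -
  have "2 * ((2 * k + 1) choose k) = (2 * k + 1 choose k) + (2 * k + 1 choose (k + 1))"
    using binomial_symmetric[of k "2 * k + 1"] by simp
  also have "\<dots> = (\<Sum>i\<in>{k, k + 1}. 2 * k + 1 choose i)" by simp
  also have "\<dots> \<le> (\<Sum>i\<le>2 * k + 1. 2 * k + 1 choose i)" by (intro sum_mono2) auto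
  also have "\<dots> = 2 ^ (2 * k + 1)" by (rule choose_row_sum)
  also have "\<dots> = 2 * 4 ^ k" by (simp add: power_mult)
  finally show ?thesis by simp
qed

text \<open>Erdos' argument: for \<open>m = 2 * k + 1\<close> the primes above \<open>k + 1\<close>
  all divide a binomial coefficient of size at most \<open>4 ^ k\<close>, and an even
  \<open>m > 2\<close> contributes no new prime.\<close>

lemma primorial_le: "\<Prod>{p. prime p \<and> p \<le> m} \<le> (4 :: nat) ^ m"
proof (induction m rule: less_induct)
  case (less m)
  consider "m \<le> 1" | "m = 2" | "m > 2" "even m" | "m > 2" "odd m" by linarith
  thus ?case
  proof cases
    case 1
    have "{p::nat. prime p \<and> p \<le> m} = {}" using 1 by (auto dest: prime_gt_1_nat)
    thus ?thesis by (simp only: prod.empty) simp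
  next
    case 2
    have "{p::nat. prime p \<and> p \<le> m} = {2}" using 2 by (auto dest: prime_ge_2_nat)
    thus ?thesis using 2 by simp
  next
    case 3
    have "\<not> prime m" using 3 prime_odd_nat by blast
    hence "p \<le> m - 1" if "prime p" "p \<le> m" for p using that by (cases "p = m") auto
    hence "{p. prime p \<and> p \<le> m} = {p. prime p \<and> p \<le> m - 1}" by auto
    hence "\<Prod>{p. prime p \<and> p \<le> m} \<le> 4 ^ (m - 1)" using less[of "m - 1"] 3 by simp
    also have "\<dots> \<le> 4 ^ m" by (intro power_increasing) auto
    finally show ?thesis .
  next
    case 4
    then obtain k where m: "m = 2 * k + 1" by (auto elim: oddE)
    have k: "k \<ge> 1" using 4 m by simp
    have eq: "{p. prime p \<and> p \<le> m} = {p. prime p \<and> p \<le> k + 1} \<union> {p. prime p \<and> k + 1 < p \<and> p \<le> m}"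
      using m k by auto
    have "\<Prod>{p. prime p \<and> p \<le> m} = \<Prod>{p. prime p \<and> p \<le> k + 1} * \<Prod>{p. prime p \<and> k + 1 < p \<and> p \<le> m}"
      unfolding eq by (rule prod.union_disjoint) auto
    moreover have "\<Prod>{p. prime p \<and> k + 1 < p \<and> p \<le> m} dvd (m choose k)"
    proof (rule prod_primes_dvd)
      fix p assume p: "p \<in> {p. prime p \<and> k + 1 < p \<and> p \<le> m}"
      have "p dvd fact m" using p by (simp add: prime_dvd_fact_iff)
      also have "fact m = fact k * fact (m - k) * (m choose k)"
        using binomial_fact_lemma[of k m] m by simp
      finally have "p dvd fact k \<or> p dvd fact (m - k) \<or> p dvd (m choose k)"
        using p by (simp add: prime_dvd_mult_iff)
      moreover have "\<not> p dvd fact k" "\<not> p dvd fact (m - k)" using p m by (auto simp: prime_dvd_fact_iff simp del: fact_Suc)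
      ultimately show "prime p \<and> p dvd (m choose k)" using p by blast
    qed auto
    hence "\<Prod>{p. prime p \<and> k + 1 < p \<and> p \<le> m} \<le> (m choose k)"
      by (rule dvd_imp_le) (use m in simp)
    hence "\<Prod>{p. prime p \<and> k + 1 < p \<and> p \<le> m} \<le> 4 ^ k" using central_binomial_le[of k] m by simp
    moreover have "\<Prod>{p. prime p \<and> p \<le> k + 1} \<le> 4 ^ (k + 1)" using less[of "k + 1"] m k by simp
    ultimately have "\<Prod>{p. prime p \<and> p \<le> m} \<le> 4 ^ (k + 1) * 4 ^ k" by (simp add: mult_mono)
    also have "\<dots> = 4 ^ m" by (simp add: m power_add[symmetric])
    finally show ?thesis .
  qed
qed

lemma finite_primes_le [simp]: "finite {p :: nat. prime p \<and> Q p \<and> real p \<le> y}"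
proof (rule finite_subset)
  show "{p :: nat. prime p \<and> Q p \<and> real p \<le> y} \<subseteq> {..nat \<lfloor>y\<rfloor>}" using le_nat_floor by blast
qed simp

lemma chebyshev_theta_le:
  assumes "y \<ge> 0"
  shows "(\<Sum>p | prime p \<and> real p \<le> y. ln (real p)) \<le> y * ln 4"
proof -
  have eq: "{p. prime p \<and> real p \<le> y} = {p. prime p \<and> p \<le> nat \<lfloor>y\<rfloor>}"
    using assms by (auto simp: le_nat_floor) (metis le_floor_iff le_nat_iff of_int_of_nat_eq zero_le_floor)
  have "(\<Sum>p | prime p \<and> real p \<le> y. ln (real p)) = ln (\<Prod>p | prime p \<and> p \<le> nat \<lfloor>y\<rfloor>. real p)"
    unfolding eq using prime_gt_0_nat by (intro ln_prod[symmetric]) auto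
  also have "(\<Prod>p | prime p \<and> p \<le> nat \<lfloor>y\<rfloor>. real p) = real (\<Prod>{p. prime p \<and> p \<le> nat \<lfloor>y\<rfloor>})" by simp
  also have "ln \<dots> \<le> ln (real (4 ^ nat \<lfloor>y\<rfloor>))"
  proof (subst ln_le_cancel_iff)
    show "0 < real (\<Prod>{p. prime p \<and> p \<le> nat \<lfloor>y\<rfloor>})"
      using prime_gt_0_nat by (auto intro!: prod_pos)
    show "0 < real ((4 :: nat) ^ nat \<lfloor>y\<rfloor>)" by simp
    show "real (\<Prod>{p. prime p \<and> p \<le> nat \<lfloor>y\<rfloor>}) \<le> real (4 ^ nat \<lfloor>y\<rfloor>)"
      by (simp only: of_nat_le_iff primorial_le)
  qed
  also have "\<dots> = real (nat \<lfloor>y\<rfloor>) * ln 4" by (simp add: ln_realpow)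
  also have "\<dots> \<le> y * ln 4" using assms by (intro mult_right_mono) auto
  finally show ?thesis .
qed

text \<open>Used with \<open>w / u\<close> bounded: primes in a range of bounded ratio carry bounded
  total weight, which disposes of the primes too large for the lattice point count.\<close>

lemma sum_ln_over_p_tail:
  assumes "0 < u" "u \<le> w"
  shows "(\<Sum>p | prime p \<and> u < real p \<and> real p \<le> w. ln (real p) / real p) \<le> w / u * ln 4"
proof -
  have "(\<Sum>p | prime p \<and> u < real p \<and> real p \<le> w. ln (real p) / real p) \<le>
      (\<Sum>p | prime p \<and> u < real p \<and> real p \<le> w. ln (real p) / u)"
    using assms by (intro sum_mono divide_left_mono) (auto simp: prime_ge_1_nat ln_ge_zero prime_gt_0_nat)
  also have "\<dots> = (\<Sum>p | prime p \<and> u < real p \<and> real p \<le> w. ln (real p)) / u"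
    by (simp add: sum_divide_distrib)
  also have "\<dots> \<le> (\<Sum>p | prime p \<and> real p \<le> w. ln (real p)) / u"
    using assms finite_primes_le[of "\<lambda>_. True" w]
    by (intro divide_right_mono sum_mono2) (auto intro!: ln_ge_zero dest: prime_ge_1_nat)
  also have "\<dots> \<le> w * ln 4 / u" using assms by (intro divide_right_mono chebyshev_theta_le) auto
  finally show ?thesis by simp
qed

lemma sum_inverse_squares_le:
  assumes "p1 > 0" "finite F" "F \<subseteq> {p1<..}"
  shows "(\<Sum>p\<in>F. 1 / real p ^ 2) \<le> 1 / real p1"
proof -
  define N where "N = Max (insert p1 F)"
  have N: "F \<subseteq> {p1<..N}" "p1 \<le> N" using assms by (auto simp: N_def)
  have "(\<Sum>p\<in>F. 1 / real p ^ 2) \<le> (\<Sum>p\<in>{p1<..N}. 1 / real p ^ 2)"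
    using N by (intro sum_mono2) auto
  also have "\<dots> \<le> 1 / real p1 - 1 / real N"
    using N(2)
  proof (induction N rule: dec_induct)
    case (step N)
    have "{p1<..Suc N} = insert (Suc N) {p1<..N}" using step by auto
    moreover have "1 / real (Suc N) ^ 2 \<le> 1 / real N - 1 / real (Suc N)"
    proof -
      have N: "real N > 0" using step assms by simp
      have "1 / real N - 1 / real (Suc N) = 1 / (real N * real (Suc N))" using N by (simp add: field_simps)
      moreover have "1 / real (Suc N) ^ 2 \<le> 1 / (real N * real (Suc N))"
        using N by (intro divide_left_mono) (auto simp: power2_eq_square)
      ultimately show ?thesis by simp
    qed
    ultimately show ?case using step by simp
  qed simp
  also have "\<dots> \<le> 1 / real p1" by simp
  finally show ?thesis .
qed

lemma power_add_one_le: "0 \<le> u \<Longrightarrow> (u + 1) ^ n \<le> 2 ^ n * (u ^ n + (1 :: real))"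
proof (cases "u \<le> 1")
  case True
  assume "0 \<le> u"
  hence "(u + 1) ^ n \<le> 2 ^ n" using True by (intro power_mono) auto
  also have "\<dots> \<le> 2 ^ n * (u ^ n + 1)" using \<open>0 \<le> u\<close> by simp
  finally show ?thesis .
next
  case False
  hence "(u + 1) ^ n \<le> (2 * u) ^ n" by (intro power_mono) auto
  also have "\<dots> \<le> 2 ^ n * (u ^ n + 1)" by (simp add: power_mult_distrib)
  finally show ?thesis .
qed

section \<open>Lattices of integer points with a norm form\<close>

definition ev :: "nat \<Rightarrow> (nat \<Rightarrow> int) \<Rightarrow> complex \<Rightarrow> complex" where
  "ev n a x = (\<Sum>j<n. of_int (a j) * x ^ j)"

text \<open>The vectors congruent to the coordinates of \<open>1\<close> modulo \<open>M\<close>;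
  their norms are units modulo each prime dividing \<open>M\<close>.\<close>

definition affv :: "int \<Rightarrow> (nat \<Rightarrow> int) \<Rightarrow> nat \<Rightarrow> int" where
  "affv M b j = (if j = 0 then 1 else 0) + M * b j"

text \<open>Here \<open>V\<close> is an orbit of conjugate algebraic integers, \<open>nrm a\<close> is the norm of the number with coordinate
  vector \<open>a\<close>, and \<open>Rt p\<close> is the set of roots modulo \<open>p\<close> of the polynomial with root set \<open>V\<close>. By \<open>bad_cover\<close> the
  vectors with norm divisible by \<open>p\<^sup>2\<close> lie in boundedly many sublattices, so that packing bounds their number.
  Restricting to the vectors \<open>affv M b\<close> with \<open>M\<close> divisible by the small primes removes these from the norms.\<close>

locale norm_lattice =
  fixes n :: nat and V :: "complex set" and nrm :: "(nat \<Rightarrow> int) \<Rightarrow> int"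
    and Rt :: "nat \<Rightarrow> int set" and p0 \<kappa> :: nat
  assumes n_pos: "n > 0" and finV: "finite V" and cardV: "card V = n"
    and nrm_eq: "\<And>a. \<bar>real_of_int (nrm a)\<bar> = (\<Prod>x\<in>V. cmod (ev n a x))"
    and nrm_nz: "\<And>a. \<exists>j<n. a j \<noteq> 0 \<Longrightarrow> nrm a \<noteq> 0"
    and Rt_sub: "\<And>p. prime p \<Longrightarrow> p > p0 \<Longrightarrow> Rt p \<subseteq> {0..<int p}"
    and Rt_card: "\<And>p. prime p \<Longrightarrow> p > p0 \<Longrightarrow> card (Rt p) \<le> n"
    and Rt_dvd: "\<And>p r a. prime p \<Longrightarrow> p > p0 \<Longrightarrow> r \<in> Rt p \<Longrightarrow> int p dvd vdot n (\<lambda>j. r ^ j) a \<Longrightarrow> int p dvd nrm a"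
    and Rt_count: "\<And>p a. prime p \<Longrightarrow> p > p0 \<Longrightarrow> nrm a \<noteq> 0 \<Longrightarrow> \<not> int p ^ 2 dvd nrm a \<Longrightarrow>
          card {r \<in> Rt p. int p dvd vdot n (\<lambda>j. r ^ j) a} = (if int p dvd nrm a then 1 else 0)"
    and bad_cover: "\<And>p. prime p \<Longrightarrow> p > p0 \<Longrightarrow> \<exists>L :: (nat \<Rightarrow> int) set set. finite L \<and> card L \<le> \<kappa> \<and>
          (\<forall>S\<in>L. (\<forall>a\<in>S. \<forall>b\<in>S. (\<lambda>j. a j - b j) \<in> S) \<and> (\<forall>a\<in>S. int p ^ 2 dvd nrm a)) \<and>
          (\<forall>a. int p ^ 2 dvd nrm a \<longrightarrow> (\<exists>S\<in>L. a \<in> S))"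
    and nrm_unit: "\<And>p M b. prime p \<Longrightarrow> int p dvd M \<Longrightarrow> \<not> int p dvd nrm (affv M b)"
begin

definition C0 :: real where "C0 = (\<Prod>x\<in>V. \<Sum>j<n. cmod x ^ j)"

lemma C0_ge_1: "C0 \<ge> 1"
  unfolding C0_def
proof (rule prod_ge_1)
  fix x
  have "(\<Sum>j\<in>{0}. cmod x ^ j) \<le> (\<Sum>j<n. cmod x ^ j)" using n_pos by (intro sum_mono2) auto
  thus "1 \<le> (\<Sum>j<n. cmod x ^ j)" by simp
qed

lemma nrm_le:
  assumes "\<And>j. j < n \<Longrightarrow> real_of_int \<bar>a j\<bar> \<le> s" "s \<ge> 0"
  shows "\<bar>real_of_int (nrm a)\<bar> \<le> C0 * s ^ n"
proof -
  have "\<bar>real_of_int (nrm a)\<bar> = (\<Prod>x\<in>V. cmod (ev n a x))" by (rule nrm_eq)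
  also have "\<dots> \<le> (\<Prod>x\<in>V. s * (\<Sum>j<n. cmod x ^ j))"
  proof (rule prod_mono, safe)
    fix x
    have "cmod (ev n a x) \<le> (\<Sum>j<n. cmod (of_int (a j) * x ^ j))" unfolding ev_def by (rule norm_sum)
    also have "\<dots> \<le> (\<Sum>j<n. s * cmod x ^ j)"
      using assms by (intro sum_mono) (auto simp: norm_mult norm_power intro!: mult_right_mono)
    finally show "cmod (ev n a x) \<le> s * (\<Sum>j<n. cmod x ^ j)" by (simp add: sum_distrib_left)
  qed auto
  also have "\<dots> = C0 * s ^ n" by (simp add: C0_def prod.distrib cardV mult.commute)
  finally show ?thesis .
qed

lemma nrm_scale: "\<bar>nrm (\<lambda>j. M * a j)\<bar> = \<bar>M\<bar> ^ n * \<bar>nrm a\<bar>"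
proof -
  have "ev n (\<lambda>j. M * a j) x = of_int M * ev n a x" for x
    by (simp add: ev_def sum_distrib_left mult.assoc)
  hence "\<bar>real_of_int (nrm (\<lambda>j. M * a j))\<bar> = \<bar>real_of_int M\<bar> ^ n * \<bar>real_of_int (nrm a)\<bar>"
    unfolding nrm_eq by (simp add: norm_mult prod.distrib cardV)
  hence "real_of_int \<bar>nrm (\<lambda>j. M * a j)\<bar> = real_of_int (\<bar>M\<bar> ^ n * \<bar>nrm a\<bar>)" by simp
  thus ?thesis by (simp only: of_int_eq_iff)
qed

text \<open>The side at which the bound \<open>C0 * s ^ n\<close> for norms reaches
  \<open>q\<close>: a nonzero vector whose norm is divisible by \<open>q\<close> has a coordinate at
  least this large.\<close>

definition lattice_scale :: "real \<Rightarrow> real" where "lattice_scale q = (q / C0) powr (1 / n)"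

lemma lattice_scale_pow: "q > 0 \<Longrightarrow> lattice_scale q ^ n = q / C0"
  using n_pos C0_ge_1 unfolding lattice_scale_def by (subst powr_power) auto

lemma lattice_scale_pos: "q > 0 \<Longrightarrow> lattice_scale q > 0"
  using C0_ge_1 by (auto simp: lattice_scale_def)

lemma nrm_sep:
  assumes "\<exists>j<n. d j \<noteq> 0" "int q dvd nrm d" "q > 0"
  shows "\<exists>j<n. lattice_scale q \<le> real_of_int \<bar>d j\<bar>"
proof (rule ccontr)
  assume neg: "\<not> ?thesis"
  define s where "s = Max ((\<lambda>j. real_of_int \<bar>d j\<bar>) ` {..<n})"
  have fin: "finite ((\<lambda>j. real_of_int \<bar>d j\<bar>) ` {..<n})" "(\<lambda>j. real_of_int \<bar>d j\<bar>) ` {..<n} \<noteq> {}" using n_pos by auto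
  have s: "real_of_int \<bar>d j\<bar> \<le> s" if "j < n" for j unfolding s_def using fin that by (intro Max_ge) auto
  have sl: "s < lattice_scale q" unfolding s_def using fin neg by (subst Max_less_iff) (auto simp: not_le)
  have s0: "s \<ge> 0" using s[of 0] n_pos by linarith
  have "real q \<le> \<bar>real_of_int (nrm d)\<bar>"
    using dvd_imp_le_int[OF nrm_nz[OF assms(1)] assms(2)] by linarith
  also have "\<dots> \<le> C0 * s ^ n" using s s0 by (rule nrm_le)
  also have "\<dots> < C0 * lattice_scale q ^ n" using C0_ge_1 sl s0 n_pos by (intro mult_strict_left_mono power_strict_mono) auto
  also have "\<dots> = real q" using C0_ge_1 assms(3) by (simp add: lattice_scale_pow)
  finally show False by simp
qed

text \<open>\<open>m0 div 2 + 1\<close> exceeds \<open>C0\<close>, so that many disjoint translates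
  of a box with at least \<open>p / C0\<close> points do not fit into the \<open>p\<close> residues.
  \<open>C3\<close> then bounds the side \<open>2 * m0 * T + 1\<close> in units of
  \<open>p powr (1 / n)\<close>, given \<open>T \<le> 2 * p powr (1 / n)\<close>.\<close>

definition m0 :: nat where "m0 = 2 * nat \<lceil>C0\<rceil>"
definition C3 :: real where "C3 = 4 * real m0 + 1"

lemma C3_pos: "C3 > 0" by (simp add: C3_def)

text \<open>A box of side about \<open>p powr (1 / n)\<close> injects into the residues modulo \<open>p\<close>, since the norm of a difference
  of two of its points is smaller than \<open>p\<close>; a bounded dilate of it therefore surjects.\<close>

lemma covering_radius:
  assumes p: "prime p" "p > p0" and r: "r \<in> Rt p"
  obtains R where "real R \<le> C3 * real p powr (1 / n)"
    "\<And>t. \<exists>b \<in> box n R. [vdot n (\<lambda>j. r ^ j) b = t] (mod int p)"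
proof -
  have p1: "p \<ge> 1" using p prime_ge_1_nat by blast
  define T where "T = nat \<lceil>lattice_scale p\<rceil>"
  have lp: "lattice_scale p > 0" using p1 by (intro lattice_scale_pos) auto
  have T: "T > 0" "real T \<ge> lattice_scale p" "real T < lattice_scale p + 1" using lp unfolding T_def by linarith+
  have inj: "b = c" if b: "b \<in> box n T" "c \<in> box n T"
    and eq: "[vdot n (\<lambda>j. r ^ j) b = vdot n (\<lambda>j. r ^ j) c] (mod int p)" for b c
  proof (rule ccontr)
    assume "b \<noteq> c"
    hence "\<exists>j<n. b j - c j \<noteq> 0" using box_ext[OF b] by auto
    moreover have "int p dvd nrm (\<lambda>j. b j - c j)"
      using eq by (intro Rt_dvd[OF p r]) (simp add: vdot_diff cong_iff_dvd_diff)
    ultimately obtain j where j: "j < n" "lattice_scale p \<le> real_of_int \<bar>b j - c j\<bar>"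
      using nrm_sep[of "\<lambda>j. b j - c j" p] p1 by auto
    \<comment> \<open>Rounding the side up does no harm: coordinates of points of the box differ by
      at most \<open>T - 1\<close>, which is still below \<open>lattice_scale p\<close>.\<close>
    have "\<bar>b j - c j\<bar> < int T" using box_bounds[OF b(1) j(1)] box_bounds[OF b(2) j(1)] by linarith
    hence "real_of_int \<bar>b j - c j\<bar> \<le> real T - 1" by linarith
    thus False using j T by linarith
  qed
  have "real p = C0 * lattice_scale p ^ n" using C0_ge_1 p1 by (simp add: lattice_scale_pow)
  also have "\<dots> \<le> C0 * real T ^ n" using T lp C0_ge_1 by (intro mult_left_mono power_mono) auto
  also have "\<dots> < real (m0 div 2 + 1) * real T ^ n"
    using T unfolding m0_def by (intro mult_strict_right_mono) (simp_all, linarith)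
  finally have "real p < real ((m0 div 2 + 1) * T ^ n)" by (simp only: of_nat_mult of_nat_power)
  hence m: "p < (m0 div 2 + 1) * T ^ n" by (simp only: of_nat_less_iff)
  have cov: "\<exists>b \<in> box n (2 * m0 * T + 1). [vdot n (\<lambda>j. r ^ j) b = t] (mod int p)" for t
    using p1 by (intro residues_covered_by_box[OF n_pos _ T(1) inj m]) auto
  have "lattice_scale p \<le> real p powr (1 / n)" unfolding lattice_scale_def using C0_ge_1 p1
    by (intro powr_mono2) (auto simp: field_simps mult_le_cancel_left1)
  moreover have pp: "1 \<le> real p powr (1 / n)" using p1 by (intro ge_one_powr_ge_zero) auto
  ultimately have "real T \<le> 2 * real p powr (1 / n)" using T by linarith
  hence "2 * real m0 * real T + 1 \<le> 2 * real m0 * (2 * real p powr (1 / n)) + real p powr (1 / n)"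
    using pp by (intro add_mono mult_left_mono) auto
  hence "real (2 * m0 * T + 1) \<le> C3 * real p powr (1 / n)" by (simp add: C3_def algebra_simps)
  thus ?thesis using cov that by blast
qed

definition cnt :: "int \<Rightarrow> nat \<Rightarrow> nat \<Rightarrow> int \<Rightarrow> nat" where
  "cnt M B p r = card {b \<in> box n B. int p dvd vdot n (\<lambda>j. r ^ j) (affv M b)}"

lemma vdot_affv: "vdot n (\<lambda>j. r ^ j) (affv M b) = 1 + M * vdot n (\<lambda>j. r ^ j) b"
proof -
  have "vdot n (\<lambda>j. r ^ j) (affv M b) = (\<Sum>j<n. (if j = 0 then 1 else 0) * r ^ j) + M * vdot n (\<lambda>j. r ^ j) b"
    by (simp add: vdot_def affv_def distrib_right sum.distrib sum_distrib_left mult.assoc)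
  also have "(\<Sum>j<n. (if j = 0 then 1 else 0) * r ^ j) = 1"
    using n_pos by (simp add: if_distrib[of "\<lambda>x. x * _"] cong: if_cong)
  finally show ?thesis .
qed

text \<open>Since \<open>M\<close> is invertible modulo \<open>p\<close>, the condition on
  \<open>affv M b\<close> confines \<open>vdot\<close> of \<open>b\<close> to one residue class, and
  the box count applies with covering radius at most \<open>\<rho>\<close>. The two bounds are close
  to each other only if \<open>\<rho>\<close> is small against \<open>B\<close>, that is, for
  \<open>p\<close> below a small multiple of \<open>B ^ n\<close>.\<close>

lemma cnt_bounds:
  assumes p: "prime p" "p > p0" and r: "r \<in> Rt p" and M: "\<not> int p dvd M"
  defines "\<rho> \<equiv> C3 * real p powr (1 / n)"
  shows "real (cnt M B p r) \<le> (real B + \<rho>) ^ n / real p"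
    and "\<rho> \<le> real B \<Longrightarrow> (real B - \<rho>) ^ n / real p \<le> real (cnt M B p r)"
proof -
  have p1: "p > 0" using p prime_gt_0_nat by blast
  obtain R where R: "real R \<le> \<rho>" "\<And>t. \<exists>b \<in> box n R. [vdot n (\<lambda>j. r ^ j) b = t] (mod int p)"
    using covering_radius[OF p r] unfolding \<rho>_def by blast
  have cop: "coprime M (int p)" using p M by (metis coprime_commute prime_imp_coprime prime_nat_int_transfer)
  then obtain t where t: "[M * t = - 1] (mod int p)"
    using cong_solve_coprime_int[OF cop] by (metis cong_scalar_right mult.assoc mult_minus_right mult.right_neutral mult_1 cong_scalar_left mult.commute)
  have "int p dvd vdot n (\<lambda>j. r ^ j) (affv M b) \<longleftrightarrow> [vdot n (\<lambda>j. r ^ j) b = t] (mod int p)" for b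
  proof -
    have "int p dvd vdot n (\<lambda>j. r ^ j) (affv M b) \<longleftrightarrow> [M * vdot n (\<lambda>j. r ^ j) b = - 1] (mod int p)"
      by (simp add: vdot_affv cong_iff_dvd_diff add.commute)
    also have "\<dots> \<longleftrightarrow> [M * vdot n (\<lambda>j. r ^ j) b = M * t] (mod int p)"
      using t by (meson cong_sym cong_trans)
    also have "\<dots> \<longleftrightarrow> [vdot n (\<lambda>j. r ^ j) b = t] (mod int p)" using cop by (simp add: cong_mult_lcancel)
    finally show ?thesis .
  qed
  hence eq: "cnt M B p r = card {b \<in> box n B. [vdot n (\<lambda>j. r ^ j) b = t] (mod int p)}"
    by (simp add: cnt_def)
  have "real (p * cnt M B p r) \<le> real ((B + R) ^ n)"
    unfolding eq using box_residue_count(1)[OF p1 R(2)] by (simp only: of_nat_le_iff)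
  also have "\<dots> \<le> (real B + \<rho>) ^ n" using R by (simp add: power_mono)
  finally show "real (cnt M B p r) \<le> (real B + \<rho>) ^ n / real p" using p1 by (simp add: field_simps)
  assume B: "\<rho> \<le> real B"
  hence RB: "R \<le> B" using R by linarith
  have "(real B - \<rho>) ^ n \<le> (real (B - R)) ^ n" using R RB B by (intro power_mono) (auto simp: of_nat_diff)
  also have "\<dots> \<le> real (p * cnt M B p r)"
    unfolding eq of_nat_power[symmetric] using box_residue_count(2)[OF p1 R(2) RB] by (simp only: of_nat_le_iff)
  finally show "(real B - \<rho>) ^ n / real p \<le> real (cnt M B p r)" using p1 by (simp add: field_simps)
qed

definition badset :: "int \<Rightarrow> nat \<Rightarrow> nat \<Rightarrow> (nat \<Rightarrow> int) set" where
  "badset M B p = {b \<in> box n B. int p ^ 2 dvd nrm (affv M b)}"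

lemma affv_nz: "M \<ge> 2 \<Longrightarrow> nrm (affv M b) \<noteq> 0"
proof -
  assume M: "M \<ge> 2"
  have "1 + M * b 0 \<noteq> 0"
  proof
    assume "1 + M * b 0 = 0"
    hence "1 = M * (- b 0)" by simp
    hence "M dvd 1" by (rule dvdI)
    thus False using M zdvd_imp_le[of M 1] by simp
  qed
  thus ?thesis using n_pos by (intro nrm_nz exI[of _ 0]) (auto simp: affv_def)
qed

lemma nrm_affv_le:
  assumes "M \<ge> 1" "b \<in> box n B"
  shows "\<bar>real_of_int (nrm (affv M b))\<bar> \<le> C0 * (real_of_int M * real B) ^ n"
proof (rule nrm_le)
  fix j assume "j < n"
  hence b: "0 \<le> b j" "b j \<le> int B - 1" using box_bounds[OF assms(2)] by force+
  have "M * b j \<le> M * (int B - 1)" using b(2) assms(1) by (intro mult_left_mono) simp_all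
  moreover have "0 \<le> M * b j" using b(1) assms(1) by simp
  moreover have "M * (int B - 1) = M * int B - M" by (simp add: right_diff_distrib)
  moreover have "\<bar>affv M b j\<bar> \<le> 1 + \<bar>M * b j\<bar>" unfolding affv_def by (cases "j = 0") (simp_all only: if_True if_False, simp_all)
  ultimately have "\<bar>affv M b j\<bar> \<le> M * int B" using assms(1) by linarith
  hence "real_of_int \<bar>affv M b j\<bar> \<le> real_of_int (M * int B)" by (simp only: of_int_le_iff)
  thus "real_of_int \<bar>affv M b j\<bar> \<le> real_of_int M * real B" by simp
qed (use assms in auto)

text \<open>Inside one of the covering lattices two vectors \<open>affv M b\<close> and
  \<open>affv M c\<close> differ by \<open>M\<close> times a vector whose norm is divisible by
  \<open>p ^ 2\<close>, since \<open>M\<close> is prime to \<open>p\<close>. So the points are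
  separated by \<open>lattice_scale (p ^ 2)\<close> and packing applies. The summand
  \<open>1\<close> dominates once \<open>p ^ 2\<close> exceeds \<open>C0 * B ^ n\<close>.\<close>

lemma card_badset:
  assumes p: "prime p" "p > p0" and M: "\<not> int p dvd M"
  shows "real (card (badset M B p)) \<le> real \<kappa> * 2 ^ n * (C0 * real B ^ n / real p ^ 2 + 1)"
proof -
  have p1: "p > 0" using p prime_gt_0_nat by blast
  obtain L :: "(nat \<Rightarrow> int) set set" where L: "finite L" "card L \<le> \<kappa>"
    and L': "\<forall>S\<in>L. (\<forall>a\<in>S. \<forall>b\<in>S. (\<lambda>j. a j - b j) \<in> S) \<and> (\<forall>a\<in>S. int p ^ 2 dvd nrm a)"
    and L5: "\<forall>a. int p ^ 2 dvd nrm a \<longrightarrow> (\<exists>S\<in>L. a \<in> S)"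
    using bad_cover[OF p] by (elim exE conjE)
  have L3: "(\<lambda>j. a j - b j) \<in> S" if "S \<in> L" "a \<in> S" "b \<in> S" for S a b using L' that by simp
  have L4: "int p ^ 2 dvd nrm a" if "S \<in> L" "a \<in> S" for S a using L' that by simp
  define l where "l = nat \<lceil>lattice_scale (real p ^ 2)\<rceil>"
  have lp: "lattice_scale (real p ^ 2) > 0" using p1 by (intro lattice_scale_pos) auto
  have l: "l > 0" "real l \<ge> lattice_scale (real p ^ 2)" using lp unfolding l_def by linarith+
  have one: "card {b \<in> box n B. affv M b \<in> S} \<le> (B div l + 1) ^ n" if S: "S \<in> L" for S
  proof (rule box_packing[OF _ l(1)])
    fix b c assume b: "b \<in> {b \<in> box n B. affv M b \<in> S}" and c: "c \<in> {b \<in> box n B. affv M b \<in> S}" and "b \<noteq> c"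
    hence nz: "\<exists>j<n. b j - c j \<noteq> 0" using box_ext[of b n B c B] by auto
    have "(\<lambda>j. affv M b j - affv M c j) = (\<lambda>j. M * (b j - c j))" by (auto simp: affv_def algebra_simps)
    hence "int p ^ 2 dvd nrm (\<lambda>j. M * (b j - c j))" using L4[OF S L3[OF S, of "affv M b" "affv M c"]] b c by simp
    hence "int p ^ 2 dvd \<bar>M\<bar> ^ n * \<bar>nrm (\<lambda>j. b j - c j)\<bar>" by (simp add: nrm_scale[symmetric])
    moreover have "coprime (int p ^ 2) (\<bar>M\<bar> ^ n)"
      using p M prime_imp_coprime[of "int p" M] by simp
    ultimately have "int (p ^ 2) dvd nrm (\<lambda>j. b j - c j)" by (simp add: coprime_dvd_mult_right_iff)
    then obtain j where j: "j < n" "lattice_scale (real (p ^ 2)) \<le> real_of_int \<bar>b j - c j\<bar>"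
      using nrm_sep[OF nz] p1 by (metis zero_less_power)
    hence "\<lceil>lattice_scale (real p ^ 2)\<rceil> \<le> \<bar>b j - c j\<bar>" by (simp add: ceiling_le_iff)
    hence "int l \<le> \<bar>b j - c j\<bar>" unfolding l_def by simp
    thus "\<exists>j<n. int l \<le> \<bar>b j - c j\<bar>" using j by blast
  qed auto
  have "badset M B p \<subseteq> (\<Union>S\<in>L. {b \<in> box n B. affv M b \<in> S})" unfolding badset_def using L5 by blast
  hence "card (badset M B p) \<le> card (\<Union>S\<in>L. {b \<in> box n B. affv M b \<in> S})" using L(1) by (intro card_mono) auto
  also have "\<dots> \<le> (\<Sum>S\<in>L. card {b \<in> box n B. affv M b \<in> S})" using L(1) by (rule card_UN_le)
  also have "\<dots> \<le> (\<Sum>S\<in>L. (B div l + 1) ^ n)" by (intro sum_mono one)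
  also have "\<dots> \<le> \<kappa> * (B div l + 1) ^ n" using L(2) by simp
  finally have "real (card (badset M B p)) \<le> real (\<kappa> * (B div l + 1) ^ n)" by (simp only: of_nat_le_iff)
  also have "\<dots> = real \<kappa> * (real (B div l) + 1) ^ n" by (simp add: add.commute)
  also have "\<dots> \<le> real \<kappa> * (2 ^ n * (real (B div l) ^ n + 1))" by (intro mult_left_mono power_add_one_le) auto
  also have "real (B div l) ^ n \<le> C0 * real B ^ n / real p ^ 2"
  proof -
    have "real (B div l) \<le> real B / real l" using of_nat_div_le_of_nat[of B l, where 'a = real] by simp
    also have "\<dots> \<le> real B / lattice_scale (real p ^ 2)" using l lp by (intro divide_left_mono) auto
    finally have "real (B div l) ^ n \<le> (real B / lattice_scale (real p ^ 2)) ^ n" by (intro power_mono) auto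
    also have "\<dots> = C0 * real B ^ n / real p ^ 2" using C0_ge_1 p1 by (simp add: power_divide lattice_scale_pow)
    finally show ?thesis .
  qed
  finally show ?thesis by (simp add: mult.assoc mult_left_mono)
qed

lemma badset_empty:
  assumes "M \<ge> 2" "C0 * (real_of_int M * real B) ^ n < real p ^ 2"
  shows "badset M B p = {}"
proof (rule ccontr)
  assume "badset M B p \<noteq> {}"
  then obtain b where b: "b \<in> box n B" "int p ^ 2 dvd nrm (affv M b)" by (auto simp: badset_def)
  have "int p ^ 2 \<le> \<bar>nrm (affv M b)\<bar>" using dvd_imp_le_int[OF affv_nz[OF assms(1)] b(2)] by simp
  hence "real_of_int (int p ^ 2) \<le> real_of_int \<bar>nrm (affv M b)\<bar>" by (simp only: of_int_le_iff)
  hence "real p ^ 2 \<le> \<bar>real_of_int (nrm (affv M b))\<bar>" by simp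
  thus False using nrm_affv_le[of M b B] assms b by simp
qed

end

section \<open>The sum of the logarithms of the norms over a box\<close>

context norm_lattice
begin

definition log_norm_sum :: "int \<Rightarrow> nat \<Rightarrow> real" where
  "log_norm_sum M B = (\<Sum>b\<in>box n B. ln \<bar>real_of_int (nrm (affv M b))\<bar>)"

lemma nrm_affv_ge_1: "M \<ge> 2 \<Longrightarrow> \<bar>real_of_int (nrm (affv M b))\<bar> \<ge> 1"
  using affv_nz[of M b] by linarith

lemma ln_nrm_affv_le:
  assumes "M \<ge> 2" "B \<ge> 1" "b \<in> box n B"
  shows "ln \<bar>real_of_int (nrm (affv M b))\<bar> \<le> real n * ln (real B) + ln (C0 * real_of_int M ^ n)"
proof -
  have "ln \<bar>real_of_int (nrm (affv M b))\<bar> \<le> ln (C0 * (real_of_int M * real B) ^ n)"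
    using nrm_affv_le[of M b B] nrm_affv_ge_1[of M b] assms by (subst ln_le_cancel_iff) auto
  also have "\<dots> = ln (real B ^ n * (C0 * real_of_int M ^ n))" by (simp add: power_mult_distrib mult_ac)
  also have "\<dots> = ln (real B ^ n) + ln (C0 * real_of_int M ^ n)"
    using assms C0_ge_1 by (intro ln_mult_pos) auto
  finally show ?thesis using assms by (simp add: ln_realpow)
qed

lemma log_norm_sum_le:
  assumes "M \<ge> 2" "B \<ge> 1"
  shows "log_norm_sum M B \<le> real B ^ n * (real n * ln (real B) + ln (C0 * real_of_int M ^ n))"
proof -
  have "log_norm_sum M B \<le> (\<Sum>b\<in>box n B. real n * ln (real B) + ln (C0 * real_of_int M ^ n))"
    unfolding log_norm_sum_def using assms by (intro sum_mono ln_nrm_affv_le) auto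
  thus ?thesis by (simp add: card_box)
qed

lemma card_int_interval:
  assumes "M \<ge> 1" "w \<ge> 0"
  shows "finite {t :: int. \<bar>real_of_int M * real_of_int t + u\<bar> < w}"
    and "real (card {t :: int. \<bar>real_of_int M * real_of_int t + u\<bar> < w}) \<le> 2 * w + 1"
proof -
  define M' where "M' = real_of_int M"
  have M': "M' \<ge> 1" using assms by (simp add: M'_def)
  have sub: "{t :: int. \<bar>real_of_int M * real_of_int t + u\<bar> < w} \<subseteq> {\<lceil>(- w - u) / M'\<rceil>..\<lfloor>(w - u) / M'\<rfloor>}"
  proof
    fix t :: int assume "t \<in> {t :: int. \<bar>real_of_int M * real_of_int t + u\<bar> < w}"
    hence "- w - u \<le> real_of_int t * M'" "real_of_int t * M' \<le> w - u" by (auto simp: M'_def mult.commute)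
    hence "(- w - u) / M' \<le> real_of_int t" "real_of_int t \<le> (w - u) / M'"
      using M' by (simp_all add: pos_divide_le_eq pos_le_divide_eq)
    thus "t \<in> {\<lceil>(- w - u) / M'\<rceil>..\<lfloor>(w - u) / M'\<rfloor>}" by (simp add: ceiling_le_iff le_floor_iff)
  qed
  thus "finite {t :: int. \<bar>real_of_int M * real_of_int t + u\<bar> < w}" by (rule finite_subset) simp
  have "card {t :: int. \<bar>real_of_int M * real_of_int t + u\<bar> < w} \<le> card {\<lceil>(- w - u) / M'\<rceil>..\<lfloor>(w - u) / M'\<rfloor>}"
    using sub by (intro card_mono) auto
  hence "real (card {t :: int. \<bar>real_of_int M * real_of_int t + u\<bar> < w}) \<le>
      real (nat (\<lfloor>(w - u) / M'\<rfloor> - \<lceil>(- w - u) / M'\<rceil> + 1))" by simp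
  also have "\<dots> \<le> 2 * w + 1"
  proof -
    have "(w - u) / M' - (- w - u) / M' = 2 * w / M'" by (simp add: diff_divide_distrib[symmetric])
    also have "\<dots> \<le> 2 * w" using M' assms mult_right_mono[of 1 M' w] by (simp add: field_simps)
    finally have "(w - u) / M' - (- w - u) / M' \<le> 2 * w" .
    moreover have "real_of_int \<lfloor>(w - u) / M'\<rfloor> \<le> (w - u) / M'" "(- w - u) / M' \<le> real_of_int \<lceil>(- w - u) / M'\<rceil>" by simp_all
    ultimately show ?thesis using assms(2) by linarith
  qed
  finally show "real (card {t :: int. \<bar>real_of_int M * real_of_int t + u\<bar> < w}) \<le> 2 * w + 1" .
qed

text \<open>With the other coordinates fixed, the real part of \<open>ev\<close> runs through an
  arithmetic progression of step \<open>M \<ge> 1\<close> as the zeroth coordinate varies, so at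
  most \<open>2 * w + 1\<close> values of that coordinate are admissible.\<close>

lemma card_small_value:
  assumes "M \<ge> 1" "w \<ge> 0"
  shows "real (card {b \<in> box n B. cmod (ev n (affv M b) x) < w}) \<le> real B ^ (n - 1) * (2 * w + 1)"
proof -
  define E where "E = PiE {..<n} (\<lambda>j. if j = 0 then {0 :: int} else {0..<int B})"
  define u where "u c = Re (ev n (affv M c) x)" for c
  define I where "I c = {t :: int. \<bar>real_of_int M * real_of_int t + u c\<bar> < w}" for c
  have finE: "finite E" unfolding E_def by (intro finite_PiE) auto
  have spl: "{..<n} = insert 0 {1..<n}" using n_pos by auto
  have cardE: "card E = B ^ (n - 1)"
  proof -
    have "card E = (\<Prod>j<n. card (if j = 0 then {0 :: int} else {0..<int B}))"
      unfolding E_def by (rule card_PiE) simp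
    also have "\<dots> = (\<Prod>j\<in>{1..<n}. B)" unfolding spl by simp
    finally show ?thesis by simp
  qed
  have sub: "{b \<in> box n B. cmod (ev n (affv M b) x) < w} \<subseteq> (\<lambda>(c, t). c(0 := t)) ` Sigma E I"
  proof
    fix b assume "b \<in> {b \<in> box n B. cmod (ev n (affv M b) x) < w}"
    hence b: "b \<in> box n B" "cmod (ev n (affv M b) x) < w" by auto
    define c where "c = b(0 := 0)"
    have "c \<in> E" unfolding E_def
    proof (rule PiE_I)
      fix j assume "j \<in> {..<n}"
      thus "c j \<in> (if j = 0 then {0} else {0..<int B})" using box_bounds[OF b(1), of j] by (auto simp: c_def)
    next
      fix j assume j: "j \<notin> {..<n}"
      have "b j = undefined" using b(1) j unfolding box_def by (rule PiE_arb)
      thus "c j = undefined" using j n_pos by (cases "j = 0") (simp_all add: c_def)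
    qed
    moreover have "ev n (affv M b) x = of_int M * of_int (b 0) + ev n (affv M c) x"
    proof -
      have "(\<Sum>j\<in>{1..<n}. of_int (affv M b j) * x ^ j) = (\<Sum>j\<in>{1..<n}. of_int (affv M c j) * x ^ j)"
        by (intro sum.cong) (simp_all add: affv_def c_def)
      moreover have "ev n a x = of_int (a 0) + (\<Sum>j\<in>{1..<n}. of_int (a j) * x ^ j)" for a
        unfolding ev_def spl by simp
      ultimately show ?thesis by (simp add: affv_def c_def)
    qed
    hence "\<bar>real_of_int M * real_of_int (b 0) + u c\<bar> \<le> cmod (ev n (affv M b) x)"
      using abs_Re_le_cmod[of "ev n (affv M b) x"] by (simp add: u_def)
    hence "b 0 \<in> I c" using b(2) by (simp add: I_def)
    ultimately have "(c, b 0) \<in> Sigma E I" by simp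
    moreover have "b = (\<lambda>(c, t). c(0 := t)) (c, b 0)" by (simp add: c_def)
    ultimately show "b \<in> (\<lambda>(c, t). c(0 := t)) ` Sigma E I" by (rule image_eqI[rotated])
  qed
  have finS: "finite (Sigma E I)" using finE card_int_interval(1)[OF assms] unfolding I_def by auto
  have "card {b \<in> box n B. cmod (ev n (affv M b) x) < w} \<le> card (Sigma E I)"
    using card_mono[OF finite_imageI[OF finS] sub] card_image_le[OF finS] by (rule le_trans)
  also have "\<dots> = (\<Sum>c\<in>E. card (I c))" using finE card_int_interval(1)[OF assms] unfolding I_def by (intro card_SigmaI) auto
  finally have "real (card {b \<in> box n B. cmod (ev n (affv M b) x) < w}) \<le> real (\<Sum>c\<in>E. card (I c))"
    by (rule of_nat_mono)
  also have "\<dots> = (\<Sum>c\<in>E. real (card (I c)))" by simp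
  also have "\<dots> \<le> (\<Sum>c\<in>E. 2 * w + 1)" unfolding I_def by (intro sum_mono card_int_interval(2) assms)
  finally show ?thesis by (simp add: cardE)
qed

text \<open>Where no conjugate is smaller than \<open>w\<close>, the norm is at least
  \<open>w ^ n\<close>; for the remaining vectors the logarithm is bounded below by
  \<open>0\<close>. With \<open>w\<close> a small multiple of \<open>B\<close> those vectors form a
  small proportion of the box.\<close>

lemma log_norm_sum_ge:
  assumes M: "M \<ge> 2" and w: "w \<ge> 1"
  shows "log_norm_sum M B \<ge> (real B ^ n - real n * real B ^ (n - 1) * (2 * w + 1)) * (real n * ln w)"
proof -
  define D where "D = (\<Union>x\<in>V. {b \<in> box n B. cmod (ev n (affv M b) x) < w})"
  have "real (card D) \<le> real (\<Sum>x\<in>V. card {b \<in> box n B. cmod (ev n (affv M b) x) < w})"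
    unfolding D_def using card_UN_le[OF finV] by (intro of_nat_mono) blast
  also have "\<dots> \<le> (\<Sum>x\<in>V. real B ^ (n - 1) * (2 * w + 1))"
    unfolding of_nat_sum using M w by (intro sum_mono card_small_value) auto
  finally have D: "real (card D) \<le> real n * real B ^ (n - 1) * (2 * w + 1)" by (simp add: cardV mult.assoc)
  have Dsub: "D \<subseteq> box n B" by (auto simp: D_def)
  have "(real B ^ n - real n * real B ^ (n - 1) * (2 * w + 1)) * (real n * ln w) \<le>
      (real B ^ n - real (card D)) * (real n * ln w)"
    using D w by (intro mult_right_mono) auto
  also have "\<dots> = (\<Sum>b\<in>box n B - D. real n * ln w)"
  proof -
    have "card D \<le> B ^ n" using card_mono[OF finite_box Dsub] by (simp add: card_box)
    thus ?thesis using Dsub finite_subset[OF Dsub] by (simp add: card_Diff_subset card_box of_nat_diff)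
  qed
  also have "\<dots> \<le> (\<Sum>b\<in>box n B - D. ln \<bar>real_of_int (nrm (affv M b))\<bar>)"
  proof (rule sum_mono)
    fix b assume b: "b \<in> box n B - D"
    have "(\<Prod>x\<in>V. w) \<le> (\<Prod>x\<in>V. cmod (ev n (affv M b) x))"
      using b w by (intro prod_mono) (auto simp: D_def not_less)
    hence "w ^ n \<le> \<bar>real_of_int (nrm (affv M b))\<bar>" by (simp add: nrm_eq cardV)
    hence "ln (w ^ n) \<le> ln \<bar>real_of_int (nrm (affv M b))\<bar>"
      using w nrm_affv_ge_1[OF M, of b] by (subst ln_le_cancel_iff) auto
    thus "real n * ln w \<le> ln \<bar>real_of_int (nrm (affv M b))\<bar>" using w by (simp add: ln_realpow)
  qed
  also have "\<dots> \<le> log_norm_sum M B"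
    unfolding log_norm_sum_def using nrm_affv_ge_1[OF M] by (intro sum_mono2) auto
  finally show ?thesis .
qed

section \<open>Comparison of the logarithmic sum with the counts for single primes\<close>

definition hits :: "int \<Rightarrow> (nat \<Rightarrow> int) \<Rightarrow> nat \<Rightarrow> nat" where
  "hits M b p = card {r \<in> Rt p. int p dvd vdot n (\<lambda>j. r ^ j) (affv M b)}"

lemma finite_Rt: "prime p \<Longrightarrow> p > p0 \<Longrightarrow> finite (Rt p)"
  using Rt_sub finite_subset by blast

lemma sum_cnt_eq:
  assumes "\<And>p. p \<in> P \<Longrightarrow> prime p \<and> p > p0"
  shows "(\<Sum>p\<in>P. ln (real p) * (\<Sum>r\<in>Rt p. real (cnt M B p r))) = (\<Sum>b\<in>box n B. \<Sum>p\<in>P. ln (real p) * real (hits M b p))"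
proof -
  have "(\<Sum>r\<in>Rt p. real (cnt M B p r)) = (\<Sum>b\<in>box n B. real (hits M b p))" if "p \<in> P" for p
  proof -
    have fin: "finite (Rt p)" using assms that finite_Rt by blast
    have "(\<Sum>r\<in>Rt p. cnt M B p r) = (\<Sum>r\<in>Rt p. \<Sum>b\<in>box n B. if int p dvd vdot n (\<lambda>j. r ^ j) (affv M b) then 1 else 0)"
      by (simp add: cnt_def sum.If_cases Int_def)
    also have "\<dots> = (\<Sum>b\<in>box n B. \<Sum>r\<in>Rt p. if int p dvd vdot n (\<lambda>j. r ^ j) (affv M b) then 1 else 0)"
      by (rule sum.swap)
    also have "\<dots> = (\<Sum>b\<in>box n B. hits M b p)" using fin by (simp add: hits_def sum.If_cases Int_def)
    finally show ?thesis by (metis of_nat_sum)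
  qed
  hence "(\<Sum>p\<in>P. ln (real p) * (\<Sum>r\<in>Rt p. real (cnt M B p r))) = (\<Sum>p\<in>P. \<Sum>b\<in>box n B. ln (real p) * real (hits M b p))"
    by (intro sum.cong) (auto simp: sum_distrib_left)
  also have "\<dots> = (\<Sum>b\<in>box n B. \<Sum>p\<in>P. ln (real p) * real (hits M b p))" by (rule sum.swap)
  finally show ?thesis .
qed

text \<open>Off the bad set of \<open>p\<close> the number of hits is \<open>1\<close> or
  \<open>0\<close> according as \<open>p\<close> divides the norm, so the weights
  \<open>ln p\<close> add up to at most the logarithm of the norm. On the bad set all of the at most
  \<open>n\<close> roots are charged.\<close>

lemma upper_ineq:
  assumes M: "M \<ge> 2" and finP: "finite P" and P: "\<And>p. p \<in> P \<Longrightarrow> prime p \<and> p > p0"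
  shows "(\<Sum>p\<in>P. ln (real p) * (\<Sum>r\<in>Rt p. real (cnt M B p r))) \<le>
    log_norm_sum M B + real n * (\<Sum>p\<in>P. ln (real p) * real (card (badset M B p)))"
proof -
  have lnp: "ln (real p) \<ge> 0" if "p \<in> P" for p using P[OF that] prime_ge_1_nat[of p] by simp
  have pt: "real (hits M b p) \<le> (if int p dvd nrm (affv M b) then 1 else 0) + real n * (if b \<in> badset M B p then 1 else 0)"
    if p: "p \<in> P" and b: "b \<in> box n B" for p b
  proof (cases "b \<in> badset M B p")
    case True
    have "hits M b p \<le> card (Rt p)" unfolding hits_def using P[OF p] finite_Rt by (intro card_mono) auto
    also have "\<dots> \<le> n" using P[OF p] Rt_card by blast
    finally show ?thesis using True by simp
  next
    case False
    hence "\<not> int p ^ 2 dvd nrm (affv M b)" using b by (simp add: badset_def)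
    thus ?thesis using False Rt_count[of p "affv M b"] P[OF p] affv_nz[OF M] by (simp add: hits_def)
  qed
  have "(\<Sum>p\<in>P. ln (real p) * (\<Sum>r\<in>Rt p. real (cnt M B p r))) = (\<Sum>b\<in>box n B. \<Sum>p\<in>P. ln (real p) * real (hits M b p))"
    using P by (rule sum_cnt_eq)
  also have "\<dots> \<le> (\<Sum>b\<in>box n B. \<Sum>p\<in>P. ln (real p) * ((if int p dvd nrm (affv M b) then 1 else 0) + real n * (if b \<in> badset M B p then 1 else 0)))"
    by (intro sum_mono mult_left_mono pt lnp)
  also have "\<dots> = (\<Sum>b\<in>box n B. \<Sum>p\<in>P. ln (real p) * (if int p dvd nrm (affv M b) then 1 else 0)) +
      (\<Sum>b\<in>box n B. \<Sum>p\<in>P. ln (real p) * (real n * (if b \<in> badset M B p then 1 else 0)))"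
    by (simp only: distrib_left sum.distrib)
  also have "(\<Sum>b\<in>box n B. \<Sum>p\<in>P. ln (real p) * (if int p dvd nrm (affv M b) then 1 else 0)) \<le> log_norm_sum M B"
    unfolding log_norm_sum_def
  proof (rule sum_mono)
    fix b
    have "(\<Sum>p\<in>P. ln (real p) * (if int p dvd nrm (affv M b) then 1 else 0)) = (\<Sum>p | p \<in> P \<and> int p dvd nrm (affv M b). ln (real p))"
      using finP by (simp add: sum.inter_filter if_distrib cong: if_cong)
    also have "\<dots> \<le> ln (real (nat \<bar>nrm (affv M b)\<bar>))"
      using finP P affv_nz[OF M, of b] by (intro sum_ln_primes_le) (auto simp: dvd_nat_abs_iff)
    finally show "(\<Sum>p\<in>P. ln (real p) * (if int p dvd nrm (affv M b) then 1 else 0)) \<le> ln \<bar>real_of_int (nrm (affv M b))\<bar>" by simp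
  qed
  also have "(\<Sum>b\<in>box n B. \<Sum>p\<in>P. ln (real p) * (real n * (if b \<in> badset M B p then 1 else 0))) =
      (\<Sum>p\<in>P. \<Sum>b\<in>box n B. ln (real p) * (real n * (if b \<in> badset M B p then 1 else 0)))"
    by (rule sum.swap)
  also have "\<dots> = real n * (\<Sum>p\<in>P. ln (real p) * real (card (badset M B p)))"
  proof -
    have "(\<Sum>b\<in>box n B. if b \<in> badset M B p then 1 else 0) = real (card (badset M B p))" for p
    proof -
      have "box n B \<inter> {b. b \<in> badset M B p} = badset M B p" by (auto simp: badset_def)
      thus ?thesis by (simp add: sum.If_cases)
    qed
    thus ?thesis by (simp add: sum_distrib_left[symmetric] mult.left_commute)
  qed
  finally show ?thesis by simp
qed

lemma ln_eq_sum_primes: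
  assumes "N > 0" "\<And>p. prime p \<Longrightarrow> \<not> p ^ 2 dvd N"
  shows "ln (real N) = (\<Sum>p | prime p \<and> p dvd N. ln (real p))"
proof -
  have eq: "prime_factors N = {p. prime p \<and> p dvd N}" using assms(1) by (auto simp: prime_factors_dvd)
  have mult: "multiplicity p N = 1" if "p \<in> prime_factors N" for p
  proof -
    have p: "prime p" "p dvd N" using that by auto
    have "multiplicity p N < 2" using assms(2)[OF p(1)] multiplicity_dvd'[of 2 p N] by linarith
    moreover have "multiplicity p N > 0" using that by (simp add: prime_factors_multiplicity)
    ultimately show ?thesis by simp
  qed
  define F where "F = prime_factors N"
  have "N = (\<Prod>p\<in>F. p ^ multiplicity p N)" unfolding F_def using assms(1) by (rule prime_factorization_nat)
  also have "\<dots> = (\<Prod>p\<in>F. p)" by (intro prod.cong) (auto simp: mult F_def)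
  finally have "ln (real N) = ln (\<Prod>p\<in>F. real p)" by simp
  also have "\<dots> = (\<Sum>p\<in>F. ln (real p))"
    unfolding F_def by (intro ln_prod) (auto dest: in_prime_factors_imp_prime prime_gt_0_nat)
  finally show ?thesis by (simp add: eq F_def)
qed

text \<open>A vector outside all bad sets has squarefree norm with all prime factors in
  \<open>P\<close>, so its logarithm is exactly the sum of \<open>ln p\<close> over the primes that
  hit it. A bad vector is charged with the trivial upper bound for its logarithm.\<close>

lemma lower_ineq:
  assumes M: "M \<ge> 2" and B: "B \<ge> 1" and p01: "p1 \<ge> p0"
    and Mp: "\<And>p. prime p \<Longrightarrow> p \<le> p1 \<Longrightarrow> int p dvd M"
  defines "P \<equiv> {p. prime p \<and> p1 < p \<and> real p \<le> C0 * (real_of_int M * real B) ^ n}"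
  shows "log_norm_sum M B \<le> (\<Sum>p\<in>P. ln (real p) * (\<Sum>r\<in>Rt p. real (cnt M B p r))) +
    (\<Sum>p\<in>P. real (card (badset M B p))) * (real n * ln (real B) + ln (C0 * real_of_int M ^ n))"
proof -
  define Lb where "Lb = real n * ln (real B) + ln (C0 * real_of_int M ^ n)"
  have finP: "finite P" unfolding P_def by simp
  have P: "prime p \<and> p > p0" if "p \<in> P" for p using that p01 by (auto simp: P_def)
  have lnp: "ln (real p) \<ge> 0" if "p \<in> P" for p using P[OF that] prime_ge_1_nat[of p] by simp
  define D where "D = (\<Union>p\<in>P. badset M B p)"
  have Dsub: "D \<subseteq> box n B" by (auto simp: D_def badset_def)
  have Lb0: "Lb \<ge> 0"
  proof -
    have "1 \<le> real_of_int M ^ n" using M by (intro one_le_power) simp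
    hence "1 * 1 \<le> C0 * real_of_int M ^ n" using C0_ge_1 by (intro mult_mono) auto
    thus ?thesis unfolding Lb_def using B by simp
  qed
  \<comment> \<open>Primes up to \<open>p1\<close> divide \<open>M\<close> and therefore not the
    norm; primes beyond the upper limit are excluded by the size of the norm.\<close>
  have big: "p \<in> P" if p: "prime p" "int p dvd nrm (affv M b)" and b: "b \<in> box n B" for p b
  proof -
    have "p > p1" using nrm_unit[OF p(1), of M b] Mp[OF p(1)] p(2) by (meson not_le)
    moreover have "real_of_int (int p) \<le> real_of_int \<bar>nrm (affv M b)\<bar>"
      using dvd_imp_le_int[OF affv_nz[OF M] p(2)] by (simp only: of_int_le_iff abs_of_nat)
    hence "real p \<le> C0 * (real_of_int M * real B) ^ n" using nrm_affv_le[of M b B] M b by simp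
    ultimately show ?thesis using p by (simp add: P_def)
  qed
  have pt: "ln \<bar>real_of_int (nrm (affv M b))\<bar> \<le> (\<Sum>p\<in>P. ln (real p) * real (hits M b p)) + (if b \<in> D then Lb else 0)"
    if b: "b \<in> box n B" for b
  proof (cases "b \<in> D")
    case True
    have "0 \<le> (\<Sum>p\<in>P. ln (real p) * real (hits M b p))" by (intro sum_nonneg mult_nonneg_nonneg lnp) auto
    thus ?thesis using True ln_nrm_affv_le[OF M B b] by (simp add: Lb_def)
  next
    case False
    define N where "N = nat \<bar>nrm (affv M b)\<bar>"
    have N: "N > 0" using affv_nz[OF M, of b] by (simp add: N_def)
    have dv: "m dvd N \<longleftrightarrow> int m dvd nrm (affv M b)" for m by (simp add: N_def dvd_nat_abs_iff)
    have nb: "\<not> p ^ 2 dvd N" if p: "prime p" for p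
    proof
      assume d: "p ^ 2 dvd N"
      hence d2: "int p ^ 2 dvd nrm (affv M b)" unfolding dv by simp
      hence "int p dvd nrm (affv M b)" by (metis dvd_power dvd_trans pos2)
      hence "p \<in> P" using big p b by blast
      thus False using False d2 b by (auto simp: D_def badset_def)
    qed
    have "ln \<bar>real_of_int (nrm (affv M b))\<bar> = ln (real N)" by (simp add: N_def)
    also have "\<dots> = (\<Sum>p | prime p \<and> p dvd N. ln (real p))" using N nb by (rule ln_eq_sum_primes)
    also have "\<dots> = (\<Sum>p | p \<in> P \<and> p dvd N. ln (real p))"
      by (intro sum.cong) (use big b P dv in auto)
    also have "\<dots> = (\<Sum>p\<in>P. ln (real p) * (if p dvd N then 1 else 0))"
      using finP by (simp add: sum.inter_filter if_distrib cong: if_cong)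
    also have "\<dots> = (\<Sum>p\<in>P. ln (real p) * real (hits M b p))"
    proof (intro sum.cong refl arg_cong2[of _ _ _ _ "(*)"])
      fix p assume "p \<in> P"
      moreover from this have "\<not> int p ^ 2 dvd nrm (affv M b)" using nb[of p] P[of p] dv[of "p ^ 2"] by simp
      ultimately show "(if p dvd N then 1 else 0) = real (hits M b p)"
        using Rt_count[of p "affv M b"] P[of p] affv_nz[OF M] by (simp add: hits_def dv)
    qed
    finally show ?thesis using False by simp
  qed
  have "log_norm_sum M B \<le> (\<Sum>b\<in>box n B. (\<Sum>p\<in>P. ln (real p) * real (hits M b p)) + (if b \<in> D then Lb else 0))"
    unfolding log_norm_sum_def by (intro sum_mono pt)
  also have "\<dots> = (\<Sum>b\<in>box n B. \<Sum>p\<in>P. ln (real p) * real (hits M b p)) + real (card D) * Lb"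
  proof -
    have "box n B \<inter> {b. b \<in> D} = D" using Dsub by auto
    thus ?thesis by (simp add: sum.distrib sum.If_cases)
  qed
  also have "real (card D) * Lb \<le> (\<Sum>p\<in>P. real (card (badset M B p))) * Lb"
  proof (rule mult_right_mono[OF _ Lb0])
    have "card D \<le> (\<Sum>p\<in>P. card (badset M B p))" unfolding D_def using finP by (rule card_UN_le)
    thus "real (card D) \<le> (\<Sum>p\<in>P. real (card (badset M B p)))" by (metis of_nat_le_iff of_nat_sum)
  qed
  finally show ?thesis using sum_cnt_eq[of P M B] P by (simp add: Lb_def)
qed

definition Kb :: real where "Kb = real \<kappa> * 2 ^ n * C0"

text \<open>The norms are at most \<open>Z ^ 2\<close>, so only primes up to \<open>Z\<close> have
  bad vectors. For these the terms \<open>B ^ n / p ^ 2\<close> add up to at most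
  \<open>B ^ n / p1\<close> and the terms \<open>1\<close> to at most \<open>Z\<close>, which is of
  order \<open>B ^ (n / 2)\<close> for fixed \<open>M\<close>. The first part is a small proportion
  of the box if \<open>p1\<close> is large.\<close>

lemma bad_total:
  assumes p1: "p1 \<ge> p0" "p1 > 0" and M: "M \<ge> 2" and finP: "finite P"
    and P: "\<And>p. p \<in> P \<Longrightarrow> prime p \<and> p > p1" and Mp: "\<And>p. p \<in> P \<Longrightarrow> \<not> int p dvd M"
  shows "(\<Sum>p\<in>P. real (card (badset M B p))) \<le> Kb * (real B ^ n / real p1 + sqrt (C0 * (real_of_int M * real B) ^ n))"
proof -
  define Z where "Z = sqrt (C0 * (real_of_int M * real B) ^ n)"
  have Z2: "Z ^ 2 = C0 * (real_of_int M * real B) ^ n" and Z0: "Z \<ge> 0"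
    unfolding Z_def using C0_ge_1 M by (auto intro!: real_sqrt_pow2 mult_nonneg_nonneg)
  define Q where "Q = {p \<in> P. real p \<le> Z}"
  have finQ: "finite Q" using finP by (simp add: Q_def)
  have "(\<Sum>p\<in>P. real (card (badset M B p))) = (\<Sum>p\<in>Q. real (card (badset M B p)))"
  proof (rule sum.mono_neutral_right[OF finP])
    show "\<forall>p\<in>P - Q. real (card (badset M B p)) = 0"
    proof
      fix p assume "p \<in> P - Q"
      hence "Z < real p" by (auto simp: Q_def)
      hence "Z ^ 2 < real p ^ 2" using Z0 by (intro power_strict_mono) auto
      hence "badset M B p = {}" using M Z2 by (intro badset_empty) auto
      thus "real (card (badset M B p)) = 0" by simp
    qed
  qed (auto simp: Q_def)
  also have "\<dots> \<le> (\<Sum>p\<in>Q. real \<kappa> * 2 ^ n * (C0 * real B ^ n / real p ^ 2 + 1))"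
    using P Mp p1 by (intro sum_mono card_badset) (force simp: Q_def)+
  also have "\<dots> = real \<kappa> * 2 ^ n * (C0 * real B ^ n * (\<Sum>p\<in>Q. 1 / real p ^ 2) + real (card Q))"
    by (simp add: sum_distrib_left sum.distrib distrib_left)
  also have "\<dots> \<le> real \<kappa> * 2 ^ n * (C0 * real B ^ n * (1 / real p1) + C0 * Z)"
  proof (intro mult_left_mono add_mono)
    show "(\<Sum>p\<in>Q. 1 / real p ^ 2) \<le> 1 / real p1"
      using P p1 finQ by (intro sum_inverse_squares_le) (auto simp: Q_def)
    have "Q \<subseteq> {1..nat \<lfloor>Z\<rfloor>}" using P le_nat_floor by (auto simp: Q_def prime_ge_1_nat Suc_le_eq prime_gt_0_nat)
    hence "card Q \<le> card {1..nat \<lfloor>Z\<rfloor>}" by (intro card_mono) auto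
    hence "real (card Q) \<le> real (nat \<lfloor>Z\<rfloor>)" by simp
    also have "\<dots> \<le> Z" using Z0 by simp
    also have "\<dots> \<le> C0 * Z" using C0_ge_1 Z0 by (simp add: mult_le_cancel_right1)
    finally show "real (card Q) \<le> C0 * Z" .
  qed (use C0_ge_1 in auto)
  also have "\<dots> = Kb * (real B ^ n / real p1 + Z)" by (simp add: Kb_def algebra_simps)
  finally show ?thesis by (simp add: Z_def)
qed

end

section \<open>The asymptotic formula for the weighted number of roots\<close>

lemma power_powr_inverse: "x \<ge> 0 \<Longrightarrow> n > 0 \<Longrightarrow> (x ^ n) powr (1 / real n) = (x :: real)"
  by (cases "x = 0") (auto simp: powr_realpow[symmetric] powr_powr)

context norm_lattice
begin

definition root_log_sum :: "nat \<Rightarrow> real \<Rightarrow> real" where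
  "root_log_sum p1 y = (\<Sum>p | prime p \<and> p1 < p \<and> real p \<le> y. real (card (Rt p)) * ln (real p) / real p)"

text \<open>The parameters are chosen in the order \<open>t\<close>, \<open>\<eta>\<close>,
  \<open>p1\<close>, \<open>M\<close>, \<open>\<epsilon>\<close>, each depending only on
  \<open>\<delta>\<close> and the lattice, so that every error is either at most a multiple of
  \<open>\<delta>\<close> in the leading term or absorbed in \<open>C\<close>.\<close>

lemma main_bounds:
  assumes \<delta>: "0 < \<delta>" "\<delta> < 1"
  obtains p1 \<eta> C where "0 < \<eta>" "p1 \<ge> p0"
    "eventually (\<lambda>B. (1 - \<delta>) * root_log_sum p1 (\<eta> * real B ^ n) \<le> (1 + \<delta>) * (real n * ln (real B)) + C \<and>
       (1 - 2 * \<delta>) * (real n * ln (real B)) - C \<le> (1 + \<delta>) * root_log_sum p1 (\<eta> * real B ^ n)) sequentially"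
proof -
  obtain t :: real where t: "0 < t" "t < 1" "(1 + t) ^ n \<le> 1 + \<delta>" "1 - \<delta> \<le> (1 - t) ^ n"
  proof -
    have "((\<lambda>t. (1 + t) ^ n) \<longlongrightarrow> (1 :: real)) (at_right 0)" "((\<lambda>t. (1 - t) ^ n) \<longlongrightarrow> (1 :: real)) (at_right 0)"
      by (auto intro!: tendsto_eq_intros)
    hence "eventually (\<lambda>t. (1 + t) ^ n < 1 + \<delta>) (at_right 0)" "eventually (\<lambda>t. 1 - \<delta> < (1 - t) ^ n) (at_right 0)"
      using \<delta> by (auto intro: order_tendstoD)
    moreover have "eventually (\<lambda>t :: real. 0 < t \<and> t < 1) (at_right 0)"
      by (rule eventually_at_rightI[of 0 1]) auto
    ultimately have "eventually (\<lambda>t. (1 + t) ^ n < 1 + \<delta> \<and> 1 - \<delta> < (1 - t) ^ n \<and> t < 1 \<and> 0 < t) (at_right (0 :: real))"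
      by eventually_elim auto
    from eventually_happens'[OF _ this] obtain t :: real
      where "(1 + t) ^ n < 1 + \<delta>" "1 - \<delta> < (1 - t) ^ n" "t < 1" "0 < t" by auto
    thus ?thesis using that[of t] by simp
  qed
  \<comment> \<open>With this choice the covering radius \<open>C3 * p powr (1 / n)\<close> is at
    most \<open>t * B\<close> for all primes \<open>p \<le> \<eta> * B ^ n\<close>.\<close>
  define \<eta> where "\<eta> = min 1 ((t / C3) ^ n)"
  have \<eta>: "0 < \<eta>" "\<eta> \<le> 1" "\<eta> \<le> (t / C3) ^ n" using t C3_pos by (auto simp: \<eta>_def)
  have n1: "real n \<ge> 1" using n_pos by simp
  have Kb0: "Kb \<ge> 0" using C0_ge_1 by (simp add: Kb_def)
  \<comment> \<open>Large enough for the part \<open>Kb * B ^ n / p1\<close> of the bad vectors to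
    be at most the proportion \<open>\<delta> / (4 * n)\<close> of the box.\<close>
  define p1 where "p1 = max 2 (max p0 (nat \<lceil>4 * real n * Kb / \<delta>\<rceil>))"
  have p1: "p1 \<ge> 2" "p1 \<ge> p0" and p1K: "4 * real n * Kb / \<delta> \<le> real p1" unfolding p1_def by linarith+
  define M where "M = int (fact p1)"
  have M2: "M \<ge> 2"
  proof -
    have "fact 2 \<le> (fact p1 :: nat)" using p1(1) by (rule fact_mono)
    hence "(2 :: nat) \<le> fact p1" by (simp add: fact_2)
    thus ?thesis unfolding M_def by (metis of_nat_le_iff of_nat_numeral)
  qed
  have Mp: "int p dvd M \<longleftrightarrow> p \<le> p1" if "prime p" for p
    using that by (simp only: M_def int_dvd_int_iff prime_dvd_fact_iff)
  define C1 where "C1 = C0 * real_of_int M ^ n"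
  have C1: "C1 \<ge> 1"
  proof -
    have "1 \<le> real_of_int M ^ n" using M2 by (intro one_le_power) simp
    hence "1 * 1 \<le> C0 * real_of_int M ^ n" using C0_ge_1 by (intro mult_mono) auto
    thus ?thesis by (simp add: C1_def)
  qed
  have C1B: "C0 * (real_of_int M * real B) ^ n = C1 * real B ^ n" for B by (simp add: C1_def power_mult_distrib)
  \<comment> \<open>Conjugates smaller than \<open>\<epsilon> * B\<close> count as small; they
    affect about the proportion \<open>2 * n * \<epsilon> = \<delta> / 2\<close> of the box.\<close>
  define \<epsilon> where "\<epsilon> = \<delta> / (4 * real n)"
  have \<epsilon>: "0 < \<epsilon>" "\<epsilon> < 1" using \<delta> n1 by (auto simp: \<epsilon>_def field_simps)
  define C4 where "C4 = real n * (1 + C3 * C1 powr (1 / n)) ^ n * (C1 / \<eta> * ln 4)"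
  define C where "C = C4 + real n * \<bar>ln \<epsilon>\<bar> + ln C1"
  define S where "S B = root_log_sum p1 (\<eta> * real B ^ n)" for B :: nat
  have main: "(1 - \<delta>) * S B \<le> (1 + \<delta>) * (real n * ln (real B)) + C \<and>
       (1 - 2 * \<delta>) * (real n * ln (real B)) - C \<le> (1 + \<delta>) * S B"
    if B1: "B \<ge> 1" and B2: "Kb * sqrt C1 * 4 * real n / \<delta> \<le> sqrt (real B)" and B3: "real B \<ge> 1 / \<epsilon>"
      and B4: "real B \<ge> 2 * real n / \<delta>" for B
  proof -
    have Bn: "real B ^ n > 0" using B1 by simp
    have lnB: "ln (real B) \<ge> 0" using B1 by simp
    \<comment> \<open>Every prime factor of a norm that exceeds \<open>p1\<close> lies in
      \<open>P'\<close>, as \<open>C1 * B ^ n\<close> bounds the norms. On \<open>P\<close> both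
      estimates for \<open>cnt\<close> are sharp; on the rest of \<open>P'\<close> there is only an
      upper bound, whose total is \<open>C4 * B ^ n\<close>.\<close>
    define P where "P = {p. prime p \<and> p1 < p \<and> real p \<le> \<eta> * real B ^ n}"
    define P' where "P' = {p. prime p \<and> p1 < p \<and> real p \<le> C1 * real B ^ n}"
    have finP: "finite P" "finite P'" unfolding P_def P'_def by auto
    have "\<eta> * real B ^ n \<le> C1 * real B ^ n" using \<eta> C1 by (intro mult_right_mono) auto
    hence PP': "P \<subseteq> P'" unfolding P_def P'_def by auto
    have Pp: "prime p" "p > p0" "p > p1" "\<not> int p dvd M" if "p \<in> P'" for p
      using that p1 Mp[of p] by (auto simp: P'_def)
    have lnp: "ln (real p) \<ge> 0" if "p \<in> P'" for p using Pp(1)[OF that] prime_ge_1_nat[of p] by simp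
    have pp: "real p > 0" if "p \<in> P'" for p using Pp(1)[OF that] prime_gt_0_nat[of p] by simp
    define bd where "bd = (\<Sum>p\<in>P'. real (card (badset M B p)))"
    have bd: "bd \<le> \<delta> / (2 * real n) * real B ^ n"
    proof -
      have "bd \<le> Kb * (real B ^ n / real p1 + sqrt (C1 * real B ^ n))"
        unfolding bd_def C1B[symmetric] using p1 M2 finP Pp by (intro bad_total) auto
      also have "\<dots> = Kb / real p1 * real B ^ n + Kb * sqrt C1 * sqrt (real B ^ n)"
        by (simp add: real_sqrt_mult distrib_left)
      also have "\<dots> \<le> \<delta> / (4 * real n) * real B ^ n + \<delta> / (4 * real n) * real B ^ n"
      proof (rule add_mono)
        have "Kb / real p1 \<le> \<delta> / (4 * real n)" using p1K p1 \<delta> n1 by (simp add: field_simps)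
        thus "Kb / real p1 * real B ^ n \<le> \<delta> / (4 * real n) * real B ^ n" using Bn by (intro mult_right_mono) auto
        have "real B ^ 1 \<le> real B ^ n" using n_pos B1 by (intro power_increasing) auto
        hence "sqrt (real B) \<le> sqrt (real B ^ n)" by simp
        hence "Kb * sqrt C1 * 4 * real n / \<delta> \<le> sqrt (real B ^ n)" using B2 by linarith
        hence "Kb * sqrt C1 \<le> \<delta> / (4 * real n) * sqrt (real B ^ n)" using \<delta> n1 by (simp add: field_simps)
        hence "Kb * sqrt C1 * sqrt (real B ^ n) \<le> \<delta> / (4 * real n) * sqrt (real B ^ n) * sqrt (real B ^ n)"
          by (intro mult_right_mono) auto
        thus "Kb * sqrt C1 * sqrt (real B ^ n) \<le> \<delta> / (4 * real n) * real B ^ n" by (simp add: mult.assoc)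
      qed
      also have "\<dots> = \<delta> / (2 * real n) * real B ^ n" by (simp add: field_simps)
      finally show ?thesis .
    qed
    have bd0: "bd \<ge> 0" unfolding bd_def by (intro sum_nonneg) auto
    define \<rho> where "\<rho> p = C3 * real p powr (1 / n)" for p :: nat
    have \<rho>1: "\<rho> p \<le> t * real B" if "p \<in> P" for p
    proof -
      have "real p \<le> \<eta> * real B ^ n" using that by (simp add: P_def)
      also have "\<dots> \<le> (t / C3) ^ n * real B ^ n" using \<eta> by (intro mult_right_mono) auto
      also have "\<dots> = (t / C3 * real B) ^ n" by (simp add: power_mult_distrib power_divide)
      finally have "real p powr (1 / n) \<le> ((t / C3 * real B) ^ n) powr (1 / n)" by (intro powr_mono2) auto
      also have "\<dots> = t / C3 * real B" using t C3_pos n_pos by (intro power_powr_inverse) auto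
      finally show ?thesis using C3_pos by (simp add: \<rho>_def field_simps)
    qed
    have \<rho>2: "\<rho> p \<le> C3 * C1 powr (1 / n) * real B" if "p \<in> P'" for p
    proof -
      have "real p powr (1 / n) \<le> (C1 * real B ^ n) powr (1 / n)" using that by (intro powr_mono2) (auto simp: P'_def)
      also have "\<dots> = C1 powr (1 / n) * real B" using C1 n_pos by (simp add: powr_mult power_powr_inverse)
      finally show ?thesis using C3_pos by (simp add: \<rho>_def mult.assoc)
    qed
    have \<rho>0: "\<rho> p \<ge> 0" for p using C3_pos by (simp add: \<rho>_def)
    define G where "G p = ln (real p) * (\<Sum>r\<in>Rt p. real (cnt M B p r))" for p
    have G_low: "(1 - \<delta>) * real B ^ n * (real (card (Rt p)) * ln (real p) / real p) \<le> G p" if p: "p \<in> P" for p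
    proof -
      have p': "p \<in> P'" using p PP' by blast
      have "(\<Sum>r\<in>Rt p. (1 - \<delta>) * real B ^ n / real p) \<le> (\<Sum>r\<in>Rt p. real (cnt M B p r))"
      proof (rule sum_mono)
        fix r assume r: "r \<in> Rt p"
        have tB: "t * real B \<le> 1 * real B" using t by (intro mult_right_mono) auto
        have "\<rho> p \<le> real B" using \<rho>1[OF p] tB by simp
        hence "(real B - \<rho> p) ^ n / real p \<le> real (cnt M B p r)"
          using cnt_bounds(2)[OF Pp(1,2)[OF p'] r Pp(4)[OF p'], of B] by (simp add: \<rho>_def)
        moreover have "(1 - \<delta>) * real B ^ n \<le> ((1 - t) * real B) ^ n"
          unfolding power_mult_distrib using t by (intro mult_right_mono) auto
        moreover have "((1 - t) * real B) ^ n \<le> (real B - \<rho> p) ^ n"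
          using \<rho>1[OF p] t tB by (intro power_mono) (auto simp: algebra_simps)
        ultimately show "(1 - \<delta>) * real B ^ n / real p \<le> real (cnt M B p r)"
          using pp[OF p'] by (meson divide_right_mono less_imp_le order_trans)
      qed
      hence "ln (real p) * (real (card (Rt p)) * ((1 - \<delta>) * real B ^ n / real p)) \<le> G p"
        unfolding G_def using lnp[OF p'] by (intro mult_left_mono) auto
      thus ?thesis by (simp add: algebra_simps)
    qed
    have G_high: "G p \<le> (1 + \<delta>) * real B ^ n * (real (card (Rt p)) * ln (real p) / real p)" if p: "p \<in> P" for p
    proof -
      have p': "p \<in> P'" using p PP' by blast
      have "(\<Sum>r\<in>Rt p. real (cnt M B p r)) \<le> (\<Sum>r\<in>Rt p. (1 + \<delta>) * real B ^ n / real p)"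
      proof (rule sum_mono)
        fix r assume r: "r \<in> Rt p"
        have "real (cnt M B p r) \<le> (real B + \<rho> p) ^ n / real p"
          using cnt_bounds(1)[OF Pp(1,2)[OF p'] r Pp(4)[OF p'], of B] by (simp add: \<rho>_def)
        moreover have "((1 + t) * real B) ^ n \<le> (1 + \<delta>) * real B ^ n"
          unfolding power_mult_distrib using t by (intro mult_right_mono) auto
        moreover have "(real B + \<rho> p) ^ n \<le> ((1 + t) * real B) ^ n"
          using \<rho>1[OF p] t \<rho>0[of p] by (intro power_mono) (auto simp: algebra_simps)
        ultimately show "real (cnt M B p r) \<le> (1 + \<delta>) * real B ^ n / real p"
          using pp[OF p'] by (meson divide_right_mono less_imp_le order_trans)
      qed
      hence "G p \<le> ln (real p) * (real (card (Rt p)) * ((1 + \<delta>) * real B ^ n / real p))"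
        unfolding G_def using lnp[OF p'] by (intro mult_left_mono) auto
      thus ?thesis by (simp add: algebra_simps)
    qed
    have G_tail: "G p \<le> real n * (1 + C3 * C1 powr (1 / n)) ^ n * real B ^ n * (ln (real p) / real p)" if p': "p \<in> P'" for p
    proof -
      have "(\<Sum>r\<in>Rt p. real (cnt M B p r)) \<le> (\<Sum>r\<in>Rt p. (1 + C3 * C1 powr (1 / n)) ^ n * real B ^ n / real p)"
      proof (rule sum_mono)
        fix r assume r: "r \<in> Rt p"
        have "real (cnt M B p r) \<le> (real B + \<rho> p) ^ n / real p"
          using cnt_bounds(1)[OF Pp(1,2)[OF p'] r Pp(4)[OF p'], of B] by (simp add: \<rho>_def)
        moreover have "(real B + \<rho> p) ^ n \<le> ((1 + C3 * C1 powr (1 / n)) * real B) ^ n"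
          using \<rho>2[OF p'] \<rho>0[of p] by (intro power_mono) (auto simp: algebra_simps)
        hence "(real B + \<rho> p) ^ n / real p \<le> ((1 + C3 * C1 powr (1 / n)) * real B) ^ n / real p"
          using pp[OF p'] by (intro divide_right_mono) auto
        ultimately show "real (cnt M B p r) \<le> (1 + C3 * C1 powr (1 / n)) ^ n * real B ^ n / real p"
          by (simp add: power_mult_distrib)
      qed
      also have "\<dots> = real (card (Rt p)) * ((1 + C3 * C1 powr (1 / n)) ^ n * real B ^ n / real p)" by simp
      also have "\<dots> \<le> real n * ((1 + C3 * C1 powr (1 / n)) ^ n * real B ^ n / real p)"
        using Rt_card[OF Pp(1,2)[OF p']] C3_pos pp[OF p'] by (intro mult_right_mono) auto
      finally have "G p \<le> ln (real p) * (real n * ((1 + C3 * C1 powr (1 / n)) ^ n * real B ^ n / real p))"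
        unfolding G_def using lnp[OF p'] by (intro mult_left_mono) auto
      thus ?thesis by (simp add: algebra_simps)
    qed
    have SB: "S B = (\<Sum>p\<in>P. real (card (Rt p)) * ln (real p) / real p)" by (simp add: S_def root_log_sum_def P_def)
    have "(1 - \<delta>) * real B ^ n * S B = (\<Sum>p\<in>P. (1 - \<delta>) * real B ^ n * (real (card (Rt p)) * ln (real p) / real p))"
      unfolding SB by (rule sum_distrib_left)
    also have "\<dots> \<le> (\<Sum>p\<in>P. G p)" by (intro sum_mono G_low)
    also have "\<dots> \<le> log_norm_sum M B + real n * (\<Sum>p\<in>P. ln (real p) * real (card (badset M B p)))"
      unfolding G_def using PP' Pp by (intro upper_ineq M2 finP) auto
    also have "\<dots> \<le> real B ^ n * (real n * ln (real B) + ln C1) + real n * (real n * ln (real B) * (\<delta> / (2 * real n) * real B ^ n))"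
    proof (intro add_mono mult_left_mono)
      show "log_norm_sum M B \<le> real B ^ n * (real n * ln (real B) + ln C1)" unfolding C1_def by (rule log_norm_sum_le[OF M2 B1])
      have "(\<Sum>p\<in>P. ln (real p) * real (card (badset M B p))) \<le> (\<Sum>p\<in>P. real n * ln (real B) * real (card (badset M B p)))"
      proof (intro sum_mono mult_right_mono)
        fix p assume p: "p \<in> P"
        have "real p \<le> \<eta> * real B ^ n" using p by (simp add: P_def)
        also have "\<dots> \<le> 1 * real B ^ n" using \<eta> by (intro mult_right_mono) auto
        finally have "ln (real p) \<le> ln (real B ^ n)" using pp[of p] p PP' Bn by (subst ln_le_cancel_iff) auto
        thus "ln (real p) \<le> real n * ln (real B)" using B1 by (simp add: ln_realpow)
      qed auto
      also have "\<dots> = real n * ln (real B) * (\<Sum>p\<in>P. real (card (badset M B p)))" by (simp add: sum_distrib_left)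
      also have "\<dots> \<le> real n * ln (real B) * bd"
        unfolding bd_def using lnB PP' finP by (intro mult_left_mono sum_mono2) auto
      also have "\<dots> \<le> real n * ln (real B) * (\<delta> / (2 * real n) * real B ^ n)" using lnB bd by (intro mult_left_mono) auto
      finally show "(\<Sum>p\<in>P. ln (real p) * real (card (badset M B p))) \<le> real n * ln (real B) * (\<delta> / (2 * real n) * real B ^ n)" .
    qed auto
    also have "\<dots> = real B ^ n * ((1 + \<delta> / 2) * (real n * ln (real B)) + ln C1)"
    proof -
      have nd: "real n * (w * (\<delta> / (2 * real n) * z)) = \<delta> / 2 * (w * z)" for w z :: real using n_pos by simp
      show ?thesis unfolding nd by (simp add: algebra_simps)
    qed
    finally have "real B ^ n * ((1 - \<delta>) * S B) \<le> real B ^ n * ((1 + \<delta> / 2) * (real n * ln (real B)) + ln C1)" by (simp add: mult_ac)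
    hence U: "(1 - \<delta>) * S B \<le> (1 + \<delta> / 2) * (real n * ln (real B)) + ln C1" using Bn by simp

    have "real B ^ n * ((1 - \<delta>) * (real n * (ln \<epsilon> + ln (real B)))) =
        (real B ^ n - real B ^ n * \<delta>) * (real n * ln (\<epsilon> * real B))"
    proof -
      have lne: "ln (\<epsilon> * real B) = ln \<epsilon> + ln (real B)" using \<epsilon> B1 by (intro ln_mult_pos) auto
      have gen: "b * ((1 - \<delta>) * (w * l)) = (b - b * \<delta>) * (w * l)" for b w l :: real by (simp add: algebra_simps)
      show ?thesis unfolding lne by (rule gen)
    qed
    also have "\<dots> \<le> (real B ^ n - real n * real B ^ (n - 1) * (2 * (\<epsilon> * real B) + 1)) * (real n * ln (\<epsilon> * real B))"
    proof (rule mult_right_mono)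
      have ne: "real n * \<epsilon> = \<delta> / 4" using n_pos by (simp add: \<epsilon>_def)
      have "real n * (2 * (\<epsilon> * real B) + 1) = 2 * (real n * \<epsilon>) * real B + real n" by (simp add: algebra_simps)
      also have "\<dots> = \<delta> * real B / 2 + real n" unfolding ne by simp
      also have "2 * real n \<le> real B * \<delta>" using B4 \<delta> by (simp add: pos_divide_le_eq)
      hence "\<delta> * real B / 2 + real n \<le> \<delta> * real B" by (simp add: mult.commute)
      finally have "real B ^ (n - 1) * (real n * (2 * (\<epsilon> * real B) + 1)) \<le> real B ^ (n - 1) * (\<delta> * real B)"
        by (intro mult_left_mono) auto
      also have "\<dots> = real B ^ n * \<delta>" using n_pos by (cases n) auto
      finally show "real B ^ n - real B ^ n * \<delta> \<le> real B ^ n - real n * real B ^ (n - 1) * (2 * (\<epsilon> * real B) + 1)"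
        by (simp add: mult_ac)
      have "1 \<le> \<epsilon> * real B" using B3 \<epsilon> by (simp add: field_simps)
      thus "0 \<le> real n * ln (\<epsilon> * real B)" by simp
    qed
    also have "\<dots> \<le> log_norm_sum M B" using B3 \<epsilon> by (intro log_norm_sum_ge M2) (simp add: field_simps)
    finally have t0: "real B ^ n * ((1 - \<delta>) * (real n * (ln \<epsilon> + ln (real B)))) \<le> log_norm_sum M B" .
    have t1: "log_norm_sum M B \<le> (\<Sum>p\<in>P'. G p) + bd * (real n * ln (real B) + ln C1)"
    proof -
      have "\<And>p. prime p \<Longrightarrow> p \<le> p1 \<Longrightarrow> int p dvd M" using Mp by blast
      from lower_ineq[OF M2 B1 p1(2) this] show ?thesis unfolding C1B by (simp only: G_def bd_def P'_def C1_def)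
    qed
    have t2: "(\<Sum>p\<in>P'. G p) = (\<Sum>p\<in>P. G p) + (\<Sum>p\<in>P' - P. G p)"
      using sum.subset_diff[OF PP' finP(2), of G] by simp
    have "(\<Sum>p\<in>P. G p) \<le> (\<Sum>p\<in>P. (1 + \<delta>) * real B ^ n * (real (card (Rt p)) * ln (real p) / real p))"
      by (intro sum_mono G_high)
    also have "\<dots> = (1 + \<delta>) * real B ^ n * S B" unfolding SB by (rule sum_distrib_left[symmetric])
    finally have t3: "(\<Sum>p\<in>P. G p) \<le> (1 + \<delta>) * real B ^ n * S B" .
    have t4: "(\<Sum>p\<in>P' - P. G p) \<le> real B ^ n * C4"
    proof -
      have "(\<Sum>p\<in>P' - P. G p) \<le> (\<Sum>p\<in>P' - P. real n * (1 + C3 * C1 powr (1 / n)) ^ n * real B ^ n * (ln (real p) / real p))"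
        by (intro sum_mono G_tail) auto
      also have "\<dots> = real n * (1 + C3 * C1 powr (1 / n)) ^ n * real B ^ n * (\<Sum>p\<in>P' - P. ln (real p) / real p)"
        by (rule sum_distrib_left[symmetric])
      also have "(\<Sum>p\<in>P' - P. ln (real p) / real p) \<le>
          (\<Sum>p | prime p \<and> \<eta> * real B ^ n < real p \<and> real p \<le> C1 * real B ^ n. ln (real p) / real p)"
        by (intro sum_mono2) (auto simp: P_def P'_def dest: prime_ge_1_nat)
      also have "\<dots> \<le> C1 * real B ^ n / (\<eta> * real B ^ n) * ln 4"
        using \<eta> Bn \<open>\<eta> * real B ^ n \<le> C1 * real B ^ n\<close> by (intro sum_ln_over_p_tail) auto
      also have "\<dots> = C1 / \<eta> * ln 4" using Bn by simp
      finally have "(\<Sum>p\<in>P' - P. G p) \<le> real n * (1 + C3 * C1 powr (1 / n)) ^ n * real B ^ n * (C1 / \<eta> * ln 4)"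
        using C3_pos by (simp add: mult_left_mono)
      thus ?thesis by (simp add: C4_def mult_ac)
    qed
    have t5: "bd * (real n * ln (real B) + ln C1) \<le> \<delta> / (2 * real n) * real B ^ n * (real n * ln (real B) + ln C1)"
      using bd lnB C1 by (intro mult_right_mono) auto
    have "real B ^ n * ((1 - \<delta>) * (real n * (ln \<epsilon> + ln (real B)))) \<le>
        (1 + \<delta>) * real B ^ n * S B + real B ^ n * C4 + \<delta> / (2 * real n) * real B ^ n * (real n * ln (real B) + ln C1)"
      using t0 t1 t2 t3 t4 t5 by linarith
    also have "\<dots> = real B ^ n * ((1 + \<delta>) * S B + C4 + \<delta> / (2 * real n) * (real n * ln (real B) + ln C1))"
    proof -
      have "a * b * s + b * c + k * b * w = b * (a * s + c + k * w)" for a b c k s w :: real by (simp add: algebra_simps)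
      thus ?thesis .
    qed
    finally have "(1 - \<delta>) * (real n * (ln \<epsilon> + ln (real B))) \<le> (1 + \<delta>) * S B + C4 + \<delta> / (2 * real n) * (real n * ln (real B) + ln C1)"
      by (rule mult_left_le_imp_le[OF _ Bn])
    also have "\<delta> / (2 * real n) * (real n * ln (real B) + ln C1) = \<delta> / 2 * ln (real B) + \<delta> / (2 * real n) * ln C1"
      using n1 by (simp add: field_simps)
    finally have L: "(1 - \<delta>) * (real n * (ln \<epsilon> + ln (real B))) \<le> (1 + \<delta>) * S B + C4 + (\<delta> / 2 * ln (real B) + \<delta> / (2 * real n) * ln C1)" .
    have lnC1: "ln C1 \<ge> 0" using C1 by simp
    have "\<delta> / (2 * real n) \<le> 1" using \<delta> n1 by (simp add: field_simps)
    hence c1: "\<delta> / (2 * real n) * ln C1 \<le> ln C1" using lnC1 mult_right_mono[of "\<delta> / (2 * real n)" 1 "ln C1"] by simp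
    have "\<delta> / 2 * ln (real B) \<le> \<delta> * ln (real B)" using lnB \<delta> by (intro mult_right_mono) auto
    also have "\<dots> \<le> \<delta> * (real n * ln (real B))"
      using lnB \<delta> n1 mult_right_mono[of 1 "real n" "ln (real B)"] by (intro mult_left_mono) auto
    finally have c2: "\<delta> / 2 * ln (real B) \<le> \<delta> * (real n * ln (real B))" .
    have "- (real n * \<bar>ln \<epsilon>\<bar>) \<le> (1 - \<delta>) * (real n * ln \<epsilon>)"
    proof -
      have "\<bar>(1 - \<delta>) * (real n * ln \<epsilon>)\<bar> = (1 - \<delta>) * (real n * \<bar>ln \<epsilon>\<bar>)" using \<delta> by (simp add: abs_mult)
      also have "\<dots> \<le> 1 * (real n * \<bar>ln \<epsilon>\<bar>)" using \<delta> by (intro mult_right_mono) auto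
      finally show ?thesis by linarith
    qed
    moreover have "(1 - \<delta>) * (real n * (ln \<epsilon> + ln (real B))) = (1 - \<delta>) * (real n * ln \<epsilon>) + (real n * ln (real B)) - \<delta> * (real n * ln (real B))"
      by (simp add: algebra_simps)
    moreover have "(1 - 2 * \<delta>) * (real n * ln (real B)) = (real n * ln (real B)) - 2 * (\<delta> * (real n * ln (real B)))" by (simp add: algebra_simps)
    ultimately have L': "(1 - 2 * \<delta>) * (real n * ln (real B)) - C \<le> (1 + \<delta>) * S B"
      using L c1 c2 unfolding C_def by linarith
    have "C4 \<ge> 0" using C3_pos C1 \<eta> by (auto simp: C4_def)
    hence "ln C1 \<le> C" unfolding C_def by simp
    moreover have "(1 + \<delta> / 2) * (real n * ln (real B)) \<le> (1 + \<delta>) * (real n * ln (real B))"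
      using \<delta> lnB by (intro mult_right_mono) auto
    ultimately show ?thesis using U L' by linarith
  qed
  have "filterlim (\<lambda>B. sqrt (real B)) at_top sequentially"
    by (intro filterlim_compose[OF sqrt_at_top] filterlim_real_sequentially)
  hence "eventually (\<lambda>B. Kb * sqrt C1 * 4 * real n / \<delta> \<le> sqrt (real B)) sequentially"
    by (simp add: filterlim_at_top)
  moreover have "eventually (\<lambda>B. real B \<ge> c) sequentially" for c
    using filterlim_real_sequentially by (simp add: filterlim_at_top)
  ultimately have "eventually (\<lambda>B. Kb * sqrt C1 * 4 * real n / \<delta> \<le> sqrt (real B) \<and> real B \<ge> 1 / \<epsilon> \<and> real B \<ge> 2 * real n / \<delta> \<and> B \<ge> 1) sequentially"
    by (intro eventually_conj eventually_ge_at_top) auto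
  hence "eventually (\<lambda>B. (1 - \<delta>) * S B \<le> (1 + \<delta>) * (real n * ln (real B)) + C \<and>
       (1 - 2 * \<delta>) * (real n * ln (real B)) - C \<le> (1 + \<delta>) * S B) sequentially"
    by eventually_elim (rule main, auto)
  thus ?thesis unfolding S_def by (rule that[OF \<eta>(1) p1(2)])
qed

end

text \<open>The weights \<open>ln p / p\<close> up to \<open>Y\<close> add up to \<open>ln Y\<close>
  asymptotically, a weak form of Mertens' theorem obtained below as \<open>psum_one\<close>. So
  \<open>psum \<phi> Y / ln Y\<close> is a weighted mean of \<open>\<phi>\<close> over the
  primes.\<close>

definition psum :: "(nat \<Rightarrow> real) \<Rightarrow> nat \<Rightarrow> real" where
  "psum \<phi> Y = (\<Sum>p | prime p \<and> p \<le> Y. \<phi> p * ln (real p) / real p)"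

context norm_lattice
begin

text \<open>Interpolation from the arguments \<open>\<eta> * B ^ n\<close> to all \<open>Y\<close>:
  passing from \<open>B\<close> to \<open>B + 1\<close> changes \<open>n * ln B\<close> by a bounded
  amount, the sums are monotone, and the primes up to \<open>p1\<close> add a constant.\<close>

lemma psum_card_Rt_bounds:
  assumes \<delta>: "0 < \<delta>" "\<delta> < 1"
  obtains C where "eventually (\<lambda>Y. (1 - \<delta>) * psum (\<lambda>p. real (card (Rt p))) Y \<le> (1 + \<delta>) * ln (real Y) + C \<and>
       (1 - 2 * \<delta>) * ln (real Y) - C \<le> (1 + \<delta>) * psum (\<lambda>p. real (card (Rt p))) Y) sequentially"
proof -
  obtain p1 \<eta> C where \<eta>: "0 < \<eta>" and p1: "p1 \<ge> p0"
    and ev: "eventually (\<lambda>B. (1 - \<delta>) * root_log_sum p1 (\<eta> * real B ^ n) \<le> (1 + \<delta>) * (real n * ln (real B)) + C \<and>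
       (1 - 2 * \<delta>) * (real n * ln (real B)) - C \<le> (1 + \<delta>) * root_log_sum p1 (\<eta> * real B ^ n)) sequentially"
    using main_bounds[OF \<delta>] by blast
  obtain B0 where B0: "\<And>B. B \<ge> B0 \<Longrightarrow> (1 - \<delta>) * root_log_sum p1 (\<eta> * real B ^ n) \<le> (1 + \<delta>) * (real n * ln (real B)) + C \<and>
       (1 - 2 * \<delta>) * (real n * ln (real B)) - C \<le> (1 + \<delta>) * root_log_sum p1 (\<eta> * real B ^ n)"
    using ev unfolding eventually_sequentially by blast
  define \<phi> where "\<phi> p = real (card (Rt p)) * ln (real p) / real p" for p
  have \<phi>0: "\<phi> p \<ge> 0" if "prime p" for p
    using prime_ge_1_nat[OF that] unfolding \<phi>_def by (intro divide_nonneg_nonneg mult_nonneg_nonneg ln_ge_zero) auto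
  have root_log_sum: "root_log_sum p1 y = (\<Sum>p | prime p \<and> p1 < p \<and> real p \<le> y. \<phi> p)" for y by (simp add: root_log_sum_def \<phi>_def)
  have root_log_sum_mono: "root_log_sum p1 y \<le> root_log_sum p1 z" if "y \<le> z" for y z
    unfolding root_log_sum using that \<phi>0 by (intro sum_mono2) auto
  define K where "K = (\<Sum>p | prime p \<and> p \<le> p1. \<phi> p)"
  have K0: "K \<ge> 0" unfolding K_def using \<phi>0 by (intro sum_nonneg) auto
  define S where "S = psum (\<lambda>p. real (card (Rt p)))"
  have S: "S Y = (\<Sum>p | prime p \<and> p \<le> Y. \<phi> p)" for Y by (simp add: S_def psum_def \<phi>_def)
  have fin: "finite {p :: nat. prime p \<and> p \<le> Y}" for Y by (rule finite_subset[of _ "{..Y}"]) auto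
  have SS1: "root_log_sum p1 (real Y) \<le> S Y" for Y
    unfolding S root_log_sum using \<phi>0 fin by (intro sum_mono2) auto
  have SS2: "S Y \<le> K + root_log_sum p1 (real Y)" for Y
  proof -
    have "S Y \<le> (\<Sum>p\<in>{p. prime p \<and> p \<le> p1} \<union> {p. prime p \<and> p1 < p \<and> real p \<le> real Y}. \<phi> p)"
      unfolding S using \<phi>0 fin by (intro sum_mono2) auto
    also have "\<dots> = K + root_log_sum p1 (real Y)" unfolding K_def root_log_sum using fin by (intro sum.union_disjoint) auto
    finally show ?thesis .
  qed
  define D where "D = \<bar>ln \<eta>\<bar> + real n * ln 2"
  define C' where "C' = \<bar>C\<bar> + K + 2 * D"
  have main: "(1 - \<delta>) * S Y \<le> (1 + \<delta>) * ln (real Y) + C' \<and> (1 - 2 * \<delta>) * ln (real Y) - C' \<le> (1 + \<delta>) * S Y"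
    if Y: "real Y \<ge> \<eta> * (real B0 + 1) ^ n" "real Y \<ge> \<eta> * 2 ^ n" "Y \<ge> 1" for Y
  proof -
    define z where "z = (real Y / \<eta>) powr (1 / n)"
    have Yn: "real Y / \<eta> > 0" using Y \<eta> by simp
    have zn: "z ^ n = real Y / \<eta>" unfolding z_def using Yn n_pos \<eta> Y by (subst powr_power) auto
    have zge: "z \<ge> w" if "real Y \<ge> \<eta> * w ^ n" "w \<ge> 0" for w
    proof -
      have "w = (w ^ n) powr (1 / n)" using that n_pos by (simp add: power_powr_inverse)
      also have "\<dots> \<le> z" unfolding z_def using that \<eta> by (intro powr_mono2) (auto simp: field_simps)
      finally show ?thesis .
    qed
    have z2: "z \<ge> 2" "z \<ge> real B0 + 1" using zge Y by auto
    define B where "B = nat \<lfloor>z\<rfloor>"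
    have B: "real B \<le> z" "z < real B + 1" "B \<ge> 1" "B \<ge> B0" using z2 unfolding B_def by linarith+
    have lnz: "real n * ln z = ln (real Y) - ln \<eta>"
      using arg_cong[OF zn, of ln] z2 Y \<eta> by (simp add: ln_realpow ln_div)
    have lo: "\<eta> * real B ^ n \<le> real Y"
    proof -
      have "real B ^ n \<le> z ^ n" using B by (intro power_mono) auto
      thus ?thesis using zn \<eta> by (simp add: field_simps)
    qed
    have hi: "real Y \<le> \<eta> * real (B + 1) ^ n"
    proof -
      have "z ^ n \<le> real (B + 1) ^ n" using B z2 by (intro power_mono) auto
      thus ?thesis using zn \<eta> by (simp add: field_simps)
    qed
    have l1: "real n * ln (real (B + 1)) \<le> ln (real Y) + D"
    proof -
      have "ln (real (B + 1)) \<le> ln (2 * z)" using B z2 by (subst ln_le_cancel_iff) auto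
      also have "\<dots> = ln 2 + ln z" using z2 by (simp add: ln_mult_pos)
      finally have "real n * ln (real (B + 1)) \<le> real n * (ln 2 + ln z)" by (intro mult_left_mono) auto
      thus ?thesis using lnz unfolding D_def by (simp add: distrib_left)
    qed
    have l2: "real n * ln (real B) \<ge> ln (real Y) - D"
    proof -
      have "z \<le> 2 * real B" using B by linarith
      hence "ln z \<le> ln (2 * real B)" using z2 B by (subst ln_le_cancel_iff) auto
      also have "\<dots> = ln 2 + ln (real B)" using B by (simp add: ln_mult_pos)
      finally have "real n * ln z \<le> real n * (ln 2 + ln (real B))" by (intro mult_left_mono) auto
      thus ?thesis using lnz unfolding D_def by (simp add: distrib_left)
    qed
    have D0: "D \<ge> 0" unfolding D_def by simp
    have "(1 - \<delta>) * S Y \<le> (1 - \<delta>) * (K + root_log_sum p1 (\<eta> * real (B + 1) ^ n))"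
      using SS2[of Y] root_log_sum_mono[OF hi] \<delta> by (intro mult_left_mono) auto
    also have "\<dots> = (1 - \<delta>) * K + (1 - \<delta>) * root_log_sum p1 (\<eta> * real (B + 1) ^ n)" by (simp add: distrib_left)
    also have "(1 - \<delta>) * K \<le> 1 * K" using \<delta> K0 by (intro mult_right_mono) auto
    also have "(1 - \<delta>) * root_log_sum p1 (\<eta> * real (B + 1) ^ n) \<le> (1 + \<delta>) * (real n * ln (real (B + 1))) + C"
      using B0[of "B + 1"] B by auto
    also have "(1 + \<delta>) * (real n * ln (real (B + 1))) \<le> (1 + \<delta>) * (ln (real Y) + D)"
      using l1 \<delta> by (intro mult_left_mono) auto
    also have "(1 + \<delta>) * (ln (real Y) + D) \<le> (1 + \<delta>) * ln (real Y) + 2 * D"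
      using \<delta> D0 mult_right_mono[of "1 + \<delta>" 2 D] by (simp add: distrib_left)
    finally have 1: "(1 - \<delta>) * S Y \<le> (1 + \<delta>) * ln (real Y) + C'" unfolding C'_def by linarith
    \<comment> \<open>As only \<open>\<delta> < 1\<close> is known, the factor
      \<open>1 - 2 * \<delta>\<close> may be negative; then the upper estimate of
      \<open>ln B\<close> is the one to use.\<close>
    have "(1 - 2 * \<delta>) * (ln (real Y)) - 2 * D \<le> (1 - 2 * \<delta>) * (real n * ln (real B))"
    proof (cases "1 - 2 * \<delta> \<ge> 0")
      case True
      have "(1 - 2 * \<delta>) * (ln (real Y) - D) \<le> (1 - 2 * \<delta>) * (real n * ln (real B))"
        using True l2 by (intro mult_left_mono) auto
      moreover have "(1 - 2 * \<delta>) * D \<le> 2 * D" using D0 \<delta> by (intro mult_right_mono) auto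
      ultimately show ?thesis by (simp add: right_diff_distrib)
    next
      case False
      have "real n * ln (real B) \<le> real n * ln (real (B + 1))" using B by (intro mult_left_mono) auto
      hence "real n * ln (real B) \<le> ln (real Y) + D" using l1 by linarith
      hence "(1 - 2 * \<delta>) * (ln (real Y) + D) \<le> (1 - 2 * \<delta>) * (real n * ln (real B))"
        using False by (intro mult_left_mono_neg) auto
      moreover have "(- 1) * D \<le> (1 - 2 * \<delta>) * D" using D0 \<delta> by (intro mult_right_mono) auto
      ultimately show ?thesis using D0 unfolding distrib_left by linarith
    qed
    also have "\<dots> \<le> (1 + \<delta>) * root_log_sum p1 (\<eta> * real B ^ n) + C" using B0[of B] B by auto
    also have "(1 + \<delta>) * root_log_sum p1 (\<eta> * real B ^ n) \<le> (1 + \<delta>) * S Y"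
      using SS1[of Y] root_log_sum_mono[OF lo] \<delta> by (intro mult_left_mono) auto
    finally have 2: "(1 - 2 * \<delta>) * ln (real Y) - C' \<le> (1 + \<delta>) * S Y" unfolding C'_def using K0 by linarith
    show ?thesis using 1 2 by blast
  qed
  have big: "eventually (\<lambda>Y. real Y \<ge> c) sequentially" for c
    using filterlim_real_sequentially by (simp add: filterlim_at_top)
  have "eventually (\<lambda>Y. real Y \<ge> \<eta> * (real B0 + 1) ^ n \<and> real Y \<ge> \<eta> * 2 ^ n \<and> Y \<ge> 1) sequentially"
    by (intro eventually_conj big eventually_ge_at_top)
  hence "eventually (\<lambda>Y. (1 - \<delta>) * S Y \<le> (1 + \<delta>) * ln (real Y) + C' \<and>
       (1 - 2 * \<delta>) * ln (real Y) - C' \<le> (1 + \<delta>) * S Y) sequentially"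
    by eventually_elim (rule main, auto)
  thus ?thesis unfolding S_def by (rule that)
qed

text \<open>For large \<open>Y\<close> the constant \<open>C\<close>, which depends on
  \<open>\<delta>\<close>, is at most \<open>\<delta> * ln Y\<close>, and then both bounds confine
  the quotient to distance \<open>4 * \<delta>\<close> from \<open>1\<close>. For orbits of
  conjugates this is Kronecker's theorem that an irreducible polynomial has one root modulo
  \<open>p\<close> on average.\<close>

theorem psum_card_Rt_asymp:
  "(\<lambda>Y. psum (\<lambda>p. real (card (Rt p))) Y / ln (real Y)) \<longlonglongrightarrow> 1"
proof (rule tendstoI)
  fix e :: real assume e: "e > 0"
  define \<delta> where "\<delta> = min (1 / 4) (e / 8)"
  have \<delta>: "0 < \<delta>" "\<delta> < 1" "\<delta> \<le> 1 / 4" "8 * \<delta> \<le> e" using e unfolding \<delta>_def by auto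
  obtain C where ev: "eventually (\<lambda>Y. (1 - \<delta>) * psum (\<lambda>p. real (card (Rt p))) Y \<le> (1 + \<delta>) * ln (real Y) + C \<and>
       (1 - 2 * \<delta>) * ln (real Y) - C \<le> (1 + \<delta>) * psum (\<lambda>p. real (card (Rt p))) Y) sequentially"
    using psum_card_Rt_bounds[OF \<delta>(1,2)] by blast
  have "filterlim (\<lambda>Y. ln (real Y)) at_top sequentially"
    by (intro filterlim_compose[OF ln_at_top] filterlim_real_sequentially)
  hence "eventually (\<lambda>Y. ln (real Y) \<ge> max 1 (\<bar>C\<bar> / \<delta>)) sequentially" by (simp only: filterlim_at_top)
  with ev show "eventually (\<lambda>Y. dist (psum (\<lambda>p. real (card (Rt p))) Y / ln (real Y)) 1 < e) sequentially"
  proof eventually_elim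
    case (elim Y)
    define s where "s = psum (\<lambda>p. real (card (Rt p))) Y"
    define l where "l = ln (real Y)"
    have l: "l \<ge> 1" "\<bar>C\<bar> \<le> \<delta> * l" using elim \<delta> by (auto simp: l_def field_simps)
    have u: "(1 - \<delta>) * s \<le> (1 + 2 * \<delta>) * l" and d: "(1 - 3 * \<delta>) * l \<le> (1 + \<delta>) * s"
      using elim l unfolding s_def[symmetric] l_def[symmetric] by (auto simp: algebra_simps)
    have "(1 - \<delta>) * (1 + 4 * \<delta>) - (1 + 2 * \<delta>) = \<delta> * (1 - 4 * \<delta>)" by (simp add: algebra_simps)
    moreover have "\<delta> * (1 - 4 * \<delta>) \<ge> 0" using \<delta> by simp
    ultimately have "(1 + 2 * \<delta>) * l \<le> ((1 - \<delta>) * (1 + 4 * \<delta>)) * l" using l by (intro mult_right_mono) auto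
    hence "(1 - \<delta>) * s \<le> (1 - \<delta>) * ((1 + 4 * \<delta>) * l)" using u by (simp add: mult.assoc)
    hence 1: "s \<le> (1 + 4 * \<delta>) * l" using \<delta> by simp
    have "(1 + \<delta>) * (1 - 4 * \<delta>) \<le> 1 - 3 * \<delta>" using \<delta> by (simp add: algebra_simps)
    hence "((1 + \<delta>) * (1 - 4 * \<delta>)) * l \<le> (1 - 3 * \<delta>) * l" using l by (intro mult_right_mono) auto
    hence "(1 + \<delta>) * ((1 - 4 * \<delta>) * l) \<le> (1 + \<delta>) * s" using d by (simp add: mult.assoc)
    hence 2: "(1 - 4 * \<delta>) * l \<le> s" using \<delta> by simp
    have "s / l \<le> 1 + 4 * \<delta>" "1 - 4 * \<delta> \<le> s / l" using 1 2 l by (auto simp: field_simps)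
    hence "\<bar>s / l - 1\<bar> \<le> 4 * \<delta>" by linarith
    also have "\<dots> < e" using \<delta> e by linarith
    finally show ?case by (simp add: s_def l_def dist_real_def)
  qed
qed

end

section \<open>Galois extensions of the rationals inside the complex numbers\<close>

definition rp :: "rat poly \<Rightarrow> complex \<Rightarrow> complex" where
  "rp u x = poly (map_poly of_rat u) x"

lemma rp_0 [simp]: "rp 0 x = 0" by (simp add: rp_def)

lemma rp_pCons [simp]: "rp (pCons a u) x = of_rat a + x * rp u x"
proof -
  have "map_poly of_rat (pCons a u) = (pCons (of_rat a) (map_poly of_rat u) :: complex poly)"
    by (rule poly_eqI) (simp add: coeff_map_poly coeff_pCons split: nat.split)
  thus ?thesis by (simp add: rp_def)
qed

lemma rp_add [simp]: "rp (u + v) x = rp u x + rp v x"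
proof -
  have "map_poly of_rat (u + v) = (map_poly of_rat u + map_poly of_rat v :: complex poly)"
    by (rule poly_eqI) (simp add: coeff_map_poly of_rat_add)
  thus ?thesis by (simp add: rp_def)
qed

lemma rp_minus [simp]: "rp (- u) x = - rp u x"
proof -
  have "map_poly of_rat (- u) = (- map_poly of_rat u :: complex poly)"
    by (rule poly_eqI) (simp add: coeff_map_poly of_rat_minus)
  thus ?thesis by (simp add: rp_def)
qed

lemma rp_diff [simp]: "rp (u - v) x = rp u x - rp v x"
  using rp_add[of u "- v" x] by simp

lemma rp_smult [simp]: "rp (smult c u) x = of_rat c * rp u x"
  by (induction u) (auto simp: of_rat_mult algebra_simps)

lemma rp_mult [simp]: "rp (u * v) x = rp u x * rp v x"
  by (induction u) (auto simp: algebra_simps)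

lemma rp_pcompose [simp]: "rp (pcompose u v) x = rp u (rp v x)"
  by (induction u) (auto simp: pcompose_pCons)

lemma rp_dvd: "u dvd v \<Longrightarrow> rp u x = 0 \<Longrightarrow> rp v x = 0"
  by (auto elim!: dvdE)

lemma map_poly_of_rat_eq_0 [simp]: "(map_poly of_rat u :: complex poly) = 0 \<longleftrightarrow> u = 0"
  by (simp add: map_poly_eq_0_iff)

lemma degree_map_poly_of_rat [simp]: "degree (map_poly of_rat u :: complex poly) = degree u"
  by (intro degree_map_poly) auto

lemma finite_rp_roots: "u \<noteq> 0 \<Longrightarrow> finite {x. rp u x = 0}"
  unfolding rp_def by (intro poly_roots_finite) simp

lemma rp_pderiv: "poly (pderiv (map_poly of_rat u)) x = rp (pderiv u) x"
proof -
  have "pderiv (map_poly of_rat u) = (map_poly of_rat (pderiv u) :: complex poly)"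
    by (rule poly_eqI) (simp add: coeff_map_poly coeff_pderiv of_rat_mult of_rat_add del: of_nat_Suc)
  thus ?thesis by (simp add: rp_def)
qed

text \<open>Determined up to a nonzero rational factor only; divisibility does not see the
  factor.\<close>

definition min_poly_of :: "rat poly \<Rightarrow> complex \<Rightarrow> bool" where
  "min_poly_of H x \<longleftrightarrow> H \<noteq> 0 \<and> rp H x = 0 \<and> (\<forall>u. rp u x = 0 \<longrightarrow> H dvd u)"

lemma exists_min_poly_of:
  assumes "u \<noteq> 0" "rp u x = 0"
  shows "\<exists>H. min_poly_of H x"
proof -
  define d where "d = (LEAST d. \<exists>u. u \<noteq> 0 \<and> rp u x = 0 \<and> degree u = d)"
  have "\<exists>u. u \<noteq> 0 \<and> rp u x = 0 \<and> degree u = d"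
    unfolding d_def by (rule LeastI_ex) (use assms in blast)
  then obtain H where H: "H \<noteq> 0" "rp H x = 0" "degree H = d" by blast
  have min: "d \<le> degree v" if "v \<noteq> 0" "rp v x = 0" for v
    unfolding d_def by (rule Least_le) (use that in blast)
  have "H dvd v" if "rp v x = 0" for v
  proof -
    have "v mod H = v - v div H * H" by (simp add: minus_div_mult_eq_mod)
    hence "rp (v mod H) x = 0" using that H by simp
    hence "v mod H = 0" using min[of "v mod H"] degree_mod_less[OF H(1), of v] H(3) by linarith
    thus ?thesis by (simp add: mod_eq_0_iff_dvd)
  qed
  thus ?thesis using H by (auto simp: min_poly_of_def)
qed

lemma alg_ints_min_poly: "x \<in> alg_ints \<Longrightarrow> \<exists>H. min_poly_of H x"
proof -
  assume "x \<in> alg_ints"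
  then obtain q where q: "poly (map_poly of_int q) x = 0" "lead_coeff q = 1"
    unfolding alg_ints_def algebraic_int_altdef_ipoly by auto
  have "map_poly of_rat (map_poly of_int q :: rat poly) = (map_poly of_int q :: complex poly)"
    by (rule poly_eqI) (simp add: coeff_map_poly)
  hence "rp (map_poly of_int q) x = 0" using q by (simp add: rp_def)
  moreover have "map_poly of_int q \<noteq> (0 :: rat poly)" using q by (auto simp: map_poly_eq_0_iff)
  ultimately show ?thesis by (intro exists_min_poly_of)
qed

lemma min_poly_degree_pos: "min_poly_of H x \<Longrightarrow> degree H > 0"
  by (rule ccontr) (auto simp: min_poly_of_def elim!: degree_eq_zeroE)

text \<open>Irreducibility: if \<open>J\<close> is minimal for \<open>y\<close> and
  \<open>H = J * w\<close>, then \<open>x\<close> is a root of \<open>J\<close> or of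
  \<open>w\<close>. The degree of \<open>w\<close> is too small for that, so \<open>H\<close> and
  \<open>J\<close> divide each other.\<close>

lemma min_poly_of_root:
  assumes H: "min_poly_of H x" and y: "rp H y = 0"
  shows "min_poly_of H y"
proof -
  have H0: "H \<noteq> 0" using H by (simp add: min_poly_of_def)
  obtain J where J: "min_poly_of J y" using exists_min_poly_of[OF H0 y] by blast
  then obtain w where w: "H = J * w" using y by (auto simp: min_poly_of_def)
  have nz: "J \<noteq> 0" "w \<noteq> 0" using H0 w by auto
  have "rp J x * rp w x = 0" using H w by (simp add: min_poly_of_def)
  hence "rp J x = 0"
  proof (rule disjE[OF iffD1[OF mult_eq_0_iff]])
    assume "rp w x = 0"
    hence "H dvd w" using H by (simp add: min_poly_of_def)
    hence "degree H \<le> degree w" using nz by (intro dvd_imp_degree_le)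
    hence "degree J = 0" using nz by (simp add: w degree_mult_eq)
    thus ?thesis using min_poly_degree_pos[OF J] by simp
  qed
  hence "H dvd J" using H by (simp add: min_poly_of_def)
  thus ?thesis using J H0 y dvd_trans by (auto simp: min_poly_of_def)
qed

lemma min_poly_of_simple_roots:
  assumes H: "min_poly_of H x" and y: "rp H y = 0"
  shows "rp (pderiv H) y \<noteq> 0"
proof
  assume "rp (pderiv H) y = 0"
  hence d: "H dvd pderiv H" using min_poly_of_root[OF H y] unfolding min_poly_of_def by blast
  have "pderiv H \<noteq> 0" using min_poly_degree_pos[OF H] by (simp add: pderiv_eq_0_iff)
  hence "degree H \<le> degree (pderiv H)" using d by (intro dvd_imp_degree_le)
  thus False using min_poly_degree_pos[OF H] by (simp add: degree_pderiv)
qed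

lemma min_poly_card_roots:
  assumes H: "min_poly_of H x"
  shows "card {y. rp H y = 0} = degree H"
proof -
  have "rsquarefree (map_poly of_rat H :: complex poly)"
    unfolding rsquarefree_roots rp_pderiv using min_poly_of_simple_roots[OF H] by (auto simp: rp_def)
  hence "smult (lead_coeff (map_poly of_rat H :: complex poly)) (\<Prod>z | poly (map_poly of_rat H) z = 0. [:-z, 1:]) = map_poly of_rat H"
    by (rule complex_poly_decompose_rsquarefree)
  hence "degree H = degree (\<Prod>z | poly (map_poly of_rat H) z = 0. [:-z, 1 :: complex:])"
    using H by (metis degree_map_poly_of_rat degree_smult_eq leading_coeff_0_iff map_poly_of_rat_eq_0 min_poly_of_def)
  also have "\<dots> = card {z :: complex. poly (map_poly of_rat H) z = 0}"
    by (subst degree_prod_eq_sum_degree) auto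
  finally show ?thesis by (simp add: rp_def)
qed

section \<open>Number fields as sets of complex numbers\<close>

definition qfield :: "complex \<Rightarrow> complex set" where
  "qfield \<theta> = {rp u \<theta> |u. True}"

lemma qfieldI: "rp u \<theta> \<in> qfield \<theta>" by (auto simp: qfield_def)

lemma qfield_gen: "\<theta> \<in> qfield \<theta>" using qfieldI[of "[:0, 1:]" \<theta>] by simp

lemma qfield_rat: "of_rat q \<in> qfield \<theta>" using qfieldI[of "[:q:]" \<theta>] by simp

lemma qfield_add: "x \<in> qfield \<theta> \<Longrightarrow> y \<in> qfield \<theta> \<Longrightarrow> x + y \<in> qfield \<theta>"
  unfolding qfield_def by (auto intro: rp_add[symmetric])

lemma qfield_mult: "x \<in> qfield \<theta> \<Longrightarrow> y \<in> qfield \<theta> \<Longrightarrow> x * y \<in> qfield \<theta>"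
  unfolding qfield_def by (auto intro: rp_mult[symmetric])

lemma qfield_trans: "x \<in> qfield y \<Longrightarrow> y \<in> qfield z \<Longrightarrow> x \<in> qfield z"
  unfolding qfield_def by (auto intro: rp_pcompose[symmetric])

lemma qfield_inverse:
  assumes H: "min_poly_of H \<theta>" and x: "x \<in> qfield \<theta>"
  shows "inverse x \<in> qfield \<theta>"
proof (cases "x = 0")
  case True thus ?thesis using qfield_rat[of 0 \<theta>] by simp
next
  case False
  obtain u where u: "x = rp u \<theta>" using x by (auto simp: qfield_def)
  have H0: "H \<noteq> 0" "rp H \<theta> = 0" using H by (auto simp: min_poly_of_def)
  define g where "g = gcd u H"
  obtain k where k: "H = g * k" unfolding g_def by (metis dvdE gcd_dvd2)
  have gk: "g \<noteq> 0" "k \<noteq> 0" using k H0 by auto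
  have "rp g \<theta> \<noteq> 0" using False u rp_dvd[of g u \<theta>] by (auto simp: g_def)
  hence "rp k \<theta> = 0" using k H0 by simp
  hence "H dvd k" using H by (simp add: min_poly_of_def)
  hence "degree H \<le> degree k" using gk by (intro dvd_imp_degree_le)
  hence "degree g = 0" using gk by (simp add: k degree_mult_eq)
  then obtain c where c: "g = [:c:]" by (rule degree_eq_zeroE)
  have c0: "c \<noteq> 0" using gk c by auto
  obtain s t where st: "s * u + t * H = g" unfolding g_def by (metis bezout_coefficients_fst_snd)
  have sx: "rp s \<theta> * x = of_rat c" using arg_cong[OF st, of "\<lambda>v. rp v \<theta>"] H0 by (simp add: u c)
  have "x * rp (smult (inverse c) s) \<theta> = of_rat (inverse c) * (rp s \<theta> * x)" by (simp add: mult_ac)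
  also have "\<dots> = of_rat (inverse c * c)" unfolding sx by (simp only: of_rat_mult)
  also have "\<dots> = 1" using c0 by simp
  finally have "inverse x = rp (smult (inverse c) s) \<theta>" by (rule inverse_unique)
  thus ?thesis using qfieldI by metis
qed

definition polys_over :: "complex set \<Rightarrow> complex poly set" where
  "polys_over F = {p. \<forall>i. coeff p i \<in> F}"

locale cfield =
  fixes F :: "complex set"
  assumes F_rat: "of_rat q \<in> F"
    and F_add: "x \<in> F \<Longrightarrow> y \<in> F \<Longrightarrow> x + y \<in> F"
    and F_mult: "x \<in> F \<Longrightarrow> y \<in> F \<Longrightarrow> x * y \<in> F"
    and F_inverse: "x \<in> F \<Longrightarrow> inverse x \<in> F"
begin

lemma F_0: "0 \<in> F" using F_rat[of 0] by simp
lemma F_1: "1 \<in> F" using F_rat[of 1] by simp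
lemma F_minus: "x \<in> F \<Longrightarrow> - x \<in> F" using F_mult[of "-1" x] F_rat[of "-1"] by simp
lemma F_diff: "x \<in> F \<Longrightarrow> y \<in> F \<Longrightarrow> x - y \<in> F" using F_add[of x "- y"] F_minus by simp
lemma F_divide: "x \<in> F \<Longrightarrow> y \<in> F \<Longrightarrow> x / y \<in> F" using F_mult F_inverse by (simp add: divide_inverse)
lemma F_of_int: "of_int k \<in> F" using F_rat[of "of_int k"] by simp
lemma F_sum: "(\<And>i. i \<in> I \<Longrightarrow> f i \<in> F) \<Longrightarrow> (\<Sum>i\<in>I. f i) \<in> F"
  by (induction I rule: infinite_finite_induct) (auto intro: F_0 F_add)
lemma F_prod: "(\<And>i. i \<in> I \<Longrightarrow> f i \<in> F) \<Longrightarrow> (\<Prod>i\<in>I. f i) \<in> F"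
  by (induction I rule: infinite_finite_induct) (auto intro: F_1 F_mult)
lemma F_power: "x \<in> F \<Longrightarrow> x ^ k \<in> F" by (induction k) (auto intro: F_1 F_mult)

lemma pv_add: "p \<in> polys_over F \<Longrightarrow> q \<in> polys_over F \<Longrightarrow> p + q \<in> polys_over F"
  by (auto simp: polys_over_def intro: F_add)
lemma pv_diff: "p \<in> polys_over F \<Longrightarrow> q \<in> polys_over F \<Longrightarrow> p - q \<in> polys_over F"
  by (auto simp: polys_over_def intro: F_diff)
lemma pv_mult: "p \<in> polys_over F \<Longrightarrow> q \<in> polys_over F \<Longrightarrow> p * q \<in> polys_over F"
  by (auto simp: polys_over_def coeff_mult intro!: F_sum F_mult)
lemma pv_pCons: "a \<in> F \<Longrightarrow> p \<in> polys_over F \<Longrightarrow> pCons a p \<in> polys_over F"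
  by (auto simp: polys_over_def coeff_pCons split: nat.split)
lemma pv_0: "0 \<in> polys_over F" by (auto simp: polys_over_def F_0)
lemma pv_monom: "a \<in> F \<Longrightarrow> monom a k \<in> polys_over F" by (auto simp: polys_over_def F_0)
lemma pv_rat: "map_poly of_rat u \<in> polys_over F" by (auto simp: polys_over_def coeff_map_poly F_rat)
lemma pv_pcompose: "p \<in> polys_over F \<Longrightarrow> q \<in> polys_over F \<Longrightarrow> pcompose p q \<in> polys_over F"
proof (induction p)
  case (pCons a p)
  have cf: "coeff (pCons a p) i \<in> F" for i using pCons.prems(1) unfolding polys_over_def by blast
  have "a \<in> F" using cf[of 0] by simp
  moreover have "p \<in> polys_over F" unfolding polys_over_def using cf[of "Suc _"] by simp
  ultimately show ?case unfolding pcompose_pCons using pCons by (intro pv_add pv_mult pv_pCons pv_0) auto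
qed (auto intro: pv_0)

text \<open>Long division by cancelling leading terms, so that the coefficients are seen to stay in
  \<open>F\<close>, which is a set of complex numbers and not a type.\<close>

lemma min_dvd:
  assumes u: "u \<in> polys_over F" "u \<noteq> 0"
    and min: "\<And>v. v \<in> polys_over F \<Longrightarrow> v \<noteq> 0 \<Longrightarrow> poly v b = 0 \<Longrightarrow> degree u \<le> degree v"
    and ub: "poly u b = 0" and v: "v \<in> polys_over F" "poly v b = 0"
  shows "u dvd v"
  using v
proof (induction "degree v" arbitrary: v rule: less_induct)
  case less
  show ?case
  proof (cases "v = 0")
    case False
    have du: "degree u \<le> degree v" using min less.prems False by blast
    have dpos: "degree u > 0"
    proof (rule ccontr)
      assume "\<not> degree u > 0"
      then obtain c where "u = [:c:]" by (auto elim: degree_eq_zeroE)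
      thus False using ub u by simp
    qed
    define m where "m = monom (lead_coeff v / lead_coeff u) (degree v - degree u)"
    define w where "w = v - m * u"
    have "lead_coeff v / lead_coeff u \<in> F" using u less.prems by (intro F_divide) (auto simp: polys_over_def)
    hence w: "w \<in> polys_over F" "poly w b = 0"
      unfolding w_def m_def using u less.prems ub by (auto intro!: pv_diff pv_mult pv_monom)
    have q0: "lead_coeff v / lead_coeff u \<noteq> 0" using False u by simp
    have m0: "m \<noteq> 0" "degree m = degree v - degree u"
      using q0 degree_monom_eq[OF q0] by (simp_all only: m_def monom_eq_0_iff not_False_eq_True)
    have dm: "degree (m * u) = degree v" using m0 u du by (simp add: degree_mult_eq)
    have "lead_coeff m = lead_coeff v / lead_coeff u" unfolding m0(2) by (simp add: m_def)
    hence lm: "lead_coeff (m * u) = lead_coeff v" using u by (simp add: lead_coeff_mult)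
    have "coeff w (degree v) = 0" unfolding w_def using dm lm by simp
    moreover have "degree w \<le> degree v" unfolding w_def using dm by (intro degree_diff_le) auto
    ultimately have "w = 0 \<or> degree w < degree v" by (metis leading_coeff_0_iff le_neq_implies_less)
    hence "u dvd w" using less.hyps[of w] w by auto
    hence "u dvd w + m * u" by (intro dvd_add) auto
    thus ?thesis by (simp add: w_def)
  qed simp
qed

end

lemma cfield_qfield: "min_poly_of H \<theta> \<Longrightarrow> cfield (qfield \<theta>)"
  by unfold_locales (auto intro: qfield_rat qfield_add qfield_mult qfield_inverse)

text \<open>The classical argument: \<open>m\<close> is chosen so that \<open>b\<close> is the only
  common root of the minimal polynomial of \<open>b\<close> and of that of \<open>a\<close> composed
  with \<open>c - m * x\<close>. A polynomial of least degree over the field of \<open>c\<close>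
  that vanishes at \<open>b\<close> divides both, hence is linear, and its coefficients yield
  \<open>b\<close>.\<close>

lemma primitive_element:
  assumes a: "a \<in> alg_ints" and b: "b \<in> alg_ints"
  obtains m :: int where "a \<in> qfield (a + of_int m * b)" "b \<in> qfield (a + of_int m * b)"
proof -
  obtain A where A: "min_poly_of A a" using alg_ints_min_poly[OF a] by blast
  obtain Bp where Bp: "min_poly_of Bp b" using alg_ints_min_poly[OF b] by blast
  \<comment> \<open>Pairs with \<open>b' = b\<close> contribute only the value \<open>0\<close>, as
    division by zero gives \<open>0\<close>.\<close>
  define S where "S = (\<lambda>(a', b'). (a' - a) / (b - b')) ` ({x. rp A x = 0} \<times> {x. rp Bp x = 0})"
  have "finite S" unfolding S_def using A Bp by (auto intro!: finite_rp_roots simp: min_poly_of_def)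
  moreover have "infinite (range (of_int :: int \<Rightarrow> complex))" by (simp add: finite_image_iff inj_def)
  ultimately have "\<exists>m :: int. of_int m \<notin> S" by (metis finite_subset image_subsetI)
  then obtain m :: int where m: "of_int m \<notin> S" by blast
  define c where "c = a + of_int m * b"
  have "c \<in> alg_ints" unfolding c_def using a b by auto
  then obtain H where H: "min_poly_of H c" using alg_ints_min_poly by blast
  interpret cfield "qfield c" by (rule cfield_qfield[OF H])
  define P1 where "P1 = pcompose (map_poly of_rat A) [:c, - of_int m :: complex:]"
  define P2 where "P2 = (map_poly of_rat Bp :: complex poly)"
  have P1: "P1 \<in> polys_over (qfield c)" unfolding P1_def
    by (intro pv_pcompose pv_rat pv_pCons pv_0 qfield_gen F_minus F_of_int)
  have P2: "P2 \<in> polys_over (qfield c)" unfolding P2_def by (rule pv_rat)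
  have P1v: "poly P1 x = rp A (c - of_int m * x)" for x by (simp add: P1_def poly_pcompose rp_def algebra_simps)
  have P2v: "poly P2 x = rp Bp x" for x by (simp add: P2_def rp_def)
  have P20: "P2 \<noteq> 0" using Bp by (simp add: P2_def min_poly_of_def)
  have b1: "poly P1 b = 0" using A by (simp add: P1v c_def min_poly_of_def)
  have b2: "poly P2 b = 0" using Bp by (simp add: P2v min_poly_of_def)
  have common: "x = b" if "poly P1 x = 0" "poly P2 x = 0" for x
  proof (rule ccontr)
    assume ne: "x \<noteq> b"
    define a' where "a' = c - of_int m * x"
    have "of_int m * (b - x) = a' - a" by (simp add: a'_def c_def algebra_simps)
    hence "of_int m = (a' - a) / (b - x)" using ne by (simp add: field_simps)
    moreover have "rp A a' = 0" "rp Bp x = 0" using that by (auto simp: P1v P2v a'_def)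
    ultimately have "of_int m \<in> S" unfolding S_def by (intro image_eqI[where x = "(a', x)"]) auto
    thus False using m by simp
  qed
  define Q where "Q u \<longleftrightarrow> u \<in> polys_over (qfield c) \<and> u \<noteq> 0 \<and> poly u b = 0" for u
  have "Q P2" using P2 P20 b2 by (simp add: Q_def)
  define u where "u = arg_min degree Q"
  have u: "Q u" unfolding u_def by (rule arg_min_natI) fact
  have umin: "degree u \<le> degree v" if "Q v" for v unfolding u_def by (rule arg_min_nat_le) fact
  have d: "u dvd P1" "u dvd P2"
    using u umin P1 P2 b1 b2 by (auto intro!: min_dvd simp: Q_def)
  have u0: "u \<noteq> 0" "poly u b = 0" using u by (auto simp: Q_def)
  then obtain w where w: "u = [:- b, 1:] * w" by (metis dvdE poly_eq_0_iff_dvd)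
  \<comment> \<open>A further root of \<open>u\<close> would be a common root, hence
    \<open>b\<close> again, and then \<open>b\<close> would be a multiple root of its minimal
    polynomial.\<close>
  have "degree w = 0"
  proof (rule ccontr)
    assume "degree w \<noteq> 0"
    hence "\<not> constant (poly w)" by (simp add: constant_degree)
    then obtain x where x: "poly w x = 0" using fundamental_theorem_of_algebra by blast
    hence "poly u x = 0" by (simp add: w)
    hence "poly P1 x = 0" "poly P2 x = 0" using d by (auto elim!: dvdE)
    hence "x = b" by (rule common)
    hence "[:- b, 1:] dvd w" using x by (simp add: poly_eq_0_iff_dvd)
    then obtain w' where "w = [:- b, 1:] * w'" by (elim dvdE)
    moreover obtain k where "P2 = u * k" using d(2) by (elim dvdE)
    ultimately have P2eq: "P2 = [:- b, 1:] * ([:- b, 1:] * (w' * k))" by (simp only: w mult.assoc)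
    have "poly (pderiv P2) b = 0" unfolding P2eq by (simp only: pderiv_mult poly_add poly_mult) simp
    hence "rp (pderiv Bp) b = 0" by (simp add: P2_def rp_pderiv)
    thus False using min_poly_of_simple_roots[OF Bp, of b] Bp by (simp add: min_poly_of_def)
  qed
  then obtain e where e: "w = [:e:]" by (rule degree_eq_zeroE)
  have e0: "e \<noteq> 0" using w e u0 by auto
  have "coeff u 0 \<in> qfield c" "coeff u 1 \<in> qfield c" using u by (auto simp: Q_def polys_over_def)
  hence m1: "- (b * e) \<in> qfield c" and m2: "e \<in> qfield c" by (simp_all add: w e mult.commute)
  have "- (- (b * e)) / e = b" using e0 by simp
  hence bc: "b \<in> qfield c" using F_divide[OF F_minus[OF m1] m2] by simp
  have "a = c - of_int m * b" by (simp add: c_def)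
  also have "\<dots> \<in> qfield c" using bc by (intro F_diff F_mult F_of_int qfield_gen)
  finally show ?thesis using that[of m] bc by (simp add: c_def)
qed

text \<open>Wanted for its induction rule: an embedding is followed from the roots of a polynomial,
  which it permutes, to the primitive element built from them.\<close>

inductive_set int_ring_gen :: "complex set \<Rightarrow> complex set" for \<Omega> where
  base: "x \<in> \<Omega> \<Longrightarrow> x \<in> int_ring_gen \<Omega>"
| int: "of_int k \<in> int_ring_gen \<Omega>"
| add: "x \<in> int_ring_gen \<Omega> \<Longrightarrow> y \<in> int_ring_gen \<Omega> \<Longrightarrow> x + y \<in> int_ring_gen \<Omega>"
| mult: "x \<in> int_ring_gen \<Omega> \<Longrightarrow> y \<in> int_ring_gen \<Omega> \<Longrightarrow> x * y \<in> int_ring_gen \<Omega>"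

lemma int_ring_gen_mono: "\<Omega> \<subseteq> \<Omega>' \<Longrightarrow> x \<in> int_ring_gen \<Omega> \<Longrightarrow> x \<in> int_ring_gen \<Omega>'"
  by (rotate_tac, induction rule: int_ring_gen.induct) (auto intro: int_ring_gen.intros)

lemma int_ring_gen_alg_ints: "\<Omega> \<subseteq> alg_ints \<Longrightarrow> x \<in> int_ring_gen \<Omega> \<Longrightarrow> x \<in> alg_ints"
  by (rotate_tac, induction rule: int_ring_gen.induct) auto

lemma primitive_element_finite:
  assumes "finite \<Omega>" "\<Omega> \<subseteq> alg_ints"
  shows "\<exists>\<theta>. \<theta> \<in> int_ring_gen \<Omega> \<and> \<Omega> \<subseteq> qfield \<theta>"
  using assms
proof (induction \<Omega> rule: finite_induct)
  case empty
  show ?case using int_ring_gen.int[of 0 "{}"] by auto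
next
  case (insert a \<Omega>)
  then obtain \<theta> where \<theta>: "\<theta> \<in> int_ring_gen \<Omega>" "\<Omega> \<subseteq> qfield \<theta>" by auto
  have "\<theta> \<in> alg_ints" "a \<in> alg_ints" using \<theta> insert int_ring_gen_alg_ints by auto
  then obtain m :: int where m: "\<theta> \<in> qfield (\<theta> + of_int m * a)" "a \<in> qfield (\<theta> + of_int m * a)"
    by (rule primitive_element)
  have "\<theta> + of_int m * a \<in> int_ring_gen (insert a \<Omega>)"
    using \<theta>(1) int_ring_gen_mono[of \<Omega> "insert a \<Omega>" \<theta>] by (auto intro: int_ring_gen.intros)
  thus ?case using m \<theta> qfield_trans by blast
qed

text \<open>The elements of \<open>G\<close> are total functions, which are meaningful only on \<open>K\<close>; outside \<open>K\<close> they can be the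
  identity.\<close>

locale galois =
  fixes K :: "complex set" and G :: "(complex \<Rightarrow> complex) set" and \<theta> :: complex
  assumes cfieldK: "cfield K"
    and finG: "finite G" and id_G: "id \<in> G"
    and comp_G: "\<sigma> \<in> G \<Longrightarrow> \<tau> \<in> G \<Longrightarrow> \<sigma> \<circ> \<tau> \<in> G"
    and inj_G: "\<sigma> \<in> G \<Longrightarrow> inj \<sigma>"
    and G_K: "\<sigma> \<in> G \<Longrightarrow> x \<in> K \<Longrightarrow> \<sigma> x \<in> K"
    and G_add: "\<sigma> \<in> G \<Longrightarrow> x \<in> K \<Longrightarrow> y \<in> K \<Longrightarrow> \<sigma> (x + y) = \<sigma> x + \<sigma> y"
    and G_mult: "\<sigma> \<in> G \<Longrightarrow> x \<in> K \<Longrightarrow> y \<in> K \<Longrightarrow> \<sigma> (x * y) = \<sigma> x * \<sigma> y"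
    and G_rat: "\<sigma> \<in> G \<Longrightarrow> \<sigma> (of_rat q) = of_rat q"
    and G_fixed: "x \<in> K \<Longrightarrow> (\<And>\<sigma>. \<sigma> \<in> G \<Longrightarrow> \<sigma> x = x) \<Longrightarrow> x \<in> \<rat>"
    and \<theta>_int: "\<theta> \<in> alg_ints" and \<theta>_prim: "K = qfield \<theta>"

text \<open>An integral primitive element \<open>\<theta>\<close> generates the splitting field.
  Each root \<open>y\<close> of its minimal polynomial defines the embedding that sends
  \<open>rp u \<theta>\<close> to \<open>rp u y\<close>, and since embeddings map the roots of
  \<open>f\<close> to roots of \<open>f\<close>, each such \<open>y\<close> lies in the field
  again.\<close>

lemma exists_galois:
  assumes f: "f \<noteq> 0" and \<Omega>: "{x. rp f x = 0} \<subseteq> alg_ints"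
  shows "\<exists>K G \<theta>. galois K G \<theta> \<and> {x. rp f x = 0} \<subseteq> K"
proof -
  define \<Omega> where "\<Omega> = {x. rp f x = 0}"
  have \<Omega>f: "finite \<Omega>" "\<Omega> \<subseteq> alg_ints" using finite_rp_roots[OF f] assms by (auto simp: \<Omega>_def)
  obtain \<theta> where \<theta>: "\<theta> \<in> int_ring_gen \<Omega>" "\<Omega> \<subseteq> qfield \<theta>" using primitive_element_finite[OF \<Omega>f] by blast
  have \<theta>i: "\<theta> \<in> alg_ints" using int_ring_gen_alg_ints[OF \<Omega>f(2) \<theta>(1)] .
  obtain H where H: "min_poly_of H \<theta>" using alg_ints_min_poly[OF \<theta>i] by blast
  define K where "K = qfield \<theta>"
  interpret cfield K unfolding K_def by (rule cfield_qfield[OF H])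
  define R where "R = {y. rp H y = 0}"
  have Rf: "finite R" unfolding R_def using H by (intro finite_rp_roots) (simp add: min_poly_of_def)
  have \<theta>R: "\<theta> \<in> R" using H by (simp add: R_def min_poly_of_def)
  have Rdvd: "rp u y = 0 \<longleftrightarrow> H dvd u" if "y \<in> R" for u y
    using min_poly_of_root[OF H, of y] that rp_dvd[of H u y] by (auto simp: R_def min_poly_of_def)
  have Req: "rp u y = rp v y \<longleftrightarrow> rp u \<theta> = rp v \<theta>" if "y \<in> R" for u v y
    using Rdvd[OF that, of "u - v"] Rdvd[OF \<theta>R, of "u - v"] by simp
  define \<sigma> where "\<sigma> y x = (if x \<in> K then rp (SOME u. x = rp u \<theta>) y else x)" for y x
  have \<sigma>: "\<sigma> y (rp u \<theta>) = rp u y" if "y \<in> R" for y u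
  proof -
    have "rp u \<theta> = rp (SOME v. rp u \<theta> = rp v \<theta>) \<theta>" by (rule someI[of _ u]) simp
    hence "rp u y = rp (SOME v. rp u \<theta> = rp v \<theta>) y" using Req[OF that] by blast
    thus ?thesis by (simp add: \<sigma>_def K_def qfieldI)
  qed
  have KE: "\<exists>u. x = rp u \<theta>" if "x \<in> K" for x using that by (auto simp: K_def qfield_def)
  \<comment> \<open>Normality: the embedding given by \<open>y\<close> maps everything generated by
    the roots of \<open>f\<close> into \<open>K\<close>, in particular \<open>\<theta>\<close>,
    whose image is \<open>y\<close>.\<close>
  have RK: "y \<in> K" if y: "y \<in> R" for y
  proof -
    have "z \<in> K \<and> \<sigma> y z \<in> K" if "z \<in> int_ring_gen \<Omega>" for z
      using that
    proof (induction rule: int_ring_gen.induct)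
      case (base x)
      then obtain u where u: "x = rp u \<theta>" using \<theta>(2) by (auto simp: qfield_def)
      have "rp (pcompose f u) \<theta> = 0" using base u by (simp add: \<Omega>_def)
      hence "rp (pcompose f u) y = 0" using Rdvd[OF y] Rdvd[OF \<theta>R] by blast
      hence "rp u y \<in> \<Omega>" by (simp add: \<Omega>_def)
      thus ?case using base u \<theta>(2) \<sigma>[OF y] by (auto simp: K_def)
    next
      case (int k)
      have "of_int k = rp [:of_int k:] \<theta>" by simp
      hence "\<sigma> y (of_int k) = of_int k" using \<sigma>[OF y, of "[:of_int k:]"] by simp
      thus ?case using F_of_int by simp
    next
      case (add a b)
      then obtain u v where uv: "a = rp u \<theta>" "b = rp v \<theta>" using KE by blast
      have "\<sigma> y (a + b) = \<sigma> y a + \<sigma> y b" using \<sigma>[OF y, of "u + v"] \<sigma>[OF y, of u] \<sigma>[OF y, of v] by (simp add: uv)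
      thus ?case using add by (auto intro: F_add)
    next
      case (mult a b)
      then obtain u v where uv: "a = rp u \<theta>" "b = rp v \<theta>" using KE by blast
      have "\<sigma> y (a * b) = \<sigma> y a * \<sigma> y b" using \<sigma>[OF y, of "u * v"] \<sigma>[OF y, of u] \<sigma>[OF y, of v] by (simp add: uv)
      thus ?case using mult by (auto intro: F_mult)
    qed
    hence "\<sigma> y \<theta> \<in> K" using \<theta>(1) by blast
    thus ?thesis using \<sigma>[OF y, of "[:0, 1:]"] by simp
  qed
  define G where "G = \<sigma> ` R"
  have \<sigma>K: "\<sigma> y x \<in> K" if yR: "y \<in> R" and xK: "x \<in> K" for y x
  proof -
    obtain u where u: "x = rp u \<theta>" using KE[OF xK] by blast
    obtain v where v: "y = rp v \<theta>" using KE[OF RK[OF yR]] by blast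
    have "\<sigma> y x = rp (pcompose u v) \<theta>" using \<sigma>[OF yR] by (simp add: u v)
    thus ?thesis by (simp only: K_def qfieldI)
  qed
  have "galois K G \<theta>"
  proof
    show "finite G" using Rf by (simp add: G_def)
    have "\<sigma> \<theta> = id"
    proof
      fix x show "\<sigma> \<theta> x = id x"
      proof (cases "x \<in> K")
        case True
        then obtain u where "x = rp u \<theta>" using KE by blast
        thus ?thesis using \<sigma>[OF \<theta>R, of u] by simp
      qed (simp add: \<sigma>_def)
    qed
    thus "id \<in> G" using \<theta>R unfolding G_def by (metis imageI)
    fix s assume s: "s \<in> G"
    then obtain y where y: "y \<in> R" "s = \<sigma> y" by (auto simp: G_def)
    show "s x \<in> K" if "x \<in> K" for x using \<sigma>K that y by simp
    show "s (of_rat q) = of_rat q" for q using \<sigma>[OF y(1), of "[:q:]"] y by simp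
    show "s (a + b) = s a + s b" if ab: "a \<in> K" "b \<in> K" for a b
    proof -
      obtain u v where uv: "a = rp u \<theta>" "b = rp v \<theta>" using KE[OF ab(1)] KE[OF ab(2)] by blast
      show ?thesis using \<sigma>[OF y(1), of "u + v"] \<sigma>[OF y(1), of u] \<sigma>[OF y(1), of v] y by (simp add: uv)
    qed
    show "s (a * b) = s a * s b" if ab: "a \<in> K" "b \<in> K" for a b
    proof -
      obtain u v where uv: "a = rp u \<theta>" "b = rp v \<theta>" using KE[OF ab(1)] KE[OF ab(2)] by blast
      show ?thesis using \<sigma>[OF y(1), of "u * v"] \<sigma>[OF y(1), of u] \<sigma>[OF y(1), of v] y by (simp add: uv)
    qed
    show "inj s"
    proof (rule injI)
      fix a b assume ab: "s a = s b"
      show "a = b"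
      proof (cases "a \<in> K \<and> b \<in> K")
        case True
        then obtain u v where uv: "a = rp u \<theta>" "b = rp v \<theta>" using KE by blast
        have "rp u y = rp v y" using ab y \<sigma>[OF y(1)] by (simp add: uv)
        thus ?thesis using Req[OF y(1)] uv by simp
      next
        case False
        have out: "s x = x" if "x \<notin> K" for x using that y by (simp add: \<sigma>_def)
        have inn: "s x \<in> K" if "x \<in> K" for x using \<sigma>K that y by simp
        show ?thesis using False ab out inn by metis
      qed
    qed
    fix t assume "t \<in> G"
    then obtain z where z: "z \<in> R" "t = \<sigma> z" by (auto simp: G_def)
    obtain v where v: "z = rp v \<theta>" using KE[OF RK[OF z(1)]] by blast
    have "rp (pcompose H v) \<theta> = 0" using z v by (simp add: R_def)
    hence "rp (pcompose H v) y = 0" using Rdvd[OF y(1)] Rdvd[OF \<theta>R] by blast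
    hence yz: "rp v y \<in> R" by (simp add: R_def)
    have "s \<circ> t = \<sigma> (rp v y)"
    proof
      fix x
      show "(s \<circ> t) x = \<sigma> (rp v y) x"
      proof (cases "x \<in> K")
        case True
        then obtain u where u: "x = rp u \<theta>" using KE by blast
        have "t x = rp (pcompose u v) \<theta>" using \<sigma>[OF z(1), of u] z u v by simp
        hence "s (t x) = rp (pcompose u v) y" using \<sigma>[OF y(1), of "pcompose u v"] y by (simp del: rp_pcompose)
        thus ?thesis using \<sigma>[OF yz, of u] u by simp
      qed (use y z in \<open>simp add: \<sigma>_def\<close>)
    qed
    thus "s \<circ> t \<in> G" using yz by (auto simp: G_def)
  next
    fix x assume x: "x \<in> K" "\<And>s. s \<in> G \<Longrightarrow> s x = x"
    obtain v where v: "x = rp v \<theta>" using KE x by blast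
    have H0: "H \<noteq> 0" using H by (simp add: min_poly_of_def)
    define u where "u = v mod H"
    have "v = v div H * H + u" by (simp add: u_def)
    hence "rp v \<theta> = rp u \<theta>" using Rdvd[OF \<theta>R, of H] by (metis add_0 dvd_refl mult_zero_right rp_add rp_mult)
    hence u: "x = rp u \<theta>" using v by simp
    have du: "degree u < degree H"
      using degree_mod_less[OF H0, of v] min_poly_degree_pos[OF H] by (auto simp: u_def)
    have fix_all: "rp u y = x" if "y \<in> R" for y using x(2)[of "\<sigma> y"] \<sigma>[OF that, of u] that u by (simp add: G_def)
    \<comment> \<open>If every embedding fixes \<open>x\<close>, then \<open>u - x\<close> vanishes
      at all \<open>degree H\<close> conjugates of \<open>\<theta>\<close> while its degree is
      smaller, so \<open>x\<close> is the constant coefficient of \<open>u\<close>.\<close>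
    have "map_poly of_rat u - [:x:] = 0"
    proof (rule ccontr)
      assume ne: "map_poly of_rat u - [:x:] \<noteq> 0"
      have "R \<subseteq> {y. poly (map_poly of_rat u - [:x:]) y = 0}" using fix_all by (auto simp: rp_def)
      hence "card R \<le> card {y. poly (map_poly of_rat u - [:x:]) y = 0}"
        by (intro card_mono poly_roots_finite ne)
      also have "\<dots> \<le> degree (map_poly of_rat u - [:x:])" by (rule card_poly_roots_bound[OF ne])
      also have "\<dots> \<le> degree u" by (intro degree_diff_le) auto
      finally show False using du min_poly_card_roots[OF H] by (simp add: R_def)
    qed
    hence "map_poly of_rat u = [:x:]" by simp
    hence "coeff (map_poly of_rat u) 0 = x" by simp
    thus "x \<in> \<rat>" by (auto simp: coeff_map_poly)
  qed (use cfield_axioms \<theta>i K_def in auto)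
  moreover have "{x. rp f x = 0} \<subseteq> K" using \<theta>(2) by (simp add: K_def \<Omega>_def)
  ultimately show ?thesis by blast
qed

section \<open>Frobenius elements\<close>

lemma clear_denominators:
  "\<exists>(d :: int) q. d > 0 \<and> map_poly of_int q = smult (of_int d) (u :: rat poly)"
proof (induction u)
  case 0
  show ?case by (intro exI[of _ 1] exI[of _ 0]) simp
next
  case (pCons a u)
  then obtain d q where dq: "d > 0" "map_poly of_int q = smult (of_int d) u" by blast
  obtain k m where a: "a = of_int k / of_int m" "m > 0" by (cases a rule: Rat_cases) (auto simp: Fract_of_int_quotient)
  have "map_poly of_int (pCons (d * k) (smult m q)) = smult (of_int (d * m)) (pCons a u)"
  proof (rule poly_eqI)
    fix i
    have "of_int (coeff q j) = of_int d * coeff u j" for j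
      using arg_cong[OF dq(2), of "\<lambda>p. coeff p j"] by (simp add: coeff_map_poly)
    thus "coeff (map_poly of_int (pCons (d * k) (smult m q))) i = coeff (smult (of_int (d * m)) (pCons a u)) i"
      using a by (auto simp: coeff_map_poly coeff_pCons split: nat.split)
  qed
  thus ?case using dq(1) a(2) by (intro exI[of _ "d * m"] exI) auto
qed

lemma alg_polys_mult:
  "p \<in> polys_over alg_ints \<Longrightarrow> q \<in> polys_over alg_ints \<Longrightarrow> p * q \<in> polys_over alg_ints"
  by (auto simp: polys_over_def coeff_mult)

lemma alg_polys_linear: "x \<in> alg_ints \<Longrightarrow> [:- x, 1:] \<in> polys_over alg_ints"
  by (auto simp: polys_over_def coeff_pCons split: nat.split)

lemma alg_polys_prod: "(\<And>i. i \<in> I \<Longrightarrow> f i \<in> polys_over alg_ints) \<Longrightarrow> (\<Prod>i\<in>I. f i) \<in> polys_over alg_ints"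
proof (induction I rule: infinite_finite_induct)
  case (insert i I)
  thus ?case by (simp add: alg_polys_mult)
qed (auto simp: polys_over_def coeff_1)

lemma (in cfield) pv_linear: "x \<in> F \<Longrightarrow> [:- x, 1:] \<in> polys_over F"
  by (intro pv_pCons pv_0 F_minus F_1)

lemma (in cfield) pv_prod: "(\<And>i. i \<in> I \<Longrightarrow> f i \<in> polys_over F) \<Longrightarrow> (\<Prod>i\<in>I. f i) \<in> polys_over F"
proof (induction I rule: infinite_finite_induct)
  case (insert i I)
  thus ?case by (simp add: pv_mult)
qed (auto simp: polys_over_def coeff_1 F_0 F_1)

lemma poly_eq_on_card:
  fixes p q :: "complex poly"
  assumes "\<And>x. x \<in> W \<Longrightarrow> poly p x = poly q x" "finite W" "degree p < card W" "degree q < card W"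
  shows "p = q"
proof (rule ccontr)
  assume ne: "p \<noteq> q"
  hence ne': "p - q \<noteq> 0" by simp
  have "W \<subseteq> {x. poly (p - q) x = 0}" using assms(1) by auto
  hence "card W \<le> card {x. poly (p - q) x = 0}" by (intro card_mono poly_roots_finite ne')
  also have "\<dots> \<le> degree (p - q)" by (rule card_poly_roots_bound[OF ne'])
  finally show False using degree_diff_less[OF assms(3,4)] by simp
qed

context galois
begin

sublocale cfield K by (rule cfieldK)

definition KZ :: "complex set" where "KZ = K \<inter> alg_ints"

lemma KZ_K: "x \<in> KZ \<Longrightarrow> x \<in> K" and KZ_A: "x \<in> KZ \<Longrightarrow> x \<in> alg_ints" by (auto simp: KZ_def)

lemma KZ_mult: "x \<in> KZ \<Longrightarrow> y \<in> KZ \<Longrightarrow> x * y \<in> KZ"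
  and KZ_diff: "x \<in> KZ \<Longrightarrow> y \<in> KZ \<Longrightarrow> x - y \<in> KZ"
  and KZ_power: "x \<in> KZ \<Longrightarrow> x ^ k \<in> KZ"
  and KZ_of_int: "of_int m \<in> KZ"
  and KZ_prod: "(\<And>i. i \<in> I \<Longrightarrow> f i \<in> KZ) \<Longrightarrow> (\<Prod>i\<in>I. f i) \<in> KZ"
  and KZ_sum: "(\<And>i. i \<in> I \<Longrightarrow> f i \<in> KZ) \<Longrightarrow> (\<Sum>i\<in>I. f i) \<in> KZ"
  unfolding KZ_def by (auto intro: F_add F_mult F_diff F_power F_of_int F_prod F_sum)

lemma KZ_0: "0 \<in> KZ" and KZ_1: "1 \<in> KZ" using KZ_of_int[of 0] KZ_of_int[of 1] by auto

lemma G_of_int: "\<sigma> \<in> G \<Longrightarrow> \<sigma> (of_int k) = of_int k"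
  using G_rat[of \<sigma> "of_int k"] by simp

lemma G_0: "\<sigma> \<in> G \<Longrightarrow> \<sigma> 0 = 0" and G_1: "\<sigma> \<in> G \<Longrightarrow> \<sigma> 1 = 1"
  using G_of_int[of \<sigma> 0] G_of_int[of \<sigma> 1] by auto

lemma G_diff: "\<sigma> \<in> G \<Longrightarrow> x \<in> K \<Longrightarrow> y \<in> K \<Longrightarrow> \<sigma> (x - y) = \<sigma> x - \<sigma> y"
  using G_add[of \<sigma> "x - y" y] F_diff[of x y] by simp

lemma G_sum: "\<sigma> \<in> G \<Longrightarrow> (\<And>i. i \<in> I \<Longrightarrow> f i \<in> K) \<Longrightarrow> \<sigma> (\<Sum>i\<in>I. f i) = (\<Sum>i\<in>I. \<sigma> (f i))"
proof (induction I rule: infinite_finite_induct)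
  case (insert i I)
  thus ?case by (simp add: G_add F_sum)
qed (simp_all add: G_0)

lemma G_prod: "\<sigma> \<in> G \<Longrightarrow> (\<And>i. i \<in> I \<Longrightarrow> f i \<in> K) \<Longrightarrow> \<sigma> (\<Prod>i\<in>I. f i) = (\<Prod>i\<in>I. \<sigma> (f i))"
proof (induction I rule: infinite_finite_induct)
  case (insert i I)
  thus ?case by (simp add: G_mult F_prod)
qed (simp_all add: G_1)

lemma G_power: "\<sigma> \<in> G \<Longrightarrow> x \<in> K \<Longrightarrow> \<sigma> (x ^ k) = \<sigma> x ^ k"
  by (induction k) (simp_all add: G_1 G_mult F_power)

lemma G_poly:
  assumes "\<sigma> \<in> G" "q \<in> polys_over K" "x \<in> K"
  shows "\<sigma> (poly q x) = poly (map_poly \<sigma> q) (\<sigma> x)"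
proof -
  have "\<sigma> (poly q x) = (\<Sum>i\<le>degree q. \<sigma> (coeff q i) * \<sigma> x ^ i)"
    using assms by (simp add: poly_altdef polys_over_def G_sum G_mult G_power F_mult F_power)
  also have "\<dots> = (\<Sum>i\<le>degree (map_poly \<sigma> q). coeff (map_poly \<sigma> q) i * \<sigma> x ^ i)"
  proof (rule sum.mono_neutral_cong_right)
    show "{..degree (map_poly \<sigma> q)} \<subseteq> {..degree q}" using degree_map_poly_le[of \<sigma> q] by auto
    show "\<forall>i\<in>{..degree q} - {..degree (map_poly \<sigma> q)}. \<sigma> (coeff q i) * \<sigma> x ^ i = 0"
    proof
      fix i assume "i \<in> {..degree q} - {..degree (map_poly \<sigma> q)}"
      hence "coeff (map_poly \<sigma> q) i = 0" by (intro coeff_eq_0) auto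
      thus "\<sigma> (coeff q i) * \<sigma> x ^ i = 0" using assms by (simp add: coeff_map_poly G_0)
    qed
  qed (use assms in \<open>auto simp: coeff_map_poly G_0\<close>)
  finally show ?thesis by (simp add: poly_altdef)
qed

lemma G_KZ: "\<sigma> \<in> G \<Longrightarrow> x \<in> KZ \<Longrightarrow> \<sigma> x \<in> KZ"
proof -
  assume \<sigma>: "\<sigma> \<in> G" and x: "x \<in> KZ"
  obtain q where q: "poly (map_poly of_int q) x = 0" "lead_coeff q = 1"
    using KZ_A[OF x] unfolding alg_ints_def algebraic_int_altdef_ipoly by auto
  have "\<sigma> (poly (map_poly of_int q) x) = poly (map_poly \<sigma> (map_poly of_int q)) (\<sigma> x)"
    using x \<sigma> by (intro G_poly) (auto simp: polys_over_def coeff_map_poly F_of_int KZ_K)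
  also have "map_poly \<sigma> (map_poly of_int q) = map_poly of_int q"
    by (rule poly_eqI) (simp add: coeff_map_poly G_0[OF \<sigma>] G_of_int[OF \<sigma>])
  finally have "poly (map_poly of_int q) (\<sigma> x) = 0" using q G_0[OF \<sigma>] by simp
  thus ?thesis using q G_K[OF \<sigma>] x unfolding KZ_def alg_ints_def algebraic_int_altdef_ipoly by auto
qed

lemma G_bij: "\<tau> \<in> G \<Longrightarrow> bij_betw (\<lambda>\<sigma>. \<tau> \<circ> \<sigma>) G G"
proof -
  assume \<tau>: "\<tau> \<in> G"
  have inj: "inj_on (\<lambda>\<sigma>. \<tau> \<circ> \<sigma>) G"
  proof (rule inj_onI, rule ext)
    fix \<sigma> \<sigma>' x assume eq: "\<tau> \<circ> \<sigma> = \<tau> \<circ> \<sigma>'"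
    have "\<tau> (\<sigma> x) = \<tau> (\<sigma>' x)" using fun_cong[OF eq, of x] by simp
    thus "\<sigma> x = \<sigma>' x" by (rule injD[OF inj_G[OF \<tau>]])
  qed
  moreover have "(\<lambda>\<sigma>. \<tau> \<circ> \<sigma>) ` G \<subseteq> G" using comp_G[OF \<tau>] by auto
  ultimately show ?thesis using finG endo_inj_surj[of G] by (simp add: bij_betw_def)
qed

lemma G_bij_right: "\<tau> \<in> G \<Longrightarrow> bij_betw (\<lambda>\<sigma>. \<sigma> \<circ> \<tau>) G G"
proof -
  assume \<tau>: "\<tau> \<in> G"
  have "id \<in> (\<lambda>\<sigma>. \<tau> \<circ> \<sigma>) ` G" using G_bij[OF \<tau>] id_G by (simp add: bij_betw_def)
  then obtain \<rho> where \<rho>: "\<rho> \<in> G" "\<tau> \<circ> \<rho> = id" by auto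
  have inj: "inj_on (\<lambda>\<sigma>. \<sigma> \<circ> \<tau>) G"
  proof (rule inj_onI)
    fix \<sigma> \<sigma>' assume "\<sigma> \<circ> \<tau> = \<sigma>' \<circ> \<tau>"
    hence "\<sigma> \<circ> (\<tau> \<circ> \<rho>) = \<sigma>' \<circ> (\<tau> \<circ> \<rho>)" by (metis comp_assoc)
    thus "\<sigma> = \<sigma>'" using \<rho> by simp
  qed
  moreover have "(\<lambda>\<sigma>. \<sigma> \<circ> \<tau>) ` G \<subseteq> G" using comp_G[OF _ \<tau>] by auto
  ultimately show ?thesis using finG endo_inj_surj[of G] by (simp add: bij_betw_def)
qed

lemma G_inv: "\<tau> \<in> G \<Longrightarrow> \<exists>\<rho>\<in>G. \<forall>x. \<rho> (\<tau> x) = x"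
proof -
  assume \<tau>: "\<tau> \<in> G"
  have "id \<in> (\<lambda>\<sigma>. \<sigma> \<circ> \<tau>) ` G" using G_bij_right[OF \<tau>] id_G by (simp add: bij_betw_def)
  then obtain \<rho> where \<rho>: "\<rho> \<in> G" "id = \<rho> \<circ> \<tau>" by auto
  have "\<rho> (\<tau> x) = x" for x using fun_cong[OF \<rho>(2), of x] by simp
  thus ?thesis using \<rho>(1) by blast
qed

lemma int_of_fixed:
  assumes "x \<in> KZ" "\<And>\<sigma>. \<sigma> \<in> G \<Longrightarrow> \<sigma> x = x"
  shows "\<exists>k. x = of_int k"
proof -
  have "x \<in> \<rat>" using G_fixed[of x] assms KZ_K by blast
  hence "x \<in> \<int>" using alg_ints_rational KZ_A assms by blast
  thus ?thesis by (auto elim: Ints_cases)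
qed

text \<open>The norm of \<open>z\<close> is a nonzero integer, and it is divisible by each
  \<open>p\<close> whose chosen prime ideal contains \<open>z\<close>.\<close>

lemma eventually_notin_prime:
  assumes z: "z \<in> KZ" "z \<noteq> 0"
  shows "\<exists>p0. \<forall>p>p0. prime p \<longrightarrow> z \<notin> prime_over p"
proof -
  define N where "N = (\<Prod>\<sigma>\<in>G. \<sigma> z)"
  have mem: "\<sigma> z \<in> KZ" if "\<sigma> \<in> G" for \<sigma> using G_KZ that z by blast
  have "\<exists>k. N = of_int k"
  proof (rule int_of_fixed)
    show "N \<in> KZ" unfolding N_def by (intro KZ_prod mem)
    fix \<tau> assume \<tau>: "\<tau> \<in> G"
    have "\<tau> N = (\<Prod>\<sigma>\<in>G. (\<tau> \<circ> \<sigma>) z)" unfolding N_def using \<tau> mem KZ_K by (simp add: G_prod)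
    also have "\<dots> = N" unfolding N_def using prod.reindex_bij_betw[OF G_bij[OF \<tau>], of "\<lambda>\<sigma>. \<sigma> z"] by simp
    finally show "\<tau> N = N" .
  qed
  then obtain k where k: "N = of_int k" by blast
  have "\<sigma> z \<noteq> 0" if "\<sigma> \<in> G" for \<sigma> using inj_G[OF that] G_0[OF that] z(2) by (metis injD)
  hence "N \<noteq> 0" unfolding N_def using finG by simp
  hence k0: "k \<noteq> 0" using k by auto
  have "z \<notin> prime_over p" if p: "p > nat \<bar>k\<bar>" "prime p" for p
  proof
    assume zP: "z \<in> prime_over p"
    have "\<sigma> z \<in> alg_ints" if "\<sigma> \<in> G" for \<sigma> using mem that KZ_A by blast
    hence "N \<in> prime_over p" unfolding N_def using zP id_G by (subst po_prod[OF p(2) refl finG]) (auto intro!: bexI[of _ id])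
    hence "int p dvd k" using po_of_int[OF p(2) refl] k by simp
    hence "int p \<le> \<bar>k\<bar>" using dvd_imp_le_int[OF k0] by fastforce
    thus False using p by linarith
  qed
  thus ?thesis by blast
qed

section \<open>Polynomials attached to Galois-stable sets\<close>

definition stable :: "complex set \<Rightarrow> bool" where
  "stable W \<longleftrightarrow> finite W \<and> W \<subseteq> KZ \<and> (\<forall>\<sigma>\<in>G. \<forall>x\<in>W. \<sigma> x \<in> W)"

lemma stable_bij: "stable W \<Longrightarrow> \<sigma> \<in> G \<Longrightarrow> bij_betw \<sigma> W W"
proof -
  assume W: "stable W" and \<sigma>: "\<sigma> \<in> G"
  have "inj_on \<sigma> W" using inj_G[OF \<sigma>] inj_on_subset by blast
  thus ?thesis using W \<sigma> endo_inj_surj[of W \<sigma>] by (auto simp: stable_def bij_betw_def)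
qed

lemma stable_bij_minus: "stable W \<Longrightarrow> \<sigma> \<in> G \<Longrightarrow> x \<in> W \<Longrightarrow> bij_betw \<sigma> (W - {x}) (W - {\<sigma> x})"
  using stable_bij[of W \<sigma>] inj_on_image_set_diff[of \<sigma> W W "{x}"] by (auto simp: bij_betw_def inj_on_diff)

text \<open>\<open>Q\<close> and its conjugate under \<open>\<sigma>\<close> take the same values on
  \<open>W\<close>, because the values of \<open>Q\<close> are equivariant, and \<open>W\<close> has
  more points than their degrees. So integrality of interpolating polynomials can be checked on
  values.\<close>

lemma rational_coeffs:
  assumes W: "stable W" and Q: "Q \<in> polys_over K" "degree Q < card W"
    and eqv: "\<And>\<sigma> x. \<sigma> \<in> G \<Longrightarrow> x \<in> W \<Longrightarrow> poly Q (\<sigma> x) = \<sigma> (poly Q x)" and \<sigma>: "\<sigma> \<in> G"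
  shows "\<sigma> (coeff Q i) = coeff Q i"
proof -
  have "map_poly \<sigma> Q = Q"
  proof (rule poly_eq_on_card[of W])
    show "finite W" using W by (simp add: stable_def)
    show "degree Q < card W" by fact
    show "degree (map_poly \<sigma> Q) < card W" using Q(2) degree_map_poly_le[of \<sigma> Q] by simp
    fix y assume "y \<in> W"
    then obtain x where x: "x \<in> W" "y = \<sigma> x" using stable_bij[OF W \<sigma>] by (auto simp: bij_betw_def)
    have "x \<in> K" using x W KZ_K by (auto simp: stable_def)
    thus "poly (map_poly \<sigma> Q) y = poly Q y" using G_poly[OF \<sigma> Q(1)] eqv[OF \<sigma> x(1)] x by simp
  qed
  thus ?thesis using coeff_map_poly[of \<sigma> Q i] G_0[OF \<sigma>] by simp
qed

lemma int_coeffs: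
  assumes W: "stable W" and Q: "Q \<in> polys_over K" "Q \<in> polys_over alg_ints" "degree Q < card W"
    and eqv: "\<And>\<sigma> x. \<sigma> \<in> G \<Longrightarrow> x \<in> W \<Longrightarrow> poly Q (\<sigma> x) = \<sigma> (poly Q x)"
  shows "\<exists>q. Q = map_poly of_int q"
proof -
  have "\<exists>k. coeff Q i = of_int k" for i
  proof (rule int_of_fixed)
    show "coeff Q i \<in> KZ" using Q by (auto simp: polys_over_def KZ_def)
  qed (rule rational_coeffs[OF W Q(1,3) eqv])
  then obtain c where c: "\<And>i. coeff Q i = of_int (c i)" by metis
  define q where "q = Poly (map c [0..<Suc (degree Q)])"
  have "coeff q i = c i" for i
  proof (cases "i \<le> degree Q")
    case False
    hence "of_int (c i) = (0 :: complex)" using c[of i] coeff_eq_0[of Q i] by simp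
    thus ?thesis using False by (simp add: q_def nth_default_def)
  qed (simp add: q_def nth_default_def del: upt_Suc)
  hence "Q = map_poly of_int q" by (intro poly_eqI) (simp add: coeff_map_poly c)
  thus ?thesis by blast
qed

text \<open>Uniqueness of interpolation needs degree below \<open>n = card W\<close>, so the leading
  term is removed first: \<open>L - X ^ n\<close> takes the equivariant values
  \<open>- x ^ n\<close> on \<open>W\<close>.\<close>

lemma root_poly:
  assumes W: "stable W"
  shows "\<exists>q. (\<Prod>x\<in>W. [:- x, 1:]) = map_poly of_int q"
proof (cases "W = {}")
  case True
  thus ?thesis by (intro exI[of _ 1]) simp
next
  case False
  define L where "L = (\<Prod>x\<in>W. [:- x, 1:])"
  define n where "n = card W"
  have fin: "finite W" using W by (simp add: stable_def)
  have n: "n > 0" using False fin by (simp add: n_def card_gt_0_iff)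
  have dL: "degree L = n" unfolding L_def n_def by (subst degree_prod_eq_sum_degree) auto
  have "lead_coeff L = 1" unfolding L_def by (simp add: lead_coeff_prod del: degree_prod_eq_sum_degree) 
  hence lL: "coeff L n = 1" using dL by simp
  define Q where "Q = L - monom 1 n"
  have LK: "L \<in> polys_over K" "L \<in> polys_over alg_ints" unfolding L_def
    using W by (auto intro!: pv_prod pv_linear alg_polys_prod alg_polys_linear simp: stable_def KZ_def)
  have QK: "Q \<in> polys_over K" unfolding Q_def by (intro pv_diff LK pv_monom F_1)
  have QA: "Q \<in> polys_over alg_ints" using LK(2) by (auto simp: Q_def polys_over_def)
  have "degree Q < card W" unfolding n_def[symmetric]
  proof (rule degree_lessI)
    show "\<forall>k\<ge>n. coeff Q k = 0" using dL lL by (auto simp: Q_def coeff_eq_0 dest!: le_neq_implies_less)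
  qed (use n in simp)
  moreover have "poly Q (\<sigma> x) = \<sigma> (poly Q x)" if "\<sigma> \<in> G" "x \<in> W" for \<sigma> x
  proof -
    have Lv: "poly L y = 0" if "y \<in> W" for y using that fin by (auto simp: L_def poly_prod)
    have xK: "x \<in> K" "\<sigma> x \<in> W" using that W KZ_K by (auto simp: stable_def)
    have "\<sigma> (0 - x ^ n) = 0 - \<sigma> x ^ n" using that xK F_0 by (simp only: G_diff G_0 G_power F_power)
    thus ?thesis using Lv[OF that(2)] Lv[OF xK(2)] by (simp add: Q_def poly_monom)
  qed
  ultimately obtain q where q: "Q = map_poly of_int q" using int_coeffs[OF W QK QA] by blast
  have "L = map_poly of_int (q + monom 1 n)"
    using q by (intro poly_eqI) (auto simp: Q_def poly_eq_iff coeff_map_poly algebra_simps)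
  thus ?thesis unfolding L_def by blast
qed

definition rpoly :: "complex set \<Rightarrow> int poly" where
  "rpoly W = (SOME q. (\<Prod>x\<in>W. [:- x, 1:]) = map_poly of_int q)"

lemma rpoly: "stable W \<Longrightarrow> map_poly of_int (rpoly W) = (\<Prod>x\<in>W. [:- x, 1:])"
  using someI_ex[OF root_poly] by (simp add: rpoly_def)

lemma rpoly_eval: "stable W \<Longrightarrow> poly (map_poly of_int (rpoly W)) z = (\<Prod>x\<in>W. z - x)"
  by (simp add: rpoly poly_prod)

lemma rpoly_eval_int: "stable W \<Longrightarrow> of_int (poly (rpoly W) r) = (\<Prod>x\<in>W. of_int r - x)"
  using rpoly_eval[of W "of_int r"] by simp

lemma \<theta>_KZ: "\<theta> \<in> KZ" unfolding KZ_def using \<theta>_int \<theta>_prim qfield_gen[of \<theta>] by blast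

lemma stable_orbit: "x \<in> KZ \<Longrightarrow> stable ((\<lambda>\<sigma>. \<sigma> x) ` G)"
  using finG G_KZ comp_G unfolding stable_def by (auto simp: image_iff) (metis comp_apply)

text \<open>Modulo the prime, \<open>\<theta> ^ p\<close> is again a root of the integer polynomial
  whose roots are the conjugates of \<open>\<theta>\<close>, so it is congruent to one of
  them.\<close>

lemma ex_frob: "prime p \<Longrightarrow> \<exists>\<sigma>\<in>G. \<theta> ^ p - \<sigma> \<theta> \<in> prime_over p"
proof -
  assume p: "prime p"
  define W where "W = (\<lambda>\<sigma>. \<sigma> \<theta>) ` G"
  have W: "stable W" unfolding W_def by (rule stable_orbit[OF \<theta>_KZ])
  define q where "q = rpoly W"
  define m where "m = Suc (degree q)"
  have ev: "poly (map_poly of_int q) z = (\<Sum>i<m. of_int (coeff q i) * z ^ i)" for z :: complex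
    unfolding m_def lessThan_Suc_atMost by (simp add: poly_altdef coeff_map_poly degree_map_poly)
  have "\<theta> \<in> W" unfolding W_def using id_G by (metis id_apply image_eqI)
  hence "poly (map_poly of_int q) \<theta> = 0" using W by (auto simp: q_def rpoly_eval stable_def)
  hence "(0 :: complex) ^ p - (\<Sum>i<m. of_int (coeff q i) * (\<theta> ^ p) ^ i) \<in> prime_over p"
    using po_frobenius_poly[OF p refl \<theta>_int, where c = "coeff q" and n = m] by (simp add: ev)
  hence "- (poly (map_poly of_int q) (\<theta> ^ p)) \<in> prime_over p"
    using prime_gt_0_nat[OF p] by (simp add: ev zero_power)
  hence "poly (map_poly of_int q) (\<theta> ^ p) \<in> prime_over p" using po_minus[OF p refl] by fastforce
  hence "(\<Prod>x\<in>W. \<theta> ^ p - x) \<in> prime_over p" using W by (simp add: q_def rpoly_eval)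
  moreover have "\<theta> ^ p - x \<in> alg_ints" if "x \<in> W" for x using that W \<theta>_int by (auto simp: stable_def KZ_def)
  ultimately obtain x where "x \<in> W" "\<theta> ^ p - x \<in> prime_over p"
    using W by (subst (asm) po_prod[OF p refl]) (auto simp: stable_def)
  thus ?thesis by (auto simp: W_def)
qed

text \<open>At a prime where distinct conjugates of \<open>\<theta>\<close> are congruent several
  elements may qualify and an arbitrary one is taken; there are finitely many such primes, and
  limits do not see them.\<close>

definition frob :: "nat \<Rightarrow> complex \<Rightarrow> complex" where
  "frob p = (SOME \<sigma>. \<sigma> \<in> G \<and> \<theta> ^ p - \<sigma> \<theta> \<in> prime_over p)"

lemma frob: "prime p \<Longrightarrow> frob p \<in> G" "prime p \<Longrightarrow> \<theta> ^ p - frob p \<theta> \<in> prime_over p"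
  using someI_ex[of "\<lambda>\<sigma>. \<sigma> \<in> G \<and> \<theta> ^ p - \<sigma> \<theta> \<in> prime_over p"] ex_frob[of p] unfolding frob_def by blast+

text \<open>The definition of \<open>frob p\<close> concerns \<open>\<theta>\<close> only. A
  multiple \<open>d * x\<close> is an integer polynomial in \<open>\<theta>\<close>, to which the
  congruence extends, and \<open>d\<close> can be cancelled for \<open>p > d\<close>.\<close>

lemma frob_cong:
  assumes x: "x \<in> KZ"
  shows "\<exists>p0. \<forall>p>p0. prime p \<longrightarrow> x ^ p - frob p x \<in> prime_over p"
proof -
  obtain u where u: "x = rp u \<theta>" using KZ_K[OF x] \<theta>_prim by (auto simp: qfield_def)
  obtain d q where dq: "d > 0" "map_poly of_int q = smult (of_int d) u" using clear_denominators[of u] by blast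
  define m where "m = Suc (degree q)"
  define ip where "ip z = (\<Sum>i<m. of_int (coeff q i) * z ^ i)" for z :: complex
  have "of_int d * x = rp (smult (of_int d) u) \<theta>" by (simp add: u)
  also have "\<dots> = rp (map_poly of_int q) \<theta>" using dq by simp
  also have "\<dots> = poly (map_poly of_int q) \<theta>"
  proof -
    have "map_poly of_rat (map_poly of_int q :: rat poly) = (map_poly of_int q :: complex poly)"
      by (rule poly_eqI) (simp add: coeff_map_poly)
    thus ?thesis by (simp add: rp_def)
  qed
  also have "\<dots> = ip \<theta>" unfolding ip_def m_def lessThan_Suc_atMost by (simp add: poly_altdef coeff_map_poly degree_map_poly)
  finally have dx: "of_int d * x = ip \<theta>" .
  have "x ^ p - frob p x \<in> prime_over p" if p: "p > nat d" "prime p" for p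
  proof -
    note P = p(2) refl[of "prime_over p"]
    define P where "P = prime_over p"
    have \<sigma>: "frob p \<in> G" "\<theta> ^ p - frob p \<theta> \<in> P" using frob[OF p(2)] by (auto simp: P_def)
    have \<sigma>\<theta>: "frob p \<theta> \<in> alg_ints" using G_KZ[OF \<sigma>(1) \<theta>_KZ] KZ_A by blast
    have "ip \<theta> ^ p - ip (\<theta> ^ p) \<in> P" unfolding ip_def P_def by (rule po_frobenius_poly[OF p(2) refl \<theta>_int])
    moreover have "ip (\<theta> ^ p) - ip (frob p \<theta>) \<in> P"
    proof -
      have "ip (\<theta> ^ p) - ip (frob p \<theta>) = (\<Sum>i<m. of_int (coeff q i) * ((\<theta> ^ p) ^ i - frob p \<theta> ^ i))"
        by (simp add: ip_def sum_subtractf right_diff_distrib)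
      also have "\<dots> \<in> P" unfolding P_def using \<sigma> \<sigma>\<theta> \<theta>_int
        by (intro po_sum[OF p(2) refl] po_mult[OF p(2) refl] po_cong_power[OF p(2) refl]) (auto simp: P_def)
      finally show ?thesis .
    qed
    ultimately have "(ip \<theta> ^ p - ip (\<theta> ^ p)) + (ip (\<theta> ^ p) - ip (frob p \<theta>)) \<in> P"
      unfolding P_def by (rule po_add[OF p(2) refl])
    hence 1: "(of_int d * x) ^ p - ip (frob p \<theta>) \<in> P" by (simp add: dx)
    have "ip (frob p \<theta>) = frob p (ip \<theta>)"
      unfolding ip_def using \<sigma>(1) \<theta>_KZ KZ_K F_of_int by (simp add: G_sum G_mult G_power G_of_int F_mult F_power)
    also have "\<dots> = of_int d * frob p x" unfolding dx[symmetric] using \<sigma>(1) KZ_K[OF x] by (simp add: G_mult G_of_int F_of_int)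
    finally have 2: "of_int d ^ p * x ^ p - of_int d * frob p x \<in> P" using 1 by (simp add: power_mult_distrib)
    have "(of_int d ^ p - of_int d) * x ^ p \<in> P"
      unfolding P_def using x KZ_A by (intro po_mult2[OF p(2) refl] po_fermat[OF p(2) refl]) auto
    with 2 have "(of_int d ^ p * x ^ p - of_int d * frob p x) - (of_int d ^ p - of_int d) * x ^ p \<in> P"
      unfolding P_def by (rule po_diff[OF p(2) refl])
    hence "of_int d * (x ^ p - frob p x) \<in> P" by (simp add: algebra_simps)
    moreover have "x ^ p - frob p x \<in> alg_ints" using x G_KZ[OF \<sigma>(1) x] KZ_A by auto
    ultimately have "of_int d \<in> P \<or> x ^ p - frob p x \<in> P" unfolding P_def by (intro po_prime[OF p(2) refl]) auto
    moreover have "of_int d \<notin> P"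
    proof
      assume "of_int d \<in> P"
      hence "int p dvd d" using po_of_int[OF p(2) refl] by (simp add: P_def)
      thus False using zdvd_imp_le[of "int p" d] dq(1) p by linarith
    qed
    ultimately show ?thesis by (simp add: P_def)
  qed
  thus ?thesis by blast
qed

end

section \<open>Norm forms of Galois orbits\<close>

lemma po_ev_cong:
  assumes p: "prime p" and xy: "x \<in> alg_ints" "y \<in> alg_ints" "x - y \<in> prime_over p"
  shows "ev n a x - ev n a y \<in> prime_over p"
proof -
  have "ev n a x - ev n a y = (\<Sum>i<n. of_int (a i) * (x ^ i - y ^ i))"
    by (simp add: ev_def sum_subtractf right_diff_distrib)
  also have "\<dots> \<in> prime_over p"
    by (intro po_sum[OF p refl] po_mult[OF p refl] po_cong_power[OF p refl] xy) auto
  finally show ?thesis .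
qed

lemma ev_of_int: "ev n a (of_int r) = of_int (vdot n (\<lambda>j. r ^ j) a)"
  by (simp add: ev_def vdot_def)

lemma ev_diff: "ev n (\<lambda>j. a j - b j) x = ev n a x - ev n b x"
  by (simp add: ev_def sum_subtractf left_diff_distrib)

text \<open>Divisibility by \<open>p ^ 2\<close> up to a factor \<open>s\<close> outside the prime
  descends to the integers. The factors \<open>p\<close> are removed one at a time, each by
  primality of the ideal.\<close>

lemma dvd_of_unit_multiple:
  assumes p: "prime p" and s: "s \<in> alg_ints" "s \<notin> prime_over p" and t: "t \<in> alg_ints"
    and eq: "s * of_int k = of_nat p ^ 2 * t"
  shows "int p ^ 2 dvd k"
proof -
  note pp = p refl[of "prime_over p"]
  have p0: "of_nat p \<noteq> (0 :: complex)" using prime_gt_0_nat[OF p] by simp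
  have step: "int p dvd m" if "s * of_int m = of_nat p * t'" "t' \<in> alg_ints" for m t'
  proof -
    have "s * of_int m \<in> prime_over p"
      unfolding that(1) using that(2) prime_over_props(2)[OF p refl] by (intro po_mult2[OF p refl]) auto
    hence "of_int m \<in> prime_over p" using po_prime[OF p refl s(1) alg_ints_of_int] s(2) by blast
    thus ?thesis using po_of_int[OF p refl] by blast
  qed
  have "s * of_int k = of_nat p * (of_nat p * t)" using eq by (simp add: power2_eq_square mult.assoc)
  hence "int p dvd k" using t by (intro step[of k "of_nat p * t"]) auto
  then obtain k' where k': "k = int p * k'" by blast
  have "of_nat p * (s * of_int k') = of_nat p * (of_nat p * t)"
    using eq by (simp add: k' power2_eq_square mult_ac)
  hence "s * of_int k' = of_nat p * t" using p0 by simp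
  hence "int p dvd k'" using t by (rule step)
  thus ?thesis by (auto simp: k' power2_eq_square)
qed

context galois
begin

lemma ev_KZ: "x \<in> KZ \<Longrightarrow> ev n a x \<in> KZ"
  unfolding ev_def by (intro KZ_sum KZ_mult KZ_power KZ_of_int)

lemma G_ev: "\<sigma> \<in> G \<Longrightarrow> x \<in> KZ \<Longrightarrow> \<sigma> (ev n a x) = ev n a (\<sigma> x)"
  unfolding ev_def using KZ_K F_of_int by (simp add: G_sum G_mult G_power G_of_int F_mult F_power)

lemma invariant_prod_int:
  assumes W: "stable W" and v: "\<And>x. x \<in> W \<Longrightarrow> v x \<in> KZ"
    and eqv: "\<And>\<sigma> x. \<sigma> \<in> G \<Longrightarrow> x \<in> W \<Longrightarrow> \<sigma> (v x) = v (\<sigma> x)"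
  shows "\<exists>k. (\<Prod>x\<in>W. v x) = of_int k"
proof (rule int_of_fixed)
  show "(\<Prod>x\<in>W. v x) \<in> KZ" using v by (intro KZ_prod)
  fix \<sigma> assume \<sigma>: "\<sigma> \<in> G"
  have "\<sigma> (\<Prod>x\<in>W. v x) = (\<Prod>x\<in>W. v (\<sigma> x))" using \<sigma> v eqv KZ_K by (simp add: G_prod)
  also have "\<dots> = (\<Prod>x\<in>W. v x)" by (rule prod.reindex_bij_betw[OF stable_bij[OF W \<sigma>]])
  finally show "\<sigma> (\<Prod>x\<in>W. v x) = (\<Prod>x\<in>W. v x)" .
qed

definition nrmW :: "complex set \<Rightarrow> (nat \<Rightarrow> int) \<Rightarrow> int" where
  "nrmW W a = (SOME k. (\<Prod>x\<in>W. ev (card W) a x) = of_int k)"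

lemma nrmW: "stable W \<Longrightarrow> of_int (nrmW W a) = (\<Prod>x\<in>W. ev (card W) a x)"
proof -
  assume W: "stable W"
  have "\<exists>k. (\<Prod>x\<in>W. ev (card W) a x) = of_int k"
    using W by (intro invariant_prod_int) (auto simp: stable_def ev_KZ G_ev subset_iff)
  from someI_ex[OF this] show ?thesis by (simp add: nrmW_def)
qed

definition rootsW :: "complex set \<Rightarrow> nat \<Rightarrow> int set" where
  "rootsW W p = {r \<in> {0..<int p}. int p dvd poly (rpoly W) r}"

text \<open>Lagrange interpolation of the cofactors \<open>\<Prod>z\<in>W - {x}. ev n a z\<close> at the points of \<open>W\<close> gives an integer
  polynomial (up to the discriminant), all of whose coefficients are divisible by \<open>p\<close> if two conjugates
  of \<open>ev n a x\<close> lie in the prime above \<open>p\<close>; taking norms, the norm of \<open>a\<close> is divisible by \<open>p ^ 2\<close>.\<close>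

lemma two_conjugates_in_prime:
  assumes W: "stable W" and p: "prime p"
    and sep: "\<And>x y. x \<in> W \<Longrightarrow> y \<in> W \<Longrightarrow> x \<noteq> y \<Longrightarrow> x - y \<notin> prime_over p"
    and xy: "x0 \<in> W" "y0 \<in> W" "x0 \<noteq> y0"
    and xP: "ev (card W) a x0 \<in> prime_over p" and yP: "ev (card W) a y0 \<in> prime_over p"
  shows "int p ^ 2 dvd nrmW W a"
proof (rule ccontr)
  assume ndvd: "\<not> int p ^ 2 dvd nrmW W a"
  define n where "n = card W"
  define N where "N = nrmW W a"
  define P where "P = prime_over p"
  note pp = p P_def
  have fin: "finite W" and WK: "\<And>x. x \<in> W \<Longrightarrow> x \<in> KZ" and WG: "\<And>\<sigma> x. \<sigma> \<in> G \<Longrightarrow> x \<in> W \<Longrightarrow> \<sigma> x \<in> W"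
    using W by (auto simp: stable_def)
  define e where "e = ev n a"
  have eKZ: "e x \<in> KZ" if "x \<in> W" for x unfolding e_def by (intro ev_KZ WK that)
  have eG: "\<sigma> (e x) = e (\<sigma> x)" if "\<sigma> \<in> G" "x \<in> W" for \<sigma> x unfolding e_def using that by (intro G_ev WK)
  have N: "of_int N = (\<Prod>x\<in>W. e x)" using nrmW[OF W, of a] by (simp add: N_def e_def n_def)
  define cof where "cof x = (\<Prod>z\<in>W - {x}. e z)" for x
  \<comment> \<open>\<open>lx x\<close> is the derivative at \<open>x\<close> of the polynomial with
    root set \<open>W\<close>, and the product \<open>D\<close> of all of these is its discriminant
    up to sign. \<open>dx x\<close>, the cofactor of \<open>lx x\<close> in \<open>D\<close>, clears
    the denominators in the interpolation formula.\<close>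
  define lx where "lx x = (\<Prod>z\<in>W - {x}. x - z)" for x
  define dx where "dx x = (\<Prod>z\<in>W - {x}. lx z)" for x
  define L where "L x = (\<Prod>z\<in>W - {x}. [:- z, 1:])" for x
  have cofKZ: "cof x \<in> KZ" for x unfolding cof_def by (intro KZ_prod eKZ) auto
  have lxKZ: "lx x \<in> KZ" if "x \<in> W" for x unfolding lx_def using that WK by (intro KZ_prod KZ_diff) auto
  have dxKZ: "dx x \<in> KZ" for x unfolding dx_def by (intro KZ_prod lxKZ) auto
  have cofG: "\<sigma> (cof x) = cof (\<sigma> x)" if "\<sigma> \<in> G" "x \<in> W" for \<sigma> x
  proof -
    have "\<sigma> (cof x) = (\<Prod>z\<in>W - {x}. \<sigma> (e z))" unfolding cof_def using eKZ KZ_K by (intro G_prod[OF that(1)]) auto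
    also have "\<dots> = (\<Prod>z\<in>W - {x}. e (\<sigma> z))" using that by (intro prod.cong) (auto simp: eG)
    also have "\<dots> = cof (\<sigma> x)" unfolding cof_def by (rule prod.reindex_bij_betw[OF stable_bij_minus[OF W that]])
    finally show ?thesis .
  qed
  have lxG: "\<sigma> (lx x) = lx (\<sigma> x)" if "\<sigma> \<in> G" "x \<in> W" for \<sigma> x
  proof -
    have "\<sigma> (lx x) = (\<Prod>z\<in>W - {x}. \<sigma> (x - z))" unfolding lx_def using that KZ_K WK by (intro G_prod[OF that(1)] F_diff) auto
    also have "\<dots> = (\<Prod>z\<in>W - {x}. \<sigma> x - \<sigma> z)" using that KZ_K WK by (intro prod.cong) (auto simp: G_diff)
    also have "\<dots> = lx (\<sigma> x)" unfolding lx_def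
      by (rule prod.reindex_bij_betw[OF stable_bij_minus[OF W that], of "\<lambda>z. \<sigma> x - z"])
    finally show ?thesis .
  qed
  obtain D where D: "(\<Prod>x\<in>W. lx x) = of_int D" using invariant_prod_int[OF W lxKZ lxG] by blast
  have lxP: "lx x \<notin> P" if "x \<in> W" for x
    unfolding lx_def using sep[OF that] fin WK that KZ_A by (subst po_prod[OF pp]) (auto simp: P_def)
  have "of_int D \<notin> P" unfolding D[symmetric] using lxP fin lxKZ KZ_A by (subst po_prod[OF pp]) auto
  hence Dp: "\<not> int p dvd D" using po_of_int[OF pp] by blast
  have Dx: "lx x * dx x = of_int D" if "x \<in> W" for x
    unfolding dx_def D[symmetric] using prod.remove[OF fin that, of lx] by simp
  \<comment> \<open>\<open>D\<close> times the Lagrange interpolation polynomial with values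
    \<open>cof x\<close> on \<open>W\<close>.\<close>
  define U where "U = (\<Sum>x\<in>W. smult (cof x * dx x) (L x))"
  have UK: "U \<in> polys_over K"
  proof -
    have "L x \<in> polys_over K" for x unfolding L_def using WK KZ_K by (intro pv_prod pv_linear) auto
    thus ?thesis unfolding U_def using cofKZ dxKZ KZ_K
      by (auto simp: polys_over_def coeff_sum intro!: F_sum F_mult)
  qed
  have LA: "L x \<in> polys_over alg_ints" for x unfolding L_def using WK KZ_A by (intro alg_polys_prod alg_polys_linear) auto
  hence UA: "U \<in> polys_over alg_ints" unfolding U_def using cofKZ dxKZ KZ_A
      by (auto simp: polys_over_def coeff_sum intro!: alg_ints_sum alg_ints_mult)
  have n2: "n \<ge> 1" using xy(1) fin by (auto simp: n_def Suc_le_eq card_gt_0_iff)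
  have dL: "degree (L x) = n - 1" if "x \<in> W" for x
    unfolding L_def using that fin by (subst degree_prod_eq_sum_degree) (auto simp: n_def)
  have "degree U \<le> n - 1" unfolding U_def using dL fin by (intro degree_sum_le) (auto intro: order.trans[OF degree_smult_le])
  hence Udeg: "degree U < card W" using n2 unfolding n_def by linarith
  have Uv: "poly U x = cof x * of_int D" if x: "x \<in> W" for x
  proof -
    have "poly U x = (\<Sum>y\<in>W. cof y * dx y * (\<Prod>z\<in>W - {y}. x - z))"
      by (simp add: U_def L_def poly_sum poly_prod)
    also have "\<dots> = (\<Sum>y\<in>{x}. cof y * dx y * (\<Prod>z\<in>W - {y}. x - z))"
      using fin x by (intro sum.mono_neutral_right) auto
    also have "\<dots> = cof x * of_int D" using Dx[OF x] by (simp add: lx_def[symmetric] mult_ac)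
    finally show ?thesis .
  qed
  have "poly U (\<sigma> x) = \<sigma> (poly U x)" if "\<sigma> \<in> G" "x \<in> W" for \<sigma> x
    using that Uv WG cofG cofKZ[of x] KZ_K F_of_int by (simp add: G_mult G_of_int)
  then obtain u where u: "U = map_poly of_int u" using int_coeffs[OF W UK UA Udeg] by blast
  have cofP: "cof x \<in> P" if "x \<in> W" for x
  proof -
    have "\<exists>z\<in>W - {x}. e z \<in> P" using xy xP yP by (cases "x = x0") (auto simp: e_def n_def P_def)
    thus ?thesis unfolding cof_def using fin eKZ KZ_A by (subst po_prod[OF pp]) auto
  qed
  have "int p dvd coeff u i" for i
  proof -
    have "coeff U i = (\<Sum>x\<in>W. cof x * (dx x * coeff (L x) i))" by (simp add: U_def coeff_sum mult.assoc)
    also have "\<dots> \<in> P" using cofP dxKZ KZ_A LA by (intro po_sum[OF pp] po_mult2[OF pp]) (auto simp: polys_over_def)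
    finally show ?thesis using po_of_int[OF pp] by (simp add: u coeff_map_poly)
  qed
  hence "[:int p:] dvd u" by (simp add: const_poly_dvd_iff)
  then obtain w where w: "u = smult (int p) w" by (auto elim!: dvdE)
  define wv where "wv x = poly (map_poly of_int w) x" for x :: complex
  have UW: "poly U x = of_nat p * wv x" for x
  proof -
    have "U = smult (of_nat p) (map_poly of_int w)" unfolding u w by (rule poly_eqI) (simp add: coeff_map_poly)
    thus ?thesis by (simp add: wv_def)
  qed
  have wK: "map_poly of_int w \<in> polys_over K" by (auto simp: polys_over_def coeff_map_poly F_of_int)
  have "\<exists>k. (\<Prod>x\<in>W. wv x) = of_int k"
  proof (rule invariant_prod_int[OF W])
    fix x assume x: "x \<in> W"
    show "wv x \<in> KZ" unfolding wv_def poly_altdef using WK[OF x] by (intro KZ_sum KZ_mult KZ_power) (auto simp: coeff_map_poly KZ_of_int)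
    fix \<sigma> assume \<sigma>: "\<sigma> \<in> G"
    have "map_poly \<sigma> (map_poly of_int w) = map_poly of_int w"
      by (rule poly_eqI) (simp add: coeff_map_poly G_0[OF \<sigma>] G_of_int[OF \<sigma>])
    thus "\<sigma> (wv x) = wv (\<sigma> x)" unfolding wv_def using G_poly[OF \<sigma> wK KZ_K[OF WK[OF x]]] by simp
  qed
  then obtain k where k: "(\<Prod>x\<in>W. wv x) = of_int k" by blast
  \<comment> \<open>The product over \<open>W\<close> of the identities
    \<open>D * N = e x * poly U x\<close>. If \<open>p\<close> divided \<open>N\<close> exactly
    once, then, \<open>D\<close> being prime to \<open>p\<close>, the left side would contain
    exactly \<open>n\<close> factors \<open>p\<close>, whereas the right side is divisible by
    \<open>N * p ^ n\<close>.\<close>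
  have "of_int (D ^ n * N ^ n) = (\<Prod>x\<in>W. of_int D * (\<Prod>z\<in>W. e z))" by (simp add: N n_def power_mult_distrib)
  also have "\<dots> = (\<Prod>x\<in>W. e x * poly U x)"
  proof (rule prod.cong[OF refl])
    fix x assume x: "x \<in> W"
    show "of_int D * (\<Prod>z\<in>W. e z) = e x * poly U x"
      using prod.remove[OF fin x, of e] by (simp add: Uv[OF x] cof_def mult_ac)
  qed
  also have "\<dots> = (\<Prod>x\<in>W. e x) * (of_nat p ^ n * (\<Prod>x\<in>W. wv x))"
    by (simp add: UW prod.distrib n_def)
  also have "\<dots> = of_int (N * (int p ^ n * k))" by (simp add: N[symmetric] k)
  finally have eq: "D ^ n * N ^ n = N * (int p ^ n * k)" by (simp only: of_int_eq_iff)
  have "(\<Prod>x\<in>W. e x) \<in> P"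
    using xy(1) xP fin eKZ KZ_A by (subst po_prod[OF pp]) (auto simp: e_def n_def P_def)
  hence "int p dvd N" using po_of_int[OF pp] N[symmetric] by simp
  then obtain m where m: "N = int p * m" by blast
  have pm: "\<not> int p dvd m"
  proof
    assume "int p dvd m"
    hence "int p ^ 2 dvd N" by (auto simp: m power2_eq_square)
    thus False using ndvd by (simp add: N_def)
  qed
  have p0: "int p \<noteq> 0" using prime_gt_0_nat[OF p] by simp
  have "int p ^ n * (D ^ n * m ^ n) = int p ^ n * (int p * (m * k))"
    using eq by (simp add: m power_mult_distrib mult_ac)
  hence "D ^ n * m ^ n = int p * (m * k)" using p0 by simp
  hence "int p dvd D ^ n * m ^ n" by simp
  hence "int p dvd D \<or> int p dvd m"
    using p by (metis prime_dvd_mult_iff prime_dvd_power prime_nat_int_transfer)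
  thus False using Dp pm by blast
qed

text \<open>Beyond \<open>p0\<close>, a root \<open>r\<close> modulo \<open>p\<close> is congruent
  to exactly one \<open>x\<close> in \<open>W\<close>, which Frobenius fixes because
  \<open>r ^ p\<close> is congruent to \<open>r\<close>; conversely a fixed \<open>x\<close> is
  congruent to an integer. Under this correspondence divisibility of \<open>vdot\<close> at
  \<open>r\<close> means that \<open>ev n a x\<close> lies in the prime.\<close>

lemma norm_lattice_orbit:
  assumes W: "stable W" and W0: "W \<noteq> {}" and trans: "\<And>x y. x \<in> W \<Longrightarrow> y \<in> W \<Longrightarrow> \<exists>\<sigma>\<in>G. \<sigma> x = y"
    and good: "\<And>p x y. prime p \<Longrightarrow> p > p0 \<Longrightarrow> x \<in> W \<Longrightarrow> y \<in> W \<Longrightarrow> x \<noteq> y \<Longrightarrow> x - y \<notin> prime_over p"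
    and frobW: "\<And>p x. prime p \<Longrightarrow> p > p0 \<Longrightarrow> x \<in> W \<Longrightarrow> x ^ p - frob p x \<in> prime_over p"
  shows "norm_lattice (card W) W (nrmW W) (rootsW W) p0 (card W * card W + card W)"
    and "\<And>p. prime p \<Longrightarrow> p > p0 \<Longrightarrow> card (rootsW W p) = card {x \<in> W. frob p x = x}"
proof -
  define n where "n = card W"
  have fin: "finite W" and WK: "\<And>x. x \<in> W \<Longrightarrow> x \<in> KZ" and WG: "\<And>\<sigma> x. \<sigma> \<in> G \<Longrightarrow> x \<in> W \<Longrightarrow> \<sigma> x \<in> W"
    using W by (auto simp: stable_def)
  have WA: "\<And>x. x \<in> W \<Longrightarrow> x \<in> alg_ints" using WK KZ_A by blast
  have n0: "n > 0" using W0 fin by (simp add: n_def card_gt_0_iff)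
  have nrm: "of_int (nrmW W a) = (\<Prod>x\<in>W. ev n a x)" for a using nrmW[OF W] by (simp add: n_def)
  have evA: "ev n a x \<in> alg_ints" if "x \<in> W" for a x using ev_KZ WK that KZ_A by blast
  have nrm_dvd: "int p dvd nrmW W a \<longleftrightarrow> (\<exists>x\<in>W. ev n a x \<in> prime_over p)" if p: "prime p" for p a
    using po_prod[OF p refl fin, of "ev n a"] evA po_of_int[OF p refl, of "nrmW W a"] by (simp add: nrm)
  have root_iff: "int p dvd poly (rpoly W) r \<longleftrightarrow> (\<exists>x\<in>W. of_int r - x \<in> prime_over p)" if p: "prime p" for p r
    using po_prod[OF p refl fin, of "\<lambda>x. of_int r - x"] WA po_of_int[OF p refl, of "poly (rpoly W) r"]
    by (simp add: rpoly_eval_int[OF W] alg_ints_diff)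
  have rsub: "rootsW W p \<subseteq> {0..<int p}" for p by (auto simp: rootsW_def)
  have same_r: "r = r'" if p: "prime p" and r: "r \<in> {0..<int p}" "r' \<in> {0..<int p}"
    and x: "of_int r - x \<in> prime_over p" "of_int r' - x \<in> prime_over p" for p r r' x
  proof (rule ccontr)
    assume ne: "r \<noteq> r'"
    have "of_int (r - r') \<in> prime_over p" using po_diff[OF p refl x] by simp
    hence "int p dvd r - r'" using po_of_int[OF p refl] by blast
    thus False using dvd_imp_le_int[of "r - r'" "int p"] ne r by auto
  qed
  have "\<exists>x. x \<in> W \<and> of_int r - x \<in> prime_over p" if "prime p" "r \<in> rootsW W p" for p r
    using root_iff[OF that(1)] that(2) by (auto simp: rootsW_def)
  then obtain xr where xr: "\<And>p r. prime p \<Longrightarrow> r \<in> rootsW W p \<Longrightarrow> xr p r \<in> W \<and> of_int r - xr p r \<in> prime_over p" by metis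
  have xr_inj: "inj_on (xr p) (rootsW W p)" if p: "prime p" for p
  proof (rule inj_onI)
    fix r r' assume r: "r \<in> rootsW W p" "r' \<in> rootsW W p" and eq: "xr p r = xr p r'"
    have "of_int r - xr p r \<in> prime_over p" "of_int r' - xr p r \<in> prime_over p"
      using xr[OF p r(1)] xr[OF p r(2)] eq by simp_all
    thus "r = r'" using r rsub[of p] by (intro same_r[OF p, of r r' "xr p r"]) auto
  qed
  have hit: "int p dvd vdot n (\<lambda>j. r ^ j) a \<longleftrightarrow> ev n a x \<in> prime_over p"
    if p: "prime p" and x: "x \<in> W" "of_int r - x \<in> prime_over p" for p r x a
  proof -
    have c: "ev n a (of_int r) - ev n a x \<in> prime_over p" using x WA by (intro po_ev_cong[OF p]) auto
    have "int p dvd vdot n (\<lambda>j. r ^ j) a \<longleftrightarrow> ev n a (of_int r) \<in> prime_over p"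
      unfolding ev_of_int by (simp add: po_of_int[OF p refl])
    also have "\<dots> \<longleftrightarrow> ev n a x \<in> prime_over p"
    proof
      assume "ev n a (of_int r) \<in> prime_over p"
      from po_diff[OF p refl this c] show "ev n a x \<in> prime_over p" by simp
    next
      assume "ev n a x \<in> prime_over p"
      from po_add[OF p refl c this] show "ev n a (of_int r) \<in> prime_over p" by simp
    qed
    finally show ?thesis .
  qed
  have frob_root: "\<exists>r\<in>rootsW W p. of_int r - x \<in> prime_over p" if p: "prime p" "p > p0" and x: "x \<in> W" "frob p x = x" for p x
  proof -
    have "x ^ p - x \<in> prime_over p" using frobW[OF p x(1)] x(2) by simp
    then obtain r where r: "r \<in> {0..<int p}" "x - of_int r \<in> prime_over p"
      using po_fixed_imp_int[OF p(1) refl WA[OF x(1)]] by blast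
    have "of_int r - x \<in> prime_over p" using po_minus[OF p(1) refl r(2)] by simp
    moreover from this have "r \<in> rootsW W p" using root_iff[OF p(1)] r x by (auto simp: rootsW_def)
    ultimately show ?thesis by blast
  qed
  have root_frob: "frob p x = x" if p: "prime p" "p > p0" and x: "x \<in> W" "of_int r - x \<in> prime_over p" for p r x
  proof (rule ccontr)
    assume ne: "frob p x \<noteq> x"
    have fW: "frob p x \<in> W" using WG frob(1)[OF p(1)] x by blast
    have 1: "of_int r ^ p - x ^ p \<in> prime_over p" using x WA by (intro po_cong_power[OF p(1) refl]) auto
    have 2: "of_int r ^ p - of_int r \<in> prime_over p" by (rule po_fermat[OF p(1) refl])
    have "x ^ p - frob p x + (of_int r ^ p - x ^ p) \<in> prime_over p" using frobW[OF p x(1)] 1 by (rule po_add[OF p(1) refl])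
    from po_diff[OF p(1) refl this 2] have "of_int r - frob p x \<in> prime_over p" by simp
    from po_diff[OF p(1) refl this x(2)] have "x - frob p x \<in> prime_over p" by simp
    thus False using good[OF p x(1) fW] ne by auto
  qed
  show card_eq: "card (rootsW W p) = card {x \<in> W. frob p x = x}" if p: "prime p" "p > p0" for p
  proof (rule bij_betw_same_card[of "xr p"])
    have "xr p ` rootsW W p = {x \<in> W. frob p x = x}"
    proof (intro equalityI subsetI)
      fix x assume "x \<in> xr p ` rootsW W p"
      thus "x \<in> {x \<in> W. frob p x = x}" using xr[OF p(1)] root_frob[OF p] by auto
    next
      fix x assume x: "x \<in> {x \<in> W. frob p x = x}"
      then obtain r where r: "r \<in> rootsW W p" "of_int r - x \<in> prime_over p" using frob_root[OF p] by blast
      have "xr p r = x"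
      proof (rule ccontr)
        assume ne: "xr p r \<noteq> x"
        have "(of_int r - xr p r) - (of_int r - x) \<in> prime_over p" using xr[OF p(1) r(1)] r(2) by (rule po_diff[OF p(1) refl, OF conjunct2])
        thus False using good[OF p, of x "xr p r"] xr[OF p(1) r(1)] x ne by auto
      qed
      thus "x \<in> xr p ` rootsW W p" using r by blast
    qed
    thus "bij_betw (xr p) (rootsW W p) {x \<in> W. frob p x = x}" using xr_inj[OF p(1)] by (simp add: bij_betw_def)
  qed
  \<comment> \<open>If only one conjugate of the value lies in the prime, it follows that Frobenius
    fixes the corresponding \<open>x\<close>, and this yields the single root counted in
    \<open>Rt_count\<close>.\<close>
  have frob_hit: "ev n a (frob p x) \<in> prime_over p" if p: "prime p" "p > p0" and x: "x \<in> W" "ev n a x \<in> prime_over p" for p x a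
  proof -
    have fW: "frob p x \<in> W" using WG frob(1)[OF p(1)] x by blast
    have "ev n a x * ev n a x ^ (p - 1) \<in> prime_over p" using evA[OF x(1)] by (intro po_mult2[OF p(1) refl] x) auto
    hence 0: "ev n a x ^ p \<in> prime_over p" using prime_gt_0_nat[OF p(1)] by (cases p) auto
    have 1: "ev n a x ^ p - ev n a (x ^ p) \<in> prime_over p"
      unfolding ev_def by (rule po_frobenius_poly[OF p(1) refl WA[OF x(1)]])
    have 2: "ev n a (x ^ p) - ev n a (frob p x) \<in> prime_over p"
      using WA x fW frobW[OF p x(1)] by (intro po_ev_cong[OF p(1)]) auto
    from po_diff[OF p(1) refl 0 1] have "ev n a (x ^ p) \<in> prime_over p" by simp
    from po_diff[OF p(1) refl this 2] show ?thesis by simp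
  qed
  have two: "int p ^ 2 dvd nrmW W a"
    if "prime p" "p > p0" "x \<in> W" "y \<in> W" "x \<noteq> y" "ev n a x \<in> prime_over p" "ev n a y \<in> prime_over p" for p a x y
    using good[OF that(1,2)] that(6,7) unfolding n_def
    by (rule two_conjugates_in_prime[OF W that(1) _ that(3,4,5)])
  show "norm_lattice (card W) W (nrmW W) (rootsW W) p0 (card W * card W + card W)"
    unfolding n_def[symmetric]
  proof
    show "0 < n" "finite W" "card W = n" by (rule n0, rule fin, simp add: n_def)
    show "\<bar>real_of_int (nrmW W a)\<bar> = (\<Prod>x\<in>W. cmod (ev n a x))" for a
    proof -
      have "\<bar>real_of_int (nrmW W a)\<bar> = cmod (of_int (nrmW W a))" by simp
      thus ?thesis unfolding nrm by (simp add: prod_norm)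
    qed
    show "nrmW W a \<noteq> 0" if ne: "\<exists>j<n. a j \<noteq> 0" for a
    proof
      assume "nrmW W a = 0"
      hence "(\<Prod>x\<in>W. ev n a x) = 0" using nrm[of a] by simp
      then obtain x where x: "x \<in> W" "ev n a x = 0" using fin by auto
      have all: "ev n a y = 0" if y: "y \<in> W" for y
      proof -
        obtain \<sigma> where \<sigma>: "\<sigma> \<in> G" "\<sigma> x = y" using trans[OF x(1) y] by blast
        have "ev n a y = \<sigma> (ev n a x)" using G_ev[OF \<sigma>(1) WK[OF x(1)]] \<sigma>(2) by simp
        thus ?thesis using x G_0[OF \<sigma>(1)] by simp
      qed
      \<comment> \<open>By transitivity all conjugates of the value vanish, so \<open>Q\<close> has
        \<open>n\<close> roots although its degree is below \<open>n\<close>.\<close>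
      define Q where "Q = Poly (map (\<lambda>j. of_int (a j) :: complex) [0..<n])"
      have cQ: "coeff Q j = (if j < n then of_int (a j) else 0)" for j
        by (simp add: Q_def nth_default_def)
      have "degree Q < n" using cQ n0 by (intro degree_lessI) auto
      have Qv: "poly Q y = ev n a y" for y
      proof -
        have "poly Q y = (\<Sum>j\<le>degree Q. coeff Q j * y ^ j)" by (rule poly_altdef)
        also have "\<dots> = (\<Sum>j<n. coeff Q j * y ^ j)"
          using \<open>degree Q < n\<close> by (intro sum.mono_neutral_left) (auto intro: coeff_eq_0)
        finally show ?thesis by (simp add: ev_def cQ)
      qed
      have "Q = 0"
        using all Qv fin \<open>degree Q < n\<close> n0 by (intro poly_eq_on_card[of W]) (auto simp: n_def)
      hence "coeff Q j = 0" for j by simp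
      thus False using ne cQ by (metis of_int_eq_0_iff)
    qed
    show "rootsW W p \<subseteq> {0..<int p}" for p by (rule rsub)
    show "card (rootsW W p) \<le> n" if "prime p" "p0 < p" for p
      using card_eq[OF that] card_mono[OF fin, of "{x \<in> W. frob p x = x}"] by (simp add: n_def)
    show "int p dvd nrmW W a" if p: "prime p" "p0 < p" and r: "r \<in> rootsW W p" "int p dvd vdot n (\<lambda>j. r ^ j) a" for p r a
      using hit[OF p(1), of "xr p r" r a] xr[OF p(1) r(1)] r(2) nrm_dvd[OF p(1)] by blast
    show "card {r \<in> rootsW W p. int p dvd vdot n (\<lambda>j. r ^ j) a} = (if int p dvd nrmW W a then 1 else 0)"
      if p: "prime p" "p0 < p" and nz: "nrmW W a \<noteq> 0" and sq: "\<not> int p ^ 2 dvd nrmW W a" for p a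
    proof (cases "int p dvd nrmW W a")
      case False
      hence "{r \<in> rootsW W p. int p dvd vdot n (\<lambda>j. r ^ j) a} = {}"
        using hit[OF p(1)] xr[OF p(1)] nrm_dvd[OF p(1)] by blast
      thus ?thesis using False by (simp only: card.empty if_False)
    next
      case True
      then obtain x where x: "x \<in> W" "ev n a x \<in> prime_over p" using nrm_dvd[OF p(1)] by blast
      have uniq: "y = x" if "y \<in> W" "ev n a y \<in> prime_over p" for y using two[OF p that(1) x(1)] that x sq by blast
      have "frob p x = x" using uniq[OF WG[OF frob(1)[OF p(1)] x(1)] frob_hit[OF p x]] .
      then obtain r where r: "r \<in> rootsW W p" "of_int r - x \<in> prime_over p" using frob_root[OF p x(1)] by blast
      have "{r \<in> rootsW W p. int p dvd vdot n (\<lambda>j. r ^ j) a} = {r}"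
      proof (intro equalityI subsetI)
        fix s assume s: "s \<in> {r \<in> rootsW W p. int p dvd vdot n (\<lambda>j. r ^ j) a}"
        hence "xr p s = x" using hit[OF p(1)] xr[OF p(1)] by (intro uniq) blast+
        hence "s = r" using s r xr[OF p(1), of s] rsub[of p] by (intro same_r[OF p(1), of s r x]) auto
        thus "s \<in> {r}" by simp
      next
        fix s assume "s \<in> {r}"
        thus "s \<in> {r \<in> rootsW W p. int p dvd vdot n (\<lambda>j. r ^ j) a}" using r hit[OF p(1) x(1) r(2)] x(2) by simp
      qed
      thus ?thesis using True by simp
    qed
    show "\<exists>L :: (nat \<Rightarrow> int) set set. finite L \<and> card L \<le> n * n + n \<and>
          (\<forall>S\<in>L. (\<forall>a\<in>S. \<forall>b\<in>S. (\<lambda>j. a j - b j) \<in> S) \<and> (\<forall>a\<in>S. int p ^ 2 dvd nrmW W a)) \<and>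
          (\<forall>a. int p ^ 2 dvd nrmW W a \<longrightarrow> (\<exists>S\<in>L. a \<in> S))"
      if p: "prime p" "p0 < p" for p
    proof -
      define P where "P = prime_over p"
      \<comment> \<open>Here the name stands for a family of lattices, not for the sum over primes:
        the vectors whose value at \<open>x\<close> is divisible by \<open>p ^ 2\<close> up to a
        factor outside the prime. If \<open>p ^ 2\<close> divides the norm, then either two
        conjugates of the value lie in the prime, or one conjugate carries the whole square.\<close>
      define root_log_sum where "root_log_sum x = {a. \<exists>s\<in>alg_ints - P. \<exists>t\<in>alg_ints. s * ev n a x = of_nat p ^ 2 * t}" for x
      define S2 where "S2 = (\<lambda>(x, y). {a. ev n a x \<in> P \<and> ev n a y \<in> P})"
      define T where "T = {(x, y) \<in> W \<times> W. x \<noteq> y}"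
      have T: "finite T" "card T \<le> n * n"
        using fin card_mono[of "W \<times> W" T] by (auto simp: T_def n_def card_cartesian_product intro: finite_subset[of _ "W \<times> W"])
      define L where "L = root_log_sum ` W \<union> S2 ` T"
      have "card L \<le> card (S2 ` T) + card (root_log_sum ` W)" unfolding L_def by (metis card_Un_le add.commute)
      also have "\<dots> \<le> n * n + n" using card_image_le[OF T(1), of S2] card_image_le[OF fin, of root_log_sum] T(2) by (simp add: n_def)
      finally have cL: "card L \<le> n * n + n" .
      have S1diff: "(\<lambda>j. a j - b j) \<in> root_log_sum x" if a: "a \<in> root_log_sum x" and b: "b \<in> root_log_sum x" for a b x
      proof -
        obtain s t where "s \<in> alg_ints - P" "t \<in> alg_ints" "s * ev n a x = of_nat p ^ 2 * t"
          using a unfolding root_log_sum_def by blast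
        moreover obtain s' t' where "s' \<in> alg_ints - P" "t' \<in> alg_ints" "s' * ev n b x = of_nat p ^ 2 * t'"
          using b unfolding root_log_sum_def by blast
        ultimately have st: "s \<in> alg_ints - P" "t \<in> alg_ints" "s * ev n a x = of_nat p ^ 2 * t"
          "s' \<in> alg_ints - P" "t' \<in> alg_ints" "s' * ev n b x = of_nat p ^ 2 * t'" by auto
        have "(s * s') * ev n (\<lambda>j. a j - b j) x = s' * (s * ev n a x) - s * (s' * ev n b x)"
          by (simp add: ev_diff algebra_simps)
        also have "\<dots> = of_nat p ^ 2 * (s' * t - s * t')" using st by (simp add: algebra_simps)
        finally have eq: "(s * s') * ev n (\<lambda>j. a j - b j) x = of_nat p ^ 2 * (s' * t - s * t')" .
        moreover have "s * s' \<in> alg_ints - P" using st po_prime[OF p(1) P_def] by auto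
        moreover have "s' * t - s * t' \<in> alg_ints" using st by auto
        ultimately show ?thesis unfolding root_log_sum_def by blast
      qed
      have S1dvd: "int p ^ 2 dvd nrmW W a" if x: "x \<in> W" and a: "a \<in> root_log_sum x" for a x
      proof -
        obtain s t where st: "s \<in> alg_ints" "s \<notin> P" "t \<in> alg_ints" "s * ev n a x = of_nat p ^ 2 * t" using a unfolding root_log_sum_def by blast
        have "s * of_int (nrmW W a) = (s * ev n a x) * (\<Prod>z\<in>W - {x}. ev n a z)"
          unfolding nrm using prod.remove[OF fin x, of "ev n a"] by (simp add: mult.assoc)
        also have "\<dots> = of_nat p ^ 2 * (t * (\<Prod>z\<in>W - {x}. ev n a z))" using st by (simp add: mult.assoc)
        finally show ?thesis using st evA by (intro dvd_of_unit_multiple[OF p(1), of s "t * (\<Prod>z\<in>W - {x}. ev n a z)"]) (auto simp: P_def)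
      qed
      have "finite L" using fin T by (simp add: L_def)
      moreover have "(\<forall>a\<in>S. \<forall>b\<in>S. (\<lambda>j. a j - b j) \<in> S) \<and> (\<forall>a\<in>S. int p ^ 2 dvd nrmW W a)" if S: "S \<in> L" for S
      proof -
        consider x where "x \<in> W" "S = root_log_sum x" | x y where "x \<in> W" "y \<in> W" "x \<noteq> y" "S = S2 (x, y)"
          using S by (auto simp: L_def T_def)
        thus ?thesis
        proof cases
          case 1
          thus ?thesis using S1diff S1dvd by blast
        next
          case 2
          have "(\<lambda>j. a j - b j) \<in> S" if "a \<in> S" "b \<in> S" for a b
            using that unfolding 2(4) S2_def by (auto simp: ev_diff intro: po_diff[OF p(1) P_def])
          moreover have "int p ^ 2 dvd nrmW W a" if "a \<in> S" for a
            using that two[OF p 2(1,2,3)] unfolding 2(4) S2_def P_def by auto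
          ultimately show ?thesis by blast
        qed
      qed
      moreover have "\<exists>S\<in>L. a \<in> S" if d: "int p ^ 2 dvd nrmW W a" for a
      proof -
        have "int p dvd nrmW W a" using d by (metis dvd_power dvd_trans pos2)
        then obtain x where x: "x \<in> W" "ev n a x \<in> P" using nrm_dvd[OF p(1)] by (auto simp: P_def)
        show ?thesis
        proof (cases "\<exists>y\<in>W. y \<noteq> x \<and> ev n a y \<in> P")
          case True
          then obtain y where "y \<in> W" "y \<noteq> x" "ev n a y \<in> P" by blast
          hence "a \<in> S2 (x, y)" "(x, y) \<in> T" using x by (auto simp: S2_def T_def)
          thus ?thesis unfolding L_def by blast
        next
          case False
          define s where "s = (\<Prod>z\<in>W - {x}. ev n a z)"
          have "s \<in> alg_ints" unfolding s_def using evA by (intro alg_ints_prod) auto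
          moreover have "s \<notin> P" unfolding s_def using False evA fin by (subst po_prod[OF p(1) P_def]) auto
          moreover obtain k where "nrmW W a = int p ^ 2 * k" using d by blast
          hence "s * ev n a x = of_nat p ^ 2 * of_int k"
            using nrm[of a] prod.remove[OF fin x(1), of "ev n a"] by (simp add: s_def mult.commute)
          ultimately have "a \<in> root_log_sum x" unfolding root_log_sum_def by blast
          thus ?thesis using x unfolding L_def by blast
        qed
      qed
      ultimately show ?thesis using cL by blast
    qed
    show "\<not> int p dvd nrmW W (affv M b)" if p: "prime p" and M: "int p dvd M" for p M b
    proof
      assume "int p dvd nrmW W (affv M b)"
      then obtain x where x: "x \<in> W" "ev n (affv M b) x \<in> prime_over p" using nrm_dvd[OF p] by blast
      have "ev n (affv M b) x = 1 + of_int M * ev n b x"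
      proof -
        have "ev n (affv M b) x = (\<Sum>j<n. of_int (if j = 0 then 1 else 0) * x ^ j) + of_int M * ev n b x"
          by (simp add: ev_def affv_def distrib_right sum.distrib sum_distrib_left mult.assoc)
        also have "(\<Sum>j<n. of_int (if j = 0 then 1 else 0) * x ^ j) = (\<Sum>j\<in>{0}. of_int (if j = 0 then 1 else 0) * x ^ j)"
          using n0 by (intro sum.mono_neutral_right) auto
        finally show ?thesis by simp
      qed
      moreover have "of_int M * ev n b x \<in> prime_over p"
        using M po_of_int[OF p refl] evA[OF x(1)] by (intro po_mult2[OF p refl]) auto
      ultimately have "1 + of_int M * ev n b x - of_int M * ev n b x \<in> prime_over p"
        using x by (intro po_diff[OF p refl]) auto
      thus False using po_1[OF p refl] by simp
    qed
  qed
qed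

end

section \<open>Equidistribution of the fixed points of Frobenius elements\<close>

lemma finite_primes_upto [simp]: "finite {p :: nat. prime p \<and> p \<le> Y}"
  by (rule finite_subset[of _ "{..Y}"]) auto

lemma ln_nat_at_top: "filterlim (\<lambda>Y. ln (real Y)) at_top sequentially"
  by (intro filterlim_compose[OF ln_at_top] filterlim_real_sequentially)

lemma const_over_ln: "(\<lambda>Y. c / ln (real Y)) \<longlonglongrightarrow> 0"
  by (intro real_tendsto_divide_at_top[OF tendsto_const] ln_nat_at_top)

lemma psum_cong_large:
  assumes lim: "(\<lambda>Y. psum \<phi> Y / ln (real Y)) \<longlonglongrightarrow> l"
    and eq: "\<And>p. prime p \<Longrightarrow> p > p0 \<Longrightarrow> \<phi> p = \<psi> p"
  shows "(\<lambda>Y. psum \<psi> Y / ln (real Y)) \<longlonglongrightarrow> l"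
proof -
  define c where "c = psum \<psi> p0 - psum \<phi> p0"
  have "psum \<psi> Y - psum \<phi> Y = c" if "Y \<ge> p0" for Y
  proof -
    have "psum \<chi> Y = psum \<chi> p0 + (\<Sum>p | prime p \<and> p0 < p \<and> p \<le> Y. \<chi> p * ln (real p) / real p)" for \<chi> :: "nat \<Rightarrow> real"
    proof -
      have "{p. prime p \<and> p \<le> Y} = {p. prime p \<and> p \<le> p0} \<union> {p. prime p \<and> p0 < p \<and> p \<le> Y}" using that by auto
      thus ?thesis unfolding psum_def by (simp only:) (rule sum.union_disjoint, auto)
    qed
    moreover have "(\<Sum>p | prime p \<and> p0 < p \<and> p \<le> Y. \<phi> p * ln (real p) / real p) = (\<Sum>p | prime p \<and> p0 < p \<and> p \<le> Y. \<psi> p * ln (real p) / real p)"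
      using eq by (intro sum.cong) auto
    ultimately show ?thesis by (simp add: c_def)
  qed
  hence "eventually (\<lambda>Y. psum \<phi> Y / ln (real Y) + c / ln (real Y) = psum \<psi> Y / ln (real Y)) sequentially"
    unfolding eventually_sequentially by (intro exI[of _ p0]) (simp add: add_divide_distrib[symmetric] algebra_simps)
  moreover have "(\<lambda>Y. psum \<phi> Y / ln (real Y) + c / ln (real Y)) \<longlonglongrightarrow> l + 0"
    by (intro tendsto_add lim const_over_ln)
  ultimately show ?thesis using Lim_transform_eventually by force
qed

lemma psum_lincomb_lim:
  assumes "\<And>i. i \<in> I \<Longrightarrow> (\<lambda>Y. psum (\<phi> i) Y / ln (real Y)) \<longlonglongrightarrow> l i"
  shows "(\<lambda>Y. psum (\<lambda>p. \<Sum>i\<in>I. c i * \<phi> i p) Y / ln (real Y)) \<longlonglongrightarrow> (\<Sum>i\<in>I. c i * l i)"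
proof -
  have eq: "psum (\<lambda>p. \<Sum>i\<in>I. c i * \<phi> i p) Y / ln (real Y) = (\<Sum>i\<in>I. c i * (psum (\<phi> i) Y / ln (real Y)))" for Y
  proof -
    have "psum (\<lambda>p. \<Sum>i\<in>I. c i * \<phi> i p) Y = (\<Sum>p | prime p \<and> p \<le> Y. \<Sum>i\<in>I. c i * (\<phi> i p * ln (real p) / real p))"
      unfolding psum_def by (intro sum.cong) (auto simp: sum_distrib_right sum_divide_distrib mult.assoc)
    also have "\<dots> = (\<Sum>i\<in>I. \<Sum>p | prime p \<and> p \<le> Y. c i * (\<phi> i p * ln (real p) / real p))" by (rule sum.swap)
    finally show ?thesis by (simp add: psum_def sum_distrib_left sum_divide_distrib)
  qed
  show ?thesis unfolding eq by (intro tendsto_sum tendsto_mult tendsto_const assms)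
qed

lemma ln_over_id_antimono:
  assumes "3 \<le> N"
  shows "ln (real (Suc N)) / real (Suc N) \<le> ln (real N) / real N"
proof -
  have N: "real N \<ge> 3" using assms by simp
  have "real N * ln (1 + 1 / real N) \<le> real N * (1 / real N)"
    using N by (intro mult_left_mono ln_add_one_self_le_self) auto
  also have "\<dots> \<le> ln (real N)"
  proof -
    have "exp 1 \<le> (3 :: real)" by (rule exp_le)
    hence "exp 1 \<le> real N" using N by linarith
    thus ?thesis using N ln_ge_iff[of "real N" 1] by simp
  qed
  finally have "real N * ln (1 + 1 / real N) \<le> ln (real N)" .
  moreover have "ln (real (Suc N)) = ln (real N) + ln (1 + 1 / real N)"
  proof -
    have "real (Suc N) = real N * (1 + 1 / real N)" using N by (simp add: field_simps)
    moreover have "0 < 1 + 1 / real N" using N by (intro add_pos_nonneg) auto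
    ultimately show ?thesis using N by (subst ln_mult_pos[symmetric]) auto
  qed
  ultimately have "real N * ln (real (Suc N)) \<le> real (Suc N) * ln (real N)"
    by (simp add: algebra_simps)
  thus ?thesis using N by (simp add: field_simps)
qed

text \<open>Summation by parts transfers relative natural density \<open>0\<close> to the weights \<open>ln p / p\<close>.\<close>

lemma psum_density_zero:
  assumes one: "(\<lambda>Y. psum (\<lambda>_. 1) Y / ln (real Y)) \<longlonglongrightarrow> 1"
    and dens: "(\<lambda>N. real (card {p \<in> E. prime p \<and> p \<le> N}) / real (card {p. prime p \<and> p \<le> N})) \<longlonglongrightarrow> 0"
  shows "(\<lambda>Y. psum (\<lambda>p. if p \<in> E then 1 else 0) Y / ln (real Y)) \<longlonglongrightarrow> 0"
proof (rule tendstoI)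
  fix \<epsilon> :: real assume \<epsilon>: "\<epsilon> > 0"
  define \<delta> where "\<delta> = \<epsilon> / 4"
  have \<delta>: "\<delta> > 0" using \<epsilon> by (simp add: \<delta>_def)
  define \<chi> where "\<chi> p = (if p \<in> E then 1 else 0 :: real)" for p
  define \<pi>1 where "\<pi>1 N = real (card {p. prime p \<and> p \<le> N})" for N :: nat
  define e where "e N = real (card {p \<in> E. prime p \<and> p \<le> N})" for N :: nat
  have "eventually (\<lambda>N. dist (e N / \<pi>1 N) 0 < \<delta>) sequentially"
    using dens \<delta> unfolding e_def \<pi>1_def by (rule tendstoD)
  then obtain N1 where N1: "\<And>N. N \<ge> N1 \<Longrightarrow> dist (e N / \<pi>1 N) 0 < \<delta>" unfolding eventually_sequentially by blast
  \<comment> \<open>From \<open>3\<close> on the weights \<open>ln N / N\<close> decrease.\<close>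
  define N0 where "N0 = max 3 N1"
  have d: "e N \<le> \<delta> * \<pi>1 N" if "N \<ge> N0" for N
  proof -
    have "{p. prime p \<and> p \<le> N} \<noteq> {}" using that two_is_prime_nat unfolding N0_def by (auto intro!: exI[of _ 2])
    hence "\<pi>1 N > 0" unfolding \<pi>1_def by (simp add: card_gt_0_iff)
    moreover have "\<bar>e N / \<pi>1 N\<bar> < \<delta>" using N1[of N] that by (simp add: N0_def)
    ultimately show ?thesis by (simp add: abs_less_iff divide_less_eq)
  qed
  define w where "w N = ln (real N) / real N" for N :: nat
  \<comment> \<open>Nonnegative from \<open>N0\<close> on. Summation by parts against decreasing
    weights then bounds the weighted sum of \<open>\<delta> - \<chi>\<close> from below by a
    constant.\<close>
  define D where "D N = \<delta> * \<pi>1 N - e N" for N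
  have S: "psum (\<lambda>p. \<delta> - \<chi> p) Y = D Y * w Y + (\<Sum>N<Y. D N * (w N - w (Suc N)))" for Y
  proof (induction Y)
    case 0
    have "{p::nat. prime p \<and> p \<le> 0} = {}" by auto
    thus ?case by (simp add: psum_def w_def)
  next
    case (Suc Y)
    have ins: "{p. prime p \<and> p \<le> Suc Y} = (if prime (Suc Y) then insert (Suc Y) {p. prime p \<and> p \<le> Y} else {p. prime p \<and> p \<le> Y})"
      by (auto simp: le_Suc_eq)
    have insE: "{p \<in> E. prime p \<and> p \<le> Suc Y} = (if prime (Suc Y) \<and> Suc Y \<in> E then insert (Suc Y) {p \<in> E. prime p \<and> p \<le> Y} else {p \<in> E. prime p \<and> p \<le> Y})"
      by (auto simp: le_Suc_eq)
    have finE: "finite {p \<in> E. prime p \<and> p \<le> Y}" by (rule finite_subset[OF _ finite_primes_upto[of Y]]) auto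
    have DS: "D (Suc Y) = D Y + (if prime (Suc Y) then \<delta> - \<chi> (Suc Y) else 0)"
      unfolding D_def \<pi>1_def e_def ins insE using finE by (auto simp: \<chi>_def algebra_simps)
    have "psum (\<lambda>p. \<delta> - \<chi> p) (Suc Y) = psum (\<lambda>p. \<delta> - \<chi> p) Y + (if prime (Suc Y) then (\<delta> - \<chi> (Suc Y)) * w (Suc Y) else 0)"
      unfolding psum_def ins by (auto simp: w_def)
    also have "\<dots> = D Y * w Y + (\<Sum>N<Y. D N * (w N - w (Suc N))) + (D (Suc Y) - D Y) * w (Suc Y)"
      using Suc.IH DS by simp
    finally show ?case by (simp add: algebra_simps)
  qed
  define c where "c = \<bar>\<Sum>N<N0. D N * (w N - w (Suc N))\<bar>"
  have low: "psum (\<lambda>p. \<delta> - \<chi> p) Y \<ge> - c" if "Y \<ge> N0" for Y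
  proof -
    have spl: "{..<Y} = {..<N0} \<union> {N0..<Y}" using that by auto
    have "(\<Sum>N<Y. D N * (w N - w (Suc N))) = (\<Sum>N<N0. D N * (w N - w (Suc N))) + (\<Sum>N\<in>{N0..<Y}. D N * (w N - w (Suc N)))"
      unfolding spl by (rule sum.union_disjoint) auto
    moreover have "(\<Sum>N\<in>{N0..<Y}. D N * (w N - w (Suc N))) \<ge> 0"
      using d ln_over_id_antimono unfolding w_def D_def N0_def by (intro sum_nonneg mult_nonneg_nonneg) auto
    moreover have "D Y * w Y \<ge> 0" using d[OF that] that unfolding D_def w_def N0_def by (intro mult_nonneg_nonneg divide_nonneg_nonneg ln_ge_zero) auto
    ultimately show ?thesis unfolding S c_def by linarith
  qed
  have lin: "psum (\<lambda>p. \<delta> - \<chi> p) Y = \<delta> * psum (\<lambda>_. 1) Y - psum \<chi> Y" for Y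
    unfolding psum_def by (simp add: sum_subtractf left_diff_distrib diff_divide_distrib sum_distrib_left)
  have pos: "psum \<chi> Y \<ge> 0" for Y
    unfolding psum_def \<chi>_def by (intro sum_nonneg divide_nonneg_nonneg mult_nonneg_nonneg ln_ge_zero) (auto dest: prime_ge_1_nat)
  have "eventually (\<lambda>Y. dist (psum (\<lambda>_. 1) Y / ln (real Y)) 1 < 1) sequentially"
    using one by (rule tendstoD) simp
  moreover have "eventually (\<lambda>Y. max 1 (c / \<delta>) \<le> ln (real Y)) sequentially"
    using ln_nat_at_top by (simp only: filterlim_at_top)
  moreover have "eventually (\<lambda>Y. Y \<ge> N0) sequentially" by (rule eventually_ge_at_top)
  ultimately show "eventually (\<lambda>Y. dist (psum (\<lambda>p. if p \<in> E then 1 else 0) Y / ln (real Y)) 0 < \<epsilon>) sequentially"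
  proof eventually_elim
    case (elim Y)
    define l where "l = ln (real Y)"
    have l: "l \<ge> 1" "c \<le> \<delta> * l" using elim \<delta> by (auto simp: l_def field_simps)
    have "\<bar>psum (\<lambda>_. 1) Y / l - 1\<bar> < 1" using elim by (simp add: l_def dist_real_def)
    hence "psum (\<lambda>_. 1) Y / l < 2" by linarith
    hence "psum (\<lambda>_. 1) Y < 2 * l" using l by (simp add: divide_less_eq)
    hence "\<delta> * psum (\<lambda>_. 1) Y \<le> \<delta> * (2 * l)" using \<delta> by (intro mult_left_mono) auto
    moreover have "psum \<chi> Y \<le> \<delta> * psum (\<lambda>_. 1) Y + c" using low[of Y] elim lin[of Y] by simp
    ultimately have "psum \<chi> Y \<le> 3 * \<delta> * l" using l by linarith
    also have "\<dots> < \<epsilon> * l" using l \<epsilon> unfolding \<delta>_def by simp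
    finally have "psum \<chi> Y / l < \<epsilon>" using l by (simp add: divide_less_eq)
    thus ?case using pos[of Y] l by (simp add: l_def \<chi>_def[abs_def] abs_of_nonneg)
  qed
qed

context galois
begin

definition fixn :: "complex set \<Rightarrow> (complex \<Rightarrow> complex) \<Rightarrow> nat" where
  "fixn W \<sigma> = card {x \<in> W. \<sigma> x = x}"

text \<open>Burnside's lemma for a transitive action: the stabilizer of \<open>y = \<tau> x\<close>
  is a translate of the set of elements that carry \<open>x\<close> to \<open>y\<close>, and these
  sets partition \<open>G\<close>.\<close>

lemma orbit_count:
  assumes x: "x \<in> KZ"
  shows "(\<Sum>\<sigma>\<in>G. fixn ((\<lambda>\<sigma>. \<sigma> x) ` G) \<sigma>) = card G"
proof -
  define W where "W = (\<lambda>\<sigma>. \<sigma> x) ` G"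
  have finW: "finite W" using finG by (simp add: W_def)
  have "(\<Sum>\<sigma>\<in>G. fixn W \<sigma>) = (\<Sum>\<sigma>\<in>G. \<Sum>y\<in>W. if \<sigma> y = y then 1 else 0)"
    using finW by (simp add: fixn_def sum.If_cases Int_def)
  also have "\<dots> = (\<Sum>y\<in>W. \<Sum>\<sigma>\<in>G. if \<sigma> y = y then 1 else 0)" by (rule sum.swap)
  also have "\<dots> = (\<Sum>y\<in>W. card {\<sigma> \<in> G. \<sigma> x = y})"
  proof (rule sum.cong[OF refl])
    fix y assume "y \<in> W"
    then obtain \<tau> where \<tau>: "\<tau> \<in> G" "y = \<tau> x" by (auto simp: W_def)
    have "(\<Sum>\<sigma>\<in>G. if \<sigma> y = y then 1 else 0 :: nat) = (\<Sum>\<sigma>\<in>G. if (\<sigma> \<circ> \<tau>) x = y then 1 else 0)"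
      by (simp add: \<tau>)
    also have "\<dots> = (\<Sum>\<sigma>\<in>G. if \<sigma> x = y then 1 else 0)"
      by (rule sum.reindex_bij_betw[OF G_bij_right[OF \<tau>(1)], of "\<lambda>\<sigma>. if \<sigma> x = y then 1 else 0"])
    also have "\<dots> = card {\<sigma> \<in> G. \<sigma> x = y}" using finG by (simp add: sum.If_cases Int_def)
    finally show "(\<Sum>\<sigma>\<in>G. if \<sigma> y = y then 1 else 0) = card {\<sigma> \<in> G. \<sigma> x = y}" .
  qed
  also have "\<dots> = card G"
  proof -
    have "card (\<Union>y\<in>W. {\<sigma> \<in> G. \<sigma> x = y}) = (\<Sum>y\<in>W. card {\<sigma> \<in> G. \<sigma> x = y})"
      using finW finG by (intro card_UN_disjoint) auto
    moreover have "(\<Union>y\<in>W. {\<sigma> \<in> G. \<sigma> x = y}) = G" by (auto simp: W_def)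
    ultimately show ?thesis by simp
  qed
  finally show ?thesis by (simp add: W_def)
qed

text \<open>Beyond \<open>p0\<close> distinct points of the orbit are incongruent and the Frobenius
  congruence holds for each of them, so the orbit gives a norm lattice whose roots modulo
  \<open>p\<close> are counted by fixed points.\<close>

lemma orbit_equidist:
  assumes x: "x \<in> KZ"
  shows "(\<lambda>Y. psum (\<lambda>p. real (fixn ((\<lambda>\<sigma>. \<sigma> x) ` G) (frob p))) Y / ln (real Y)) \<longlonglongrightarrow> 1"
proof -
  define W where "W = (\<lambda>\<sigma>. \<sigma> x) ` G"
  have W: "stable W" unfolding W_def by (rule stable_orbit[OF x])
  have fin: "finite W" and WK: "\<And>y. y \<in> W \<Longrightarrow> y \<in> KZ" using W by (auto simp: stable_def)
  have ne: "W \<noteq> {}" using id_G by (auto simp: W_def)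
  have trans: "\<exists>\<sigma>\<in>G. \<sigma> y = z" if yz: "y \<in> W" "z \<in> W" for y z
  proof -
    obtain \<tau> \<rho> where \<tau>: "\<tau> \<in> G" "y = \<tau> x" "\<rho> \<in> G" "z = \<rho> x" using yz by (auto simp: W_def)
    obtain \<tau>' where "\<tau>' \<in> G" "\<forall>x. \<tau>' (\<tau> x) = x" using G_inv[OF \<tau>(1)] by blast
    thus ?thesis using \<tau> comp_G[of \<rho> \<tau>'] by (intro bexI[of _ "\<rho> \<circ> \<tau>'"]) auto
  qed
  have "\<exists>p0. \<forall>p>p0. prime p \<longrightarrow> y ^ p - frob p y \<in> prime_over p" if "y \<in> W" for y using frob_cong WK that by blast
  then obtain a where a: "\<And>y p. y \<in> W \<Longrightarrow> p > a y \<Longrightarrow> prime p \<Longrightarrow> y ^ p - frob p y \<in> prime_over p" by metis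
  have "\<exists>b. \<forall>yz\<in>{(y, z) \<in> W \<times> W. y \<noteq> z}. \<forall>p>b yz. prime p \<longrightarrow> fst yz - snd yz \<notin> prime_over p"
    using WK by (intro bchoice ballI eventually_notin_prime) (auto intro: KZ_diff)
  then obtain b where b: "\<forall>yz\<in>{(y, z) \<in> W \<times> W. y \<noteq> z}. \<forall>p>b yz. prime p \<longrightarrow> fst yz - snd yz \<notin> prime_over p"
    by (rule exE)
  define p0 where "p0 = Max (insert 0 (a ` W)) + Max (insert 0 (b ` (W \<times> W)))"
  have aM: "a y \<le> p0" if "y \<in> W" for y
  proof -
    have "a y \<le> Max (insert 0 (a ` W))" using that fin by (intro Max_ge) auto
    thus ?thesis unfolding p0_def by linarith
  qed
  have bM: "b (y, z) \<le> p0" if "y \<in> W" "z \<in> W" for y z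
  proof -
    have "b (y, z) \<le> Max (insert 0 (b ` (W \<times> W)))" using that fin by (intro Max_ge) auto
    thus ?thesis unfolding p0_def by linarith
  qed
  have good: "y - z \<notin> prime_over p" if p: "prime p" "p > p0" and yz: "y \<in> W" "z \<in> W" "y \<noteq> z" for p y z
  proof -
    have "(y, z) \<in> {(y, z) \<in> W \<times> W. y \<noteq> z}" "p > b (y, z)" using bM[OF yz(1,2)] p yz by auto
    thus ?thesis using b p(1) by fastforce
  qed
  have frobW: "y ^ p - frob p y \<in> prime_over p" if "prime p" "p > p0" "y \<in> W" for p y
    using a[of y p] aM[OF that(3)] that by simp
  interpret L: norm_lattice "card W" W "nrmW W" "rootsW W" p0 "card W * card W + card W"
    by (rule norm_lattice_orbit(1)[OF W ne trans good frobW])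
  have "real (card (rootsW W p)) = real (fixn W (frob p))" if "prime p" "p > p0" for p
    using norm_lattice_orbit(2)[OF W ne trans good frobW that] by (simp add: fixn_def)
  with L.psum_card_Rt_asymp show ?thesis unfolding W_def[symmetric] by (rule psum_cong_large)
qed

text \<open>Each orbit contributes \<open>1\<close> to both sides, by \<open>orbit_equidist\<close>
  and by Burnside's count; the orbits are removed one after the other.\<close>

theorem fix_equidist:
  assumes "stable W"
  shows "(\<lambda>Y. psum (\<lambda>p. real (fixn W (frob p))) Y / ln (real Y)) \<longlonglongrightarrow> (\<Sum>\<sigma>\<in>G. real (fixn W \<sigma>)) / real (card G)"
  using assms
proof (induction "card W" arbitrary: W rule: less_induct)
  case less
  show ?case
  proof (cases "W = {}")
    case True
    thus ?thesis by (simp add: fixn_def psum_def)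
  next
    case False
    then obtain x where x: "x \<in> W" by blast
    have fin: "finite W" and WK: "W \<subseteq> KZ" and WG: "\<And>\<sigma> y. \<sigma> \<in> G \<Longrightarrow> y \<in> W \<Longrightarrow> \<sigma> y \<in> W"
      using less.prems by (auto simp: stable_def)
    have xK: "x \<in> KZ" using x WK by blast
    define O1 where "O1 = (\<lambda>\<sigma>. \<sigma> x) ` G"
    have OW: "O1 \<subseteq> W" using WG x by (auto simp: O1_def)
    have xO: "x \<in> O1" unfolding O1_def using id_G by (metis id_apply image_eqI)
    have Og: "\<sigma> y \<in> O1 \<longleftrightarrow> y \<in> O1" if \<sigma>: "\<sigma> \<in> G" for \<sigma> y
    proof
      assume "\<sigma> y \<in> O1"
      then obtain \<tau> where \<tau>: "\<tau> \<in> G" "\<sigma> y = \<tau> x" by (auto simp: O1_def)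
      obtain \<rho> where \<rho>: "\<rho> \<in> G" "\<forall>x. \<rho> (\<sigma> x) = x" using G_inv[OF \<sigma>] by blast
      have "y = (\<rho> \<circ> \<tau>) x" using \<rho>(2) \<tau>(2) by (metis comp_apply)
      thus "y \<in> O1" unfolding O1_def using comp_G[OF \<rho>(1) \<tau>(1)] by blast
    next
      assume "y \<in> O1"
      thus "\<sigma> y \<in> O1" using stable_orbit[OF xK] \<sigma> by (auto simp: O1_def[symmetric] stable_def)
    qed
    have st: "stable (W - O1)" using fin WK WG Og by (auto simp: stable_def)
    have "card (W - O1) < card W" using fin xO x by (intro psubset_card_mono) auto
    note IH = less.hyps[OF this st]
    have fx: "fixn W \<sigma> = fixn O1 \<sigma> + fixn (W - O1) \<sigma>" for \<sigma>
    proof -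
      have "{x \<in> W. \<sigma> x = x} = {x \<in> O1. \<sigma> x = x} \<union> {x \<in> W - O1. \<sigma> x = x}" using OW by auto
      thus ?thesis unfolding fixn_def using fin finite_subset[OF OW fin]
        by (simp only:) (rule card_Un_disjoint, auto)
    qed
    have "psum (\<lambda>p. real (fixn W (frob p))) Y / ln (real Y) =
        psum (\<lambda>p. real (fixn O1 (frob p))) Y / ln (real Y) + psum (\<lambda>p. real (fixn (W - O1) (frob p))) Y / ln (real Y)" for Y
      unfolding psum_def fx by (simp add: distrib_right add_divide_distrib sum.distrib)
    moreover have "(\<Sum>\<sigma>\<in>G. real (fixn W \<sigma>)) / real (card G) = 1 + (\<Sum>\<sigma>\<in>G. real (fixn (W - O1) \<sigma>)) / real (card G)"
    proof -
      have "(\<Sum>\<sigma>\<in>G. real (fixn O1 \<sigma>)) = real (card G)" using orbit_count[OF xK] unfolding O1_def by (metis of_nat_sum)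
      moreover have "card G > 0" using finG id_G by (auto simp: card_gt_0_iff)
      ultimately show ?thesis unfolding fx by (simp add: sum.distrib add_divide_distrib)
    qed
    ultimately show ?thesis using tendsto_add[OF orbit_equidist[OF xK] IH] by (simp add: O1_def)
  qed
qed

text \<open>Two different tuples are identified only if \<open>b\<close> is a root of the nonzero
  polynomial formed from their difference, so finitely many integers are excluded.\<close>

lemma exists_separating_int:
  fixes T :: "(nat \<Rightarrow> complex) set"
  assumes "finite T" "\<And>s t. s \<in> T \<Longrightarrow> t \<in> T \<Longrightarrow> s \<noteq> t \<Longrightarrow> \<exists>j<k. s j \<noteq> t j"
  shows "\<exists>b :: int. inj_on (\<lambda>t. \<Sum>j<k. of_int b ^ j * t j) T"
proof -
  define Q where "Q = (\<lambda>(s, t). Poly (map (\<lambda>j. s j - t j :: complex) [0..<k]))"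
  have Qv: "poly (Q (s, t)) z = (\<Sum>j<k. z ^ j * s j) - (\<Sum>j<k. z ^ j * t j)" for s t z
  proof -
    have c: "coeff (Q (s, t)) j = (if j < k then s j - t j else 0)" for j by (simp add: Q_def nth_default_def)
    have "poly (Q (s, t)) z = (\<Sum>j\<le>max k (degree (Q (s, t))). coeff (Q (s, t)) j * z ^ j)"
      unfolding poly_altdef by (intro sum.mono_neutral_left) (auto intro: coeff_eq_0)
    also have "\<dots> = (\<Sum>j<k. coeff (Q (s, t)) j * z ^ j)"
      by (intro sum.mono_neutral_right) (auto simp: c)
    finally show ?thesis by (simp add: c sum_subtractf[symmetric] algebra_simps)
  qed
  define Z where "Z = (\<Union>st\<in>{(s, t) \<in> T \<times> T. s \<noteq> t}. {z. poly (Q st) z = 0})"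
  have "finite {z. poly (Q (s, t)) z = 0}" if "s \<in> T" "t \<in> T" "s \<noteq> t" for s t
  proof (rule poly_roots_finite)
    obtain j where j: "j < k" "s j \<noteq> t j" using assms(2) \<open>s \<in> T\<close> \<open>t \<in> T\<close> \<open>s \<noteq> t\<close> by blast
    hence "coeff (Q (s, t)) j \<noteq> 0" by (simp add: Q_def nth_default_def)
    thus "Q (s, t) \<noteq> 0" by auto
  qed
  moreover have "finite {(s, t) \<in> T \<times> T. s \<noteq> t}" by (rule finite_subset[of _ "T \<times> T"]) (use assms(1) in auto)
  ultimately have "finite Z" unfolding Z_def by auto
  moreover have "infinite (range (of_int :: int \<Rightarrow> complex))" by (simp add: finite_image_iff inj_def)
  ultimately have "\<exists>b :: int. of_int b \<notin> Z" by (metis finite_subset image_subsetI)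
  then obtain b :: int where b: "of_int b \<notin> Z" by blast
  have "inj_on (\<lambda>t. \<Sum>j<k. of_int b ^ j * t j) T"
  proof (rule inj_onI, rule ccontr)
    fix s t assume "s \<in> T" "t \<in> T" "(\<Sum>j<k. of_int b ^ j * s j) = (\<Sum>j<k. of_int b ^ j * t j)" "s \<noteq> t"
    hence "of_int b \<in> Z" unfolding Z_def by (auto intro!: bexI[of _ "(s, t)"] simp: Qv)
    thus False using b by simp
  qed
  thus ?thesis by blast
qed

text \<open>The tuples in \<open>W\<^sup>k\<close> are encoded by the numbers \<open>\<Sum>j<k. b ^ j * t j\<close> for a suitable integer \<open>b\<close>, which
  form a stable set on which \<open>\<sigma>\<close> has \<open>fixn W \<sigma> ^ k\<close> fixed points.\<close>

lemma moment_equidist: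
  assumes W: "stable W"
  shows "(\<lambda>Y. psum (\<lambda>p. real (fixn W (frob p)) ^ k) Y / ln (real Y)) \<longlonglongrightarrow> (\<Sum>\<sigma>\<in>G. real (fixn W \<sigma>) ^ k) / real (card G)"
proof -
  have fin: "finite W" and WK: "\<And>y. y \<in> W \<Longrightarrow> y \<in> KZ" and WG: "\<And>\<sigma> y. \<sigma> \<in> G \<Longrightarrow> y \<in> W \<Longrightarrow> \<sigma> y \<in> W"
    using W by (auto simp: stable_def)
  define T where "T = PiE {..<k} (\<lambda>_. W)"
  have finT: "finite T" unfolding T_def using fin by (intro finite_PiE) auto
  have Text: "s = t" if "s \<in> T" "t \<in> T" "\<And>j. j < k \<Longrightarrow> s j = t j" for s t
    using that unfolding T_def PiE_def by (intro extensionalityI[of s "{..<k}"]) simp_all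
  obtain b :: int where b: "inj_on (\<lambda>t. \<Sum>j<k. of_int b ^ j * t j) T"
    using exists_separating_int[OF finT, of k] Text by blast
  define v where "v t = (\<Sum>j<k. of_int b ^ j * t j)" for t :: "nat \<Rightarrow> complex"
  have TW: "t j \<in> W" if "t \<in> T" "j < k" for t j using that unfolding T_def by (auto dest: PiE_mem)
  have vinj: "inj_on v T" using b by (simp add: v_def[abs_def])
  define act where "act \<sigma> t = restrict (\<lambda>j. \<sigma> (t j)) {..<k}" for \<sigma> :: "complex \<Rightarrow> complex" and t
  have actT: "act \<sigma> t \<in> T" if "\<sigma> \<in> G" "t \<in> T" for \<sigma> t
    unfolding act_def T_def using WG TW that by auto
  have vact: "\<sigma> (v t) = v (act \<sigma> t)" if "\<sigma> \<in> G" "t \<in> T" for \<sigma> t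
  proof -
    have tK: "t j \<in> K" if "j < k" for j using TW[OF \<open>t \<in> T\<close> that] WK KZ_K by blast
    have "\<sigma> (v t) = (\<Sum>j<k. \<sigma> (of_int b ^ j * t j))" unfolding v_def
      using tK by (intro G_sum[OF that(1)] F_mult F_power F_of_int) auto
    also have "\<dots> = (\<Sum>j<k. of_int b ^ j * \<sigma> (t j))"
      using tK that(1) by (intro sum.cong) (auto simp: G_mult G_power G_of_int F_of_int F_power)
    finally show ?thesis by (simp add: v_def act_def)
  qed
  have st: "stable (v ` T)"
    unfolding stable_def
  proof (intro conjI ballI)
    show "finite (v ` T)" using finT by simp
    show "v ` T \<subseteq> KZ"
    proof (rule image_subsetI)
      fix t assume "t \<in> T"
      thus "v t \<in> KZ" unfolding v_def using WK TW by (intro KZ_sum KZ_mult KZ_power KZ_of_int) auto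
    qed
    fix \<sigma> y assume \<sigma>: "\<sigma> \<in> G" and "y \<in> v ` T"
    then obtain t where t: "t \<in> T" "y = v t" by blast
    show "\<sigma> y \<in> v ` T" unfolding t(2) vact[OF \<sigma> t(1)] by (intro imageI actT \<sigma> t)
  qed
  have fx: "fixn (v ` T) \<sigma> = fixn W \<sigma> ^ k" if \<sigma>: "\<sigma> \<in> G" for \<sigma>
  proof -
    have "{y \<in> v ` T. \<sigma> y = y} = v ` {t \<in> T. act \<sigma> t = t}"
      using vact[OF \<sigma>] actT[OF \<sigma>] inj_onD[OF vinj] by auto
    hence "fixn (v ` T) \<sigma> = card {t \<in> T. act \<sigma> t = t}"
      unfolding fixn_def using vinj by (simp add: card_image inj_on_subset)
    also have "{t \<in> T. act \<sigma> t = t} = PiE {..<k} (\<lambda>_. {x \<in> W. \<sigma> x = x})"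
    proof (intro equalityI subsetI)
      fix t assume t: "t \<in> {t \<in> T. act \<sigma> t = t}"
      have "\<sigma> (t j) = t j" if "j < k" for j
      proof -
        have "act \<sigma> t j = t j" using t by simp
        thus ?thesis using that by (simp add: act_def)
      qed
      thus "t \<in> PiE {..<k} (\<lambda>_. {x \<in> W. \<sigma> x = x})" using t unfolding T_def PiE_def by auto
    next
      fix t assume t: "t \<in> PiE {..<k} (\<lambda>_. {x \<in> W. \<sigma> x = x})"
      have tT: "t \<in> T" using t unfolding T_def PiE_def by auto
      have "act \<sigma> t = t" using t by (intro Text actT[OF \<sigma>] tT) (auto simp: act_def dest: PiE_mem)
      thus "t \<in> {t \<in> T. act \<sigma> t = t}" using tT by simp
    qed
    also have "card \<dots> = fixn W \<sigma> ^ k" by (simp add: card_PiE fixn_def)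
    finally show ?thesis .
  qed
  have "(\<Sum>\<sigma>\<in>G. real (fixn (v ` T) \<sigma>)) = (\<Sum>\<sigma>\<in>G. real (fixn W \<sigma>) ^ k)" using fx by (intro sum.cong) auto
  moreover have "real (fixn (v ` T) (frob p)) = real (fixn W (frob p)) ^ k" if "prime p" for p
    using fx[OF frob(1)[OF that]] by simp
  ultimately show ?thesis using psum_cong_large[OF fix_equidist[OF st], of 0 "\<lambda>p. real (fixn W (frob p)) ^ k"] by simp
qed

text \<open>On \<open>{0..d}\<close> the indicator of \<open>0\<close> is a polynomial, so its mean
  is a linear combination of the moments of the number of fixed points.\<close>

theorem fixed_point_free_density:
  assumes W: "stable W"
  shows "(\<lambda>Y. psum (\<lambda>p. if fixn W (frob p) = 0 then 1 else 0) Y / ln (real Y)) \<longlonglongrightarrow>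
    real (card {\<sigma> \<in> G. fixn W \<sigma> = 0}) / real (card G)"
proof -
  define d where "d = card W"
  have fin: "finite W" using W by (simp add: stable_def)
  define Q where "Q = (\<Prod>i\<in>{1..d}. [:1, - 1 / real i:])"
  have Qv: "poly Q (real m) = (if m = 0 then 1 else 0)" if "m \<le> d" for m
  proof (cases "m = 0")
    case False
    hence "poly Q (real m) = 0" unfolding Q_def poly_prod using that by (intro prod_zero) (auto intro!: bexI[of _ m])
    thus ?thesis using False by simp
  qed (simp add: Q_def poly_prod)
  have fd: "fixn W \<sigma> \<le> d" for \<sigma> unfolding fixn_def d_def using fin by (intro card_mono) auto
  have ind: "(if fixn W \<sigma> = 0 then 1 else 0) = (\<Sum>k\<le>degree Q. coeff Q k * real (fixn W \<sigma>) ^ k)" for \<sigma>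
    using Qv[OF fd, of \<sigma>] by (simp add: poly_altdef)
  have "(\<lambda>Y. psum (\<lambda>p. \<Sum>k\<le>degree Q. coeff Q k * real (fixn W (frob p)) ^ k) Y / ln (real Y)) \<longlonglongrightarrow>
      (\<Sum>k\<le>degree Q. coeff Q k * ((\<Sum>\<sigma>\<in>G. real (fixn W \<sigma>) ^ k) / real (card G)))"
    by (intro psum_lincomb_lim moment_equidist W)
  moreover have "(\<Sum>k\<le>degree Q. coeff Q k * ((\<Sum>\<sigma>\<in>G. real (fixn W \<sigma>) ^ k) / real (card G))) =
      (\<Sum>\<sigma>\<in>G. \<Sum>k\<le>degree Q. coeff Q k * real (fixn W \<sigma>) ^ k) / real (card G)"
    by (subst sum.swap) (simp add: sum_distrib_left sum_divide_distrib)
  moreover have "(\<Sum>\<sigma>\<in>G. \<Sum>k\<le>degree Q. coeff Q k * real (fixn W \<sigma>) ^ k) = real (card {\<sigma> \<in> G. fixn W \<sigma> = 0})"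
    unfolding ind[symmetric] using finG by (simp add: sum.If_cases Int_def)
  ultimately show ?thesis unfolding ind by simp
qed

text \<open>The orbit of \<open>0\<close> is a single point, which every Frobenius element
  fixes.\<close>

lemma psum_one: "(\<lambda>Y. psum (\<lambda>_. 1) Y / ln (real Y)) \<longlonglongrightarrow> 1"
proof -
  have img: "(\<lambda>\<sigma>. \<sigma> 0) ` G = {0}" using G_0 id_G by (auto simp: image_iff intro!: bexI[of _ id])
  have one: "real (fixn {0} (frob p)) = 1" if "prime p" for p
  proof -
    have "{x \<in> {0}. frob p x = x} = {0}" using G_0[OF frob(1)[OF that]] by auto
    thus ?thesis by (simp add: fixn_def)
  qed
  show ?thesis by (rule psum_cong_large[OF orbit_equidist[OF KZ_0, unfolded img], of 0]) (rule one)
qed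

end

section \<open>Points over the completions of the rationals\<close>

lemma (in ring_hom_cring) hom_add_pow_int:
  assumes "x \<in> carrier R"
  shows "h ([(k :: int)] \<cdot> x) = [k] \<cdot>\<^bsub>S\<^esub> h x"
proof -
  have "h \<in> hom (add_monoid R) (add_monoid S)" by (auto simp: hom_def)
  from hom_int_pow[OF this _ R.a_group S.a_group, of x k] show ?thesis
    using assms by (simp add: add_pow_def)
qed

lemma (in ring_hom_cring) eval_int_poly_hom:
  assumes x: "x \<in> carrier R"
  shows "h (eval_int_poly R f x) = eval_int_poly S f (h x)"
proof -
  have "h (eval_int_poly R f x) = (\<Oplus>\<^bsub>S\<^esub>i\<in>{..Polynomial.degree f}. (h \<circ> (\<lambda>i. [Polynomial.coeff f i] \<cdot>\<^bsub>R\<^esub> (x [^]\<^bsub>R\<^esub> i))) i)"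
    unfolding eval_int_poly_def using x by (intro hom_finsum) auto
  also have "\<dots> = eval_int_poly S f (h x)"
    unfolding eval_int_poly_def using x by (intro S.finsum_cong') (auto simp: hom_add_pow_int ring.hom_nat_pow)
  finally show ?thesis .
qed

lemma (in cring) eval_int_poly_closed [simp, intro]:
  "x \<in> carrier R \<Longrightarrow> eval_int_poly R f x \<in> carrier R"
  unfolding eval_int_poly_def by (intro finsum_closed) auto

text \<open>Serves twice: for the real points, and for the rational entries of Cauchy
  sequences.\<close>

lemma type_algebra_simps:
  defines "K \<equiv> ring_of_type_algebra :: 'a :: comm_ring_1 ring"
  shows "carrier K = UNIV" "x \<otimes>\<^bsub>K\<^esub> y = x * y" "x \<oplus>\<^bsub>K\<^esub> y = x + y" "\<zero>\<^bsub>K\<^esub> = 0" "\<one>\<^bsub>K\<^esub> = 1"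
    "x [^]\<^bsub>K\<^esub> (n :: nat) = x ^ n" "[k] \<cdot>\<^bsub>K\<^esub> x = of_int k * x" "eval_int_poly K f x = poly (map_poly of_int f) x"
proof -
  interpret cring K unfolding K_def by (rule cring_from_type_algebra)
  note K = K_def ring_of_type_algebra_def
  show 1: "carrier K = UNIV" "x \<otimes>\<^bsub>K\<^esub> y = x * y" "x \<oplus>\<^bsub>K\<^esub> y = x + y" "\<zero>\<^bsub>K\<^esub> = 0" "\<one>\<^bsub>K\<^esub> = 1" for x y
    by (simp_all add: K)
  show pow: "x [^]\<^bsub>K\<^esub> (n :: nat) = x ^ n" for x n
    by (induction n) (simp_all add: 1 mult.commute)
  have nat: "[int m] \<cdot>\<^bsub>K\<^esub> x = of_nat m * x" for m x
  proof -
    have "[m] \<cdot>\<^bsub>K\<^esub> x = of_nat m * x"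
      by (induction m) (simp_all add: 1 algebra_simps)
    thus ?thesis by (simp add: add_pow_def int_pow_int)
  qed
  have minus: "\<ominus>\<^bsub>K\<^esub> y = - y" for y
    by (rule minus_equality) (simp_all add: 1)
  show smul: "[k] \<cdot>\<^bsub>K\<^esub> x = of_int k * x" for k x
  proof (cases "k \<ge> 0")
    case True
    thus ?thesis using nat[of "nat k" x] by simp
  next
    case False
    have "[k] \<cdot>\<^bsub>K\<^esub> x = \<ominus>\<^bsub>K\<^esub> ([(- k)] \<cdot>\<^bsub>K\<^esub> x)"
      using add.int_pow_neg[of x "- k"] by (simp add: 1)
    thus ?thesis using nat[of "nat (- k)" x] False by (simp add: minus)
  qed
  have fin: "(\<Oplus>\<^bsub>K\<^esub>i\<in>A. g i) = sum g A" for g :: "nat \<Rightarrow> 'a" and A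
    by (induction A rule: infinite_finite_induct) (simp_all add: 1)
  show "eval_int_poly K f x = poly (map_poly of_int f) x"
    unfolding eval_int_poly_def fin smul pow poly_altdef
  proof (rule sum.mono_neutral_cong_right)
    show "\<forall>i\<in>{..Polynomial.degree f} - {..Polynomial.degree (map_poly of_int f :: 'a poly)}. of_int (Polynomial.coeff f i) * x ^ i = 0"
    proof
      fix i assume "i \<in> {..Polynomial.degree f} - {..Polynomial.degree (map_poly of_int f :: 'a poly)}"
      hence "Polynomial.coeff (map_poly of_int f :: 'a poly) i = 0" by (intro coeff_eq_0) auto
      thus "of_int (Polynomial.coeff f i) * x ^ i = 0" by (simp add: coeff_map_poly)
    qed
  qed (auto simp: coeff_map_poly degree_map_poly_le)
qed

section \<open>The ring of Cauchy sequences for the p-adic absolute value\<close>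

context
  fixes p :: nat
  assumes p: "prime p"
begin

lemma prime_int_p: "prime (int p)" using p by simp

lemma padic_abs_0 [simp]: "padic_abs p 0 = 0"
  by (simp add: padic_abs_def)

text \<open>The absolute value is defined on reduced fractions; being free to use any fraction turns
  multiplicativity and the ultrametric inequality into statements about multiplicities.\<close>

lemma padic_abs_divide:
  assumes "a \<noteq> 0" "b \<noteq> 0"
  shows "padic_abs p (rat_of_int a / rat_of_int b) =
    real p powi (int (multiplicity (int p) b) - int (multiplicity (int p) a))"
proof -
  obtain c d where cd: "quotient_of (rat_of_int a / rat_of_int b) = (c, d)" by fastforce
  have d0: "d \<noteq> 0" using quotient_of_denom_pos[OF cd] by simp
  have eq: "rat_of_int a / rat_of_int b = rat_of_int c / rat_of_int d" by (rule quotient_of_div[OF cd])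
  hence "rat_of_int (a * d) = rat_of_int (c * b)" using assms d0 by (simp add: field_simps)
  hence e: "a * d = c * b" by (simp only: of_int_eq_iff)
  hence c0: "c \<noteq> 0" using assms d0 by auto
  have "multiplicity (int p) (a * d) = multiplicity (int p) (c * b)" by (simp only: e)
  hence "multiplicity (int p) a + multiplicity (int p) d = multiplicity (int p) c + multiplicity (int p) b"
    using prime_int_p assms c0 d0 by (simp add: prime_elem_multiplicity_mult_distrib)
  thus ?thesis using assms by (simp add: padic_abs_def cd) (rule arg_cong[of _ _ "\<lambda>z. real p powi z"], linarith)
qed

lemma rat_int_fraction: obtains a b where "q = rat_of_int a / rat_of_int b" "b \<noteq> 0"
  using quotient_of_div[of q] quotient_of_denom_pos[of q] by (metis less_irrefl prod.exhaust)

lemma padic_abs_nonneg [simp]: "padic_abs p q \<ge> 0"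
  by (simp add: padic_abs_def)

lemma padic_abs_mult: "padic_abs p (x * y) = padic_abs p x * padic_abs p y"
proof (cases "x = 0 \<or> y = 0")
  case True
  thus ?thesis by auto
next
  case False
  obtain a b where x: "x = rat_of_int a / rat_of_int b" "b \<noteq> 0" by (rule rat_int_fraction)
  obtain c d where y: "y = rat_of_int c / rat_of_int d" "d \<noteq> 0" by (rule rat_int_fraction)
  have ac: "a \<noteq> 0" "c \<noteq> 0" using False x y by auto
  have xy: "x * y = rat_of_int (a * c) / rat_of_int (b * d)" by (simp add: x y)
  have ac': "a * c \<noteq> 0" "b * d \<noteq> 0" using x y ac by auto
  have "padic_abs p (x * y) = real p powi (int (multiplicity (int p) (b * d)) - int (multiplicity (int p) (a * c)))"
    unfolding xy by (rule padic_abs_divide[OF ac'])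
  also have "\<dots> = real p powi ((int (multiplicity (int p) b) - int (multiplicity (int p) a)) +
      (int (multiplicity (int p) d) - int (multiplicity (int p) c)))"
    using prime_int_p x y ac by (simp add: prime_elem_multiplicity_mult_distrib algebra_simps)
  also have "\<dots> = padic_abs p x * padic_abs p y"
    using p x y ac prime_gt_0_nat[OF p] by (simp add: padic_abs_divide power_int_add)
  finally show ?thesis .
qed

lemma padic_abs_uminus: "padic_abs p (- x) = padic_abs p x"
proof -
  have "padic_abs p (- 1) = 1" using padic_abs_divide[of "-1" 1] by simp
  thus ?thesis using padic_abs_mult[of "- 1" x] by simp
qed

lemma padic_abs_add: "padic_abs p (x + y) \<le> max (padic_abs p x) (padic_abs p y)"
proof (cases "x = 0 \<or> y = 0 \<or> x + y = 0")
  case True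
  thus ?thesis by (auto simp: le_max_iff_disj)
next
  case False
  obtain a b where x: "x = rat_of_int a / rat_of_int b" "b \<noteq> 0" by (rule rat_int_fraction)
  obtain c d where y: "y = rat_of_int c / rat_of_int d" "d \<noteq> 0" by (rule rat_int_fraction)
  define A C where "A = a * d" and "C = c * b"
  have x': "x = rat_of_int A / rat_of_int (b * d)" and y': "y = rat_of_int C / rat_of_int (b * d)"
    using x y by (simp_all add: A_def C_def)
  have bd: "b * d \<noteq> 0" using x y by simp
  have s: "x + y = rat_of_int (A + C) / rat_of_int (b * d)" by (simp add: x' y' add_divide_distrib)
  have n: "A \<noteq> 0" "C \<noteq> 0" "A + C \<noteq> 0" using False x' y' s by (auto simp del: of_int_add)
  define k where "k = min (multiplicity (int p) A) (multiplicity (int p) C)"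
  have "int p ^ k dvd A" "int p ^ k dvd C" by (auto simp: k_def intro: multiplicity_dvd')
  hence "int p ^ k dvd A + C" by (rule dvd_add)
  hence k: "k \<le> multiplicity (int p) (A + C)"
    using n prime_int_p by (intro multiplicity_geI) auto
  have p1: "real p \<ge> 1" using prime_gt_0_nat[OF p] by simp
  have "real p powi (int (multiplicity (int p) (b * d)) - int (multiplicity (int p) (A + C))) \<le>
      real p powi (int (multiplicity (int p) (b * d)) - int k)"
    using k p1 by (intro power_int_increasing) auto
  moreover have "padic_abs p (x + y) = real p powi (int (multiplicity (int p) (b * d)) - int (multiplicity (int p) (A + C)))"
    unfolding s by (rule padic_abs_divide[OF n(3) bd])
  moreover have "padic_abs p x = real p powi (int (multiplicity (int p) (b * d)) - int (multiplicity (int p) A))"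
    unfolding x' by (rule padic_abs_divide[OF n(1) bd])
  moreover have "padic_abs p y = real p powi (int (multiplicity (int p) (b * d)) - int (multiplicity (int p) C))"
    unfolding y' by (rule padic_abs_divide[OF n(2) bd])
  ultimately show ?thesis unfolding k_def min_def by (auto simp: le_max_iff_disj split: if_splits)
qed

lemma padic_abs_diff: "padic_abs p (x - y) \<le> max (padic_abs p x) (padic_abs p y)"
  using padic_abs_add[of x "- y"] by (simp add: padic_abs_uminus)

text \<open>The base \<open>1 / p\<close> is weakened to \<open>1 / 2\<close>, as the bound serves
  only to prove convergence to \<open>0\<close>.\<close>

lemma padic_abs_of_int:
  assumes "int p ^ m dvd k"
  shows "padic_abs p (of_int k) \<le> (1 / 2) ^ m"
proof (cases "k = 0")
  case False
  have m: "m \<le> multiplicity (int p) k" using assms False prime_int_p by (intro multiplicity_geI) auto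
  have "padic_abs p (of_int k) = real p powi (- int (multiplicity (int p) k))"
    using padic_abs_divide[OF False, of 1] by simp
  also have "\<dots> = (1 / real p) ^ multiplicity (int p) k"
    by (simp add: power_int_minus power_one_over inverse_eq_divide)
  also have "\<dots> \<le> (1 / real p) ^ m" using m prime_gt_0_nat[OF p] by (intro power_decreasing) auto
  also have "\<dots> \<le> (1 / 2) ^ m" using prime_ge_2_nat[OF p] by (intro power_mono) (auto simp: field_simps)
  finally show ?thesis .
qed auto

abbreviation "C \<equiv> padic_cauchy_ring p"

lemma carrier_padic: "s \<in> carrier C \<longleftrightarrow> (\<forall>\<epsilon>>0. \<exists>N. \<forall>i\<ge>N. \<forall>j\<ge>N. padic_abs p (s i - s j) < \<epsilon>)"
  by (simp add: padic_cauchy_ring_def)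

lemma padic_bounded:
  assumes "s \<in> carrier C"
  shows "\<exists>B>0. \<forall>i. padic_abs p (s i) \<le> B"
proof -
  obtain N where N: "\<forall>i\<ge>N. \<forall>j\<ge>N. padic_abs p (s i - s j) < 1" using assms[unfolded carrier_padic, rule_format, of 1] by auto
  define B where "B = Max (insert 1 ((\<lambda>i. padic_abs p (s i)) ` {..N}))"
  have B: "x \<in> insert 1 ((\<lambda>i. padic_abs p (s i)) ` {..N}) \<Longrightarrow> x \<le> B" for x unfolding B_def by (intro Max_ge) auto
  have "padic_abs p (s i) \<le> B" for i
  proof (cases "i \<le> N")
    case True
    thus ?thesis by (intro B) auto
  next
    case False
    have "padic_abs p (s i) \<le> max (padic_abs p (s i - s N)) (padic_abs p (s N))" using padic_abs_add[of "s i - s N" "s N"] by simp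
    moreover have "padic_abs p (s i - s N) \<le> 1" using N False by (simp add: less_imp_le)
    moreover have "1 \<le> B" "padic_abs p (s N) \<le> B" by (auto intro!: B)
    ultimately show ?thesis by linarith
  qed
  moreover have "B > 0" using B[of 1] by simp
  ultimately show ?thesis by blast
qed

lemma padic_add_closed:
  assumes s: "s \<in> carrier C" and t: "t \<in> carrier C"
  shows "(\<lambda>i. s i + t i) \<in> carrier C"
  unfolding carrier_padic
proof (intro allI impI)
  fix \<epsilon> :: real assume e: "\<epsilon> > 0"
  obtain N where N: "\<forall>i\<ge>N. \<forall>j\<ge>N. padic_abs p (s i - s j) < \<epsilon>" using s e unfolding carrier_padic by blast
  obtain M where M: "\<forall>i\<ge>M. \<forall>j\<ge>M. padic_abs p (t i - t j) < \<epsilon>" using t e unfolding carrier_padic by blast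
  have "padic_abs p ((s i + t i) - (s j + t j)) < \<epsilon>" if "i \<ge> max N M" "j \<ge> max N M" for i j
  proof -
    have "padic_abs p ((s i - s j) + (t i - t j)) \<le> max (padic_abs p (s i - s j)) (padic_abs p (t i - t j))" by (rule padic_abs_add)
    also have "\<dots> < \<epsilon>" using N M that by simp
    finally show ?thesis by (simp add: algebra_simps)
  qed
  thus "\<exists>N. \<forall>i\<ge>N. \<forall>j\<ge>N. padic_abs p ((s i + t i) - (s j + t j)) < \<epsilon>" by blast
qed

lemma padic_mult_closed:
  assumes s: "s \<in> carrier C" and t: "t \<in> carrier C"
  shows "(\<lambda>i. s i * t i) \<in> carrier C"
  unfolding carrier_padic
proof (intro allI impI)
  fix \<epsilon> :: real assume e: "\<epsilon> > 0"
  obtain A where A: "A > 0" "\<And>i. padic_abs p (s i) \<le> A" using padic_bounded[OF s] by blast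
  obtain B where B: "B > 0" "\<And>i. padic_abs p (t i) \<le> B" using padic_bounded[OF t] by blast
  have eB: "\<epsilon> / B > 0" and eA: "\<epsilon> / A > 0" using e A B by auto
  obtain N where N: "\<forall>i\<ge>N. \<forall>j\<ge>N. padic_abs p (s i - s j) < \<epsilon> / B" using s eB unfolding carrier_padic by blast
  obtain M where M: "\<forall>i\<ge>M. \<forall>j\<ge>M. padic_abs p (t i - t j) < \<epsilon> / A" using t eA unfolding carrier_padic by blast
  have "padic_abs p (s i * t i - s j * t j) < \<epsilon>" if "i \<ge> max N M" "j \<ge> max N M" for i j
  proof -
    have "s i * t i - s j * t j = (s i - s j) * t i + s j * (t i - t j)" by (simp add: algebra_simps)
    hence "padic_abs p (s i * t i - s j * t j) \<le> max (padic_abs p (s i - s j) * padic_abs p (t i)) (padic_abs p (s j) * padic_abs p (t i - t j))"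
      using padic_abs_add[of "(s i - s j) * t i" "s j * (t i - t j)"] by (simp add: padic_abs_mult)
    moreover have "padic_abs p (s i - s j) * padic_abs p (t i) < \<epsilon>"
    proof -
      have "padic_abs p (s i - s j) * padic_abs p (t i) \<le> padic_abs p (s i - s j) * B" by (intro mult_left_mono B) auto
      also have "\<dots> < \<epsilon>" using N that B(1) by (simp add: pos_less_divide_eq)
      finally show ?thesis .
    qed
    moreover have "padic_abs p (s j) * padic_abs p (t i - t j) < \<epsilon>"
    proof -
      have "padic_abs p (s j) * padic_abs p (t i - t j) \<le> A * padic_abs p (t i - t j)" by (intro mult_right_mono A) auto
      also have "\<dots> < \<epsilon>" using M that A(1) by (simp add: pos_less_divide_eq mult.commute)
      finally show ?thesis .
    qed
    ultimately show ?thesis by linarith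
  qed
  thus "\<exists>N. \<forall>i\<ge>N. \<forall>j\<ge>N. padic_abs p (s i * t i - s j * t j) < \<epsilon>" by blast
qed

lemma padic_uminus_closed: "s \<in> carrier C \<Longrightarrow> (\<lambda>i. - s i) \<in> carrier C"
  unfolding carrier_padic by (metis minus_diff_minus padic_abs_uminus)

lemma padic_const_closed: "(\<lambda>_. q) \<in> carrier C"
  unfolding carrier_padic by simp

lemma cring_padic: "cring C"
proof (rule cringI)
  show "abelian_group C"
  proof (rule abelian_groupI)
    fix x assume "x \<in> carrier C"
    thus "\<exists>y\<in>carrier C. y \<oplus>\<^bsub>C\<^esub> x = \<zero>\<^bsub>C\<^esub>"
      by (intro bexI[of _ "\<lambda>i. - x i"] padic_uminus_closed) (simp_all add: padic_cauchy_ring_def)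
  next
    show "\<zero>\<^bsub>C\<^esub> \<in> carrier C" using padic_const_closed[of 0] by (simp add: padic_cauchy_ring_def)
  next
    fix x y assume "x \<in> carrier C" "y \<in> carrier C"
    thus "x \<oplus>\<^bsub>C\<^esub> y \<in> carrier C" using padic_add_closed[of x y] by (simp add: padic_cauchy_ring_def)
  qed (simp_all add: padic_cauchy_ring_def algebra_simps)
  show "comm_monoid C"
  proof (rule comm_monoidI)
    show "\<one>\<^bsub>C\<^esub> \<in> carrier C" using padic_const_closed[of 1] by (simp add: padic_cauchy_ring_def)
  next
    fix x y assume "x \<in> carrier C" "y \<in> carrier C"
    thus "x \<otimes>\<^bsub>C\<^esub> y \<in> carrier C" using padic_mult_closed[of x y] by (simp add: padic_cauchy_ring_def)
  qed (simp_all add: padic_cauchy_ring_def algebra_simps)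
qed (simp add: padic_cauchy_ring_def algebra_simps)

lemma padic_null_subset: "padic_null_ideal p \<subseteq> carrier C"
proof
  fix s assume "s \<in> padic_null_ideal p"
  hence lim: "(\<lambda>i. padic_abs p (s i)) \<longlonglongrightarrow> 0" by (simp add: padic_null_ideal_def)
  show "s \<in> carrier C"
    unfolding carrier_padic
  proof (intro allI impI)
    fix \<epsilon> :: real assume e: "\<epsilon> > 0"
    obtain N where N: "\<forall>i\<ge>N. padic_abs p (s i) < \<epsilon>" using LIMSEQ_D[OF lim e] by auto
    have "padic_abs p (s i - s j) < \<epsilon>" if "i \<ge> N" "j \<ge> N" for i j
      using padic_abs_diff[of "s i" "s j"] N that by (meson le_less_trans max_less_iff_conj)
    thus "\<exists>N. \<forall>i\<ge>N. \<forall>j\<ge>N. padic_abs p (s i - s j) < \<epsilon>" by blast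
  qed
qed

lemma padic_null_add:
  assumes "s \<in> padic_null_ideal p" "t \<in> padic_null_ideal p"
  shows "(\<lambda>i. s i + t i) \<in> padic_null_ideal p"
proof -
  have lim: "(\<lambda>i. padic_abs p (s i) + padic_abs p (t i)) \<longlonglongrightarrow> 0"
    using assms unfolding padic_null_ideal_def by (auto intro!: tendsto_add_zero)
  have "padic_abs p (s i + t i) \<le> padic_abs p (s i) + padic_abs p (t i)" for i
    using padic_abs_add[of "s i" "t i"] padic_abs_nonneg[of "s i"] padic_abs_nonneg[of "t i"] by linarith
  thus ?thesis unfolding padic_null_ideal_def
    using tendsto_sandwich[OF _ _ tendsto_const lim] by simp
qed

lemma padic_null_mult:
  assumes s: "s \<in> padic_null_ideal p" and t: "t \<in> carrier C"
  shows "(\<lambda>i. s i * t i) \<in> padic_null_ideal p"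
proof -
  obtain B where B: "B > 0" "\<And>i. padic_abs p (t i) \<le> B" using padic_bounded[OF t] by blast
  have lim: "(\<lambda>i. padic_abs p (s i) * B) \<longlonglongrightarrow> 0"
    using s unfolding padic_null_ideal_def by (auto intro!: tendsto_mult_left_zero)
  have "padic_abs p (s i * t i) \<le> padic_abs p (s i) * B" for i
    unfolding padic_abs_mult by (intro mult_left_mono B) auto
  thus ?thesis unfolding padic_null_ideal_def
    using tendsto_sandwich[OF _ _ tendsto_const lim] by simp
qed

lemma ideal_padic_null: "ideal (padic_null_ideal p) C"
proof (rule idealI)
  interpret cring C by (rule cring_padic)
  show "ring C" by (rule ring_axioms)
  show "subgroup (padic_null_ideal p) (add_monoid C)"
  proof (rule add.subgroupI)
    show "padic_null_ideal p \<subseteq> carrier C" by (rule padic_null_subset)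
    show "padic_null_ideal p \<noteq> {}" proof -
      have "(\<lambda>_. 0) \<in> padic_null_ideal p" by (simp add: padic_null_ideal_def)
      thus ?thesis by blast
    qed
  next
    fix s assume s: "s \<in> padic_null_ideal p"
    have "\<ominus>\<^bsub>C\<^esub> s = (\<lambda>i. - s i)"
      using s padic_null_subset padic_uminus_closed by (intro minus_equality) (auto simp: padic_cauchy_ring_def)
    thus "\<ominus>\<^bsub>C\<^esub> s \<in> padic_null_ideal p" using s by (simp add: padic_null_ideal_def padic_abs_uminus)
  next
    fix s t assume "s \<in> padic_null_ideal p" "t \<in> padic_null_ideal p"
    thus "s \<oplus>\<^bsub>C\<^esub> t \<in> padic_null_ideal p" using padic_null_add[of s t] by (simp add: padic_cauchy_ring_def)
  qed
next
  fix s t assume "s \<in> padic_null_ideal p" "t \<in> carrier C"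
  thus "t \<otimes>\<^bsub>C\<^esub> s \<in> padic_null_ideal p" "s \<otimes>\<^bsub>C\<^esub> t \<in> padic_null_ideal p"
    using padic_null_mult[of s t] by (simp_all add: padic_cauchy_ring_def mult.commute)
qed

text \<open>Evaluation at an index carries polynomial expressions in sequences to the same
  expressions in their rational entries.\<close>

lemma padic_proj_hom: "ring_hom_cring C (ring_of_type_algebra :: rat ring) (\<lambda>s. s i)"
proof -
  have "(\<lambda>s. s i) \<in> Ring.ring_hom C (ring_of_type_algebra :: rat ring)"
    by (rule ring_hom_memI) (simp_all add: type_algebra_simps(1-5) padic_cauchy_ring_def)
  thus ?thesis
    by (intro ring_hom_cring.intro ring_hom_cring_axioms.intro cring_padic cring_from_type_algebra)
qed

lemma padic_of_int_seq:
  fixes x :: "nat \<Rightarrow> int"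
  assumes x: "\<And>i. int p ^ i dvd x (Suc i) - x i"
  shows "(\<lambda>i. rat_of_int (x i)) \<in> carrier C"
  unfolding carrier_padic
proof (intro allI impI)
  have D: "int p ^ N dvd x (N + k) - x N" for N k
  proof (induction k)
    case (Suc k)
    have "int p ^ N dvd int p ^ (N + k)" by (simp add: power_add)
    hence "int p ^ N dvd x (Suc (N + k)) - x (N + k)" using x dvd_trans by blast
    from dvd_add[OF this Suc] show ?case by simp
  qed simp
  fix \<epsilon> :: real assume e: "\<epsilon> > 0"
  obtain N where N: "(1 / 2 :: real) ^ N < \<epsilon>" using real_arch_pow_inv[OF e, of "1/2"] by auto
  have "padic_abs p (rat_of_int (x i) - rat_of_int (x j)) < \<epsilon>" if "i \<ge> N" "j \<ge> N" for i j
  proof -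
    have "int p ^ N dvd (x i - x N) - (x j - x N)"
      using D[of N "i - N", simplified] D[of N "j - N", simplified] that by (intro dvd_diff[of _ "x i - x N"]) simp_all
    from padic_abs_of_int[OF this] show ?thesis using N by simp
  qed
  thus "\<exists>N. \<forall>i\<ge>N. \<forall>j\<ge>N. padic_abs p (rat_of_int (x i) - rat_of_int (x j)) < \<epsilon>" by blast
qed

text \<open>Integer sequences whose successive terms agree modulo \<open>p ^ i\<close> are Cauchy,
  and the defect in the equation is a null sequence, so the classes of the two sequences form a
  point of the affine chart.\<close>

theorem padic_twist_has_point:
  fixes x y :: "nat \<Rightarrow> int"
  assumes x: "\<And>i. int p ^ i dvd x (Suc i) - x i" and y: "\<And>i. int p ^ i dvd y (Suc i) - y i"
    and xy: "\<And>i. int p ^ i dvd d * y i ^ n - poly f (x i)"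
  shows "twist_has_point (padic_field p) n d f"
proof -
  define I where "I = padic_null_ideal p"
  interpret C: cring C by (rule cring_padic)
  interpret I: ideal I C unfolding I_def by (rule ideal_padic_null)
  interpret q: ring_hom_cring C "C Quot I" "\<lambda>s. I +>\<^bsub>C\<^esub> s" by (rule I.rcos_ring_hom_cring) (rule cring_padic)
  define s t where "s = (\<lambda>i. rat_of_int (x i))" and "t = (\<lambda>i. rat_of_int (y i))"
  have s: "s \<in> carrier C" and t: "t \<in> carrier C" unfolding s_def t_def using x y padic_of_int_seq by auto
  define u v where "u = [d] \<cdot>\<^bsub>C\<^esub> (t [^]\<^bsub>C\<^esub> n)" and "v = eval_int_poly C f s"
  have uv: "u \<in> carrier C" "v \<in> carrier C" using s t by (auto simp: u_def v_def)
  have pt: "(u \<ominus>\<^bsub>C\<^esub> v) i = rat_of_int (d * y i ^ n - poly f (x i))" for i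
  proof -
    interpret h: ring_hom_cring C "ring_of_type_algebra :: rat ring" "\<lambda>s. s i" by (rule padic_proj_hom)
    have m: "(\<ominus>\<^bsub>C\<^esub> v) i = - v i"
    proof -
      have "(\<ominus>\<^bsub>C\<^esub> v \<oplus>\<^bsub>C\<^esub> v) i = \<zero>\<^bsub>C\<^esub> i" using uv by (simp add: C.l_neg)
      thus ?thesis by (simp add: padic_cauchy_ring_def eq_neg_iff_add_eq_0)
    qed
    have "u i = of_int d * t i ^ n" using t h.hom_add_pow_int[of "t [^]\<^bsub>C\<^esub> n" d] h.ring.hom_nat_pow[OF t, of n]
      by (simp add: u_def type_algebra_simps)
    moreover have "v i = poly (map_poly of_int f) (s i)"
      using h.eval_int_poly_hom[OF s, of f] by (simp add: v_def type_algebra_simps)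
    moreover have "(u \<ominus>\<^bsub>C\<^esub> v) i = u i - v i" unfolding a_minus_def using m by (simp add: padic_cauchy_ring_def)
    ultimately show ?thesis by (simp add: s_def t_def)
  qed
  have "u \<ominus>\<^bsub>C\<^esub> v \<in> I"
    unfolding I_def padic_null_ideal_def
  proof (rule CollectI, rule tendsto_sandwich[OF _ _ tendsto_const])
    show "(\<lambda>i. (1 / 2 :: real) ^ i) \<longlonglongrightarrow> 0" by (intro LIMSEQ_realpow_zero) auto
    show "\<forall>\<^sub>F i in sequentially. padic_abs p ((u \<ominus>\<^bsub>C\<^esub> v) i) \<le> (1 / 2) ^ i"
      unfolding pt using padic_abs_of_int[OF xy] by (intro always_eventually allI)
  qed simp
  hence "I +>\<^bsub>C\<^esub> u = I +>\<^bsub>C\<^esub> v" using C.quotient_eq_iff_same_a_r_cos[OF I.ideal_axioms uv] by simp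
  moreover have "I +>\<^bsub>C\<^esub> u = [d] \<cdot>\<^bsub>C Quot I\<^esub> ((I +>\<^bsub>C\<^esub> t) [^]\<^bsub>C Quot I\<^esub> n)"
    unfolding u_def using t by (simp add: q.hom_add_pow_int q.ring.hom_nat_pow)
  moreover have "I +>\<^bsub>C\<^esub> v = eval_int_poly (C Quot I) f (I +>\<^bsub>C\<^esub> s)"
    unfolding v_def by (rule q.eval_int_poly_hom[OF s])
  moreover have "I +>\<^bsub>C\<^esub> s \<in> carrier (C Quot I)" "I +>\<^bsub>C\<^esub> t \<in> carrier (C Quot I)" using s t q.hom_closed by blast+
  ultimately have "(I +>\<^bsub>C\<^esub> s, I +>\<^bsub>C\<^esub> t) \<in> affine_chart_points (C Quot I) n d f"
    by (simp add: affine_chart_points_def)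
  thus ?thesis unfolding twist_has_point_def padic_field_def I_def by blast
qed

end

lemma real_twist_has_point:
  assumes "real_of_int d * y ^ n = poly (map_poly of_int f) x"
  shows "twist_has_point (ring_of_type_algebra :: real ring) n d f"
proof -
  have "(x, y) \<in> affine_chart_points (ring_of_type_algebra :: real ring) n d f"
    using assms by (simp add: affine_chart_points_def type_algebra_simps)
  thus ?thesis unfolding twist_has_point_def by blast
qed

section \<open>Hensel's lemma\<close>

lemma diff_dvd_poly_diff:
  fixes p :: "'a :: comm_ring_1 poly"
  shows "x - y dvd poly p x - poly p y"
proof (induction p)
  case (pCons a p)
  have "poly (pCons a p) x - poly (pCons a p) y = x * (poly p x - poly p y) + (x - y) * poly p y"
    by (simp add: algebra_simps)
  thus ?case using pCons by (metis dvd_add dvd_mult dvd_triv_left)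
qed simp

lemma poly_taylor2:
  fixes g :: "'a :: idom poly"
  shows "\<exists>q. poly g (x + h) = poly g x + h * poly (pderiv g) x + h ^ 2 * q"
proof (induction g)
  case (pCons a g)
  then obtain q where q: "poly g (x + h) = poly g x + h * poly (pderiv g) x + h ^ 2 * q" by blast
  have "poly (pCons a g) (x + h) = poly (pCons a g) x + h * poly (pderiv (pCons a g)) x + h ^ 2 * (poly (pderiv g) x + (x + h) * q)"
    unfolding poly_pCons q pderiv_pCons poly_add by (simp add: algebra_simps power2_eq_square)
  thus ?case by blast
qed auto

text \<open>Newton's iteration with the derivative inverted only modulo \<open>p\<close>, so that
  each step gains one factor \<open>p\<close>. The clause guarded by \<open>i = 0\<close> carries
  the initial value through the dependent choice.\<close>

lemma hensel_sequence:
  fixes g :: "int poly"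
  assumes p: "prime p" and r: "int p dvd poly g r" "\<not> int p dvd poly (pderiv g) r"
  shows "\<exists>x. x 0 = r \<and> (\<forall>i. int p ^ Suc i dvd poly g (x i) \<and> int p ^ Suc i dvd x (Suc i) - x i)"
proof -
  have "\<exists>x. \<forall>i. (int p ^ Suc i dvd poly g (x i) \<and> int p dvd x i - r \<and> (i = 0 \<longrightarrow> x i = r)) \<and> int p ^ Suc i dvd x (Suc i) - x i"
  proof (rule dependent_nat_choice)
    show "\<exists>x. int p ^ Suc 0 dvd poly g x \<and> int p dvd x - r \<and> (0 = (0::nat) \<longrightarrow> x = r)" using r by auto
  next
    fix x i assume A: "int p ^ Suc i dvd poly g x \<and> int p dvd x - r \<and> (i = 0 \<longrightarrow> x = r)"
    have "x - r dvd poly (pderiv g) x - poly (pderiv g) r" by (rule diff_dvd_poly_diff)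
    hence "int p dvd poly (pderiv g) x - poly (pderiv g) r" using A dvd_trans by blast
    hence "\<not> int p dvd poly (pderiv g) x" using r(2) by (metis dvd_diff_right_iff)
    hence "coprime (poly (pderiv g) x) (int p)" using p by (metis coprime_commute prime_imp_coprime prime_nat_int_transfer)
    then obtain w where w: "[poly (pderiv g) x * w = 1] (mod int p)" using cong_solve_coprime_int by blast
    obtain c where c: "poly g x = int p ^ Suc i * c" using A by blast
    define h where "h = - (int p ^ Suc i * c * w)"
    obtain q where q: "poly g (x + h) = poly g x + h * poly (pderiv g) x + h ^ 2 * q" using poly_taylor2 by blast
    have "int p dvd c * (1 - poly (pderiv g) x * w)" using w by (metis cong_iff_dvd_diff dvd_mult dvd_diff_commute)
    hence "int p ^ Suc i * int p dvd int p ^ Suc i * (c * (1 - poly (pderiv g) x * w))" by (rule mult_dvd_mono[OF dvd_refl])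
    moreover have "int p ^ Suc i * int p dvd h ^ 2 * q"
    proof -
      have "h ^ 2 * q = (int p ^ Suc i * int p) * (int p ^ i * (c * w) ^ 2 * q)"
        by (simp add: h_def power2_eq_square algebra_simps)
      thus ?thesis by (metis dvd_triv_left)
    qed
    moreover have "poly g (x + h) = int p ^ Suc i * (c * (1 - poly (pderiv g) x * w)) + h ^ 2 * q"
      unfolding q c by (simp add: h_def algebra_simps)
    ultimately have "int p ^ Suc i * int p dvd poly g (x + h)" by (metis dvd_add)
    moreover have "int p dvd h" unfolding h_def by simp
    hence "int p dvd (x - r) + h" using A by (intro dvd_add) auto
    ultimately show "\<exists>y. (int p ^ Suc (Suc i) dvd poly g y \<and> int p dvd y - r \<and> (Suc i = 0 \<longrightarrow> y = r)) \<and> int p ^ Suc i dvd y - x"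
      by (intro exI[of _ "x + h"]) (auto simp: h_def algebra_simps)
  qed
  then obtain x where "\<forall>i. (int p ^ Suc i dvd poly g (x i) \<and> int p dvd x i - r \<and> (i = 0 \<longrightarrow> x i = r)) \<and> int p ^ Suc i dvd x (Suc i) - x i"
    by blast
  thus ?thesis by (intro exI[of _ x]) blast
qed

section \<open>Roots modulo large primes\<close>

text \<open>Multiplying the roots by the leading coefficient makes them algebraic integers; modulo
  primes not dividing that coefficient, \<open>f\<close> and \<open>H\<close> have roots for the
  same \<open>p\<close>.\<close>

lemma exists_monic_scaling:
  fixes f :: "int poly"
  assumes d: "degree f > 0"
  shows "\<exists>H. lead_coeff H = 1 \<and> degree H = degree f \<and> (\<forall>r. poly H (lead_coeff f * r) = lead_coeff f ^ (degree f - 1) * poly f r)"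
proof -
  define c d where "c = lead_coeff f" and "d = degree f"
  define H where "H = Poly (map (\<lambda>i. if i = d then 1 else coeff f i * c ^ (d - 1 - i)) [0..<Suc d])"
  have cH: "coeff H i = (if i = d then 1 else if i < d then coeff f i * c ^ (d - 1 - i) else 0)" for i
    unfolding H_def by (simp add: nth_default_def del: upt_Suc)
  have dH: "degree H = d"
  proof (rule antisym)
    show "degree H \<le> d" by (rule degree_le) (simp add: cH)
    show "d \<le> degree H" by (rule le_degree) (simp add: cH)
  qed
  have spl: "{..d} = insert d {..<d}" by auto
  have "poly H (c * r) = c ^ (d - 1) * poly f r" for r
  proof -
    have "poly H (c * r) = (c * r) ^ d + (\<Sum>i<d. coeff f i * c ^ (d - 1 - i) * (c * r) ^ i)"
      unfolding poly_altdef dH spl by (simp add: cH)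
    also have "(\<Sum>i<d. coeff f i * c ^ (d - 1 - i) * (c * r) ^ i) = (\<Sum>i<d. c ^ (d - 1) * (coeff f i * r ^ i))"
    proof (rule sum.cong[OF refl])
      fix i assume "i \<in> {..<d}"
      hence "c ^ (d - 1 - i) * c ^ i = c ^ (d - 1)" by (simp add: power_add[symmetric])
      thus "coeff f i * c ^ (d - 1 - i) * (c * r) ^ i = c ^ (d - 1) * (coeff f i * r ^ i)"
        by (simp add: power_mult_distrib mult_ac)
    qed
    also have "(c * r) ^ d = c ^ (d - 1) * (c * r ^ d)"
    proof -
      have "c ^ d = c ^ (d - 1) * c" using d by (metis d_def power_minus_mult)
      thus ?thesis by (simp add: power_mult_distrib mult.assoc)
    qed
    also have "c ^ (d - 1) * (c * r ^ d) + (\<Sum>i<d. c ^ (d - 1) * (coeff f i * r ^ i)) = c ^ (d - 1) * (\<Sum>i\<le>d. coeff f i * r ^ i)"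
      unfolding spl by (simp add: sum_distrib_left distrib_left c_def d_def)
    finally show ?thesis by (simp add: poly_altdef d_def)
  qed
  moreover have "lead_coeff H = 1" unfolding dH by (simp add: cH)
  ultimately show ?thesis using dH unfolding c_def d_def by (intro exI[of _ H] conjI allI) simp_all
qed

text \<open>The value at \<open>r\<close> is the product of \<open>r - x\<close> over the list of
  complex roots with repetitions, and the ideal is prime.\<close>

lemma prime_dvd_poly_iff:
  fixes H :: "int poly"
  assumes H: "lead_coeff H = 1" and p: "prime p"
  shows "int p dvd poly H r \<longleftrightarrow> (\<exists>x. poly (map_poly of_int H) x = 0 \<and> of_int r - x \<in> prime_over p)"
proof
  define Hc where "Hc = (map_poly of_int H :: complex poly)"
  have al: "x \<in> alg_ints" if "poly Hc x = 0" for x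
    using that H unfolding Hc_def alg_ints_def algebraic_int_altdef_ipoly by blast
  have val: "poly Hc (of_int r) = of_int (poly H r)" by (simp add: Hc_def)
  {
    assume d: "int p dvd poly H r"
    obtain as where as: "smult (coeff Hc (degree Hc)) (\<Prod>a\<leftarrow>as. [:- a, 1:]) = Hc"
      using fundamental_theorem_algebra_factorized[of Hc] by blast
    have "coeff Hc (degree Hc) = 1" using H by (simp add: Hc_def degree_map_poly coeff_map_poly)
    hence Hp: "Hc = (\<Prod>a\<leftarrow>as. [:- a, 1:])" using as by simp
    have roots: "poly Hc a = 0" if "a \<in> set as" for a
      using that unfolding Hp by (induction as) auto
    have "(\<Prod>a\<leftarrow>bs. of_int r - a) \<in> prime_over p \<Longrightarrow> set bs \<subseteq> alg_ints \<Longrightarrow> \<exists>a\<in>set bs. of_int r - a \<in> prime_over p" for bs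
    proof (induction bs)
      case Nil
      thus ?case using po_1[OF p refl] by simp
    next
      case (Cons b bs)
      have "(\<Prod>a\<leftarrow>bs. of_int r - a) \<in> alg_ints" using Cons.prems(2) by (induction bs) auto
      moreover have "of_int r - b \<in> alg_ints" using Cons.prems by auto
      ultimately have "of_int r - b \<in> prime_over p \<or> (\<Prod>a\<leftarrow>bs. of_int r - a) \<in> prime_over p"
        using Cons.prems(1) by (intro po_prime[OF p refl]) auto
      thus ?case using Cons by auto
    qed
    moreover have "(\<Prod>a\<leftarrow>as. of_int r - a) \<in> prime_over p"
    proof -
      have "poly Hc (of_int r) = (\<Prod>a\<leftarrow>as. of_int r - a)" unfolding Hp by (induction as) (auto simp: left_diff_distrib)
      hence "(\<Prod>a\<leftarrow>as. of_int r - a) = of_int (poly H r)" using val by simp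
      moreover have "(of_int (poly H r) :: complex) \<in> prime_over p" using d po_of_int[OF p refl] by blast
      ultimately show ?thesis by simp
    qed
    moreover have "set as \<subseteq> alg_ints" using roots al by blast
    ultimately show "\<exists>x. poly (map_poly of_int H) x = 0 \<and> of_int r - x \<in> prime_over p"
      using roots unfolding Hc_def by blast
  }
  assume "\<exists>x. poly (map_poly of_int H) x = 0 \<and> of_int r - x \<in> prime_over p"
  then obtain x where x: "poly Hc x = 0" "of_int r - x \<in> prime_over p" by (auto simp: Hc_def)
  define m where "m = Suc (degree H)"
  have ev: "poly Hc z = ev m (coeff H) z" for z
    unfolding ev_def m_def lessThan_Suc_atMost by (simp add: Hc_def poly_altdef coeff_map_poly degree_map_poly)
  have "poly Hc (of_int r) - poly Hc x \<in> prime_over p"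
    unfolding ev using x al by (intro po_ev_cong[OF p]) auto
  thus "int p dvd poly H r" using x val po_of_int[OF p refl] by simp
qed

theorem eventually_root_of_density_one:
  fixes f :: "int poly"
  assumes d: "degree f > 0" and wi: "weakly_intersective f"
  shows "\<exists>p0. \<forall>p>p0. prime p \<longrightarrow> (\<exists>r. int p dvd poly f r)"
proof -
  define c where "c = lead_coeff f"
  have c0: "c \<noteq> 0" using d by (auto simp: c_def)
  obtain H where H: "lead_coeff H = 1" "degree H = degree f" "\<And>r. poly H (c * r) = c ^ (degree f - 1) * poly f r"
    using exists_monic_scaling[OF d] unfolding c_def by blast
  define W where "W = {x :: complex. poly (map_poly of_int H) x = 0}"
  have rpH: "rp (map_poly of_int H) x = poly (map_poly of_int H) x" for x
  proof -
    have "map_poly of_rat (map_poly of_int H :: rat poly) = (map_poly of_int H :: complex poly)"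
      by (rule poly_eqI) (simp add: coeff_map_poly)
    thus ?thesis by (simp add: rp_def)
  qed
  have H0: "(map_poly of_int H :: rat poly) \<noteq> 0" using H(1) by (auto simp: map_poly_eq_0_iff)
  have WA: "W \<subseteq> alg_ints" using H(1) unfolding W_def alg_ints_def algebraic_int_altdef_ipoly by blast
  obtain K G \<theta> where gal: "galois K G \<theta>" and WK: "W \<subseteq> K"
    using exists_galois[OF H0] WA unfolding rpH W_def[symmetric] by blast
  interpret galois K G \<theta> by (rule gal)
  have WKZ: "W \<subseteq> KZ" using WA WK by (auto simp: KZ_def)
  have finW: "finite W" using finite_rp_roots[OF H0] by (simp add: rpH W_def)
  have stW: "stable W"
    unfolding stable_def
  proof (intro conjI ballI finW WKZ)
    fix \<sigma> x assume \<sigma>: "\<sigma> \<in> G" and x: "x \<in> W"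
    have "\<sigma> (poly (map_poly of_int H) x) = poly (map_poly \<sigma> (map_poly of_int H)) (\<sigma> x)"
      using x WK by (intro G_poly[OF \<sigma>]) (auto simp: polys_over_def coeff_map_poly F_of_int)
    also have "map_poly \<sigma> (map_poly of_int H) = map_poly of_int H"
      by (rule poly_eqI) (simp add: coeff_map_poly G_0[OF \<sigma>] G_of_int[OF \<sigma>])
    finally show "\<sigma> x \<in> W" using x G_0[OF \<sigma>] by (simp add: W_def)
  qed
  have WG: "\<sigma> x \<in> W" if "\<sigma> \<in> G" "x \<in> W" for \<sigma> x using stW that by (simp add: stable_def)
  have "\<exists>a. \<forall>y\<in>W. \<forall>p>a y. prime p \<longrightarrow> y ^ p - frob p y \<in> prime_over p"
    using WKZ by (intro bchoice ballI frob_cong) auto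
  then obtain a where a: "\<forall>y\<in>W. \<forall>p>a y. prime p \<longrightarrow> y ^ p - frob p y \<in> prime_over p" by (rule exE)
  have "\<exists>b. \<forall>yz\<in>{(y, z) \<in> W \<times> W. y \<noteq> z}. \<forall>p>b yz. prime p \<longrightarrow> fst yz - snd yz \<notin> prime_over p"
    using WKZ by (intro bchoice ballI eventually_notin_prime) (auto intro!: KZ_diff)
  then obtain b where b: "\<forall>yz\<in>{(y, z) \<in> W \<times> W. y \<noteq> z}. \<forall>p>b yz. prime p \<longrightarrow> fst yz - snd yz \<notin> prime_over p"
    by (rule exE)
  \<comment> \<open>The last summand makes the leading coefficient invertible modulo
    \<open>p\<close>, for the passage between \<open>f\<close> and \<open>H\<close>.\<close>
  define p0 where "p0 = Max (insert 0 (a ` W)) + Max (insert 0 (b ` (W \<times> W))) + nat \<bar>c\<bar>"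
  have aM: "a y \<le> p0" if "y \<in> W" for y
  proof -
    have "a y \<le> Max (insert 0 (a ` W))" using that finW by (intro Max_ge) auto
    thus ?thesis unfolding p0_def by linarith
  qed
  have bM: "b (y, z) \<le> p0" if "y \<in> W" "z \<in> W" for y z
  proof -
    have "b (y, z) \<le> Max (insert 0 (b ` (W \<times> W)))" using that finW by (intro Max_ge) auto
    thus ?thesis unfolding p0_def by linarith
  qed
  have good: "y - z \<notin> prime_over p" if p: "prime p" "p > p0" and yz: "y \<in> W" "z \<in> W" "y \<noteq> z" for p y z
  proof -
    have "(y, z) \<in> {(y, z) \<in> W \<times> W. y \<noteq> z}" "p > b (y, z)" using bM[OF yz(1,2)] p yz by auto
    thus ?thesis using b p(1) by fastforce
  qed
  have frobW: "y ^ p - frob p y \<in> prime_over p" if "prime p" "p > p0" "y \<in> W" for p y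
    using a aM[OF that(3)] that by simp
  have H_root: "(\<exists>r. int p dvd poly H r) \<longleftrightarrow> fixn W (frob p) \<noteq> 0" if p: "prime p" "p > p0" for p
  proof -
    note pp = p(1) refl[of "prime_over p"]
    have "(\<exists>r. int p dvd poly H r) \<longleftrightarrow> (\<exists>r. \<exists>x\<in>W. of_int r - x \<in> prime_over p)"
      unfolding prime_dvd_poly_iff[OF H(1) p(1)] W_def by auto
    also have "\<dots> \<longleftrightarrow> (\<exists>x\<in>W. frob p x = x)"
    proof
      assume "\<exists>r. \<exists>x\<in>W. of_int r - x \<in> prime_over p"
      then obtain r x where x: "x \<in> W" and r: "of_int r - x \<in> prime_over p" by blast
      have fW: "frob p x \<in> W" using WG frob(1)[OF p(1)] x by blast
      have 1: "of_int r ^ p - x ^ p \<in> prime_over p" using x r WA by (intro po_cong_power[OF pp]) auto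
      have 2: "of_int r ^ p - of_int r \<in> prime_over p" by (rule po_fermat[OF pp])
      have "x ^ p - frob p x + (of_int r ^ p - x ^ p) \<in> prime_over p" using frobW[OF p x] 1 by (rule po_add[OF pp])
      from po_diff[OF pp this 2] have "of_int r - frob p x \<in> prime_over p" by simp
      from po_diff[OF pp this r] have "x - frob p x \<in> prime_over p" by simp
      hence "frob p x = x" using good[OF p x fW] by fastforce
      thus "\<exists>x\<in>W. frob p x = x" using x by blast
    next
      assume "\<exists>x\<in>W. frob p x = x"
      then obtain x where x: "x \<in> W" "frob p x = x" by blast
      have "x ^ p - x \<in> prime_over p" using frobW[OF p x(1)] x(2) by simp
      then obtain r where "x - of_int r \<in> prime_over p" using po_fixed_imp_int[OF pp] x WA by blast
      from po_minus[OF pp this] show "\<exists>r. \<exists>x\<in>W. of_int r - x \<in> prime_over p" using x by auto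
    qed
    also have "\<dots> \<longleftrightarrow> fixn W (frob p) \<noteq> 0" using finW by (auto simp: fixn_def)
    finally show ?thesis .
  qed
  have f_root: "(\<exists>r. int p dvd poly f r) \<longleftrightarrow> fixn W (frob p) \<noteq> 0" if p: "prime p" "p > p0" for p
  proof -
    have pc: "\<not> int p dvd c"
    proof
      assume "int p dvd c"
      hence "int p \<le> \<bar>c\<bar>" using dvd_imp_le_int[OF c0] by fastforce
      thus False using p unfolding p0_def by linarith
    qed
    have cop: "coprime c (int p)" using p pc by (metis coprime_commute prime_imp_coprime prime_nat_int_transfer)
    have "(\<exists>r. int p dvd poly f r) \<longleftrightarrow> (\<exists>r. int p dvd poly H r)"
    proof
      assume "\<exists>r. int p dvd poly f r"
      then obtain r where "int p dvd poly f r" by blast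
      hence "int p dvd poly H (c * r)" unfolding H(3) by simp
      thus "\<exists>r. int p dvd poly H r" by blast
    next
      assume "\<exists>r. int p dvd poly H r"
      then obtain s where s: "int p dvd poly H s" by blast
      obtain i where i: "[c * i = 1] (mod int p)" using cong_solve_coprime_int[OF cop] by blast
      have "[c * i * s = 1 * s] (mod int p)" by (rule cong_scalar_right[OF i])
      hence "[c * (i * s) = s] (mod int p)" by (simp add: mult.assoc)
      moreover have "c * (i * s) - s dvd poly H (c * (i * s)) - poly H s" by (rule diff_dvd_poly_diff)
      ultimately have "int p dvd poly H (c * (i * s)) - poly H s" by (meson cong_iff_dvd_diff dvd_trans)
      hence "int p dvd poly H (c * (i * s))" using s by (metis dvd_add diff_add_cancel)
      hence "int p dvd c ^ (degree f - 1) * poly f (i * s)" unfolding H(3) .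
      moreover have "coprime (int p) (c ^ (degree f - 1))" using cop by (simp add: coprime_commute)
      ultimately have "int p dvd poly f (i * s)" by (simp add: coprime_dvd_mult_right_iff)
      thus "\<exists>r. int p dvd poly f r" by blast
    qed
    thus ?thesis using H_root[OF p] by simp
  qed
  define E where "E = {p. prime p \<and> \<not> (\<exists>r. int p dvd poly f r)}"
  have dens: "(\<lambda>N. real (card {p \<in> E. prime p \<and> p \<le> N}) / real (card {p. prime p \<and> p \<le> N})) \<longlonglongrightarrow> 0"
  proof -
    define R where "R = {p. prime p \<and> (\<exists>a. [poly f a = 0] (mod int p))}"
    have lim: "(\<lambda>N. real (card {p \<in> R. prime p \<and> p \<le> N}) / real (card {p. prime p \<and> p \<le> N})) \<longlonglongrightarrow> 1"
      using wi unfolding weakly_intersective_def has_prime_density_def R_def .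
    have "real (card {p \<in> E. prime p \<and> p \<le> N}) / real (card {p. prime p \<and> p \<le> N}) =
        1 - real (card {p \<in> R. prime p \<and> p \<le> N}) / real (card {p. prime p \<and> p \<le> N})" if N: "N \<ge> 2" for N
    proof -
      have un: "{p. prime p \<and> p \<le> N} = {p \<in> E. prime p \<and> p \<le> N} \<union> {p \<in> R. prime p \<and> p \<le> N}"
        by (auto simp: E_def R_def cong_0_iff)
      have "card {p. prime p \<and> p \<le> N} = card {p \<in> E. prime p \<and> p \<le> N} + card {p \<in> R. prime p \<and> p \<le> N}"
        unfolding un by (rule card_Un_disjoint) (auto simp: E_def R_def cong_0_iff intro: finite_subset[OF _ finite_primes_upto[of N]])
      moreover have "2 \<in> {p. prime p \<and> p \<le> N}" using N by simp
      hence "card {p. prime p \<and> p \<le> N} \<noteq> 0" using finite_primes_upto[of N] by (metis card_0_eq empty_iff)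
      ultimately have e: "real (card {p \<in> E. prime p \<and> p \<le> N}) = real (card {p. prime p \<and> p \<le> N}) - real (card {p \<in> R. prime p \<and> p \<le> N})"
          and b: "real (card {p. prime p \<and> p \<le> N}) \<noteq> 0" by linarith+
      have "x / z = 1 - y / z" if "x = z - y" "z \<noteq> 0" for x y z :: real using that by (simp add: diff_divide_distrib)
      from this[OF e b] show ?thesis .
    qed
    hence "eventually (\<lambda>N. 1 - real (card {p \<in> R. prime p \<and> p \<le> N}) / real (card {p. prime p \<and> p \<le> N}) =
        real (card {p \<in> E. prime p \<and> p \<le> N}) / real (card {p. prime p \<and> p \<le> N})) sequentially"
      unfolding eventually_sequentially by (intro exI[of _ 2]) simp
    moreover have "(\<lambda>N. 1 - real (card {p \<in> R. prime p \<and> p \<le> N}) / real (card {p. prime p \<and> p \<le> N})) \<longlonglongrightarrow> 1 - 1"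
      by (intro tendsto_diff tendsto_const lim)
    ultimately show ?thesis using Lim_transform_eventually by force
  qed
  have "(\<lambda>Y. psum (\<lambda>p. if p \<in> E then 1 else 0) Y / ln (real Y)) \<longlonglongrightarrow> 0"
    by (rule psum_density_zero[OF psum_one dens])
  hence "(\<lambda>Y. psum (\<lambda>p. if fixn W (frob p) = 0 then 1 else 0) Y / ln (real Y)) \<longlonglongrightarrow> 0"
    by (rule psum_cong_large[of _ _ p0]) (use f_root in \<open>auto simp: E_def\<close>)
  with fixed_point_free_density[OF stW] have "real (card {\<sigma> \<in> G. fixn W \<sigma> = 0}) / real (card G) = 0"
    by (rule LIMSEQ_unique)
  moreover have "card G > 0" using finG id_G by (auto simp: card_gt_0_iff)
  ultimately have "card {\<sigma> \<in> G. fixn W \<sigma> = 0} = 0" by simp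
  hence "{\<sigma> \<in> G. fixn W \<sigma> = 0} = {}" using finG by simp
  \<comment> \<open>Every Frobenius element lies in \<open>G\<close>, so the exceptional set is
    empty beyond \<open>p0\<close> and not merely of density \<open>0\<close>.\<close>
  hence "fixn W (frob p) \<noteq> 0" if "prime p" for p using frob(1)[OF that] by auto
  hence "\<forall>p>p0. prime p \<longrightarrow> (\<exists>r. int p dvd poly f r)" using f_root by simp
  thus ?thesis by (rule exI)
qed

section \<open>Locally soluble twists\<close>

lemma nth_power_free_decomp:
  assumes n: "n \<ge> 1" and N: "N \<noteq> 0"
  shows "\<exists>d k. N = d * k ^ n \<and> nth_power_free n d"
  using N
proof (induction "nat \<bar>N\<bar>" arbitrary: N rule: less_induct)
  case less
  show ?case
  proof (cases "nth_power_free n N")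
    case True
    thus ?thesis by (intro exI[of _ N] exI[of _ 1]) simp
  next
    case False
    then obtain k where k: "k ^ n dvd N" "\<not> is_unit k" by (auto simp: nth_power_free_def)
    then obtain e where e: "N = k ^ n * e" by blast
    have "k \<noteq> 0" "e \<noteq> 0" using less.prems e n by auto
    hence "\<bar>k\<bar> \<ge> 2" using k(2) by (auto simp: zdvd1_eq)
    hence "\<bar>k\<bar> ^ 1 \<le> \<bar>k\<bar> ^ n" using n by (intro power_increasing) auto
    hence "\<bar>k ^ n\<bar> \<ge> 2" using \<open>\<bar>k\<bar> \<ge> 2\<close> by (simp add: power_abs)
    hence "2 * \<bar>e\<bar> \<le> \<bar>N\<bar>" unfolding e abs_mult by (intro mult_right_mono) auto
    hence "nat \<bar>e\<bar> < nat \<bar>N\<bar>" using \<open>e \<noteq> 0\<close> by linarith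
    from less.hyps[OF this \<open>e \<noteq> 0\<close>] obtain d l where "e = d * l ^ n" "nth_power_free n d" by blast
    thus ?thesis using e by (intro exI[of _ d] exI[of _ "l * k"]) (simp add: power_mult_distrib)
  qed
qed

text \<open>A prime \<open>q\<close> with \<open>q ^ n\<close> dividing the product divides only one
  of the coprime factors; \<open>d\<close> is excluded by assumption and \<open>u\<close> because
  \<open>n \<ge> 2\<close>.\<close>

lemma nth_power_free_mult_squarefree:
  assumes n: "n \<ge> 2" and d: "nth_power_free n d" "d \<noteq> 0" and u: "squarefree u" and cop: "coprime d u"
  shows "nth_power_free n (d * u)"
  unfolding nth_power_free_def
proof (intro allI impI, rule ccontr)
  fix k assume k: "k ^ n dvd d * u" and nu: "\<not> is_unit k"
  have u0: "u \<noteq> 0" using u by auto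
  have "k \<noteq> 0" using k n d(2) u0 by (auto simp: power_0_left)
  then obtain q where q: "prime q" "q dvd k" using nu prime_divisor_exists[of k] by blast
  have qn: "q ^ n dvd d * u" using k q(2) dvd_power_same dvd_trans by blast
  have nuq: "\<not> is_unit q" using q(1) by (metis not_prime_unit)
  show False
  proof (cases "q dvd u")
    case False
    hence "coprime q u" using q(1) by (simp add: prime_imp_coprime)
    hence "coprime (q ^ n) u" by simp
    hence "q ^ n dvd d" using qn by (simp add: coprime_dvd_mult_left_iff)
    thus False using d(1) nuq by (auto simp: nth_power_free_def)
  next
    case True
    hence "\<not> q dvd d" using cop nuq by (meson coprime_common_divisor)
    hence "coprime q d" using q(1) by (simp add: prime_imp_coprime)
    hence "coprime (q ^ n) d" by simp
    hence "q ^ n dvd u" using qn by (simp add: coprime_dvd_mult_right_iff)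
    moreover have "q ^ 2 dvd q ^ n" using n by (rule le_imp_power_dvd)
    ultimately have "q ^ 2 dvd u" by (rule dvd_trans[rotated])
    thus False using u nuq by (auto simp: squarefree_def)
  qed
qed

lemma squarefree_of_nat_int: "squarefree (k :: nat) \<Longrightarrow> squarefree (int k)"
  unfolding squarefree_def
proof (intro allI impI)
  fix x assume "\<forall>x. x ^ 2 dvd k \<longrightarrow> is_unit x" and "x ^ 2 dvd int k"
  hence "int (nat \<bar>x\<bar> ^ 2) dvd int k" by simp
  hence "nat \<bar>x\<bar> ^ 2 dvd k" by (simp only: int_dvd_int_iff)
  hence "is_unit (nat \<bar>x\<bar>)" using \<open>\<forall>x. x ^ 2 dvd k \<longrightarrow> is_unit x\<close> by blast
  hence "\<bar>x\<bar> = 1" by simp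
  thus "is_unit x" by (simp add: zdvd1_eq)
qed

lemma squarefree_imp_coprime_pderiv:
  fixes g :: "rat poly"
  assumes "squarefree g"
  shows "coprime g (pderiv g)"
proof (rule ccontr)
  assume nc: "\<not> coprime g (pderiv g)"
  have g0: "g \<noteq> 0" using assms by auto
  define h where "h = gcd g (pderiv g)"
  have "h \<noteq> 0" using g0 by (simp add: h_def)
  moreover have "\<not> is_unit h" using nc unfolding h_def by (metis is_unit_gcd)
  ultimately obtain q where q: "prime q" "q dvd h" using prime_divisor_exists by blast
  have qg: "q dvd g" and qg': "q dvd pderiv g" using q(2) by (auto simp: h_def)
  obtain e where e: "g = q * e" using qg by blast
  have nu: "\<not> is_unit q" using q(1) by (metis not_prime_unit)
  have q0: "q \<noteq> 0" using q(1) by auto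
  have dq: "degree q > 0" using nu q0 by (simp add: is_unit_iff_degree)
  have "q dvd q * pderiv e + e * pderiv q" using qg' unfolding e pderiv_mult by simp
  hence "q dvd e * pderiv q" by (simp add: dvd_add_right_iff)
  moreover have "\<not> q dvd pderiv q"
  proof
    assume "q dvd pderiv q"
    moreover have "pderiv q \<noteq> 0" using dq by (simp add: pderiv_eq_0_iff)
    ultimately have "degree q \<le> degree (pderiv q)" by (rule dvd_imp_degree_le)
    thus False using dq by (simp add: degree_pderiv)
  qed
  ultimately have "q dvd e" using q(1) by (simp add: prime_dvd_mult_iff)
  hence "q ^ 2 dvd g" unfolding e power2_eq_square by (rule mult_dvd_mono[OF dvd_refl])
  thus False using assms nu by (auto simp: squarefree_def)
qed

text \<open>\<open>D\<close> plays the role of the discriminant: modulo a prime not dividing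
  \<open>D\<close> every root of \<open>f\<close> is simple.\<close>

lemma squarefree_int_bezout:
  fixes f :: "int poly"
  assumes "squarefree (map_poly rat_of_int f)"
  shows "\<exists>(D :: int) A B. D \<noteq> 0 \<and> (\<forall>r. poly A r * poly f r + poly B r * poly (pderiv f) r = D)"
proof -
  define g where "g = map_poly rat_of_int f"
  have "coprime g (pderiv g)" using squarefree_imp_coprime_pderiv assms by (simp add: g_def)
  then obtain a b where ab: "a * g + b * pderiv g = 1"
    using bezout_coefficients_fst_snd[of g "pderiv g"] by (metis coprime_imp_gcd_eq_1)
  obtain da A where A: "da > 0" "map_poly rat_of_int A = smult (of_int da) a" using clear_denominators[of a] by blast
  obtain db B where B: "db > 0" "map_poly rat_of_int B = smult (of_int db) b" using clear_denominators[of b] by blast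
  have g': "pderiv g = map_poly rat_of_int (pderiv f)"
    by (rule poly_eqI) (simp add: g_def coeff_map_poly coeff_pderiv)
  have ev: "rat_of_int (poly q r) = poly (map_poly rat_of_int q) (of_int r)" for q r by simp
  have "db * poly A r * poly f r + da * poly B r * poly (pderiv f) r = da * db" for r
  proof -
    have "rat_of_int (db * poly A r * poly f r + da * poly B r * poly (pderiv f) r) =
      of_int db * poly (map_poly rat_of_int A) (of_int r) * poly g (of_int r) +
      of_int da * poly (map_poly rat_of_int B) (of_int r) * poly (pderiv g) (of_int r)"
      unfolding g' unfolding g_def by (simp only: of_int_add of_int_mult ev)
    also have "\<dots> = of_int (da * db) * poly (a * g + b * pderiv g) (of_int r)"
      unfolding A B by (simp add: algebra_simps)
    also have "\<dots> = of_int (da * db)" unfolding ab by simp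
    finally show ?thesis by (simp only: of_int_eq_iff)
  qed
  hence "\<forall>r. poly (smult db A) r * poly f r + poly (smult da B) r * poly (pderiv f) r = da * db" by simp
  moreover have "da * db \<noteq> 0" using A(1) B(1) by simp
  ultimately show ?thesis by blast
qed

section \<open>Real and p-adic points on the twists\<close>

lemma padic_point_from_simple_root:
  assumes p: "prime p" and r: "int p dvd poly f r" "\<not> int p dvd poly (pderiv f) r" and n: "n \<ge> 1"
  shows "twist_has_point (padic_field p) n d f"
proof -
  obtain x where x: "\<And>i. int p ^ Suc i dvd poly f (x i)" "\<And>i. int p ^ Suc i dvd x (Suc i) - x i"
    using hensel_sequence[OF p r] by blast
  have w: "int p ^ i dvd z" if "int p ^ Suc i dvd z" for i z using that by (metis dvd_mult_right power_Suc)
  show ?thesis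
    by (rule padic_twist_has_point[OF p, where x = x and y = "\<lambda>_. 0"]) (use n w x in \<open>auto simp: power_0_left\<close>)
qed

text \<open>Makes the equation \<open>u * (1 + n * w) ^ n = 1\<close>, after division by \<open>n\<^sup>2\<close>, accessible to Hensel's lemma
  also at the primes dividing \<open>n\<close>.\<close>

lemma power_one_plus_expansion:
  fixes a :: "'a :: comm_ring_1"
  shows "\<exists>q. \<forall>w. (1 + a * w) ^ m = 1 + of_nat m * a * w + a ^ 2 * w ^ 2 * poly q w"
proof (induction m)
  case 0
  show ?case by (intro exI[of _ 0]) simp
next
  case (Suc m)
  then obtain q where q: "\<And>w. (1 + a * w) ^ m = 1 + of_nat m * a * w + a ^ 2 * w ^ 2 * poly q w" by blast
  have "(1 + a * w) ^ Suc m = 1 + of_nat (Suc m) * a * w + a ^ 2 * w ^ 2 * poly ([:of_nat m:] + [:1, a:] * q) w" for w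
    unfolding power_Suc q by (simp add: algebra_simps power2_eq_square)
  thus ?case by blast
qed

lemma padic_point_from_nth_root:
  assumes p: "prime p" and c: "int p dvd c" and fa: "poly f a = d * k ^ n"
  shows "twist_has_point (padic_field p) n (d * (1 + int n ^ 2 * c)) f"
proof -
  define u where "u = 1 + int n ^ 2 * c"
  obtain q where q: "\<And>w. (1 + int n * w) ^ n = 1 + int n * int n * w + int n ^ 2 * w ^ 2 * poly q w"
    using power_one_plus_expansion[of "int n" n] by auto
  \<comment> \<open>\<open>u * (1 + n * w) ^ n - 1\<close> divided by \<open>n ^ 2\<close>. At
    \<open>0\<close> its value is \<open>c\<close>, a multiple of \<open>p\<close>, and its
    derivative is \<open>u\<close>, a unit modulo \<open>p\<close>, even if \<open>p\<close> divides
    \<open>n\<close>.\<close>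
  define g where "g = [:c:] + smult u ([:0, 1:] + [:0, 0, 1:] * q)"
  have g: "int n ^ 2 * poly g w = u * (1 + int n * w) ^ n - 1" for w
    unfolding q by (simp add: g_def u_def algebra_simps power2_eq_square)
  have g0: "poly g 0 = c" by (simp add: g_def)
  have "poly (pderiv g) 0 = u" by (simp add: g_def pderiv_add pderiv_smult pderiv_mult pderiv_pCons)
  moreover have "\<not> int p dvd u"
  proof
    assume "int p dvd u"
    moreover have "int p dvd int n ^ 2 * c" using c by simp
    ultimately have "int p dvd 1" unfolding u_def by (metis add_diff_cancel_right' dvd_diff)
    thus False using p by (simp add: prime_gt_1_nat zdvd1_eq)
  qed
  ultimately obtain w where w: "\<And>i. int p ^ Suc i dvd poly g (w i)" "\<And>i. int p ^ Suc i dvd w (Suc i) - w i"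
    using hensel_sequence[OF p, of g 0] c g0 by auto
  have low: "int p ^ i dvd z" if "int p ^ Suc i dvd z" for i z using that by (metis dvd_mult_right power_Suc)
  \<comment> \<open>The second coordinate is \<open>k\<close> divided by an \<open>n\<close>th root
    of \<open>u\<close>, and \<open>1 + n * w\<close> approximates the inverse of that root.\<close>
  define y where "y = (\<lambda>i. k * (1 + int n * w i))"
  show ?thesis
    unfolding u_def[symmetric]
  proof (rule padic_twist_has_point[OF p, where x = "\<lambda>_. a" and y = y])
    fix i
    show "int p ^ i dvd a - a" by simp
    have "y (Suc i) - y i = k * int n * (w (Suc i) - w i)" by (simp add: y_def algebra_simps)
    thus "int p ^ i dvd y (Suc i) - y i" using low[OF w(2)[of i]] by simp
    have "d * u * y i ^ n - poly f a = d * k ^ n * (u * (1 + int n * w i) ^ n - 1)"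
      unfolding fa y_def power_mult_distrib by (simp add: right_diff_distrib mult_ac)
    also have "\<dots> = d * k ^ n * int n ^ 2 * poly g (w i)" by (simp add: g[symmetric] mult.assoc)
    finally show "int p ^ i dvd d * u * y i ^ n - poly f a" using low[OF w(1)[of i]] by simp
  qed
qed

lemma real_point_of_positive_twist:
  assumes n: "n \<ge> 1" and u: "u > 0" and fa: "poly f a = d * k ^ n"
  shows "twist_has_point (ring_of_type_algebra :: real ring) n (d * u) f"
proof (rule real_twist_has_point)
  have "root n (real_of_int u) ^ n = real_of_int u" using n u by (intro real_root_pow_pos2) auto
  hence "real_of_int (d * u) * (real_of_int k / root n (real_of_int u)) ^ n = real_of_int (d * k ^ n)"
    using u by (simp add: power_divide)
  also have "\<dots> = poly (map_poly of_int f) (real_of_int a)" unfolding fa[symmetric] by simp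
  finally show "real_of_int (d * u) * (real_of_int k / root n (real_of_int u)) ^ n = poly (map_poly of_int f) (real_of_int a)" .
qed

lemma locally_soluble_twists:
  assumes n: "n \<ge> 1" and c: "c \<ge> 0" and fa: "poly f a = d * k ^ n"
    and small: "\<And>p. prime p \<Longrightarrow> p \<le> P \<Longrightarrow> int p dvd c"
    and large: "\<And>p. prime p \<Longrightarrow> p > P \<Longrightarrow> \<exists>r. int p dvd poly f r \<and> \<not> int p dvd poly (pderiv f) r"
  shows "twist_locally_soluble n (d * (1 + int n ^ 2 * c)) f"
  unfolding twist_locally_soluble_def
proof (intro conjI allI impI)
  show "twist_has_point (ring_of_type_algebra :: real ring) n (d * (1 + int n ^ 2 * c)) f"
    using n fa c by (intro real_point_of_positive_twist[where a = a and k = k]) (auto intro: add_pos_nonneg)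
  fix p :: nat assume p: "prime p"
  show "twist_has_point (padic_field p) n (d * (1 + int n ^ 2 * c)) f"
  proof (cases "p \<le> P")
    case True
    thus ?thesis using padic_point_from_nth_root[OF p small[OF p] fa] by simp
  next
    case False
    then obtain r where "int p dvd poly f r" "\<not> int p dvd poly (pderiv f) r" using large[OF p] by auto
    thus ?thesis by (rule padic_point_from_simple_root[OF p _ _ n])
  qed
qed

text \<open>A sieve by squares of primes. As \<open>m\<close> is even, only odd primes matter, and
  over these the telescoping bound for the sum of \<open>1 / q ^ 2\<close> is \<open>1 / 2\<close>;
  with \<open>q = 2\<close> included it would be \<open>1\<close> and give nothing. A prime dividing
  a term is prime to \<open>m\<close>, so each \<open>q ^ 2\<close> removes a single residue class
  of indices.\<close>

lemma card_squarefree_progression: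
  fixes m J :: nat
  assumes m: "even m" "m > 0"
  shows "real (card {j \<in> {..J}. squarefree (1 + m * j)}) \<ge> real J / 2 - sqrt (1 + real m * real J)"
proof -
  define Q where "Q = {q. prime q \<and> q > 2 \<and> q ^ 2 \<le> 1 + m * J}"
  define S where "S = {j \<in> {..J}. squarefree (1 + m * j)}"
  define A where "A q = {j \<in> {..J}. q ^ 2 dvd 1 + m * j}" for q
  have sq: "real q \<le> sqrt (1 + real m * real J)" if "q \<in> Q" for q
  proof -
    have "real (q ^ 2) \<le> real (1 + m * J)" using that unfolding Q_def by (simp only: of_nat_le_iff mem_Collect_eq)
    thus ?thesis by (intro real_le_rsqrt) simp
  qed
  have Qsub: "Q \<subseteq> {1..nat \<lfloor>sqrt (1 + real m * real J)\<rfloor>}"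
    using sq le_nat_floor by (auto simp: Q_def Suc_le_eq prime_gt_0_nat)
  have finQ: "finite Q" using Qsub finite_subset by blast
  have "card Q \<le> card {1..nat \<lfloor>sqrt (1 + real m * real J)\<rfloor>}" using Qsub by (intro card_mono) auto
  hence cardQ: "real (card Q) \<le> sqrt (1 + real m * real J)"
  proof -
    assume "card Q \<le> card {1..nat \<lfloor>sqrt (1 + real m * real J)\<rfloor>}"
    hence "real (card Q) \<le> real (nat \<lfloor>sqrt (1 + real m * real J)\<rfloor>)" by (simp only: of_nat_le_iff card_atLeastAtMost diff_Suc_1)
    also have "\<dots> \<le> sqrt (1 + real m * real J)" by (rule of_nat_floor) simp
    finally show ?thesis .
  qed
  have cov: "{..J} \<subseteq> S \<union> (\<Union>q\<in>Q. A q)"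
  proof
    fix j assume j: "j \<in> {..J}"
    show "j \<in> S \<union> (\<Union>q\<in>Q. A q)"
    proof (cases "squarefree (1 + m * j)")
      case True
      thus ?thesis using j by (simp add: S_def)
    next
      case False
      then obtain x where x: "x ^ 2 dvd 1 + m * j" "\<not> is_unit x" by (auto simp: squarefree_def)
      obtain q where q: "prime q" "q dvd x" using x(2) prime_factor_nat[of x] by auto
      have qd: "q ^ 2 dvd 1 + m * j" using q(2) x(1) dvd_power_same dvd_trans by blast
      have "q \<noteq> 2"
      proof
        assume "q = 2"
        hence "2 dvd 1 + m * j" using qd by (metis dvd_mult_left power2_eq_square)
        thus False using m by simp
      qed
      hence "q > 2" using prime_ge_2_nat[OF q(1)] by simp
      moreover have "q ^ 2 \<le> 1 + m * j" using qd by (rule dvd_imp_le) simp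
      hence "q ^ 2 \<le> 1 + m * J" using j by (meson add_left_mono atMost_iff le_trans mult_le_mono2)
      ultimately have "q \<in> Q" using q by (simp add: Q_def)
      moreover have "j \<in> A q" using j qd by (simp add: A_def)
      ultimately show ?thesis by blast
    qed
  qed
  have cardA: "real (card (A q)) \<le> real J * (1 / real q ^ 2) + 1" if "q \<in> Q" for q
  proof -
    have q: "prime q" using that by (simp add: Q_def)
    have inj: "inj_on (\<lambda>j. j div q ^ 2) (A q)"
    proof (rule inj_onI)
      fix i j assume i: "i \<in> A q" and j: "j \<in> A q" and e: "i div q ^ 2 = j div q ^ 2"
      have "[1 + m * i = 1 + m * j] (mod q ^ 2)" using i j unfolding A_def Cong.cong_def by (simp add: mod_eq_0_iff_dvd)
      hence *: "[m * i = m * j] (mod q ^ 2)" by (simp only: cong_add_lcancel_nat)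
      have "\<not> q dvd m"
      proof
        assume "q dvd m"
        hence "q dvd m * i" by simp
        moreover have "q dvd 1 + m * i" using i by (auto simp: A_def power2_eq_square dest: dvd_mult_left)
        ultimately have "q dvd 1" by (metis dvd_add_left_iff)
        thus False using q by simp
      qed
      hence "coprime q m" using q by (rule prime_imp_coprime[rotated])
      hence "coprime m (q ^ 2)" by (simp add: coprime_commute)
      hence "[i = j] (mod q ^ 2)" using * by (simp add: cong_mult_lcancel_nat)
      hence "i mod q ^ 2 = j mod q ^ 2" by (simp add: Cong.cong_def)
      thus "i = j" using e by (metis div_mult_mod_eq)
    qed
    have "(\<lambda>j. j div q ^ 2) ` A q \<subseteq> {..J div q ^ 2}" by (auto simp: A_def div_le_mono)
    from card_inj_on_le[OF inj this] have "card (A q) \<le> Suc (J div q ^ 2)" by simp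
    hence "real (card (A q)) \<le> real (J div q ^ 2) + 1" by linarith
    also have "real (J div q ^ 2) \<le> real J / real (q ^ 2)" by (rule of_nat_div_le_of_nat)
    finally show ?thesis by simp
  qed
  have "card {..J} \<le> card (S \<union> (\<Union>q\<in>Q. A q))" using cov finQ by (intro card_mono) (auto simp: S_def A_def)
  also have "\<dots> \<le> card S + card (\<Union>q\<in>Q. A q)" by (rule card_Un_le)
  also have "\<dots> \<le> card S + (\<Sum>q\<in>Q. card (A q))" by (intro add_left_mono card_UN_le finQ)
  finally have "real (J + 1) \<le> real (card S) + (\<Sum>q\<in>Q. real (card (A q)))" by (simp flip: of_nat_sum of_nat_add)
  also have "(\<Sum>q\<in>Q. real (card (A q))) \<le> (\<Sum>q\<in>Q. real J * (1 / real q ^ 2) + 1)" by (intro sum_mono cardA)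
  also have "\<dots> = real J * (\<Sum>q\<in>Q. 1 / real q ^ 2) + real (card Q)" by (simp add: sum.distrib sum_distrib_left)
  also have "\<dots> \<le> real J * (1 / real 2) + sqrt (1 + real m * real J)"
    using finQ cardQ by (intro add_mono mult_left_mono sum_inverse_squares_le) (auto simp: Q_def)
  finally show ?thesis unfolding S_def by simp
qed

text \<open>The lower bound on \<open>J\<close> makes the square root error at most
  \<open>J / 4\<close>, half of the main term.\<close>

lemma card_squarefree_progression_linear:
  fixes m J :: nat
  assumes m: "even m" "m > 0" and J: "J \<ge> 16 * (1 + m)"
  shows "real (card {j \<in> {..J}. squarefree (1 + m * j)}) \<ge> real J / 4"
proof -
  have J': "real J \<ge> 16 * (1 + real m)" using J proof -
    have "real J \<ge> real (16 * (1 + m))" using J by (simp only: of_nat_le_iff)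
    thus ?thesis by simp
  qed
  have "1 + real m * real J \<le> (1 + real m) * real J" using J' m by (simp add: algebra_simps)
  also have "\<dots> \<le> (real J / 16) * real J" using J' by (intro mult_right_mono) auto
  also have "\<dots> = (real J / 4) ^ 2" by (simp add: power2_eq_square)
  finally have "sqrt (1 + real m * real J) \<le> real J / 4" by (intro real_le_lsqrt) auto
  thus ?thesis using card_squarefree_progression[OF m, of J] by linarith
qed

text \<open>Without roots the gcd would be \<open>n \<ge> 2\<close>; and a constant with a root is
  \<open>0\<close>, which the factorization with \<open>A \<noteq> 0\<close> rules out.\<close>

lemma superelliptic_model_degree_pos:
  assumes n: "n \<ge> 2" and "superelliptic_model n (map_poly rat_of_int f)"
  shows "degree f > 0"
proof (rule ccontr)
  assume "\<not> degree f > 0"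
  then obtain c where c: "f = [:c:]" by (auto elim: degree_eq_zeroE)
  obtain A :: "rat alg_closure" and S e where A: "A \<noteq> 0" "finite S"
      "map_poly to_ac (map_poly rat_of_int f) = smult A (\<Prod>\<alpha>\<in>S. [:-\<alpha>, 1:] ^ e \<alpha>)"
      "\<forall>\<alpha>\<in>S. 1 \<le> e \<alpha> \<and> e \<alpha> < n" "Gcd (insert n (e ` S)) = 1"
    using assms(2) unfolding superelliptic_model_def by blast
  have "S \<noteq> {}" using A(5) n by auto
  then obtain \<alpha> where \<alpha>: "\<alpha> \<in> S" by blast
  have "poly (\<Prod>\<alpha>\<in>S. [:-\<alpha>, 1:] ^ e \<alpha>) \<alpha> = 0"
    unfolding poly_prod using A(2,4) \<alpha> by (intro prod_zero) force+
  hence "poly (map_poly to_ac (map_poly rat_of_int f)) \<alpha> = 0" unfolding A(3) by simp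
  hence c0: "c = 0" by (cases "c = 0") (simp_all add: c map_poly_pCons)
  have "smult A (\<Prod>\<alpha>\<in>S. [:-\<alpha>, 1:] ^ e \<alpha>) \<noteq> 0" using A(1,2) by (simp add: prod_zero_iff)
  thus False using A(3) c0 c by simp
qed

theorem theorem4:
  fixes n :: nat and f :: "int poly"
  assumes "n \<ge> 2"
    and "superelliptic_model n (map_poly rat_of_int f)"
    and "squarefree (map_poly rat_of_int f)"
    and "weakly_intersective f"
  shows "(\<lambda>B :: real. real (locally_soluble_twist_count n f B)) \<in> \<Omega>(\<lambda>B. B)"
proof -
  note n = assms(1)
  have deg: "degree f > 0" by (rule superelliptic_model_degree_pos[OF assms(1,2)])
  obtain p0 where p0: "\<And>p. p > p0 \<Longrightarrow> prime p \<Longrightarrow> \<exists>r. int p dvd poly f r"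
    using eventually_root_of_density_one[OF deg assms(4)] by blast
  obtain D :: int and U V where D: "D \<noteq> 0" "\<And>r. poly U r * poly f r + poly V r * poly (pderiv f) r = D"
    using squarefree_int_bezout[OF assms(3)] by blast
  have "f \<noteq> 0" using deg by auto
  hence "finite {a. poly f a = 0}" by (rule poly_roots_finite)
  then obtain a where a: "poly f a \<noteq> 0" using infinite_UNIV_int by (metis (mono_tags) UNIV_eq_I mem_Collect_eq)
  obtain d k where dk: "poly f a = d * k ^ n" "nth_power_free n d"
    using nth_power_free_decomp[OF _ a, of n] n by auto
  have d0: "d \<noteq> 0" using a dk by auto
  \<comment> \<open>Beyond \<open>P\<close> there are roots modulo \<open>p\<close>, and they are
    simple because \<open>p\<close> does not divide \<open>D\<close>. The \<open>+ 2\<close> makes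
    \<open>fact P\<close> even, as the squarefree count requires.\<close>
  define P where "P = max p0 (nat \<bar>D\<bar>) + 2"
  \<comment> \<open>The factor \<open>d\<close> makes \<open>1 + m * j\<close> prime to
    \<open>d\<close>, so that multiplying by it creates no \<open>n\<close>th powers.\<close>
  define M where "M = fact P * nat \<bar>d\<bar>"
  define m where "m = n ^ 2 * M"
  have M0: "M > 0" using d0 by (simp add: M_def)
  have m0: "m > 0" using M0 n by (simp add: m_def)
  have "2 dvd (fact P :: nat)" by (rule dvd_fact) (auto simp: P_def)
  hence m_even: "even m" by (simp add: m_def M_def)
  have sol: "twist_locally_soluble n (d * (1 + int m * int j)) f" for j
  proof -
    have "twist_locally_soluble n (d * (1 + int n ^ 2 * (int M * int j))) f"
    proof (rule locally_soluble_twists[OF _ _ dk(1), where P = P])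
      fix p :: nat assume p: "prime p" "p \<le> P"
      hence "p dvd fact P" by (intro dvd_fact) (use prime_ge_1_nat[OF p(1)] in auto)
      hence "p dvd M * j" by (simp add: M_def)
      thus "int p dvd int M * int j" by (metis int_dvd_int_iff of_nat_mult)
    next
      fix p :: nat assume p: "prime p" "p > P"
      then obtain r where r: "int p dvd poly f r" using p0[of p] by (fastforce simp: P_def)
      have "\<not> int p dvd poly (pderiv f) r"
      proof
        assume "int p dvd poly (pderiv f) r"
        hence "int p dvd poly U r * poly f r + poly V r * poly (pderiv f) r" using r by simp
        hence "int p dvd D" unfolding D(2) .
        hence "int p \<le> \<bar>D\<bar>" using dvd_imp_le_int[OF D(1)] by fastforce
        thus False using p unfolding P_def by linarith
      qed
      thus "\<exists>r. int p dvd poly f r \<and> \<not> int p dvd poly (pderiv f) r" using r by blast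
    qed (use n in auto)
    thus ?thesis by (simp add: m_def mult.assoc)
  qed
  have npf: "nth_power_free n (d * (1 + int m * int j))" if "squarefree (1 + m * j)" for j
  proof (rule nth_power_free_mult_squarefree[OF n dk(2) d0])
    have "squarefree (int (1 + m * j))" using that by (rule squarefree_of_nat_int)
    thus "squarefree (1 + int m * int j)" by simp
    have "d dvd int m * int j" by (simp add: m_def M_def)
    hence "gcd d (1 + int m * int j) = gcd d 1" by (metis dvdE gcd_add_mult add.commute mult.commute)
    thus "coprime d (1 + int m * int j)" by (simp add: coprime_iff_gcd_eq_1)
  qed
  \<comment> \<open>\<open>K * J\<close> bounds the twists with index at most \<open>J\<close>, as
    \<open>1 + m * J \<le> 2 * m * J\<close> for \<open>J \<ge> 1\<close>.\<close>
  define K where "K = 2 * real_of_int \<bar>d\<bar> * real m"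
  have K1: "K \<ge> 1"
  proof -
    have "1 * 1 \<le> real_of_int \<bar>d\<bar> * real m" using d0 m0 by (intro mult_mono) auto
    thus ?thesis by (simp add: K_def)
  qed
  define J0 where "J0 = 16 * (1 + m)"
  \<comment> \<open>At least a quarter of the roughly \<open>B / K\<close> indices give squarefree
    numbers; a further factor \<open>2\<close> pays for rounding \<open>J\<close> down.\<close>
  have large: "real (locally_soluble_twist_count n f B) \<ge> B / (8 * K)" if B: "B \<ge> 2 * K * (1 + real J0)" for B
  proof -
    define \<beta> where "\<beta> = B / K"
    define J where "J = nat \<lfloor>\<beta>\<rfloor>"
    have "\<beta> \<ge> 2 * (1 + real J0)" using B K1 by (simp add: \<beta>_def le_divide_eq mult_ac)
    hence BK: "\<beta> \<ge> 2 + 2 * real J0" by (simp only: distrib_left)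
    have J00: "real J0 \<ge> 0" by simp
    have BK0: "\<beta> \<ge> 0" using BK J00 by linarith
    have J1: "real J \<le> \<beta>" unfolding J_def using BK0 by simp
    have J2: "real J \<ge> \<beta> - 1" unfolding J_def using BK0 by linarith
    have "real J \<ge> real J0" "real J \<ge> 1" using J2 BK J00 by linarith+
    hence J16: "J \<ge> 16 * (1 + m)" and Jpos: "J \<ge> 1" by (simp_all add: J0_def)
    define S where "S = {j \<in> {..J}. squarefree (1 + m * j)}"
    define T where "T = {e :: int. \<bar>real_of_int e\<bar> \<le> B \<and> nth_power_free n e \<and> twist_locally_soluble n e f}"
    have "T \<subseteq> {- \<lceil>B\<rceil>..\<lceil>B\<rceil>}" by (auto simp: T_def abs_le_iff) linarith+
    hence finT: "finite T" by (rule finite_subset) simp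
    have inj: "inj_on (\<lambda>j. d * (1 + int m * int j)) S" using d0 m0 by (auto intro!: inj_onI)
    have "(\<lambda>j. d * (1 + int m * int j)) ` S \<subseteq> T"
    proof clarify
      fix j assume j: "j \<in> S"
      have "1 + m * j \<le> 1 + m * J" using j by (simp add: S_def)
      also have "1 \<le> m * J" using m0 Jpos by simp
      finally have "1 + m * j \<le> 2 * m * J" by simp
      hence "real (1 + m * j) \<le> real (2 * m * J)" by (simp only: of_nat_le_iff)
      hence "\<bar>real_of_int (d * (1 + int m * int j))\<bar> \<le> real_of_int \<bar>d\<bar> * real (2 * m * J)"
        by (simp add: abs_mult mult_left_mono)
      also have "\<dots> = K * real J" by (simp add: K_def)
      also have "\<dots> \<le> B" using J1 K1 by (simp add: \<beta>_def pos_le_divide_eq mult.commute)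
      finally show "d * (1 + int m * int j) \<in> T" using npf[of j] sol[of j] j by (simp add: T_def S_def)
    qed
    from card_inj_on_le[OF inj this finT] have "real (card S) \<le> real (card T)" by simp
    moreover have "real (card S) \<ge> real J / 4"
      unfolding S_def by (rule card_squarefree_progression_linear[OF m_even m0 J16])
    moreover have "B / (8 * K) = \<beta> / 8" by (simp add: \<beta>_def)
    ultimately show ?thesis using J2 BK J00 unfolding locally_soluble_twist_count_def T_def[symmetric] by linarith
  qed
  have "eventually (\<lambda>B. norm (real (locally_soluble_twist_count n f B)) \<ge> 1 / (8 * K) * norm B) at_top"
    using eventually_ge_at_top[of "2 * K * (1 + real J0)"]
  proof eventually_elim
    case (elim B)
    have "2 * K * (1 + real J0) \<ge> 0" using K1 by simp
    thus ?case using large[OF elim] elim by simp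
  qed
  moreover have "1 / (8 * K) > 0" using K1 by simp
  ultimately show ?thesis by (intro landau_omega.bigI)
qed

end
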